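(* Let $F$ be a non-discrete locally compact non-archimedean field of characteristic $\neq 2$, with residue field of characteristic $p$ and cardinality $q$. Let $R$ be an integral domain with $p\in R^\times$, containing a square root of $q$, and let $\chi:F\to R^\times$ be a non-trivial smooth character. Let $X$ be a finite-dimensional $F$-vector space, $W=X\times X^*$, and let $\mathrm{Mp}(W)$ be the metaplectic group attached to $R$ and $\chi$, with projection $\pi:\mathrm{Mp}(W)\to\mathrm{Sp}(W)$. Then there exists a subgroup $\mathrm{Mp}_2(W)$ of $\mathrm{Mp}(W)$ that is a cover of $\mathrm{Sp}(W)$ with kernel $\mu_2(R)=\{t\in R^\times: t^2=1\}$, i.e. $\pi$ restricted to $\mathrm{Mp}_2(W)$ is surjective onto $\mathrm{Sp}(W)$ with kernel $\mu_2(R)$ (viewed in $\mathrm{Mp}(W)$ via $R^\times\subset\mathrm{Mp}(W)$). In particular, when $\mathrm{char}(R)\neq2$, $\mathrm{Mp}_2(W)$ is a $2$-cover of $\mathrm{Sp}(W)$.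
   Context: A smooth character of $F$ is a group homomorphism $F\to R^\times$ with open kernel. $X^*=\mathrm{Hom}_F(X,F)$; $[x,x^*]=x^*(x)$ and $\langle x,x^*\rangle=\chi([x,x^*])$. On $W=X\times X^*$ put $\mathcal B((x_1,x_1^* ),(x_2,x_2^* ))=[x_1,x_2^*]$ and $\mathcal F=\chi\circ\mathcal B$. $\mathrm{Sp}(W)$ is the group of $F$-linear automorphisms $\sigma$ of $W$ preserving the form $(w_1,w_2)\mapsto\mathcal B(w_1,w_2)-\mathcal B(w_2,w_1)$. For $\sigma\in\mathrm{Sp}(W)$ put $f_\sigma(w)=\frac12(\mathcal B(\sigma w,\sigma w)-\mathcal B(w,w))$. $A(W)$ is the set $W\times R^\times$ with group law $(w_1,t_1)(w_2,t_2)=(w_1+w_2,t_1t_2\mathcal F(w_1,w_2))$; its center is $Z=\{(0,t):t\in R^\times\}$. $B_0(W)$ is the group of automorphisms of $A(W)$ acting trivially on $Z$. $\mathcal S(X)$ is the $R$-module of locally constant compactly supported functions $X\to R$, and $\mathrm{Aut}(\mathcal S(X))$ its group of $R$-linear automorphisms. For $w=(v,v^* )\in W$ and $t\in R^\times$, $U(w,t)\in\mathrm{Aut}(\mathcal S(X))$ is $(U(w,t)\Phi)(x)=t\,\Phi(x+v)\langle x,v^*\rangle$; the map $U$ is an isomorphism from $A(W)$ onto a subgroup $\mathbb A(W)$ of $\mathrm{Aut}(\mathcal S(X))$. $\mathbb B_0(W)$ is the normalizer of $\mathbb A(W)$ in $\mathrm{Aut}(\mathcal S(X))$. The homomorphism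 $\pi_0:\mathbb B_0(W)\to B_0(W)$ sends $\mathbf s$ to conjugation by $\mathbf s$ on $\mathbb A(W)\cong A(W)$ (identified via $U$). The homomorphism $\mu:\mathrm{Sp}(W)\to B_0(W)$ sends $\sigma$ to the automorphism $(w,t)\mapsto(\sigma(w),\chi(f_\sigma(w))t)$. The metaplectic group is $\mathrm{Mp}(W)=\{(\sigma,\mathbf s)\in\mathrm{Sp}(W)\times\mathbb B_0(W):\mu(\sigma)=\pi_0(\mathbf s)\}$, and $\pi(\sigma,\mathbf s)=\sigma$. The group $R^\times$ is embedded in $\mathrm{Mp}(W)$ by $t\mapsto(\mathrm{id},t\cdot\mathrm{id}_{\mathcal S(X)})$; it is the kernel of $\pi$. *)

theory Defs
  imports
    "HOL-Analysis.Analysis"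
    "HOL-Algebra.Algebra"
    "HOL-Algebra.Algebraic_Closure_Type"
    "HOL-Library.Function_Algebras"
begin

section \<open>Non-archimedean local fields\<close>

definition nonarch_absolute_value :: "('f::field \<Rightarrow> real) \<Rightarrow> bool" where
  "nonarch_absolute_value v \<longleftrightarrow>
     (\<forall>x. 0 \<le> v x) \<and> (\<forall>x. v x = 0 \<longleftrightarrow> x = 0) \<and>
     (\<forall>x y. v (x * y) = v x * v y) \<and>
     (\<forall>x y. v (x + y) \<le> max (v x) (v y))"

definition field_topology :: "('f::field \<Rightarrow> real) \<Rightarrow> 'f topology" where
  "field_topology v = Metric_space.mtopology UNIV (\<lambda>x y. v (x - y))"

definition nonarch_local_field :: "('f::field \<Rightarrow> real) \<Rightarrow> bool" where
  "nonarch_local_field v \<longleftrightarrow>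
     nonarch_absolute_value v \<and>
     field_topology v \<noteq> discrete_topology UNIV \<and>
     locally_compact_space (field_topology v)"

definition valuation_ring :: "('f::field \<Rightarrow> real) \<Rightarrow> 'f ring" where
  "valuation_ring v = (ring_of_type_algebra :: 'f ring) \<lparr> carrier := {x. v x \<le> 1} \<rparr>"

definition residue_field :: "('f::field \<Rightarrow> real) \<Rightarrow> 'f set ring" where
  "residue_field v = valuation_ring v Quot {x. v x < 1}"

definition has_characteristic :: "('a, 'm) ring_scheme \<Rightarrow> nat \<Rightarrow> bool" where
  "has_characteristic K p \<longleftrightarrow> (\<forall>n::nat. [n] \<cdot>\<^bsub>K\<^esub> \<one>\<^bsub>K\<^esub> = \<zero>\<^bsub>K\<^esub> \<longleftrightarrow> p dvd n)"

definition smooth_character ::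
    "('f::field \<Rightarrow> real) \<Rightarrow> ('f \<Rightarrow> 'r::comm_ring_1) \<Rightarrow> bool" where
  "smooth_character v chi \<longleftrightarrow>
     (\<forall>x. chi x dvd 1) \<and> (\<forall>x y. chi (x + y) = chi x * chi y) \<and>
     openin (field_topology v) {x. chi x = 1}"


section \<open>The symplectic space and its symplectic group\<close>

text \<open>
  The vector space \<open>X\<close> is the whole type \<open>'x\<close> with scalar multiplication \<open>smul\<close>;
  \<open>W\<close> is a set of pairs, with the componentwise (and, on functionals, pointwise) operations.
  As in \<open>Bij\<close>, maps on \<open>W\<close>, \<open>A(W)\<close> and \<open>S(X)\<close> are extensional, i.e. undefined off these sets.
\<close>

definition dual_space :: "('f::field \<Rightarrow> 'x::ab_group_add \<Rightarrow> 'x) \<Rightarrow> ('x \<Rightarrow> 'f) set" where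
  "dual_space smul = {x'. Vector_Spaces.linear smul (*) x'}"

definition W_space :: "('f::field \<Rightarrow> 'x::ab_group_add \<Rightarrow> 'x) \<Rightarrow> ('x \<times> ('x \<Rightarrow> 'f)) set" where
  "W_space smul = UNIV \<times> dual_space smul"

definition W_smul ::
    "('f::field \<Rightarrow> 'x::ab_group_add \<Rightarrow> 'x) \<Rightarrow> 'f \<Rightarrow> 'x \<times> ('x \<Rightarrow> 'f) \<Rightarrow> 'x \<times> ('x \<Rightarrow> 'f)" where
  "W_smul smul a w = (smul a (fst w), \<lambda>y. a * snd w y)"

definition B_form :: "'x \<times> ('x \<Rightarrow> 'f) \<Rightarrow> 'x \<times> ('x \<Rightarrow> 'f) \<Rightarrow> 'f" where
  "B_form w\<^sub>1 w\<^sub>2 = snd w\<^sub>2 (fst w\<^sub>1)"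

definition Sp ::
    "('f::field \<Rightarrow> 'x::ab_group_add \<Rightarrow> 'x) \<Rightarrow> ('x \<times> ('x \<Rightarrow> 'f) \<Rightarrow> 'x \<times> ('x \<Rightarrow> 'f)) monoid" where
  "Sp smul = BijGroup (W_space smul) \<lparr> carrier := {\<sigma> \<in> Bij (W_space smul).
     (\<forall>w\<^sub>1\<in>W_space smul. \<forall>w\<^sub>2\<in>W_space smul. \<sigma> (w\<^sub>1 + w\<^sub>2) = \<sigma> w\<^sub>1 + \<sigma> w\<^sub>2) \<and>
     (\<forall>a. \<forall>w\<in>W_space smul. \<sigma> (W_smul smul a w) = W_smul smul a (\<sigma> w)) \<and>
     (\<forall>w\<^sub>1\<in>W_space smul. \<forall>w\<^sub>2\<in>W_space smul.
        B_form (\<sigma> w\<^sub>1) (\<sigma> w\<^sub>2) - B_form (\<sigma> w\<^sub>2) (\<sigma> w\<^sub>1) = B_form w\<^sub>1 w\<^sub>2 - B_form w\<^sub>2 w\<^sub>1)} \<rparr>"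

definition f_sigma ::
    "('x \<times> ('x \<Rightarrow> 'f::field) \<Rightarrow> 'x \<times> ('x \<Rightarrow> 'f)) \<Rightarrow> 'x \<times> ('x \<Rightarrow> 'f) \<Rightarrow> 'f" where
  "f_sigma \<sigma> w = (B_form (\<sigma> w) (\<sigma> w) - B_form w w) / 2"


section \<open>The Heisenberg group and its automorphisms\<close>

definition A_grp ::
    "('f::field \<Rightarrow> 'x::ab_group_add \<Rightarrow> 'x) \<Rightarrow> ('f \<Rightarrow> 'r::comm_ring_1)
     \<Rightarrow> (('x \<times> ('x \<Rightarrow> 'f)) \<times> 'r) monoid" where
  "A_grp smul chi =
     \<lparr> carrier = W_space smul \<times> {t. t dvd 1},
       mult = (\<lambda>(w\<^sub>1, t\<^sub>1) (w\<^sub>2, t\<^sub>2). (w\<^sub>1 + w\<^sub>2, t\<^sub>1 * t\<^sub>2 * chi (B_form w\<^sub>1 w\<^sub>2))),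
       one = (0, 1) \<rparr>"

definition B0_grp ::
    "('f::field \<Rightarrow> 'x::ab_group_add \<Rightarrow> 'x) \<Rightarrow> ('f \<Rightarrow> 'r::comm_ring_1)
     \<Rightarrow> (('x \<times> ('x \<Rightarrow> 'f)) \<times> 'r \<Rightarrow> ('x \<times> ('x \<Rightarrow> 'f)) \<times> 'r) monoid" where
  "B0_grp smul chi = AutoGroup (A_grp smul chi)
     \<lparr> carrier := {\<alpha> \<in> auto (A_grp smul chi). \<forall>t. t dvd 1 \<longrightarrow> \<alpha> (0, t) = (0, t)} \<rparr>"

definition mu_map ::
    "('f::field \<Rightarrow> 'x::ab_group_add \<Rightarrow> 'x) \<Rightarrow> ('f \<Rightarrow> 'r::comm_ring_1)
     \<Rightarrow> ('x \<times> ('x \<Rightarrow> 'f) \<Rightarrow> 'x \<times> ('x \<Rightarrow> 'f))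
     \<Rightarrow> ('x \<times> ('x \<Rightarrow> 'f)) \<times> 'r \<Rightarrow> ('x \<times> ('x \<Rightarrow> 'f)) \<times> 'r" where
  "mu_map smul chi \<sigma> = (\<lambda>(w, t) \<in> carrier (A_grp smul chi). (\<sigma> w, chi (f_sigma \<sigma> w) * t))"


section \<open>Schwartz functions and the operators \<open>U (w, t)\<close>\<close>

text \<open>
  A finite-dimensional space over a local field carries the topology of \<open>F\<^sup>n\<close>, transported
  along the coordinates in a basis. The resulting topology does not depend on the basis, here
  the one chosen by \<open>extend_basis {}\<close>.
\<close>

definition X_topology ::
    "('f::field \<Rightarrow> real) \<Rightarrow> ('f \<Rightarrow> 'x::ab_group_add \<Rightarrow> 'x) \<Rightarrow> 'x topology" where
  "X_topology v smul =
     (let B = vector_space.extend_basis smul {} in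
      pullback_topology UNIV (\<lambda>x. \<lambda>b\<in>B. module.representation smul B x b)
        (product_topology (\<lambda>_. field_topology v) B))"

definition locally_constant :: "'a topology \<Rightarrow> ('a \<Rightarrow> 'b) \<Rightarrow> bool" where
  "locally_constant T f \<longleftrightarrow> (\<forall>x\<in>topspace T. \<exists>U. openin T U \<and> x \<in> U \<and> (\<forall>y\<in>U. f y = f x))"

definition Schwartz ::
    "('f::field \<Rightarrow> real) \<Rightarrow> ('f \<Rightarrow> 'x::ab_group_add \<Rightarrow> 'x) \<Rightarrow> ('x \<Rightarrow> 'r::comm_ring_1) set" where
  "Schwartz v smul = {\<Phi>. locally_constant (X_topology v smul) \<Phi> \<and>
     compactin (X_topology v smul) (X_topology v smul closure_of {x. \<Phi> x \<noteq> 0})}"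

definition Aut_S ::
    "('f::field \<Rightarrow> real) \<Rightarrow> ('f \<Rightarrow> 'x::ab_group_add \<Rightarrow> 'x)
     \<Rightarrow> (('x \<Rightarrow> 'r::comm_ring_1) \<Rightarrow> ('x \<Rightarrow> 'r)) monoid" where
  "Aut_S v smul = BijGroup (Schwartz v smul) \<lparr> carrier := {s \<in> Bij (Schwartz v smul).
     (\<forall>\<Phi>\<in>Schwartz v smul. \<forall>\<Psi>\<in>Schwartz v smul. s (\<Phi> + \<Psi>) = s \<Phi> + s \<Psi>) \<and>
     (\<forall>r. \<forall>\<Phi>\<in>Schwartz v smul. s (\<lambda>x. r * \<Phi> x) = (\<lambda>x. r * s \<Phi> x))} \<rparr>"

definition U_op ::
    "('f::field \<Rightarrow> real) \<Rightarrow> ('f \<Rightarrow> 'x::ab_group_add \<Rightarrow> 'x) \<Rightarrow> ('f \<Rightarrow> 'r::comm_ring_1)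
     \<Rightarrow> ('x \<times> ('x \<Rightarrow> 'f)) \<times> 'r \<Rightarrow> ('x \<Rightarrow> 'r) \<Rightarrow> ('x \<Rightarrow> 'r)" where
  "U_op v smul chi = (\<lambda>((y, y'), t). \<lambda>\<Phi>\<in>Schwartz v smul. \<lambda>x. t * \<Phi> (x + y) * chi (y' x))"

definition AA ::
    "('f::field \<Rightarrow> real) \<Rightarrow> ('f \<Rightarrow> 'x::ab_group_add \<Rightarrow> 'x) \<Rightarrow> ('f \<Rightarrow> 'r::comm_ring_1)
     \<Rightarrow> (('x \<Rightarrow> 'r) \<Rightarrow> ('x \<Rightarrow> 'r)) set" where
  "AA v smul chi = U_op v smul chi ` carrier (A_grp smul chi)"

definition BB0_grp ::
    "('f::field \<Rightarrow> real) \<Rightarrow> ('f \<Rightarrow> 'x::ab_group_add \<Rightarrow> 'x) \<Rightarrow> ('f \<Rightarrow> 'r::comm_ring_1)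
     \<Rightarrow> (('x \<Rightarrow> 'r) \<Rightarrow> ('x \<Rightarrow> 'r)) monoid" where
  "BB0_grp v smul chi = Aut_S v smul \<lparr> carrier := normalizer (Aut_S v smul) (AA v smul chi) \<rparr>"

definition pi0_map ::
    "('f::field \<Rightarrow> real) \<Rightarrow> ('f \<Rightarrow> 'x::ab_group_add \<Rightarrow> 'x) \<Rightarrow> ('f \<Rightarrow> 'r::comm_ring_1)
     \<Rightarrow> (('x \<Rightarrow> 'r) \<Rightarrow> ('x \<Rightarrow> 'r))
     \<Rightarrow> ('x \<times> ('x \<Rightarrow> 'f)) \<times> 'r \<Rightarrow> ('x \<times> ('x \<Rightarrow> 'f)) \<times> 'r" where
  "pi0_map v smul chi s = (\<lambda>a \<in> carrier (A_grp smul chi).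
     inv_into (carrier (A_grp smul chi)) (U_op v smul chi)
       (s \<otimes>\<^bsub>Aut_S v smul\<^esub> U_op v smul chi a \<otimes>\<^bsub>Aut_S v smul\<^esub> inv\<^bsub>Aut_S v smul\<^esub> s))"


section \<open>The metaplectic group\<close>

definition Mp ::
    "('f::field \<Rightarrow> real) \<Rightarrow> ('f \<Rightarrow> 'x::ab_group_add \<Rightarrow> 'x) \<Rightarrow> ('f \<Rightarrow> 'r::comm_ring_1)
     \<Rightarrow> (('x \<times> ('x \<Rightarrow> 'f) \<Rightarrow> 'x \<times> ('x \<Rightarrow> 'f)) \<times> (('x \<Rightarrow> 'r) \<Rightarrow> ('x \<Rightarrow> 'r))) monoid" where
  "Mp v smul chi = (Sp smul \<times>\<times> BB0_grp v smul chi)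
     \<lparr> carrier := {(\<sigma>, s) \<in> carrier (Sp smul) \<times> carrier (BB0_grp v smul chi).
                   mu_map smul chi \<sigma> = pi0_map v smul chi s} \<rparr>"

definition Mp_proj ::
    "('x \<times> ('x \<Rightarrow> 'f) \<Rightarrow> 'x \<times> ('x \<Rightarrow> 'f)) \<times> (('x \<Rightarrow> 'r) \<Rightarrow> ('x \<Rightarrow> 'r))
     \<Rightarrow> ('x \<times> ('x \<Rightarrow> 'f) \<Rightarrow> 'x \<times> ('x \<Rightarrow> 'f))" where
  "Mp_proj = fst"

definition unit_embedding ::
    "('f::field \<Rightarrow> real) \<Rightarrow> ('f \<Rightarrow> 'x::ab_group_add \<Rightarrow> 'x) \<Rightarrow> 'r::comm_ring_1
     \<Rightarrow> ('x \<times> ('x \<Rightarrow> 'f) \<Rightarrow> 'x \<times> ('x \<Rightarrow> 'f)) \<times> (('x \<Rightarrow> 'r) \<Rightarrow> ('x \<Rightarrow> 'r))" where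
  "unit_embedding v smul t = (\<lambda>w\<in>W_space smul. w, \<lambda>\<Phi>\<in>Schwartz v smul. \<lambda>x. t * \<Phi> x)"

definition mu2 :: "'r::comm_ring_1 set" where
  "mu2 = {t. t dvd 1 \<and> t\<^sup>2 = 1}"

definition is_cover ::
    "('a, 'm) monoid_scheme \<Rightarrow> ('b, 'n) monoid_scheme \<Rightarrow> ('a \<Rightarrow> 'b) \<Rightarrow> 'a set \<Rightarrow> bool" where
  "is_cover G H f K \<longleftrightarrow>
     group_hom G H f \<and> f ` carrier G = carrier H \<and> kernel G H f = K"

end

theory Submission
  imports Defs "Jordan_Normal_Form.Determinant"
begin

text \<open>
  The group \<open>Mp\<^sub>2(W)\<close> is generated by the signs and by explicit lifts of generators of \<open>Sp(W)\<close>: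
  multiplication by \<open>x \<mapsto> \<chi>(\<beta>(x, x))\<close> lifts a Siegel unipotent, and convolution with
  \<open>s \<mapsto> \<chi>(c s\<^sup>2)\<close> along a line, divided by the Gauss sum \<open>G(c)\<close>, lifts a transvection.
  To see that the only scalars so obtained are signs, follow the functional
  \<open>\<Psi>\<^sub>\<beta>(\<Phi>) = \<integral> \<chi>(\<beta>(x, x)) \<Phi>(x) dx\<close>. A generator over \<open>\<sigma>\<close> carries \<open>\<Psi>\<^sub>\<beta>\<close> to a multiple
  \<open>j \<Psi>\<^sub>\<beta>\<^sub>'\<close> with \<open>(j G(1))\<^sup>2 = G(1 / det A)\<^sup>2\<close>, where \<open>A\<close> is the matrix by which \<open>\<sigma>\<close> maps the graph of
  \<open>2 \<beta>'\<close> to the graph of \<open>2 \<beta>\<close>. The map \<open>c \<mapsto> (G(c) / G(1))\<^sup>2\<close> is multiplicative, because the Weil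
  index of a quaternion norm form is a sign: two copies of that form are isotropic. Hence the relation
  persists along products, as long as \<open>\<beta>\<close> avoids the zeros of some rational functions, and for a
  scalar \<open>t\<close> over the identity it says \<open>t\<^sup>2 = 1\<close>.
\<close>

section \<open>Sums over transversals\<close>

text \<open>Only squares of the scalars \<open>j\<close> are ever compared, so no cocycle and no
  Hilbert symbol has to be computed. The obstacle is the coefficient ring: over an arbitrary
  integral domain there is neither measure nor convergence. Every integral is therefore a finite sum
  over coset representatives of lattices, scaled by powers of the unit \<open>q\<close>; it
  stabilises as the lattices vary, because a Gaussian oscillates outside a fixed lattice and a
  nontrivial character sum vanishes in a domain. Schur's lemma likewise has to come from explicit
  averages of Heisenberg operators. The square root of \<open>q\<close> serves to scale
  \<open>G(c)\<close> by the square root of the absolute value of \<open>c\<close>, after which it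
  depends on \<open>c\<close> only modulo squares; this is what lets quadratic form theory act on
  it. The zeros to be avoided are those of the denominators \<open>c + \<beta>(y, y)\<close> that
  appear when a square is completed along the line of \<open>y\<close>. The isotropy statement is
  hardest in residue characteristic two, where reduction modulo the maximal ideal does not classify
  forms; there it follows from counting cosets of lattices.\<close>

definition add_subgroup :: "'a::ab_group_add set \<Rightarrow> bool" where
  "add_subgroup H \<longleftrightarrow> 0 \<in> H \<and> (\<forall>x\<in>H. \<forall>y\<in>H. x - y \<in> H)"

lemma add_subgroup_0: "add_subgroup H \<Longrightarrow> 0 \<in> H"
  by (simp add: add_subgroup_def)

lemma add_subgroup_diff: "add_subgroup H \<Longrightarrow> x \<in> H \<Longrightarrow> y \<in> H \<Longrightarrow> x - y \<in> H"
  by (simp add: add_subgroup_def)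

lemma add_subgroup_minus: "add_subgroup H \<Longrightarrow> x \<in> H \<Longrightarrow> - x \<in> H"
  by (metis add_subgroup_def diff_0)

lemma add_subgroup_add: "add_subgroup H \<Longrightarrow> x \<in> H \<Longrightarrow> y \<in> H \<Longrightarrow> x + y \<in> H"
  by (metis add_subgroup_minus add_subgroup_def diff_minus_eq_add)

definition transversal :: "'a::ab_group_add set \<Rightarrow> 'a set \<Rightarrow> 'a set \<Rightarrow> bool" where
  "transversal T G H \<longleftrightarrow> T \<subseteq> G \<and> (\<forall>g\<in>G. \<exists>!t. t \<in> T \<and> g - t \<in> H)"

text \<open>\<open>r\<close> picks by \<open>SOME\<close> from a predicate that is the same for
  congruent elements, so each coset meeting \<open>G\<close> receives exactly one
  representative.\<close>

lemma transversal_exists: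
  assumes "add_subgroup G" "add_subgroup H"
  shows "\<exists>T. transversal T G H"
proof -
  define r where "r g = (SOME x. x \<in> G \<and> g - x \<in> H)" for g
  have r: "r g \<in> G \<and> g - r g \<in> H" if "g \<in> G" for g
    unfolding r_def by (rule someI_ex, rule exI[of _ g]) (use that assms in \<open>auto simp: add_subgroup_0\<close>)
  have "r g = r g'" if "g \<in> G" "g' \<in> G" "g - r g' \<in> H" for g g'
  proof -
    have "g - g' \<in> H"
      using add_subgroup_diff[OF assms(2) that(3), of "g' - r g'"] r[OF that(2)] by simp
    have "g - x \<in> H \<longleftrightarrow> g' - x \<in> H" for x
    proof
      assume "g - x \<in> H"
      then show "g' - x \<in> H" using add_subgroup_diff[OF assms(2) _ \<open>g - g' \<in> H\<close>] by fastforce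
    next
      assume "g' - x \<in> H"
      then show "g - x \<in> H" using add_subgroup_add[OF assms(2) _ \<open>g - g' \<in> H\<close>] by fastforce
    qed
    then show ?thesis by (simp add: r_def)
  qed
  note uniq = this
  have "\<exists>!t. t \<in> r ` G \<and> g - t \<in> H" if "g \<in> G" for g
  proof (rule ex1I[of _ "r g"])
    show "r g \<in> r ` G \<and> g - r g \<in> H" using r[OF that] that by blast
    fix t assume "t \<in> r ` G \<and> g - t \<in> H"
    then obtain g' where "g' \<in> G" "t = r g'" "g - r g' \<in> H" by blast
    then show "t = r g" using uniq[OF that] by simp
  qed
  moreover have "r ` G \<subseteq> G" using r by auto
  ultimately have "transversal (r ` G) G H" by (simp add: transversal_def)
  then show ?thesis ..
qed

lemma transversal_obtain:
  assumes "transversal T G H" "g \<in> G"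
  obtains t where "t \<in> T" "g - t \<in> H"
  using assms unfolding transversal_def by blast

lemma transversal_subset: "transversal T G H \<Longrightarrow> T \<subseteq> G"
  by (simp add: transversal_def)

lemma transversal_unique:
  assumes "transversal T G H" "add_subgroup H" "t \<in> T" "t' \<in> T" "t - t' \<in> H"
  shows "t = t'"
proof -
  have "t \<in> G" using assms by (auto simp: transversal_def)
  then have "\<exists>!t'. t' \<in> T \<and> t - t' \<in> H" using assms by (simp add: transversal_def)
  moreover have "t - t \<in> H" using add_subgroup_0[OF assms(2)] by simp
  ultimately show ?thesis using assms(3-5) by blast
qed

lemma transversalI:
  assumes "T \<subseteq> G" "add_subgroup H" "\<And>g. g \<in> G \<Longrightarrow> \<exists>t\<in>T. g - t \<in> H"
    and "\<And>t t'. t \<in> T \<Longrightarrow> t' \<in> T \<Longrightarrow> t - t' \<in> H \<Longrightarrow> t = t'"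
  shows "transversal T G H"
  unfolding transversal_def
proof (intro conjI ballI assms(1))
  fix g assume "g \<in> G"
  then obtain t where t: "t \<in> T" "g - t \<in> H" using assms(3) by blast
  show "\<exists>!t. t \<in> T \<and> g - t \<in> H"
  proof (rule ex1I[of _ t])
    fix t' assume t': "t' \<in> T \<and> g - t' \<in> H"
    have "(g - t) - (g - t') \<in> H" using t t' by (blast intro: add_subgroup_diff[OF assms(2)])
    then have "t' - t \<in> H" by simp
    then show "t' = t" using assms(4) t t' by blast
  qed (use t in blast)
qed

text \<open>Sending each representative to the congruent one in the other transversal is a bijection
  that preserves \<open>f\<close>.\<close>

lemma transversal_sum_eq:
  assumes "transversal T G H" "transversal T' G H" "add_subgroup H"
    and "\<And>g h. g \<in> G \<Longrightarrow> h \<in> H \<Longrightarrow> f (g + h) = f g"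
  shows "sum f T = sum f T'"
proof -
  define p where "p t = (SOME t'. t' \<in> T' \<and> t - t' \<in> H)" for t
  define p' where "p' t = (SOME t'. t' \<in> T \<and> t - t' \<in> H)" for t
  have p: "p t \<in> T' \<and> t - p t \<in> H" if "t \<in> T" for t
  proof -
    have "t \<in> G" using that transversal_subset[OF assms(1)] by blast
    then show ?thesis
      unfolding p_def using someI_ex[of "\<lambda>t'. t' \<in> T' \<and> t - t' \<in> H"] transversal_obtain[OF assms(2)] by blast
  qed
  have p': "p' t \<in> T \<and> t - p' t \<in> H" if "t \<in> T'" for t
  proof -
    have "t \<in> G" using that transversal_subset[OF assms(2)] by blast
    then show ?thesis
      unfolding p'_def using someI_ex[of "\<lambda>t'. t' \<in> T \<and> t - t' \<in> H"] transversal_obtain[OF assms(1)] by blast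
  qed
  have pp: "p' (p t) = t" if "t \<in> T" for t
  proof (rule transversal_unique[OF assms(1,3) _ that])
    show "p' (p t) \<in> T" using p[OF that] p' by blast
    have "- ((t - p t) + (p t - p' (p t))) \<in> H"
      using p[OF that] p'[of "p t"] by (intro add_subgroup_minus add_subgroup_add assms) auto
    then show "p' (p t) - t \<in> H" by (simp add: algebra_simps)
  qed
  have pp': "p (p' t) = t" if "t \<in> T'" for t
  proof (rule transversal_unique[OF assms(2,3) _ that])
    show "p (p' t) \<in> T'" using p'[OF that] p by blast
    have "- ((t - p' t) + (p' t - p (p' t))) \<in> H"
      using p'[OF that] p[of "p' t"] by (intro add_subgroup_minus add_subgroup_add assms) auto
    then show "p (p' t) - t \<in> H" by (simp add: algebra_simps)
  qed
  have "f (p t) = f t" if "t \<in> T" for t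
  proof -
    have "t \<in> G" using that transversal_subset[OF assms(1)] by blast
    moreover have "- (t - p t) \<in> H" using p[OF that] add_subgroup_minus[OF assms(3)] by blast
    ultimately show ?thesis using assms(4)[of t "- (t - p t)"] by simp
  qed
  then show ?thesis
    by (intro sum.reindex_bij_witness[of _ p' p]) (use p p' pp pp' in auto)
qed

text \<open>Two representatives close to the same element of \<open>C\<close> are congruent, hence
  equal. To bound an index it thus suffices to exhibit a covering set.\<close>

lemma transversal_card_le:
  assumes "transversal T G H" "add_subgroup H" "finite C" "\<And>x. x \<in> G \<Longrightarrow> \<exists>y\<in>C. x - y \<in> H"
  shows "finite T" "card T \<le> card C"
proof -
  have "\<forall>t\<in>T. \<exists>y\<in>C. t - y \<in> H" using assms(4) transversal_subset[OF assms(1)] by blast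
  then obtain f where f: "\<And>t. t \<in> T \<Longrightarrow> f t \<in> C \<and> t - f t \<in> H" by metis
  have inj: "inj_on f T"
  proof (rule inj_onI)
    fix s t assume st: "s \<in> T" "t \<in> T" "f s = f t"
    have "(s - f s) - (t - f t) \<in> H" by (rule add_subgroup_diff[OF assms(2)]) (use f[OF st(1)] f[OF st(2)] in auto)
    then show "s = t" using transversal_unique[OF assms(1,2) st(1,2)] st(3) by simp
  qed
  have "f ` T \<subseteq> C" using f by blast
  then show "finite T" "card T \<le> card C"
    using inj assms(3) by (auto intro: inj_on_finite card_inj_on_le)
qed

lemma transversal_finite_coarser:
  assumes "transversal T G H" "finite T" "transversal T' G M" "add_subgroup M" "H \<subseteq> M"
  shows "finite T'"
proof (rule transversal_card_le(1)[OF assms(3,4,2)])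
  fix x assume "x \<in> G"
  then obtain t where "t \<in> T" "x - t \<in> H" using transversal_obtain[OF assms(1)] by blast
  then show "\<exists>y\<in>T. x - y \<in> M" using assms(5) by blast
qed

text \<open>The sum over the quotient of \<open>G\<close> by \<open>H\<close>, the finite stand-in
  for an integral. One fixed choice of representatives makes linearity and the exchange of two sums
  immediate; for \<open>H\<close>-periodic \<open>f\<close> the choice is immaterial by
  \<open>tsum_eq\<close>.\<close>

definition tsum :: "'a::ab_group_add set \<Rightarrow> 'a set \<Rightarrow> ('a \<Rightarrow> 'r::comm_ring_1) \<Rightarrow> 'r" where
  "tsum G H f = sum f (SOME T. transversal T G H)"

lemma tsum_eq:
  assumes "transversal T G H" "add_subgroup H"
    and "\<And>g h. g \<in> G \<Longrightarrow> h \<in> H \<Longrightarrow> f (g + h) = f g"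
  shows "tsum G H f = sum f T"
proof -
  have "transversal (SOME T. transversal T G H) G H"
    using someI_ex[of "\<lambda>T. transversal T G H"] assms(1) by blast
  then show ?thesis
    unfolding tsum_def using transversal_sum_eq[OF _ assms(1,2), of _ f] assms(3) by blast
qed

lemma tsum_cong:
  assumes "add_subgroup G" "add_subgroup H" "\<And>g. g \<in> G \<Longrightarrow> f g = f' g"
  shows "tsum G H f = tsum G H f'"
  unfolding tsum_def
proof (rule sum.cong[OF refl])
  fix t assume "t \<in> (SOME T. transversal T G H)"
  then show "f t = f' t"
    using someI_ex[OF transversal_exists[OF assms(1,2)]] assms(3) by (auto simp: transversal_def)
qed

lemma tsum_add: "tsum G H (\<lambda>s. f s + f' s) = tsum G H f + tsum G H f'"
  by (simp add: tsum_def sum.distrib)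

lemma tsum_mult_left: "tsum G H (\<lambda>s. c * f s) = c * tsum G H f"
  by (simp add: tsum_def sum_distrib_left)

lemma tsum_swap: "tsum G H (\<lambda>s. tsum G' H' (f s)) = tsum G' H' (\<lambda>s'. tsum G H (\<lambda>s. f s s'))"
  unfolding tsum_def by (rule sum.swap)

lemma transversal_shift:
  assumes "transversal T G H" "add_subgroup G" "add_subgroup H" "a \<in> G"
  shows "transversal ((\<lambda>t. t + a) ` T) G H"
proof (rule transversalI)
  show "(\<lambda>t. t + a) ` T \<subseteq> G"
    using transversal_subset[OF assms(1)] assms by (auto intro: add_subgroup_add)
  fix g assume "g \<in> G"
  then have "g - a \<in> G" using assms add_subgroup_diff by blast
  then obtain t where "t \<in> T" "g - a - t \<in> H" using transversal_obtain[OF assms(1)] by blast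
  then show "\<exists>t\<in>(\<lambda>t. t + a) ` T. g - t \<in> H" by (auto simp: algebra_simps intro!: bexI[of _ t])
qed (use transversal_unique[OF assms(1,3)] assms in auto)

lemma tsum_shift:
  assumes "add_subgroup G" "add_subgroup H" "a \<in> G"
    and "\<And>g h. g \<in> G \<Longrightarrow> h \<in> H \<Longrightarrow> f (g + h) = f g"
  shows "tsum G H (\<lambda>s. f (s + a)) = tsum G H f"
proof -
  obtain T where T: "transversal T G H" using transversal_exists assms by blast
  have "tsum G H (\<lambda>s. f (s + a)) = (\<Sum>s\<in>T. f (s + a))"
  proof (rule tsum_eq[OF T assms(2)])
    fix g h assume "g \<in> G" "h \<in> H"
    then show "f (g + h + a) = f (g + a)"
      using assms(4)[OF add_subgroup_add[OF assms(1) _ assms(3)], of g h] by (simp add: add.assoc add.commute[of a])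
  qed
  also have "\<dots> = sum f ((\<lambda>t. t + a) ` T)"
    by (subst sum.reindex) (auto simp: inj_on_def)
  also have "\<dots> = tsum G H f"
    using tsum_eq[OF transversal_shift[OF T assms(1,2,3)] assms(2), of f] assms(4) by simp
  finally show ?thesis .
qed

lemma transversal_tower:
  assumes "transversal T1 G M" "transversal T2 M H" "add_subgroup G" "add_subgroup M"
    "add_subgroup H" "H \<subseteq> M" "M \<subseteq> G"
  shows "transversal ((\<lambda>(a, b). a + b) ` (T1 \<times> T2)) G H" "inj_on (\<lambda>(a, b). a + b) (T1 \<times> T2)"
proof -
  have sub: "T1 \<subseteq> G" "T2 \<subseteq> M" using assms by (auto simp: transversal_def)
  have uniq: "a = a' \<and> b = b'"
    if "a \<in> T1" "b \<in> T2" "a' \<in> T1" "b' \<in> T2" "(a + b) - (a' + b') \<in> H" for a b a' b'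
  proof -
    have "(a + b) - (a' + b') - (b - b') \<in> M"
      using that sub assms(6) by (blast intro: add_subgroup_diff[OF assms(4)])
    then have "a - a' \<in> M" by (simp add: algebra_simps)
    then have "a = a'" using transversal_unique[OF assms(1,4)] that by blast
    moreover from this have "b = b'" using transversal_unique[OF assms(2,5)] that by simp
    ultimately show ?thesis by blast
  qed
  show "inj_on (\<lambda>(a, b). a + b) (T1 \<times> T2)"
  proof (rule inj_onI)
    fix s t assume st: "s \<in> T1 \<times> T2" "t \<in> T1 \<times> T2" "(\<lambda>(a, b). a + b) s = (\<lambda>(a, b). a + b) t"
    obtain a b a' b' where [simp]: "s = (a, b)" "t = (a', b')" by fastforce
    show "s = t" using uniq[of a b a' b'] st add_subgroup_0[OF assms(5)] by simp
  qed
  show "transversal ((\<lambda>(a, b). a + b) ` (T1 \<times> T2)) G H"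
  proof (rule transversalI[OF _ assms(5)])
    show "(\<lambda>(a, b). a + b) ` (T1 \<times> T2) \<subseteq> G"
      using sub assms(3,7) by (auto intro!: add_subgroup_add)
    fix g assume "g \<in> G"
    then obtain a where a: "a \<in> T1" "g - a \<in> M" using transversal_obtain[OF assms(1)] by blast
    then obtain b where b: "b \<in> T2" "g - a - b \<in> H" using transversal_obtain[OF assms(2)] by blast
    show "\<exists>t\<in>(\<lambda>(a, b). a + b) ` (T1 \<times> T2). g - t \<in> H"
      by (rule bexI[of _ "a + b"]) (use a b in \<open>auto simp: diff_diff_eq\<close>)
  next
    fix t t' assume "t \<in> (\<lambda>(a, b). a + b) ` (T1 \<times> T2)" "t' \<in> (\<lambda>(a, b). a + b) ` (T1 \<times> T2)" "t - t' \<in> H"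
    then show "t = t'" using uniq by fastforce
  qed
qed

text \<open>Fubini for the chain \<open>H \<subseteq> M \<subseteq> G\<close>.\<close>

lemma tsum_tower:
  assumes "transversal T1 G M" "transversal T2 M H" "add_subgroup G" "add_subgroup M"
    "add_subgroup H" "H \<subseteq> M" "M \<subseteq> G"
    and "\<And>g h. g \<in> G \<Longrightarrow> h \<in> H \<Longrightarrow> f (g + h) = f g"
  shows "tsum G H f = (\<Sum>a\<in>T1. \<Sum>b\<in>T2. f (a + b))"
proof -
  note tt = transversal_tower[OF assms(1-7)]
  have "tsum G H f = sum f ((\<lambda>(a, b). a + b) ` (T1 \<times> T2))"
    by (rule tsum_eq[OF tt(1)]) (use assms in auto)
  also have "\<dots> = (\<Sum>(a, b)\<in>T1 \<times> T2. f (a + b))"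
    by (subst sum.reindex[OF tt(2)]) (simp add: case_prod_unfold)
  finally show ?thesis by (simp add: sum.cartesian_product)
qed

text \<open>Translation by \<open>u\<close> multiplies the sum by \<open>\<xi> u\<close>, which
  differs from 1; in an integral domain the sum must vanish.\<close>

lemma character_sum_eq_0:
  fixes \<xi> :: "'a::ab_group_add \<Rightarrow> 'r::idom"
  assumes "transversal T M H" "add_subgroup M" "add_subgroup H" "H \<subseteq> M"
    and hom: "\<And>u u'. u \<in> M \<Longrightarrow> u' \<in> M \<Longrightarrow> \<xi> (u + u') = \<xi> u * \<xi> u'"
    and "\<And>h. h \<in> H \<Longrightarrow> \<xi> h = 1" and "u \<in> M" "\<xi> u \<noteq> 1"
  shows "sum \<xi> T = 0"
proof -
  have per: "\<xi> (g + h) = \<xi> g" if "g \<in> M" "h \<in> H" for g h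
    using assms that by auto
  have "sum \<xi> T = tsum M H \<xi>" using tsum_eq[OF assms(1,3)] per by metis
  also have "\<dots> = tsum M H (\<lambda>s. \<xi> (s + u))"
    by (rule tsum_shift[symmetric]) (use assms per in auto)
  also have "\<dots> = tsum M H (\<lambda>s. \<xi> u * \<xi> s)"
    by (rule tsum_cong) (use assms in auto)
  also have "\<dots> = \<xi> u * sum \<xi> T"
    unfolding tsum_mult_left using tsum_eq[OF assms(1,3)] per by metis
  finally have "(\<xi> u - 1) * sum \<xi> T = 0" by (simp add: algebra_simps)
  then show ?thesis using assms(8) by simp
qed

text \<open>On cosets of \<open>M\<close> outside \<open>G0\<close> a function of the second degree oscillates, so its sum is
  supported in \<open>G0\<close>.\<close>

lemma tsum_oscillating:
  fixes f :: "'a::ab_group_add \<Rightarrow> 'r::idom"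
  assumes "add_subgroup G" "add_subgroup G0" "add_subgroup M" "add_subgroup H"
    "H \<subseteq> M" "M \<subseteq> G0" "G0 \<subseteq> G"
    and fin: "transversal T G M" "finite T"
    and f: "\<And>g u. g \<in> G \<Longrightarrow> u \<in> M \<Longrightarrow> f (g + u) = f g * \<xi> g u"
    and hom: "\<And>g u u'. g \<in> G \<Longrightarrow> u \<in> M \<Longrightarrow> u' \<in> M \<Longrightarrow> \<xi> g (u + u') = \<xi> g u * \<xi> g u'"
    and triv: "\<And>g h. g \<in> G \<Longrightarrow> h \<in> H \<Longrightarrow> \<xi> g h = 1"
    and osc: "\<And>g. g \<in> G \<Longrightarrow> g \<notin> G0 \<Longrightarrow> \<exists>u\<in>M. \<xi> g u \<noteq> 1"
  shows "tsum G H f = tsum G0 H f"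
proof -
  obtain T2 where T2: "transversal T2 M H" using transversal_exists[OF assms(3,4)] by blast
  have per: "f (g + h) = f g" if "g \<in> G" "h \<in> H" for g h
    using f[of g h] triv[of g h] that assms(5) by (simp add: subset_iff)
  \<comment> \<open>Because \<open>M \<subseteq> G0\<close>, the representatives that happen to lie
    in \<open>G0\<close> already represent \<open>G0\<close> modulo \<open>M\<close>.\<close>
  have T0: "transversal (T \<inter> G0) G0 M"
  proof (rule transversalI[OF _ assms(3)])
    fix g assume g: "g \<in> G0"
    then obtain t where t: "t \<in> T" "g - t \<in> M" using transversal_obtain[OF fin(1)] assms(7) by blast
    have "g - (g - t) \<in> G0" using g t assms(6) by (blast intro: add_subgroup_diff[OF assms(2)])
    then show "\<exists>t\<in>T \<inter> G0. g - t \<in> M" using t by auto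
  qed (use transversal_unique[OF fin(1) assms(3)] in auto)
  have "tsum G H f = (\<Sum>a\<in>T. \<Sum>b\<in>T2. f (a + b))"
    by (rule tsum_tower[OF fin(1) T2]) (use assms per in auto)
  also have "\<dots> = (\<Sum>a\<in>T \<inter> G0. \<Sum>b\<in>T2. f (a + b))"
  proof (rule sum.mono_neutral_right)
    show "\<forall>a\<in>T - T \<inter> G0. (\<Sum>b\<in>T2. f (a + b)) = 0"
    proof
      fix a assume a: "a \<in> T - T \<inter> G0"
      then have aG: "a \<in> G" using fin by (auto simp: transversal_def)
      then obtain u where u: "u \<in> M" "\<xi> a u \<noteq> 1" using osc a by blast
      have "(\<Sum>b\<in>T2. f (a + b)) = (\<Sum>b\<in>T2. f a * \<xi> a b)"
        using f aG T2 by (intro sum.cong) (auto simp: transversal_def)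
      also have "\<dots> = f a * sum (\<xi> a) T2" by (simp add: sum_distrib_left)
      also have "sum (\<xi> a) T2 = 0"
        by (rule character_sum_eq_0[where \<xi>="\<xi> a" and u=u, OF T2 assms(3,4,5)]) (use hom triv u aG in auto)
      finally show "(\<Sum>b\<in>T2. f (a + b)) = 0" by simp
    qed
  qed (use fin in auto)
  also have "\<dots> = tsum G0 H f"
    by (rule tsum_tower[OF T0 T2, symmetric]) (use assms per in auto)
  finally show ?thesis .
qed

lemma transversal_image:
  fixes h :: "'a::ab_group_add \<Rightarrow> 'b::ab_group_add"
  assumes "transversal T G H" "add_subgroup H" "add_subgroup (h ` H)"
    "\<And>x y. h (x - y) = h x - h y" "inj h"
  shows "transversal (h ` T) (h ` G) (h ` H)"
proof (rule transversalI[OF _ assms(3)])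
  show "h ` T \<subseteq> h ` G" using transversal_subset[OF assms(1)] by blast
  fix g assume "g \<in> h ` G"
  then obtain g' where g: "g = h g'" "g' \<in> G" by blast
  then obtain t where "t \<in> T" "g' - t \<in> H" using transversal_obtain[OF assms(1)] by blast
  then show "\<exists>t\<in>h ` T. g - t \<in> h ` H" using g assms(4) by (metis imageI)
next
  fix t t' assume "t \<in> h ` T" "t' \<in> h ` T" "t - t' \<in> h ` H"
  then obtain s s' where s: "s \<in> T" "t = h s" "s' \<in> T" "t' = h s'" by blast
  then have "h (s - s') \<in> h ` H" using \<open>t - t' \<in> h ` H\<close> assms(4) by simp
  then have "s - s' \<in> H" using assms(5) by (simp add: inj_image_mem_iff)
  then show "t = t'" using transversal_unique[OF assms(1,2) s(1,3)] s by simp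
qed

lemma tsum_image:
  fixes h :: "'a::ab_group_add \<Rightarrow> 'b::ab_group_add"
  assumes "\<And>x y. h (x - y) = h x - h y" "inj h" "add_subgroup G" "add_subgroup H" "add_subgroup (h ` H)"
    and per: "\<And>x y. x \<in> h ` G \<Longrightarrow> y \<in> h ` H \<Longrightarrow> f (x + y) = f x"
  shows "tsum (h ` G) (h ` H) f = tsum G H (\<lambda>x. f (h x))"
proof -
  obtain T where T: "transversal T G H" using transversal_exists assms by blast
  have add: "h (x + y) = h x + h y" for x y
  proof -
    have "h 0 = 0" using assms(1)[of 0 0] by simp
    then show ?thesis using assms(1)[of x "- y"] assms(1)[of 0 y] by simp
  qed
  have "tsum (h ` G) (h ` H) f = sum f (h ` T)"
    by (rule tsum_eq[OF transversal_image[OF T assms(4,5,1,2)]]) (use assms in auto)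
  also have "\<dots> = (\<Sum>x\<in>T. f (h x))"
    using assms(2) by (subst sum.reindex) (auto intro: inj_on_subset)
  also have "\<dots> = tsum G H (\<lambda>x. f (h x))"
    by (rule tsum_eq[OF T assms(4), symmetric]) (use per in \<open>auto simp: add\<close>)
  finally show ?thesis .
qed

section \<open>Local fields\<close>

locale local_field =
  fixes v :: "'f::field \<Rightarrow> real"
  assumes local_field: "nonarch_local_field v"
begin

lemma v_nonneg: "0 \<le> v x" and v_eq_0: "v x = 0 \<longleftrightarrow> x = 0"
  and v_mult: "v (x * y) = v x * v y" and v_add: "v (x + y) \<le> max (v x) (v y)"
  using local_field unfolding nonarch_local_field_def nonarch_absolute_value_def by blast+

lemma v_0 [simp]: "v 0 = 0"
  using v_eq_0 by simp

lemma v_pos: "x \<noteq> 0 \<Longrightarrow> 0 < v x"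
  using v_nonneg[of x] v_eq_0[of x] by linarith

lemma v_1 [simp]: "v 1 = 1"
  using v_mult[of 1 1] v_pos[of 1] by simp

lemma v_minus [simp]: "v (- x) = v x"
proof -
  have "(v (- 1))\<^sup>2 = 1" using v_mult[of "- 1" "- 1"] by (simp add: power2_eq_square)
  then have "v (- 1) = 1" using v_nonneg[of "- 1"] by (simp add: power2_eq_1_iff)
  then show ?thesis using v_mult[of "- 1" x] by simp
qed

lemma v_diff: "v (x - y) \<le> max (v x) (v y)"
  using v_add[of x "- y"] by simp

lemma v_minus_commute: "v (x - y) = v (y - x)"
  using v_minus[of "x - y"] by simp

lemma v_power: "v (x ^ n) = v x ^ n"
  by (induction n) (auto simp: v_mult)

lemma v_inverse: "v (inverse x) = inverse (v x)"
proof (cases "x = 0")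
  case False
  then have "v x * v (inverse x) = 1" using v_mult[of x "inverse x"] by simp
  then show ?thesis by (metis inverse_unique)
qed simp

lemma v_divide: "v (x / y) = v x / v y"
  by (simp add: divide_inverse v_mult v_inverse)

text \<open>The isosceles triangle principle of an ultrametric.\<close>

lemma v_eq_of_close: "v (x - y) < v y \<Longrightarrow> v x = v y"
  using v_add[of "x - y" y] v_diff[of x "x - y"] by (auto simp: max_def split: if_splits)

lemma v_of_nat_le_1: "v (of_nat n) \<le> 1"
proof (induction n)
  case (Suc n)
  then show ?case using v_add[of 1 "of_nat n"] by simp
qed simp

section \<open>Metric topology and sequential compactness\<close>

sublocale M: Metric_space UNIV "\<lambda>x y. v (x - y)"
proof
  fix x y z
  show "0 \<le> v (x - y)" by (rule v_nonneg)
  show "v (x - y) = v (y - x)" by (rule v_minus_commute)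
  show "v (x - y) = 0 \<longleftrightarrow> x = y" by (simp add: v_eq_0)
  have "v (x - z) \<le> max (v (x - y)) (v (y - z))" using v_add[of "x - y" "y - z"] by simp
  then show "v (x - z) \<le> v (x - y) + v (y - z)"
    using v_nonneg[of "x - y"] v_nonneg[of "y - z"] by linarith
qed

lemma field_topology_eq: "field_topology v = M.mtopology"
  by (simp add: field_topology_def)

lemma openin_field_iff:
  "openin (field_topology v) S \<longleftrightarrow> (\<forall>x\<in>S. \<exists>r>0. \<forall>y. v (x - y) < r \<longrightarrow> y \<in> S)"
  by (auto simp: field_topology_eq M.openin_mtopology subset_iff M.in_mball)

text \<open>Otherwise every ball of radius \<open>e\<close> is a single point and the topology is
  discrete.\<close>

lemma small_nonzero:
  assumes "0 < e" shows "\<exists>x. x \<noteq> 0 \<and> v x < e"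
proof (rule ccontr)
  assume *: "\<not> ?thesis"
  have "openin (field_topology v) {x}" for x
    unfolding openin_field_iff using assms *
    by (metis right_minus_eq singletonD singletonI)
  moreover have "topspace (field_topology v) = UNIV" by (simp add: field_topology_eq)
  ultimately have "discrete_topology UNIV = field_topology v"
    by (simp add: discrete_topology_unique)
  then show False using local_field by (simp add: nonarch_local_field_def)
qed

lemma compact_small_ball: "\<exists>r>0. compactin (field_topology v) {x. v x \<le> r}"
proof -
  have "locally_compact_space (field_topology v)"
    using local_field by (simp add: nonarch_local_field_def)
  then obtain U V where UV: "openin (field_topology v) U" "compactin (field_topology v) V" "0 \<in> U" "U \<subseteq> V"
    unfolding locally_compact_space_def by (metis M.topspace_mtopology UNIV_I field_topology_eq)
  then obtain r where r: "r > 0" "\<And>y. v (0 - y) < r \<Longrightarrow> y \<in> U" unfolding openin_field_iff by blast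
  have "{x. v x \<le> r / 2} \<subseteq> V" using r UV(4) by fastforce
  moreover have "closedin (field_topology v) {x. v x \<le> r / 2}"
  proof -
    have "{x. v x \<le> r / 2} = M.mcball 0 (r / 2)" by (auto simp: M.in_mcball)
    then show ?thesis using M.closedin_mcball by (simp add: field_topology_eq)
  qed
  ultimately have "compactin (field_topology v) {x. v x \<le> r / 2}"
    using closed_compactin UV(2) by blast
  then show ?thesis using r(1) by (intro exI[of _ "r / 2"]) simp
qed

text \<open>Local compactness yields just one small compact ball. Multiplication by a small
  \<open>a\<close> moves the sequence into it, and the limit found there is divided by
  \<open>a\<close> again. The bound passes to a nonzero limit because terms close to it have the
  same absolute value.\<close>

lemma bounded_subsequence:
  assumes "\<And>n. v (\<sigma> n) \<le> R"
  shows "\<exists>l r. v l \<le> R \<and> strict_mono (r::nat \<Rightarrow> nat) \<and> (\<forall>e>0. \<exists>N. \<forall>n\<ge>N. v (\<sigma> (r n) - l) < e)"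
proof -
  obtain r0 where r0: "r0 > 0" "compactin (field_topology v) {x. v x \<le> r0}"
    using compact_small_ball by blast
  obtain a where a: "a \<noteq> 0" "v a < r0 / (\<bar>R\<bar> + 1)"
    using small_nonzero[of "r0 / (\<bar>R\<bar> + 1)"] r0 by auto
  have a_le: "v (a * \<sigma> n) \<le> r0" for n
  proof -
    have "v a * v (\<sigma> n) \<le> r0 / (\<bar>R\<bar> + 1) * (\<bar>R\<bar> + 1)"
      using a(2) assms[of n] by (intro mult_mono) (use r0(1) in \<open>auto simp: v_nonneg\<close>)
    also have "\<dots> = r0" by (simp add: add_nonneg_eq_0_iff)
    finally show ?thesis by (simp add: v_mult)
  qed
  have "range (\<lambda>n. a * \<sigma> n) \<subseteq> {x. v x \<le> r0}" using a_le by auto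
  then obtain l r where lr: "l \<in> {x. v x \<le> r0}" "strict_mono (r::nat\<Rightarrow>nat)"
      "limitin M.mtopology ((\<lambda>n. a * \<sigma> n) \<circ> r) l sequentially"
    using r0(2) M.compactin_sequentially[of "{x. v x \<le> r0}"] unfolding field_topology_eq by blast
  have conv: "\<exists>N. \<forall>n\<ge>N. v (\<sigma> (r n) - l / a) < e" if "e > 0" for e
  proof -
    have "e * v a > 0" using that v_pos[OF a(1)] by simp
    then obtain N where N: "\<And>n. n \<ge> N \<Longrightarrow> v (a * \<sigma> (r n) - l) < e * v a"
      using lr(3) unfolding M.limitin_metric eventually_sequentially by auto
    have "v (\<sigma> (r n) - l / a) < e" if "n \<ge> N" for n
    proof -
      have "a * \<sigma> (r n) - l = a * (\<sigma> (r n) - l / a)" using a(1) by (simp add: field_simps)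
      then have "v a * v (\<sigma> (r n) - l / a) < e * v a" using N[OF that] by (simp add: v_mult)
      then show ?thesis using v_pos[OF a(1)] by (simp add: mult.commute)
    qed
    then show ?thesis by blast
  qed
  moreover have "v (l / a) \<le> R"
  proof (cases "l / a = 0")
    case True
    then have "v (l / a) = 0" by (simp only: v_0)
    then show ?thesis using assms[of 0] v_nonneg[of "\<sigma> 0"] by linarith
  next
    case False
    then obtain N where "v (\<sigma> (r N) - l / a) < v (l / a)" using conv[OF v_pos] by blast
    then show ?thesis using v_eq_of_close assms by metis
  qed
  ultimately show ?thesis using lr(2) by blast
qed

text \<open>The supremum \<open>s\<close> of the absolute values below 1 is attained: along a
  convergent subsequence of a maximising sequence the absolute values are eventually constant, equal
  to that of the limit, and they approach \<open>s\<close>.\<close>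

lemma uniformizer_exists: "\<exists>w. 0 < v w \<and> v w < 1 \<and> (\<forall>x. v x < 1 \<longrightarrow> v x \<le> v w)"
proof -
  define s where "s = Sup {v x |x. v x < 1}"
  have ne: "{v x |x. v x < 1} \<noteq> {}" by (auto intro!: exI[of _ 0])
  have bdd: "bdd_above {v x |x. v x < 1}" by (rule bdd_aboveI[of _ 1]) auto
  have le: "v x \<le> s" if "v x < 1" for x
    unfolding s_def by (rule cSup_upper[OF _ bdd]) (use that in blast)
  obtain x0 where x0: "x0 \<noteq> 0" "v x0 < 1" using small_nonzero[of 1] by auto
  then have s_pos: "0 < s" using le v_pos less_le_trans by blast
  have "\<exists>x. v x < 1 \<and> s - 1 / real (Suc n) < v x" for n
  proof -
    have "s - 1 / real (Suc n) < s" by simp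
    then obtain y where "y \<in> {v x |x. v x < 1}" "s - 1 / real (Suc n) < y"
      unfolding s_def by (rule less_cSupE[OF _ ne])
    then show ?thesis by auto
  qed
  then obtain \<sigma> where \<sigma>: "\<And>n. v (\<sigma> n) < 1" "\<And>n. s - 1 / real (Suc n) < v (\<sigma> n)" by metis
  have "v (\<sigma> n) \<le> s" for n using le \<sigma>(1) by blast
  then obtain l r where l: "v l \<le> s" "strict_mono (r::nat\<Rightarrow>nat)" "\<And>e. e > 0 \<Longrightarrow> \<exists>N. \<forall>n\<ge>N. v (\<sigma> (r n) - l) < e"
    using bounded_subsequence by metis
  obtain N where N: "\<And>n. n \<ge> N \<Longrightarrow> v (\<sigma> (r n) - l) < s / 2" using l(3)[of "s / 2"] s_pos by auto
  obtain k where k: "1 / real (Suc k) < s / 2"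
    using s_pos reals_Archimedean[of "s / 2"] by (auto simp: inverse_eq_divide)
  have v_l: "v l = v (\<sigma> (r n)) \<and> s - 1 / real (Suc n) < v (\<sigma> (r n))" if "n \<ge> max N k" for n
  proof
    have "r n \<ge> n" by (rule seq_suble[OF l(2)])
    then have "1 / real (Suc (r n)) \<le> 1 / real (Suc n)" by (intro divide_left_mono) auto
    then show gt: "s - 1 / real (Suc n) < v (\<sigma> (r n))" using \<sigma>(2)[of "r n"] by simp
    have "1 / real (Suc n) \<le> 1 / real (Suc k)" using that by (intro divide_left_mono) auto
    then have "s / 2 < v (\<sigma> (r n))" using gt k by simp
    then show "v l = v (\<sigma> (r n))"
      using N[of n] that by (intro v_eq_of_close) (simp add: v_minus_commute)
  qed
  have "s \<le> v l"
  proof (rule ccontr)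
    assume "\<not> s \<le> v l"
    then obtain m where m: "1 / real (Suc m) < s - v l"
      using reals_Archimedean[of "s - v l"] by (auto simp: inverse_eq_divide)
    have "1 / real (Suc (max m (max N k))) \<le> 1 / real (Suc m)" by (intro divide_left_mono) auto
    then show False using v_l[of "max m (max N k)"] m by simp
  qed
  moreover have "v l < 1" using v_l[of "max N k"] \<sigma>(1) by simp
  ultimately show ?thesis using s_pos le by (intro exI[of _ l]) force
qed

definition \<pi> where "\<pi> = (SOME w. 0 < v w \<and> v w < 1 \<and> (\<forall>x. v x < 1 \<longrightarrow> v x \<le> v w))"

lemma v_\<pi>: "0 < v \<pi>" "v \<pi> < 1" and v_le_\<pi>: "v x < 1 \<Longrightarrow> v x \<le> v \<pi>"
  unfolding \<pi>_def using someI_ex[OF uniformizer_exists] by blast+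

lemma \<pi>_nonzero [simp]: "\<pi> \<noteq> 0"
  using v_\<pi>(1) by auto

lemma v_power_int: "v (x powi k) = v x powi k"
  by (simp add: power_int_def v_power v_inverse)

lemma powi_v_\<pi>_pos: "0 < v \<pi> powi k"
  using v_\<pi>(1) by simp

lemma powi_v_\<pi>_less_iff: "v \<pi> powi j < v \<pi> powi k \<longleftrightarrow> k < j"
  and powi_v_\<pi>_le_iff: "v \<pi> powi j \<le> v \<pi> powi k \<longleftrightarrow> k \<le> j"
proof -
  have less: "v \<pi> powi j < v \<pi> powi k" if "k < j" for j k
    using that v_\<pi> by (intro power_int_strict_decreasing)
  show "v \<pi> powi j < v \<pi> powi k \<longleftrightarrow> k < j" "v \<pi> powi j \<le> v \<pi> powi k \<longleftrightarrow> k \<le> j"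
    using less[of k j] less[of j k] by (cases j k rule: linorder_cases; force)+
qed

lemma powi_v_\<pi>_small: "0 < e \<Longrightarrow> \<exists>k. v \<pi> powi k < e"
  using real_arch_pow_inv[OF _ v_\<pi>(2)] by (metis power_int_of_nat)

text \<open>\<open>v x\<close> lies between two consecutive powers of \<open>v \<pi>\<close>;
  dividing by the larger one gives an absolute value below 1, hence at most \<open>v \<pi>\<close>,
  so the lower bound is attained.\<close>

lemma v_eq_powi:
  assumes "x \<noteq> 0" shows "\<exists>k. v x = v \<pi> powi k"
proof -
  obtain n where n: "v \<pi> ^ n < v x" using real_arch_pow_inv[OF v_pos[OF assms] v_\<pi>(2)] by blast
  obtain m where m: "v \<pi> ^ m < inverse (v x)"
    using real_arch_pow_inv[of "inverse (v x)"] v_pos[OF assms] v_\<pi>(2) by auto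
  define P where "P k \<longleftrightarrow> v \<pi> powi (int k - int m) \<le> v x" for k :: nat
  have "P (n + m)" using n by (simp add: P_def)
  moreover have "\<not> P 0"
  proof -
    have "v x < inverse (v \<pi> ^ m)"
      using m v_pos[OF assms] v_\<pi>(1) by (metis inverse_inverse_eq inverse_less_imp_less inverse_positive_iff_positive zero_less_power)
    then show ?thesis by (simp add: P_def power_int_minus)
  qed
  ultimately obtain k where k: "P (Suc k)" "\<not> P k"
    using ex_least_nat_less[of P "n + m"] by blast
  define j where "j = int k - int m"
  have j: "v \<pi> powi (j + 1) \<le> v x" "v x < v \<pi> powi j"
    using k by (auto simp: P_def j_def algebra_simps)
  have "v (x / \<pi> powi j) < 1"
    using j(2) powi_v_\<pi>_pos[of j] by (simp add: v_divide v_power_int)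
  then have "v x / v \<pi> powi j \<le> v \<pi>" using v_le_\<pi>[of "x / \<pi> powi j"] by (simp add: v_divide v_power_int)
  then have "v x \<le> v \<pi> powi (j + 1)"
    using powi_v_\<pi>_pos[of j] v_\<pi>(1) by (simp add: power_int_add pos_divide_le_eq mult.commute)
  then show ?thesis using j(1) by (intro exI[of _ "j + 1"]) simp
qed

text \<open>The normalised additive valuation. \<open>ord 0\<close> is an arbitrary integer, which
  is why 0 is treated apart in \<open>U_iff_ord\<close>, whereas \<open>U_ord\<close> holds for 0 as
  well.\<close>

definition ord :: "'f \<Rightarrow> int" where "ord x = (SOME k. v x = v \<pi> powi k)"

lemma v_eq_ord: "x \<noteq> 0 \<Longrightarrow> v x = v \<pi> powi ord x"
  unfolding ord_def by (rule someI_ex[OF v_eq_powi])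

lemma ord_unique: "v x = v \<pi> powi k \<Longrightarrow> ord x = k"
proof -
  assume k: "v x = v \<pi> powi k"
  then have "x \<noteq> 0" using powi_v_\<pi>_pos[of k] by auto
  then have "v \<pi> powi ord x = v \<pi> powi k" using k v_eq_ord[of x] by simp
  then show ?thesis
    using powi_v_\<pi>_le_iff[of "ord x" k] powi_v_\<pi>_le_iff[of k "ord x"] by simp
qed

lemma ord_mult: "x \<noteq> 0 \<Longrightarrow> y \<noteq> 0 \<Longrightarrow> ord (x * y) = ord x + ord y"
  using v_\<pi>(1) by (intro ord_unique) (simp add: v_mult v_eq_ord[of x] v_eq_ord[of y] power_int_add)

lemma ord_1 [simp]: "ord 1 = 0"
  by (intro ord_unique) simp

lemma ord_minus [simp]: "ord (- x) = ord x"
  by (simp add: ord_def)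

lemma ord_\<pi>: "ord (\<pi> powi k) = k"
  by (intro ord_unique) (simp add: v_power_int)

lemma ord_inverse: "x \<noteq> 0 \<Longrightarrow> ord (inverse x) = - ord x"
  by (intro ord_unique) (simp add: v_inverse v_eq_ord[of x] power_int_minus)

lemma ord_divide: "x \<noteq> 0 \<Longrightarrow> y \<noteq> 0 \<Longrightarrow> ord (x / y) = ord x - ord y"
  by (simp add: divide_inverse ord_mult ord_inverse)

text \<open>The fractional ideal generated by the \<open>k\<close>-th power of the uniformizer; it
  shrinks as \<open>k\<close> grows.\<close>

definition U :: "int \<Rightarrow> 'f set" where "U k = {x. v x \<le> v \<pi> powi k}"

lemma U_subgroup: "add_subgroup (U k)"
  unfolding add_subgroup_def U_def
proof (intro conjI ballI)
  show "0 \<in> {x. v x \<le> v \<pi> powi k}" using powi_v_\<pi>_pos[of k] by simp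
  fix x y assume "x \<in> {x. v x \<le> v \<pi> powi k}" "y \<in> {x. v x \<le> v \<pi> powi k}"
  then show "x - y \<in> {x. v x \<le> v \<pi> powi k}" using v_diff[of x y] by simp
qed

lemmas U_0 = add_subgroup_0[OF U_subgroup]
  and U_add = add_subgroup_add[OF U_subgroup]
  and U_diff = add_subgroup_diff[OF U_subgroup]
  and U_minus = add_subgroup_minus[OF U_subgroup]

lemma U_iff_ord: "x \<in> U k \<longleftrightarrow> x = 0 \<or> k \<le> ord x"
  by (cases "x = 0") (auto simp: U_0 U_def v_eq_ord[of x] powi_v_\<pi>_le_iff powi_v_\<pi>_pos less_imp_le)

lemma U_mono: "j \<le> k \<Longrightarrow> U k \<subseteq> U j"
  by (auto simp: U_iff_ord)

lemma U_monoD: "x \<in> U k \<Longrightarrow> j \<le> k \<Longrightarrow> x \<in> U j"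
  using U_mono by blast

lemma U_minus_iff [simp]: "- x \<in> U k \<longleftrightarrow> x \<in> U k"
  by (simp add: U_def)

lemma U_mult: "x \<in> U j \<Longrightarrow> y \<in> U k \<Longrightarrow> x * y \<in> U (j + k)"
  by (cases "x = 0 \<or> y = 0") (auto simp: U_iff_ord ord_mult)

lemma U_mult_iff: "c \<noteq> 0 \<Longrightarrow> c * x \<in> U k \<longleftrightarrow> x \<in> U (k - ord c)"
  by (cases "x = 0") (auto simp: U_iff_ord ord_mult)

lemma U_ord: "x \<in> U (ord x)"
  by (simp add: U_iff_ord)

lemma U_1_iff: "x \<in> U 1 \<longleftrightarrow> v x < 1"
  using v_le_\<pi>[of x] v_\<pi>(2) by (auto simp: U_def)

lemma U_0_iff: "x \<in> U 0 \<longleftrightarrow> v x \<le> 1"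
  by (simp add: U_def)

lemma U_Suc_iff: "x \<in> U (k + 1) \<longleftrightarrow> v x < v \<pi> powi k"
  by (cases "x = 0") (auto simp: U_0 U_iff_ord v_eq_ord[of x] powi_v_\<pi>_less_iff powi_v_\<pi>_pos)

lemma U_image_mult: "c \<noteq> 0 \<Longrightarrow> (*) c ` U k = U (ord c + k)"
proof
  assume c: "c \<noteq> 0"
  show "(*) c ` U k \<subseteq> U (ord c + k)" using U_mult[OF U_ord] by blast
  show "U (ord c + k) \<subseteq> (*) c ` U k"
  proof
    fix x assume "x \<in> U (ord c + k)"
    then have "x / c \<in> U k" using U_mult_iff[OF c, of "x / c" "ord c + k"] c by simp
    then show "x \<in> (*) c ` U k" using c by (auto intro!: image_eqI[of _ _ "x / c"])
  qed
qed

text \<open>An infinite set of representatives would contain a convergent sequence of distinct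
  elements, whose late terms are congruent modulo \<open>U 1\<close>.\<close>

lemma finite_residue_transversal:
  assumes T: "transversal T (U 0) (U 1)" shows "finite T"
proof (rule ccontr)
  assume "infinite T"
  then obtain \<sigma> :: "nat \<Rightarrow> 'f" where \<sigma>: "inj \<sigma>" "range \<sigma> \<subseteq> T"
    using infinite_countable_subset by blast
  have "v (\<sigma> n) \<le> 1" for n
    using \<sigma>(2) transversal_subset[OF T] U_0_iff by blast
  then obtain l r where lr: "strict_mono (r::nat\<Rightarrow>nat)" "\<And>e. e > 0 \<Longrightarrow> \<exists>N. \<forall>n\<ge>N. v (\<sigma> (r n) - l) < e"
    using bounded_subsequence by metis
  obtain N where N: "\<And>n. n \<ge> N \<Longrightarrow> v (\<sigma> (r n) - l) < 1" using lr(2)[of 1] by auto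
  have "(\<sigma> (r N) - l) - (\<sigma> (r (Suc N)) - l) \<in> U 1"
    using N[of N] N[of "Suc N"] by - (rule U_diff; simp add: U_1_iff)
  then have "\<sigma> (r N) = \<sigma> (r (Suc N))"
    using \<sigma>(2) by (intro transversal_unique[OF T U_subgroup]) auto
  then have "r N = r (Suc N)" using \<sigma>(1) by (simp add: inj_eq)
  then show False using lr(1) by (metis n_not_Suc_n strict_mono_eq)
qed

definition q :: nat where "q = card (SOME T. transversal T (U 0) (U 1))"

lemma transversal_card_eq:
  assumes "transversal T G H" "transversal T' G H" "add_subgroup H"
  shows "card T = card T'"
  using transversal_sum_eq[OF assms, of "\<lambda>_. 1::int"] by simp

lemma residue_transversal_card:
  assumes "transversal T (U 0) (U 1)" shows "card T = q"
  unfolding q_def using assms someI_ex[OF transversal_exists[OF U_subgroup U_subgroup], of 0 1]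
  by (intro transversal_card_eq[OF _ _ U_subgroup])

lemma U_transversal_step: "\<exists>T. transversal T (U k) (U (k + 1)) \<and> finite T \<and> card T = q"
proof -
  obtain T where T: "transversal T (U 0) (U 1)" using transversal_exists U_subgroup by blast
  have ne: "\<pi> powi k \<noteq> 0" by simp
  have "transversal ((*) (\<pi> powi k) ` T) ((*) (\<pi> powi k) ` U 0) ((*) (\<pi> powi k) ` U 1)"
    by (rule transversal_image[OF T U_subgroup])
      (use ne U_subgroup in \<open>auto simp: U_image_mult[OF ne] right_diff_distrib inj_def\<close>)
  moreover have "card ((*) (\<pi> powi k) ` T) = card T"
    using ne by (intro card_image) (auto simp: inj_on_def)
  ultimately show ?thesis
    using finite_residue_transversal[OF T] residue_transversal_card[OF T]
    by (intro exI[of _ "(*) (\<pi> powi k) ` T"]) (simp add: U_image_mult ord_\<pi>)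
qed

lemma U_transversal:
  assumes "j \<le> k"
  shows "\<exists>T. transversal T (U j) (U k) \<and> finite T \<and> card T = q ^ nat (k - j)"
proof -
  have "\<exists>T. transversal T (U j) (U (j + int n)) \<and> finite T \<and> card T = q ^ n" for n
  proof (induction n)
    case 0
    have "transversal {0} (U j) (U j)"
      by (rule transversalI) (auto simp: U_0 U_subgroup)
    then show ?case by (intro exI[of _ "{0}"]) simp
  next
    case (Suc n)
    then obtain T where T: "transversal T (U j) (U (j + int n))" "finite T" "card T = q ^ n" by blast
    obtain T' where T': "transversal T' (U (j + int n)) (U (j + int n + 1))" "finite T'" "card T' = q"
      using U_transversal_step by blast
    have sub: "U (j + int n + 1) \<subseteq> U (j + int n)" "U (j + int n) \<subseteq> U j" by (auto intro: U_monoD)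
    note tt = transversal_tower[OF T(1) T'(1) U_subgroup U_subgroup U_subgroup sub]
    have "card ((\<lambda>(a, b). a + b) ` (T \<times> T')) = q ^ Suc n"
      using card_image[OF tt(2)] T T' by (simp add: card_cartesian_product)
    then show ?case using tt(1) T(2) T'(2)
      by (intro exI[of _ "(\<lambda>(a, b). a + b) ` (T \<times> T')"]) (simp add: algebra_simps)
  qed
  from this[of "nat (k - j)"] show ?thesis using assms by simp
qed

lemma U_transversal_finite:
  assumes "transversal T (U j) (U k)" "j \<le> k"
  shows "finite T" "card T = q ^ nat (k - j)"
proof -
  obtain T' where T': "transversal T' (U j) (U k)" "finite T'" "card T' = q ^ nat (k - j)"
    using U_transversal[OF assms(2)] by blast
  show c: "card T = q ^ nat (k - j)" using transversal_card_eq[OF assms(1) T'(1) U_subgroup] T' by simp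
  have "T' \<noteq> {}" using T'(1) U_0 unfolding transversal_def by blast
  then have "card T' > 0" using T'(2) by (simp add: card_gt_0_iff)
  then show "finite T" using c T'(3) by (intro card_ge_0_finite) simp
qed

lemma infinite_F: "infinite (UNIV :: 'f set)"
proof
  assume fin: "finite (UNIV :: 'f set)"
  have "inj (\<lambda>k::int. \<pi> powi k)" by (rule injI) (metis ord_\<pi>)
  then show False using fin infinite_UNIV_int by (metis finite_imageD finite_subset subset_UNIV)
qed

section \<open>Hensel's lemma for squares\<close>

text \<open>The derivative \<open>2 * y + 1\<close> is congruent to 1 for \<open>y\<close> in the
  maximal ideal, whatever the residue characteristic. Newton's iteration with the derivative
  replaced by 1 changes \<open>f y\<close> into \<open>f y * f y - 2 * y * f y\<close>, so each step
  gains one power of the uniformizer.\<close>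

lemma quadratic_root_exists:
  assumes "v e < 1" shows "\<exists>y. v y < 1 \<and> y\<^sup>2 + y = e"
proof -
  define f where "f y = y\<^sup>2 + y - e" for y
  define y where "y = rec_nat 0 (\<lambda>_ y. y - f y)"
  have y_Suc: "y (Suc n) = y n - f (y n)" and y_0: "y 0 = 0" for n by (simp_all add: y_def)
  have inv: "y n \<in> U 1 \<and> f (y n) \<in> U (1 + int n)" for n
  proof (induction n)
    case 0
    show ?case using assms by (simp add: y_0 U_0 f_def U_1_iff)
  next
    case (Suc n)
    have d1: "f (y n) \<in> U 1" using Suc by (auto intro: U_monoD)
    have "y (Suc n) \<in> U 1" using Suc d1 by (auto simp: y_Suc intro: U_diff)
    moreover have "f (y (Suc n)) = f (y n) * f (y n) - 2 * (y n * f (y n))"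
      by (simp add: f_def y_Suc algebra_simps power2_eq_square)
    moreover have ff: "f (y n) * f (y n) \<in> U (1 + (1 + int n))" "y n * f (y n) \<in> U (1 + (1 + int n))"
      using Suc d1 by (blast intro: U_mult)+
    moreover have "f (y n) * f (y n) - 2 * (y n * f (y n)) \<in> U (1 + (1 + int n))"
      unfolding mult_2 by (rule U_diff[OF ff(1) U_add[OF ff(2) ff(2)]])
    ultimately show ?case by simp
  qed
  \<comment> \<open>A limit point of the iterates suffices: \<open>f (y n)\<close> tends to 0, and
    \<open>f (y n) - f l\<close> factors as \<open>(y n - l) * (y n + l + 1)\<close>.\<close>
  have "v (y n) \<le> 1" for n using inv[of n] U_1_iff[of "y n"] by simp
  then obtain l r where l: "v l \<le> 1" "strict_mono (r::nat\<Rightarrow>nat)" "\<And>e. e > 0 \<Longrightarrow> \<exists>N. \<forall>n\<ge>N. v (y (r n) - l) < e"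
    using bounded_subsequence by metis
  have "f l \<in> U k" for k
  proof -
    obtain N where N: "\<And>n. n \<ge> N \<Longrightarrow> v (y (r n) - l) < v \<pi> powi k"
      using l(3)[OF powi_v_\<pi>_pos] by blast
    define n where "n = max N (nat k)"
    have "y (r n) - l \<in> U k" using N[of n] by (simp add: n_def U_def less_imp_le)
    moreover have "y (r n) + l + 1 \<in> U 0"
      using inv[of "r n"] l(1) by (intro U_add) (auto simp: U_0_iff U_1_iff)
    ultimately have "(y (r n) - l) * (y (r n) + l + 1) \<in> U k" using U_mult[of _ k _ 0] by simp
    moreover have "f (y (r n)) \<in> U k"
    proof (rule U_monoD)
      show "f (y (r n)) \<in> U (1 + int (r n))" using inv by blast
      show "k \<le> 1 + int (r n)" using seq_suble[OF l(2), of n] by (simp add: n_def) linarith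
    qed
    ultimately have "f (y (r n)) - (y (r n) - l) * (y (r n) + l + 1) \<in> U k" by (rule U_diff[rotated])
    moreover have "f (y (r n)) - (y (r n) - l) * (y (r n) + l + 1) = f l"
      by (simp add: f_def algebra_simps power2_eq_square)
    ultimately show ?thesis by simp
  qed
  then have "f l = 0" using U_iff_ord[of "f l" "ord (f l) + 1"] by auto
  moreover have "v l < 1"
  proof -
    obtain N where "v (y (r N) - l) < 1" using l(3)[of 1] by auto
    then have "y (r N) - (y (r N) - l) \<in> U 1" using inv by - (rule U_diff; simp add: U_1_iff)
    then show ?thesis by (simp add: U_1_iff)
  qed
  ultimately show ?thesis by (intro exI[of _ l]) (simp add: f_def)
qed

text \<open>The substitution \<open>z = 1 + 2 * y\<close> turns \<open>z\<^sup>2 = 1 + 4 * e\<close>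
  into \<open>y\<^sup>2 + y = e\<close>. The factor 4 makes the statement valid also when 2 is not a
  unit of the valuation ring.\<close>

lemma square_of_one_plus:
  assumes "v e < 1" shows "\<exists>z. z\<^sup>2 = 1 + 4 * e"
proof -
  obtain y where "y\<^sup>2 + y = e" using quadratic_root_exists[OF assms] by blast
  then have "(1 + 2 * y)\<^sup>2 = 1 + 4 * e" by (auto simp: algebra_simps power2_eq_square)
  then show ?thesis by blast
qed

end

section \<open>The residue field\<close>

text \<open>Sylow's theorem provides a subgroup of order \<open>r\<close>, hence an element of order
  \<open>r\<close>, and the order of an element divides any exponent of the group.\<close>

lemma (in group) prime_dvd_exponent:
  assumes "finite (carrier G)" "Factorial_Ring.prime r" "r dvd order G"
    and "\<And>x. x \<in> carrier G \<Longrightarrow> x [^] (p::nat) = \<one>"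
  shows "r dvd p"
proof -
  obtain m where "order G = r * m" using assms(3) by blast
  then obtain H where H: "subgroup H G" "card H = r"
    using sylow_thm[OF assms(2) is_group, of 1 m] assms(1) by auto
  have "H \<noteq> {\<one>}" using H(2) assms(2) by auto
  moreover have "\<one> \<in> H" by (rule subgroup.one_closed[OF H(1)])
  ultimately obtain h where h: "h \<in> H" "h \<noteq> \<one>" by blast
  have hG: "h \<in> carrier G" by (rule subgroup.mem_carrier[OF H(1) h(1)])
  have "h [^]\<^bsub>G\<lparr>carrier := H\<rparr>\<^esub> r = \<one>"
    using group.pow_order_eq_1[OF subgroup.subgroup_is_group[OF H(1) is_group], of h] h(1) H(2)
    by (simp add: order_def)
  then have "h [^] r = \<one>" by (simp add: nat_pow_def)
  then have "ord h dvd r" using pow_eq_id[OF hG] by blast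
  moreover have "ord h \<noteq> 1" using ord_eq_1[OF hG] h(2) by simp
  ultimately have "ord h = r" using assms(2) by (metis prime_nat_iff)
  moreover have "ord h dvd p" using pow_eq_id[OF hG] assms(4)[OF hG] by blast
  ultimately show ?thesis by simp
qed

lemma (in ring) prime_dvd_characteristic:
  assumes "finite (carrier R)" "[(p::nat)] \<cdot>\<^bsub>R\<^esub> \<one> = \<zero>" "Factorial_Ring.prime r" "r dvd card (carrier R)"
  shows "r dvd p"
proof (rule group.prime_dvd_exponent[OF a_group])
  fix x assume "x \<in> carrier (add_monoid R)"
  then have x: "x \<in> carrier R" by simp
  have "([p] \<cdot>\<^bsub>R\<^esub> \<one>) \<otimes> x = [p] \<cdot>\<^bsub>R\<^esub> (\<one> \<otimes> x)" using x by (intro add_pow_ldistr) auto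
  then have "[p] \<cdot>\<^bsub>R\<^esub> x = \<zero>" using x assms(2) by simp
  then show "x [^]\<^bsub>add_monoid R\<^esub> p = \<one>\<^bsub>add_monoid R\<^esub>" by (simp add: add_pow_def)
qed (use assms in \<open>auto simp: order_def\<close>)

context local_field
begin

lemma valuation_ring_ring: "ring (valuation_ring v)"
proof -
  have cl: "v x \<le> 1 \<Longrightarrow> v y \<le> 1 \<Longrightarrow> v (x + y) \<le> 1" "v x \<le> 1 \<Longrightarrow> v y \<le> 1 \<Longrightarrow> v (x * y) \<le> 1" for x y
    using v_add[of x y] by (auto simp: v_mult mult_le_one v_nonneg)
  have ag: "abelian_group (valuation_ring v)"
  proof (rule abelian_groupI)
    fix x assume "x \<in> carrier (valuation_ring v)"
    then show "\<exists>y\<in>carrier (valuation_ring v). y \<oplus>\<^bsub>valuation_ring v\<^esub> x = \<zero>\<^bsub>valuation_ring v\<^esub>"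
      by (intro bexI[of _ "- x"]) (auto simp: valuation_ring_def ring_of_type_algebra_def)
  qed (auto simp: valuation_ring_def ring_of_type_algebra_def cl algebra_simps)
  have m: "Group.monoid (valuation_ring v)"
    by (rule Group.monoidI) (auto simp: valuation_ring_def ring_of_type_algebra_def cl algebra_simps)
  show ?thesis
    by (rule ringI[OF ag m])
      (auto simp: valuation_ring_def ring_of_type_algebra_def algebra_simps)
qed

lemma residue_field_ring: "ring (residue_field v)"
proof -
  interpret V: ring "valuation_ring v" by (rule valuation_ring_ring)
  have minus: "\<ominus>\<^bsub>valuation_ring v\<^esub> x = - x" if "v x \<le> 1" for x
  proof -
    have "- x \<oplus>\<^bsub>valuation_ring v\<^esub> x = \<zero>\<^bsub>valuation_ring v\<^esub>"
      by (simp add: valuation_ring_def ring_of_type_algebra_def)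
    then show ?thesis
      using V.minus_equality[of "- x" x] that by (simp add: valuation_ring_def)
  qed
  have "subgroup {x. v x < 1} (add_monoid (valuation_ring v))"
  proof (rule V.add.subgroupI)
    fix x assume "x \<in> {x. v x < 1}"
    then show "\<ominus>\<^bsub>valuation_ring v\<^esub> x \<in> {x. v x < 1}"
      using minus[of x] by simp
  next
    fix x y assume "x \<in> {x. v x < 1}" "y \<in> {x. v x < 1}"
    then show "x \<oplus>\<^bsub>valuation_ring v\<^esub> y \<in> {x. v x < 1}"
      using v_add[of x y] by (simp add: valuation_ring_def ring_of_type_algebra_def)
  next
    have "0 \<in> {x. v x < 1}" by simp
    then show "{x. v x < 1} \<noteq> {}" by blast
  qed (auto simp: valuation_ring_def)
  then have "ideal {x. v x < 1} (valuation_ring v)"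
  proof (rule idealI[OF valuation_ring_ring])
    fix a x assume "a \<in> {x. v x < 1}" "x \<in> carrier (valuation_ring v)"
    then have "v a * v x < 1" using mult_left_le[of "v x" "v a"] v_nonneg[of a]
      by (simp add: valuation_ring_def)
    then show "x \<otimes>\<^bsub>valuation_ring v\<^esub> a \<in> {x. v x < 1}" "a \<otimes>\<^bsub>valuation_ring v\<^esub> x \<in> {x. v x < 1}"
      by (simp_all add: valuation_ring_def ring_of_type_algebra_def v_mult mult.commute)
  qed
  then show ?thesis unfolding residue_field_def by (rule ideal.quotient_is_ring)
qed

lemma carrier_residue_field: "carrier (residue_field v) = (\<lambda>a. (\<lambda>h. h + a) ` U 1) ` U 0"
proof -
  have "{x. v x < 1} = U 1" by (auto simp: U_1_iff)
  moreover have "{x. v x \<le> 1} = U 0" by (auto simp: U_0_iff)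
  ultimately show ?thesis
    by (auto simp: residue_field_def FactRing_def A_RCOSETS_def RCOSETS_def r_coset_def
        valuation_ring_def ring_of_type_algebra_def image_def)
qed

text \<open>Identifies the index \<open>q\<close> used for counting with the cardinality of the
  residue field as a quotient ring.\<close>

lemma card_residue_field: "finite (carrier (residue_field v))" "card (carrier (residue_field v)) = q"
proof -
  obtain T where T: "transversal T (U 0) (U 1)" using transversal_exists U_subgroup by blast
  define C where "C a = (\<lambda>h. h + a) ` U 1" for a
  have C: "C a = C b \<longleftrightarrow> a - b \<in> U 1" for a b
  proof
    assume "C a = C b"
    moreover have "0 + a \<in> C a" unfolding C_def by (rule imageI[OF U_0])
    ultimately show "a - b \<in> U 1" by (auto simp: C_def)
  next
    assume ab: "a - b \<in> U 1"
    have "x \<in> C a \<longleftrightarrow> x - a \<in> U 1" for x a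
      by (auto simp: C_def intro!: image_eqI[of _ _ "x - a"])
    moreover have "x - a \<in> U 1 \<longleftrightarrow> x - b \<in> U 1" for x
      using U_add[OF _ ab, of "x - a"] U_diff[OF _ ab, of "x - b"] by auto
    ultimately show "C a = C b" by blast
  qed
  have "bij_betw C T (C ` U 0)"
  proof (rule bij_betw_imageI)
    show "inj_on C T"
      using transversal_unique[OF T U_subgroup] by (auto simp: inj_on_def C)
    show "C ` T = C ` U 0"
    proof
      show "C ` T \<subseteq> C ` U 0" using transversal_subset[OF T] by blast
      show "C ` U 0 \<subseteq> C ` T"
      proof
        fix c assume "c \<in> C ` U 0"
        then obtain a where a: "a \<in> U 0" "c = C a" by blast
        obtain t where "t \<in> T" "a - t \<in> U 1" using transversal_obtain[OF T a(1)] by blast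
        then show "c \<in> C ` T" using a(2) C by blast
      qed
    qed
  qed
  moreover have "carrier (residue_field v) = C ` U 0"
    unfolding carrier_residue_field C_def ..
  ultimately show "finite (carrier (residue_field v))" "card (carrier (residue_field v)) = q"
    using finite_residue_transversal[OF T] residue_transversal_card[OF T]
    by (auto simp: bij_betw_finite bij_betw_same_card)
qed

lemma q_ge_2: "2 \<le> q"
proof -
  obtain T where T: "transversal T (U 0) (U 1)" using transversal_exists U_subgroup by blast
  obtain s where s: "s \<in> T" "0 - s \<in> U 1" using transversal_obtain[OF T U_0] by blast
  have "1 \<in> U 0" by (simp add: U_0_iff)
  then obtain t where t: "t \<in> T" "1 - t \<in> U 1" using transversal_obtain[OF T] by blast
  have "s \<noteq> t"
  proof
    assume "s = t"
    then have "(1 - t) - (0 - t) \<in> U 1" using s t by - (rule U_diff, auto)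
    then show False by (simp add: U_1_iff)
  qed
  then have "card {s, t} = 2" by simp
  then show ?thesis
    using card_mono[OF finite_residue_transversal[OF T], of "{s, t}"] s t residue_transversal_card[OF T] by simp
qed

text \<open>Every prime factor of \<open>q\<close> divides \<open>p\<close>, by Cauchy's theorem in
  the additive group of the residue field, so it is a unit of \<open>R\<close>; the divisors of
  \<open>q\<close> follow by induction.\<close>

lemma q_unit:
  assumes "has_characteristic (residue_field v) p" "(of_nat p :: 'r::comm_ring_1) dvd 1"
  shows "(of_nat q :: 'r) dvd 1"
proof -
  have p0: "[p] \<cdot>\<^bsub>residue_field v\<^esub> \<one>\<^bsub>residue_field v\<^esub> = \<zero>\<^bsub>residue_field v\<^esub>"
    using assms(1) by (simp add: has_characteristic_def)
  have prime_unit: "(of_nat r :: 'r) dvd 1" if "Factorial_Ring.prime r" "r dvd q" for r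
  proof -
    have "r dvd p"
      using ring.prime_dvd_characteristic[OF residue_field_ring card_residue_field(1) p0]
        that card_residue_field(2) by simp
    then obtain m where "p = r * m" by blast
    then have "(of_nat r :: 'r) dvd of_nat p" by simp
    then show ?thesis using assms(2) by (rule dvd_trans)
  qed
  have "(of_nat n :: 'r) dvd 1" if "n dvd q" "n > 0" for n
    using that
  proof (induction n rule: less_induct)
    case (less n)
    show ?case
    proof (cases "n = 1")
      case False
      then obtain r where r: "Factorial_Ring.prime r" "r dvd n" using prime_factor_nat by blast
      then obtain m where m: "n = r * m" by blast
      have "m < n" "m dvd q" "m > 0" using m r less.prems prime_gt_1_nat[OF r(1)]
        by (auto intro: dvd_trans[of m n q])
      then have "(of_nat m :: 'r) dvd 1" using less.IH by blast
      moreover have "(of_nat r :: 'r) dvd 1" using prime_unit r dvd_trans less.prems by blast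
      ultimately show ?thesis unfolding m of_nat_mult
        using mult_dvd_mono[of "of_nat r :: 'r" 1 "of_nat m" 1] by simp
    qed simp
  qed
  then show ?thesis using q_ge_2 by simp
qed

section \<open>Isotropy of quadratic forms in eight variables\<close>

text \<open>Pigeonhole: the squares and the elements \<open>u\<close> minus a square each fill more
  than half of the residue classes, so they share a class.\<close>

lemma sum_two_squares_mod:
  assumes "v u \<le> 1" "v 2 = 1"
  shows "\<exists>x z. v x \<le> 1 \<and> v z \<le> 1 \<and> x\<^sup>2 + z\<^sup>2 - u \<in> U 1"
proof -
  obtain T where T: "transversal T (U 0) (U 1)" using transversal_exists U_subgroup by blast
  have fT: "finite T" by (rule finite_residue_transversal[OF T])
  define rp where "rp x = (SOME t. t \<in> T \<and> x - t \<in> U 1)" for x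
  have rp: "rp x \<in> T \<and> x - rp x \<in> U 1" if "x \<in> U 0" for x
    unfolding rp_def by (rule someI_ex) (use transversal_obtain[OF T that] in blast)
  have rp_eq: "rp x = rp y \<longleftrightarrow> x - y \<in> U 1" if "x \<in> U 0" "y \<in> U 0" for x y
  proof
    assume "rp x = rp y"
    then have "(x - rp x) - (y - rp x) \<in> U 1" using rp[OF that(1)] rp[OF that(2)] by - (rule U_diff, auto)
    then show "x - y \<in> U 1" by simp
  next
    assume xy: "x - y \<in> U 1"
    have "(x - y) - ((x - rp x) - (y - rp y)) \<in> U 1"
      using U_diff[OF xy U_diff] rp[OF that(1)] rp[OF that(2)] by blast
    then have "rp x - rp y \<in> U 1" by (simp add: algebra_simps)
    then show "rp x = rp y" using transversal_unique[OF T U_subgroup] rp that by blast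
  qed
  have T0: "t \<in> U 0" if "t \<in> T" for t using that transversal_subset[OF T] by blast
  have sq0: "t\<^sup>2 \<in> U 0" if "t \<in> U 0" for t using U_mult[OF that that] by (simp add: power2_eq_square)
  have u0: "u \<in> U 0" using assms by (simp add: U_0_iff)
  define f where "f t = rp (t\<^sup>2)" for t
  define g where "g t = rp (u - t\<^sup>2)" for t
  have unit: "x \<in> U 1 \<or> y \<in> U 1" if "x * y \<in> U 1" "x \<in> U 0" "y \<in> U 0" for x y
  proof (rule ccontr)
    assume "\<not> (x \<in> U 1 \<or> y \<in> U 1)"
    then have "v x = 1" "v y = 1" using that(2,3) by (auto simp: U_0_iff U_1_iff)
    then show False using that(1) by (simp add: U_1_iff v_mult)
  qed
  have f_eq: "f s = f t \<longleftrightarrow> s\<^sup>2 - t\<^sup>2 \<in> U 1" if "s \<in> T" "t \<in> T" for s t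
    unfolding f_def using rp_eq sq0 T0 that by blast
  have g_eq: "g s = g t \<longleftrightarrow> f s = f t" if "s \<in> T" "t \<in> T" for s t
  proof -
    have "g s = g t \<longleftrightarrow> (u - s\<^sup>2) - (u - t\<^sup>2) \<in> U 1"
      unfolding g_def by (rule rp_eq) (use U_diff[OF u0 sq0[OF T0]] that in auto)
    also have "\<dots> \<longleftrightarrow> - (s\<^sup>2 - t\<^sup>2) \<in> U 1" by (simp add: algebra_simps)
    also have "\<dots> \<longleftrightarrow> f s = f t" using f_eq[OF that] by (simp only: U_minus_iff)
    finally show ?thesis .
  qed
  have fib: "f s = f t \<Longrightarrow> s = t \<or> s = rp (- t)" if "s \<in> T" "t \<in> T" for s t
  proof -
    assume "f s = f t"
    then have "(s - t) * (s + t) \<in> U 1" using f_eq[OF that] by (simp add: algebra_simps power2_eq_square)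
    moreover have "s - t \<in> U 0" "s + t \<in> U 0" using U_diff U_add T0 that by blast+
    ultimately consider "s - t \<in> U 1" | "s + t \<in> U 1" using unit by blast
    then show "s = t \<or> s = rp (- t)"
    proof cases
      case 1 then show ?thesis using transversal_unique[OF T U_subgroup] that by blast
    next
      case 2
      have mt: "- t \<in> U 0" using T0 that by simp
      have "(s + t) + (- t - rp (- t)) \<in> U 1" using U_add[OF 2] rp[OF mt] by blast
      then have "s - rp (- t) \<in> U 1" by (simp add: algebra_simps)
      then show ?thesis using transversal_unique[OF T U_subgroup] that rp[OF mt] by blast
    qed
  qed
  \<comment> \<open>A fibre of squaring is contained in a pair of opposite classes, and the fibre of
    0 is a single class.\<close>
  have card_f: "q < 2 * card (f ` T)"
  proof -
    define t0 where "t0 = rp 0"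
    have t0: "t0 \<in> T" "t0 \<in> U 1" using rp[OF U_0] by (auto simp: t0_def)
    have rp0: "rp (- t0) = t0"
      using rp_eq[of "- t0" 0] t0 T0 U_0 by (auto simp: t0_def)
    have "q = (\<Sum>t\<in>T. 1)" using residue_transversal_card[OF T] by simp
    also have "\<dots> = (\<Sum>y\<in>f ` T. \<Sum>t\<in>{t \<in> T. f t = y}. 1)"
      by (rule sum.group[symmetric]) (use fT in auto)
    also have "\<dots> = (\<Sum>y\<in>f ` T. card {t \<in> T. f t = y})" by simp
    also have "\<dots> = card {t \<in> T. f t = f t0} + (\<Sum>y\<in>f ` T - {f t0}. card {t \<in> T. f t = y})"
      using fT t0 by (intro sum.remove) auto
    also have "card {t \<in> T. f t = f t0} \<le> card {t0}"
      using fib[OF _ t0(1)] rp0 by (intro card_mono) auto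
    also have "(\<Sum>y\<in>f ` T - {f t0}. card {t \<in> T. f t = y}) \<le> (\<Sum>y\<in>f ` T - {f t0}. 2)"
    proof (rule sum_mono)
      fix y assume "y \<in> f ` T - {f t0}"
      then obtain s where s: "s \<in> T" "y = f s" by blast
      have "card {t \<in> T. f t = y} \<le> card {s, rp (- s)}"
        using fib[OF _ s(1)] s(2) by (intro card_mono) auto
      also have "\<dots> \<le> 2" by (simp add: card_insert_if)
      finally show "card {t \<in> T. f t = y} \<le> 2" .
    qed
    also have "(\<Sum>y\<in>f ` T - {f t0}. 2) = 2 * (card (f ` T) - 1)"
      using fT t0 by (simp add: card_Diff_singleton)
    finally have "q \<le> 1 + 2 * (card (f ` T) - 1)" by simp
    moreover have "card (f ` T) > 0" using fT t0 by (auto simp: card_gt_0_iff)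
    ultimately show ?thesis by simp
  qed
  \<comment> \<open>\<open>f\<close> and \<open>g\<close> have the same fibres, so \<open>h\<close>
    matches their images bijectively.\<close>
  have "card (g ` T) = card (f ` T)"
  proof -
    define h where "h y = g (SOME t. t \<in> T \<and> f t = y)" for y
    have h: "h (f t) = g t" if "t \<in> T" for t
    proof -
      have "(SOME s. s \<in> T \<and> f s = f t) \<in> T \<and> f (SOME s. s \<in> T \<and> f s = f t) = f t"
        by (rule someI_ex) (use that in blast)
      then show ?thesis unfolding h_def using g_eq that by blast
    qed
    have "inj_on h (f ` T)" unfolding inj_on_def using h g_eq by auto
    moreover have "h ` f ` T = g ` T" using h by force
    ultimately show ?thesis using card_image by metis
  qed
  moreover have fgT: "f ` T \<subseteq> T" "g ` T \<subseteq> T"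
    using rp[OF sq0[OF T0]] rp[OF U_diff[OF u0 sq0[OF T0]]] unfolding f_def g_def by blast+
  moreover have "card (f ` T \<union> g ` T) \<le> q"
    using card_mono[OF fT, of "f ` T \<union> g ` T"] fgT residue_transversal_card[OF T] by simp
  ultimately have "f ` T \<inter> g ` T \<noteq> {}"
    using card_f card_Un_disjoint[of "f ` T" "g ` T"] finite_imageI[OF fT, of f] finite_imageI[OF fT, of g] by linarith
  then obtain t s where ts: "t \<in> T" "s \<in> T" "f t = g s" by blast
  then have "t\<^sup>2 - (u - s\<^sup>2) \<in> U 1"
    unfolding f_def g_def using rp_eq[of "t\<^sup>2" "u - s\<^sup>2"] sq0 T0 U_diff[OF u0] by blast
  then show ?thesis
    using ts T0 U_0_iff by (intro exI[of _ t] exI[of _ s]) (auto simp: algebra_simps)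
qed

text \<open>A solution modulo the maximal ideal is lifted by changing a coordinate that is a unit;
  were neither a unit, \<open>u\<close> would not be one.\<close>

lemma sum_two_squares:
  assumes "v u = 1" "v 2 = 1"
  shows "\<exists>x z. x\<^sup>2 + z\<^sup>2 = u"
proof -
  have *: "\<exists>x z. x\<^sup>2 + z\<^sup>2 = u" if "x\<^sup>2 + z\<^sup>2 - u \<in> U 1" "v x = 1" for x z
  proof -
    have x: "x \<noteq> 0" using that(2) by auto
    have two: "(2::'f) \<noteq> 0" using assms(2) by auto
    \<comment> \<open>Chosen so that \<open>(1 + 4 * e) * x\<^sup>2 + z\<^sup>2 = u\<close>.\<close>
    define e where "e = - (x\<^sup>2 + z\<^sup>2 - u) / (4 * x\<^sup>2)"
    have v4: "v 4 = 1" using v_mult[of 2 2] assms(2) by simp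
    have "v e < 1"
      using that by (simp add: e_def v_divide v_mult v_power v4 U_1_iff v_minus_commute[of u])
    then obtain w where "w\<^sup>2 = 1 + 4 * e" using square_of_one_plus by blast
    moreover have "4 * e * x\<^sup>2 = - (x\<^sup>2 + z\<^sup>2 - u)"
    proof -
      have "(4::'f) \<noteq> 0" using v4 by auto
      then show ?thesis using x by (simp add: e_def)
    qed
    ultimately have "(w * x)\<^sup>2 + z\<^sup>2 = u"
      by (simp add: power_mult_distrib algebra_simps)
    then show ?thesis by blast
  qed
  obtain x z where xz: "v x \<le> 1" "v z \<le> 1" "x\<^sup>2 + z\<^sup>2 - u \<in> U 1"
    using sum_two_squares_mod[of u] assms by auto
  consider "v x = 1" | "v z = 1" | "v x < 1" "v z < 1" using xz by fastforce
  then show ?thesis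
  proof cases
    case 1 then show ?thesis using * xz(3) by blast
  next
    case 2 then show ?thesis using *[of z x] xz(3) by (simp add: add.commute)
  next
    case 3
    have "x * x \<in> U (1 + 1)" "z * z \<in> U (1 + 1)" using 3 by (blast intro: U_mult U_1_iff[THEN iffD2])+
    then have "x\<^sup>2 + z\<^sup>2 \<in> U 1" unfolding power2_eq_square by (intro U_add U_monoD[of _ "1 + 1" 1]) auto
    then have "(x\<^sup>2 + z\<^sup>2) - (x\<^sup>2 + z\<^sup>2 - u) \<in> U 1" using xz(3) by (rule U_diff)
    then show ?thesis using assms by (simp add: U_1_iff)
  qed
qed

text \<open>Modulo the maximal ideal \<open>(s - t)\<^sup>2\<close> equals the difference of the
  squares since 2 vanishes there. Squaring is therefore injective on the finite set of classes,
  hence surjective.\<close>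

lemma square_mod_exists:
  assumes "v 2 < 1" "v c \<le> 1"
  shows "\<exists>s. s \<in> U 0 \<and> s\<^sup>2 - c \<in> U 1"
proof -
  obtain T where T: "transversal T (U 0) (U 1)" using transversal_exists U_subgroup by blast
  have fT: "finite T" by (rule finite_residue_transversal[OF T])
  have T0: "t \<in> U 0" if "t \<in> T" for t using that transversal_subset[OF T] by blast
  define f where "f x = (SOME t. t \<in> T \<and> x\<^sup>2 - t \<in> U 1)" for x
  have f: "f x \<in> T \<and> x\<^sup>2 - f x \<in> U 1" if "x \<in> T" for x
  proof -
    have "x\<^sup>2 \<in> U 0" using U_mult[OF T0[OF that] T0[OF that]] by (simp add: power2_eq_square)
    then show ?thesis
      unfolding f_def by (intro someI_ex[of "\<lambda>t. t \<in> T \<and> x\<^sup>2 - t \<in> U 1"]) (use transversal_obtain[OF T] in blast)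
  qed
  have two: "2 \<in> U 1" using assms(1) by (simp add: U_1_iff)
  have "inj_on f T"
  proof (rule inj_onI)
    fix s t assume st: "s \<in> T" "t \<in> T" "f s = f t"
    have "(s\<^sup>2 - f s) - (t\<^sup>2 - f s) \<in> U 1" using f[OF st(1)] f[OF st(2)] st(3) by - (rule U_diff, auto)
    moreover have "2 * (t * (s - t)) \<in> U (1 + (0 + 0))"
      by (intro U_mult two T0 st U_diff)
    ultimately have "((s\<^sup>2 - f s) - (t\<^sup>2 - f s)) - 2 * (t * (s - t)) \<in> U 1" by - (rule U_diff, auto)
    then have "(s - t) * (s - t) \<in> U 1" by (simp add: algebra_simps power2_eq_square)
    then have "v (s - t) * v (s - t) < 1" by (simp add: U_1_iff v_mult)
    then have "v (s - t) < 1"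
      using mult_mono[of 1 "v (s - t)" 1 "v (s - t)"] by (cases "v (s - t) < 1") auto
    then show "s = t" using transversal_unique[OF T U_subgroup st(1,2)] by (simp add: U_1_iff)
  qed
  then have surj: "f ` T = T" using f fT by (intro endo_inj_surj) blast+
  have "c \<in> U 0" using assms by (simp add: U_0_iff)
  then obtain t where t: "t \<in> T" "c - t \<in> U 1" using transversal_obtain[OF T] by blast
  then have "t \<in> f ` T" using surj by simp
  then obtain s where s: "s \<in> T" "f s = t" by blast
  have "(s\<^sup>2 - f s) - (c - t) \<in> U 1" using U_diff f[OF s(1)] t(2) by blast
  then show ?thesis using s T0[OF s(1)] by (intro exI[of _ s]) simp
qed

end

section \<open>Anisotropic diagonal forms in residue characteristic two\<close>

locale anisotropic_form = local_field v for v :: "'f::field \<Rightarrow> real" +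
  fixes n :: nat and c :: "nat \<Rightarrow> 'f"
  assumes two: "(2::'f) \<noteq> 0" and v_two: "v 2 < 1"
    and anisotropic: "\<And>x i. (\<Sum>i<n. c i * (x i)\<^sup>2) = 0 \<Longrightarrow> i < n \<Longrightarrow> x i = 0"
begin

definition Q :: "(nat \<Rightarrow> 'f) \<Rightarrow> 'f" where "Q x = (\<Sum>i<n. c i * (x i)\<^sup>2)"
definition B :: "(nat \<Rightarrow> 'f) \<Rightarrow> (nat \<Rightarrow> 'f) \<Rightarrow> 'f" where "B x y = (\<Sum>i<n. 2 * c i * x i * y i)"
definition V :: "(nat \<Rightarrow> 'f) set" where "V = {x. \<forall>i\<ge>n. x i = 0}"
text \<open>A filtration of the space by values of \<open>Q\<close>. By \<open>B_bound\<close> each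
  \<open>A k\<close> is a lattice, multiplication by the uniformizer carries \<open>A k\<close> to
  \<open>A (k + 2)\<close>, and one step of the filtration has index at most
  \<open>q\<^sup>2\<close>. Comparing these two facts bounds the dimension by 4.\<close>

definition A :: "int \<Rightarrow> (nat \<Rightarrow> 'f) set" where "A k = {x \<in> V. Q x \<in> U k}"

lemma Q_comb: "Q (\<lambda>i. s * x i + y i) = s\<^sup>2 * Q x + s * B x y + Q y"
  unfolding Q_def B_def sum_distrib_left sum.distrib[symmetric]
  by (intro sum.cong) (auto simp: algebra_simps power2_eq_square)

lemma Q_smult: "Q (\<lambda>i. s * x i) = s\<^sup>2 * Q x"
  unfolding Q_def sum_distrib_left by (intro sum.cong) (auto simp: power_mult_distrib)

lemma B_diff: "B x (\<lambda>i. y i - s * z i) = B x y - s * B x z"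
  unfolding B_def sum_distrib_left sum_subtractf[symmetric]
  by (intro sum.cong) (auto simp: algebra_simps)

lemma V_smult: "x \<in> V \<Longrightarrow> (\<lambda>i. s * x i) \<in> V"
  by (auto simp: V_def)

lemma Q_eq_0: "Q x = 0 \<Longrightarrow> i < n \<Longrightarrow> x i = 0"
  using anisotropic by (simp add: Q_def)

text \<open>Were the inequality false, Hensel's lemma would give a root of \<open>t \<mapsto> Q (t x + y)\<close>.\<close>

lemma B_bound: "(v (B x y))\<^sup>2 \<le> v (Q x) * v (Q y)"
proof (rule ccontr)
  assume "\<not> ?thesis"
  then have gt: "v (Q x * Q y) < v ((B x y)\<^sup>2)" by (simp add: v_mult v_power)
  then have B0: "B x y \<noteq> 0" using v_nonneg[of "Q x * Q y"] by auto
  have Qx: "Q x \<noteq> 0"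
  proof
    assume "Q x = 0"
    then have "B x y = 0" using Q_eq_0 unfolding B_def by (intro sum.neutral) auto
    then show False using B0 by simp
  qed
  define e where "e = - (Q x * Q y) / (B x y)\<^sup>2"
  have "v e < 1" using gt B0 by (simp add: e_def v_divide v_pos)
  then obtain z where z: "z\<^sup>2 = 1 + 4 * e" using square_of_one_plus by blast
  \<comment> \<open>The quadratic formula for \<open>t\<^sup>2 * Q x + t * B x y + Q y\<close>; its
    discriminant is the square of \<open>B x y * z\<close>.\<close>
  define t where "t = B x y * (z - 1) / (2 * Q x)"
  have t: "2 * Q x * t = B x y * (z - 1)" using two Qx by (simp add: t_def)
  have "(B x y)\<^sup>2 * z\<^sup>2 = (B x y)\<^sup>2 - 4 * (Q x * Q y)"
    using B0 by (simp add: z e_def field_simps)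
  then have "(2 * Q x * t + B x y)\<^sup>2 = (B x y)\<^sup>2 - 4 * (Q x * Q y)"
    unfolding t by (simp add: algebra_simps power2_eq_square)
  then have "(4 * Q x) * (t\<^sup>2 * Q x + t * B x y + Q y) = 0"
    by (simp add: algebra_simps power2_eq_square)
  moreover have "(4::'f) \<noteq> 0" using two by (metis mult_2 mult_eq_0_iff numeral_Bit0 numeral_times_numeral one_add_one)
  ultimately have "Q (\<lambda>i. t * x i + y i) = 0" using Qx by (simp add: Q_comb)
  \<comment> \<open>Anisotropy makes \<open>y\<close> proportional to \<open>x\<close> on the
    relevant coordinates. Then the square of \<open>B x y\<close> is \<open>4 * Q x * Q y\<close>,
    whose absolute value is too small because \<open>v 2 < 1\<close>.\<close>
  then have y: "y i = - t * x i" if "i < n" for i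
    using Q_eq_0[OF _ that] by (simp add: eq_neg_iff_add_eq_0 add.commute)
  have By: "B x y = - (2 * t) * Q x"
    unfolding B_def Q_def sum_distrib_left
    by (intro sum.cong) (auto simp: y power2_eq_square)
  have Qy: "Q y = t\<^sup>2 * Q x"
    unfolding Q_def sum_distrib_left by (intro sum.cong) (auto simp: y power_mult_distrib)
  have "v ((B x y)\<^sup>2) = (v 2)\<^sup>2 * v (Q x * Q y)"
    by (simp add: By Qy v_mult v_power power2_eq_square)
      (use v_mult[of 2 2] in simp)
  also have "\<dots> \<le> 1 * v (Q x * Q y)"
    using v_two v_nonneg[of 2] by (intro mult_right_mono power_le_one v_nonneg) auto
  finally show False using gt by simp
qed

lemma B_in_U: "x \<in> A k \<Longrightarrow> y \<in> A k \<Longrightarrow> B x y \<in> U k"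
proof -
  assume "x \<in> A k" "y \<in> A k"
  then have "v (Q x) * v (Q y) \<le> (v \<pi> powi k) * (v \<pi> powi k)"
    using powi_v_\<pi>_pos[of k] by (intro mult_mono) (auto simp: A_def U_def v_nonneg)
  then have "(v (B x y))\<^sup>2 \<le> (v \<pi> powi k)\<^sup>2"
    using B_bound[of x y] by (simp add: power2_eq_square)
  then have "v (B x y) \<le> v \<pi> powi k"
    by (rule power2_le_imp_le) (use powi_v_\<pi>_pos[of k] in simp)
  then show ?thesis by (simp add: U_def)
qed

lemma A_comb:
  assumes "x \<in> A k" "y \<in> A k" "s \<in> U 0"
  shows "(\<lambda>i. s * x i + y i) \<in> A k"
proof -
  have "s * s * Q x \<in> U (0 + 0 + k)" using assms by (intro U_mult) (auto simp: A_def)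
  moreover have "s * B x y \<in> U (0 + k)" by (intro U_mult assms B_in_U[OF assms(1,2)])
  ultimately have "s\<^sup>2 * Q x \<in> U k" "s * B x y \<in> U k" by (simp_all add: power2_eq_square)
  then have "Q (\<lambda>i. s * x i + y i) \<in> U k"
    unfolding Q_comb using assms(2) by (auto simp: A_def intro!: U_add)
  then show ?thesis using assms by (auto simp: A_def V_def)
qed

lemma A_subgroup: "add_subgroup (A k)"
  unfolding add_subgroup_def
proof (intro conjI ballI)
  show "0 \<in> A k" by (simp add: A_def V_def Q_def U_0)
  fix x y assume xy: "x \<in> A k" "y \<in> A k"
  have one: "- 1 \<in> U 0" by (simp add: U_0_iff)
  have "(\<lambda>i. - 1 * y i + x i) \<in> A k" by (rule A_comb[OF xy(2,1) one])
  also have "(\<lambda>i. - 1 * y i + x i) = x - y" by (rule ext) simp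
  finally show "x - y \<in> A k" .
qed

lemma A_mono: "j \<le> k \<Longrightarrow> A k \<subseteq> A j"
  using U_mono[of j k] by (auto simp: A_def)

lemma A_smult_iff: "s \<noteq> 0 \<Longrightarrow> x \<in> V \<Longrightarrow> (\<lambda>i. s * x i) \<in> A k \<longleftrightarrow> x \<in> A (k - 2 * ord s)"
  using U_mult_iff[of "s * s" "Q x" k] V_smult[of x s]
  by (simp add: A_def Q_smult ord_mult power2_eq_square)

lemma A_smult_U1: "s \<in> U 1 \<Longrightarrow> x \<in> A k \<Longrightarrow> (\<lambda>i. s * x i) \<in> A (k + 1)"
  using U_mult[of "s * s" "1 + 1" "Q x" k] U_mult[of s 1 s 1] U_monoD[of "s * s * Q x" "2 + k" "k + 1"]
  by (simp add: A_def Q_smult power2_eq_square V_smult)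

text \<open>An anisotropic quadratic form over a finite field of characteristic two has at most two
  variables: a third vector can be made orthogonal to the first, and squares are surjective.\<close>

lemma A_cover: "\<exists>C\<subseteq>A k. finite C \<and> card C \<le> q\<^sup>2 \<and> (\<forall>x\<in>A k. \<exists>y\<in>C. x - y \<in> A (k + 1))"
proof (cases "A k \<subseteq> A (k + 1)")
  case True
  show ?thesis
  proof (intro exI conjI)
    show "{0 :: nat \<Rightarrow> 'f} \<subseteq> A k" using add_subgroup_0[OF A_subgroup] by simp
    show "card {0 :: nat \<Rightarrow> 'f} \<le> q\<^sup>2" using q_ge_2 one_le_power[of q 2] by simp
    show "\<forall>x\<in>A k. \<exists>y\<in>{0}. x - y \<in> A (k + 1)" using True by auto
  qed simp
next
  case False
  then obtain x where x: "x \<in> A k" "x \<notin> A (k + 1)" by blast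
  have vQx: "v (Q x) = v \<pi> powi k" using x U_Suc_iff[of "Q x" k] by (auto simp: A_def U_def)
  have Qx: "Q x \<noteq> 0" using vQx powi_v_\<pi>_pos[of k] by auto
  obtain T where T: "transversal T (U 0) (U 1)" using transversal_exists U_subgroup by blast
  have fT: "finite T" "card T = q" using finite_residue_transversal[OF T] residue_transversal_card[OF T] by auto
  have T0: "t \<in> U 0" if "t \<in> T" for t using that transversal_subset[OF T] by blast
  \<comment> \<open>A vector that is orthogonal to \<open>x\<close> modulo \<open>U (k + 1)\<close>
    enters \<open>A (k + 1)\<close> after a multiple of \<open>x\<close> is added: choose
    \<open>s\<close> with square congruent to \<open>- Q y / Q x\<close>.\<close>
  have kill: "\<exists>s\<in>U 0. (\<lambda>i. s * x i + y i) \<in> A (k + 1)" if y: "y \<in> A k" "B x y \<in> U (k + 1)" for y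
  proof -
    have "v (- (Q y / Q x)) \<le> 1" using y(1) powi_v_\<pi>_pos[of k] by (simp add: v_divide vQx A_def U_def)
    then obtain s where s: "s \<in> U 0" "s\<^sup>2 - - (Q y / Q x) \<in> U 1" using square_mod_exists[OF v_two] by blast
    have "(s\<^sup>2 + Q y / Q x) * Q x \<in> U (1 + k)" using s(2) x(1) by (intro U_mult) (auto simp: A_def)
    then have 1: "s\<^sup>2 * Q x + Q y \<in> U (k + 1)" using Qx by (simp add: algebra_simps)
    have 2: "s * B x y \<in> U (0 + (k + 1))" by (intro U_mult s y)
    have "Q (\<lambda>i. s * x i + y i) = (s\<^sup>2 * Q x + Q y) + s * B x y" by (simp add: Q_comb)
    also have "\<dots> \<in> U (k + 1)" using U_add[OF 1] 2 by simp
    finally show ?thesis using s(1) x(1) y(1) by (intro bexI[of _ s]) (auto simp: A_def V_def)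
  qed
  have reduce: "\<exists>t\<in>T. (\<lambda>i. (s - t) * z i) \<in> A (k + 1)" if "s \<in> U 0" "z \<in> A k" for s z
    using transversal_obtain[OF T that(1)] A_smult_U1 that(2) by metis
  have x': "- x \<in> A k" by (rule add_subgroup_minus[OF A_subgroup x(1)])
  show ?thesis
  proof (cases "\<exists>x2\<in>A k. \<forall>s\<in>U 0. x2 - (\<lambda>i. s * x i) \<notin> A (k + 1)")
    case False
    define C where "C = (\<lambda>s i. s * x i) ` T"
    have "\<exists>y\<in>C. z - y \<in> A (k + 1)" if z: "z \<in> A k" for z
    proof -
      obtain s where s: "s \<in> U 0" "z - (\<lambda>i. s * x i) \<in> A (k + 1)" using False z by blast
      obtain t where t: "t \<in> T" "(\<lambda>i. (s - t) * x i) \<in> A (k + 1)" using reduce[OF s(1) x(1)] by blast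
      have "(z - (\<lambda>i. s * x i)) + (\<lambda>i. (s - t) * x i) \<in> A (k + 1)"
        by (rule add_subgroup_add[OF A_subgroup s(2) t(2)])
      also have "(z - (\<lambda>i. s * x i)) + (\<lambda>i. (s - t) * x i) = z - (\<lambda>i. t * x i)"
        by (auto simp: fun_eq_iff algebra_simps)
      finally have "z - (\<lambda>i. t * x i) \<in> A (k + 1)" .
      moreover have "(\<lambda>i. t * x i) \<in> C" using t(1) by (auto simp: C_def)
      ultimately show ?thesis by blast
    qed
    moreover have "C \<subseteq> A k"
      using A_comb[OF x(1) add_subgroup_0[OF A_subgroup] T0] by (auto simp: C_def)
    moreover have "card C \<le> q" using card_image_le[OF fT(1), of "\<lambda>s i. s * x i"] fT(2) by (simp add: C_def)
    moreover have "q \<le> q\<^sup>2" by (simp add: power2_eq_square)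
    ultimately show ?thesis using fT(1) by (intro exI[of _ C]) (auto simp: C_def)
  next
    case True
    then obtain x2 where x2: "x2 \<in> A k" "\<And>s. s \<in> U 0 \<Longrightarrow> x2 - (\<lambda>i. s * x i) \<notin> A (k + 1)" by blast
    \<comment> \<open>Otherwise \<open>kill\<close> would make \<open>x2\<close> a multiple of
      \<open>x\<close> modulo \<open>A (k + 1)\<close>.\<close>
    have B2: "B x x2 \<notin> U (k + 1)"
    proof
      assume "B x x2 \<in> U (k + 1)"
      then obtain s where s: "s \<in> U 0" "(\<lambda>i. s * x i + x2 i) \<in> A (k + 1)" using kill[OF x2(1)] by blast
      have "x2 - (\<lambda>i. - s * x i) = (\<lambda>i. s * x i + x2 i)" by (auto simp: fun_eq_iff)
      then show False using x2(2)[of "- s"] s by simp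
    qed
    define C where "C = (\<lambda>(s, t) i. s * x i + t * x2 i) ` (T \<times> T)"
    have "\<exists>y\<in>C. z - y \<in> A (k + 1)" if z: "z \<in> A k" for z
    proof -
      \<comment> \<open>Subtracting \<open>l * x2\<close> makes \<open>z\<close> orthogonal to
        \<open>x\<close>, so \<open>kill\<close> applies to the remainder; \<open>l\<close> is
        integral because \<open>B x x2\<close> has the largest absolute value possible on
        \<open>A k\<close>.\<close>
      define l where "l = B x z / B x x2"
      have vB2: "v (B x x2) = v \<pi> powi k"
        using B2 B_in_U[OF x(1) x2(1)] U_Suc_iff[of "B x x2" k] by (auto simp: U_def)
      have B20: "B x x2 \<noteq> 0" using vB2 powi_v_\<pi>_pos[of k] by auto
      have l: "l \<in> U 0"
        using B_in_U[OF x(1) z] vB2 powi_v_\<pi>_pos[of k] by (simp add: l_def U_0_iff v_divide U_def)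
      define y where "y = (\<lambda>i. z i - l * x2 i)"
      have "(\<lambda>i. - l * x2 i + z i) \<in> A k" by (rule A_comb[OF x2(1) z]) (use l in simp)
      then have y: "y \<in> A k" by (simp add: y_def)
      have "B x y = B x z - l * B x x2" unfolding y_def by (rule B_diff)
      then have "B x y = 0" using B20 by (simp add: l_def)
      then obtain s where s: "s \<in> U 0" "(\<lambda>i. s * x i + y i) \<in> A (k + 1)" using kill[OF y] U_0 by auto
      obtain t1 where t1: "t1 \<in> T" "(\<lambda>i. (- s - t1) * x i) \<in> A (k + 1)" using reduce[of "- s" x] s x by auto
      obtain t2 where t2: "t2 \<in> T" "(\<lambda>i. (l - t2) * x2 i) \<in> A (k + 1)" using reduce[OF l x2(1)] by blast
      have "(\<lambda>i. s * x i + y i) + (\<lambda>i. (- s - t1) * x i) + (\<lambda>i. (l - t2) * x2 i) \<in> A (k + 1)"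
        by (intro add_subgroup_add[OF A_subgroup] s t1 t2)
      also have "(\<lambda>i. s * x i + y i) + (\<lambda>i. (- s - t1) * x i) + (\<lambda>i. (l - t2) * x2 i)
        = z - (\<lambda>i. t1 * x i + t2 * x2 i)" by (auto simp: fun_eq_iff algebra_simps y_def)
      finally have "z - (\<lambda>i. t1 * x i + t2 * x2 i) \<in> A (k + 1)" .
      moreover have "(\<lambda>i. t1 * x i + t2 * x2 i) \<in> C" using t1(1) t2(1) by (auto simp: C_def)
      ultimately show ?thesis by blast
    qed
    moreover have "C \<subseteq> A k"
    proof -
      have "(\<lambda>i. s * x i + t * x2 i) \<in> A k" if "s \<in> T" "t \<in> T" for s t
        using A_comb[OF x(1) A_comb[OF x2(1) add_subgroup_0[OF A_subgroup] T0[OF that(2)]] T0[OF that(1)]] by simp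
      then show ?thesis by (auto simp: C_def)
    qed
    moreover have "card C \<le> q\<^sup>2"
      using card_image_le[of "T \<times> T" "\<lambda>(s, t) i. s * x i + t * x2 i"] fT
      by (simp add: C_def card_cartesian_product power2_eq_square)
    ultimately show ?thesis using fT(1) by (intro exI[of _ C]) (auto simp: C_def)
  qed
qed

lemma A_transversal: "\<exists>T. transversal T (A 0) (A (int m)) \<and> finite T \<and> card T \<le> q ^ (2 * m)"
proof (induction m)
  case 0
  have "transversal {0} (A 0) (A (int 0))"
    by (rule transversalI) (auto simp: A_subgroup add_subgroup_0)
  then show ?case by (intro exI[of _ "{0}"]) simp
next
  case (Suc m)
  then obtain T where T: "transversal T (A 0) (A (int m))" "finite T" "card T \<le> q ^ (2 * m)" by blast
  obtain T' where T': "transversal T' (A (int m)) (A (int m + 1))" using transversal_exists A_subgroup by blast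
  obtain C where C: "finite C" "card C \<le> q\<^sup>2" "\<And>x. x \<in> A (int m) \<Longrightarrow> \<exists>y\<in>C. x - y \<in> A (int m + 1)"
    using A_cover[of "int m"] by blast
  have fT': "finite T'" "card T' \<le> q\<^sup>2"
    using transversal_card_le[OF T' A_subgroup C(1,3)] C(2) by auto
  note tt = transversal_tower[OF T(1) T' A_subgroup A_subgroup A_subgroup A_mono A_mono]
  have "card ((\<lambda>(a, b). a + b) ` (T \<times> T')) = card T * card T'"
    using card_image[OF tt(2)] by (simp add: card_cartesian_product)
  also have "\<dots> \<le> q ^ (2 * m) * q\<^sup>2" by (intro mult_mono T fT') auto
  also have "\<dots> = q ^ (2 * Suc m)" by (simp add: power_add power2_eq_square)
  finally show ?case
    using tt(1) T(2) fT'(1) by (intro exI[of _ "(\<lambda>(a, b). a + b) ` (T \<times> T')"]) (simp add: add.commute)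
qed

end

context local_field
begin

lemma bounded_subsequence_finite:
  assumes "\<And>k i. v (\<sigma> k i) \<le> R"
  shows "\<exists>l r. strict_mono (r::nat \<Rightarrow> nat) \<and> (\<forall>e>0. \<exists>N. \<forall>k\<ge>N. \<forall>i<(n::nat). v (\<sigma> (r k) i - l i) < e)"
proof (induction n)
  case 0
  show ?case by (intro exI[of _ undefined] exI[of _ id]) (auto simp: strict_mono_def)
next
  case (Suc n)
  then obtain l r where r: "strict_mono (r::nat\<Rightarrow>nat)"
      and l: "\<And>e. e > 0 \<Longrightarrow> \<exists>N. \<forall>k\<ge>N. \<forall>i<n. v (\<sigma> (r k) i - l i) < e" by blast
  obtain m s where s: "strict_mono (s::nat\<Rightarrow>nat)"
      and m: "\<And>e. e > 0 \<Longrightarrow> \<exists>N. \<forall>k\<ge>N. v (\<sigma> (r (s k)) n - m) < e"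
    using bounded_subsequence[of "\<lambda>k. \<sigma> (r k) n" R] assms by blast
  have "\<exists>N. \<forall>k\<ge>N. \<forall>i<Suc n. v (\<sigma> ((r \<circ> s) k) i - (l(n := m)) i) < e" if "e > 0" for e
  proof -
    obtain N1 where N1: "\<And>k i. k \<ge> N1 \<Longrightarrow> i < n \<Longrightarrow> v (\<sigma> (r k) i - l i) < e" using l[OF \<open>e > 0\<close>] by blast
    obtain N2 where N2: "\<And>k. k \<ge> N2 \<Longrightarrow> v (\<sigma> (r (s k)) n - m) < e" using m[OF \<open>e > 0\<close>] by blast
    have "v (\<sigma> ((r \<circ> s) k) i - (l(n := m)) i) < e" if "k \<ge> max N1 N2" "i < Suc n" for k i
    proof (cases "i = n")
      case False
      have "s k \<ge> k" by (rule seq_suble[OF s])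
      then show ?thesis using N1[of "s k" i] that False by simp
    qed (use N2 that in simp)
    then show ?thesis by blast
  qed
  moreover have "strict_mono (r \<circ> s)" using r s by (simp add: strict_mono_o)
  ultimately show ?case by blast
qed

end

context anisotropic_form
begin

lemma Q_diff: "Q x - Q y = (\<Sum>i<n. c i * ((x i - y i) * (x i + y i)))"
  unfolding Q_def sum_subtractf[symmetric]
  by (intro sum.cong) (auto simp: algebra_simps power2_eq_square)

lemma U_sum: "(\<And>i. i \<in> I \<Longrightarrow> f i \<in> U k) \<Longrightarrow> sum f I \<in> U k"
  by (induction I rule: infinite_finite_induct) (auto simp: U_0 intro: U_add)

lemma coefficient_bound: "\<exists>d\<ge>0. \<forall>i<n. c i \<in> U (- d)"
proof -
  define d where "d = (\<Sum>i<n. \<bar>ord (c i)\<bar>)"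
  have "c i \<in> U (- d)" if "i < n" for i
  proof -
    have "\<bar>ord (c i)\<bar> \<le> d" unfolding d_def using that by (intro member_le_sum) auto
    then have "- d \<le> ord (c i)" by linarith
    then show ?thesis by (simp add: U_iff_ord)
  qed
  then show ?thesis by (intro exI[of _ d]) (auto simp: d_def sum_nonneg)
qed

text \<open>Otherwise dividing vectors of \<open>A 0\<close> by their largest coordinate produces
  vectors of sup norm 1 with \<open>Q\<close> tending to 0, and a limit point is a nonzero isotropic
  vector.\<close>

lemma A_bounded: "\<exists>b\<ge>0. \<forall>x\<in>A 0. \<forall>i. x i \<in> U (- b)"
proof (rule ccontr)
  assume *: "\<not> ?thesis"
  have "\<exists>y\<in>V. Q y \<in> U (int k) \<and> (\<forall>i. v (y i) \<le> 1) \<and> (\<exists>i<n. v (y i) = 1)" for k :: nat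
  proof -
    obtain x i0 where x: "x \<in> A 0" "x i0 \<notin> U (- int k)" using * by (metis of_nat_0_le_iff)
    have i0: "i0 < n"
    proof (rule ccontr)
      assume "\<not> i0 < n"
      then have "x i0 = 0" using x(1) by (simp add: A_def V_def)
      then show False using x(2) U_0 by simp
    qed
    define M where "M = Max (v ` x ` {..<n})"
    have M: "M \<in> v ` x ` {..<n}" unfolding M_def using i0 by (intro Max_in) auto
    then obtain j where j: "j < n" "M = v (x j)" by auto
    have le: "v (x i) \<le> v (x j)" if "i < n" for i
      unfolding j(2)[symmetric] M_def using that by (intro Max_ge) auto
    have "v (x i0) > 0" using x(2) U_0 by (metis v_pos)
    then have xj: "x j \<noteq> 0" using le[OF i0] by auto
    have "x j \<notin> U (- int k)" using le[OF i0] x(2) by (auto simp: U_def)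
    then have o: "ord (x j) < - int k" using xj by (auto simp: U_iff_ord)
    define y where "y = (\<lambda>i. inverse (x j) * x i)"
    have yV: "y \<in> V" using x(1) V_smult by (auto simp: A_def y_def)
    have "Q y = (inverse (x j))\<^sup>2 * Q x" unfolding y_def by (rule Q_smult)
    also have "\<dots> \<in> U (- 2 * ord (x j) + 0)"
      using x(1) xj by (intro U_mult) (auto simp: A_def U_iff_ord power2_eq_square ord_mult ord_inverse)
    finally have "Q y \<in> U (int k)" using o by (elim U_monoD) simp
    moreover have "v (y i) \<le> 1" for i
    proof (cases "i < n")
      case True
      have "y i = x i / x j" by (simp add: y_def divide_inverse mult.commute)
      then show ?thesis using le[OF True] v_pos[OF xj] by (simp add: v_divide divide_le_eq_1_pos)
    next
      case False
      then show ?thesis using yV by (simp add: V_def)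
    qed
    moreover have "v (y j) = 1" using xj by (simp add: y_def)
    ultimately show ?thesis using yV j(1) by blast
  qed
  then have "\<forall>k::nat. \<exists>y. Q y \<in> U (int k) \<and> (\<forall>i. v (y i) \<le> 1) \<and> (\<exists>i<n. v (y i) = 1)" by blast
  from choice[OF this] obtain \<sigma> where
    \<sigma>: "\<And>k::nat. Q (\<sigma> k) \<in> U (int k)" "\<And>k i. v (\<sigma> k i) \<le> 1" "\<And>k. \<exists>i<n. v (\<sigma> k i) = 1"
    by blast
  obtain l r where r: "strict_mono (r::nat\<Rightarrow>nat)"
    and l: "\<And>e. e > 0 \<Longrightarrow> \<exists>N. \<forall>k\<ge>N. \<forall>i<n. v (\<sigma> (r k) i - l i) < e"
    using bounded_subsequence_finite[where \<sigma>=\<sigma> and R=1 and n=n, OF \<sigma>(2)] by blast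
  obtain d where d: "d \<ge> 0" "\<And>i. i < n \<Longrightarrow> c i \<in> U (- d)" using coefficient_bound by blast
  have "Q l \<in> U m" for m
  proof -
    define k0 where "k0 = max (m + d) 1"
    obtain N where N: "\<And>k i. k \<ge> N \<Longrightarrow> i < n \<Longrightarrow> v (\<sigma> (r k) i - l i) < v \<pi> powi k0"
      using l[OF powi_v_\<pi>_pos] by blast
    define k where "k = max N (nat m)"
    have close: "\<sigma> (r k) i - l i \<in> U k0" if "i < n" for i
      using N[of k i] that by (simp add: k_def U_def less_imp_le)
    have "c i * ((\<sigma> (r k) i - l i) * (\<sigma> (r k) i + l i)) \<in> U m" if i: "i < n" for i
    proof -
      have s: "\<sigma> (r k) i \<in> U 0" using \<sigma>(2) by (simp add: U_0_iff)
      have "\<sigma> (r k) i - l i \<in> U 0" using close[OF i] by (rule U_monoD) (simp add: k0_def)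
      then have "\<sigma> (r k) i - (\<sigma> (r k) i - l i) \<in> U 0" by (rule U_diff[OF s])
      then have "l i \<in> U 0" by simp
      then have "\<sigma> (r k) i + l i \<in> U 0" by (rule U_add[OF s])
      then have "c i * ((\<sigma> (r k) i - l i) * (\<sigma> (r k) i + l i)) \<in> U (- d + (k0 + 0))"
        using d(2) close i by (intro U_mult) auto
      then show ?thesis by (rule U_monoD) (simp add: k0_def)
    qed
    then have "Q (\<sigma> (r k)) - Q l \<in> U m" unfolding Q_diff by (intro U_sum) auto
    moreover have "Q (\<sigma> (r k)) \<in> U m"
    proof (rule U_monoD[OF \<sigma>(1)])
      show "m \<le> int (r k)" using seq_suble[OF r, of k] by (simp add: k_def) linarith
    qed
    ultimately have "Q (\<sigma> (r k)) - (Q (\<sigma> (r k)) - Q l) \<in> U m" using U_diff by blast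
    then show ?thesis by simp
  qed
  then have "Q l = 0" using U_iff_ord[of "Q l" "ord (Q l) + 1"] by auto
  then have l0: "l i = 0" if "i < n" for i using Q_eq_0 that by blast
  obtain N where N: "\<And>k i. k \<ge> N \<Longrightarrow> i < n \<Longrightarrow> v (\<sigma> (r k) i - l i) < 1" using l[of 1] by auto
  obtain i where "i < n" "v (\<sigma> (r N) i) = 1" using \<sigma>(3) by blast
  then show False using N[of N i] l0 by simp
qed

text \<open>The set \<open>E\<close> consists of \<open>q ^ (m * n)\<close> vectors of
  \<open>A 0\<close> that stay distinct modulo \<open>A (2 * j)\<close>, while that quotient has at
  most \<open>q ^ (4 * j)\<close> elements. As \<open>j\<close> exceeds \<open>m\<close> by a
  constant only, a large \<open>m\<close> forces \<open>n \<le> 4\<close>.\<close>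

lemma variables_le_4: "n \<le> 4"
proof (rule ccontr)
  assume n: "\<not> n \<le> 4"
  obtain b where b: "b \<ge> 0" "\<And>x i. x \<in> A 0 \<Longrightarrow> x i \<in> U (- b)" using A_bounded by blast
  obtain d where d: "d \<ge> 0" "\<And>i. i < n \<Longrightarrow> c i \<in> U (- d)" using coefficient_bound by blast
  \<comment> \<open>With five variables the count would give
    \<open>5 * m \<le> 4 * m + 4 * nat (d + b)\<close>; this is the least \<open>m\<close> violating
    it.\<close>
  define m where "m = 4 * nat (d + b) + 1"
  define j where "j = nat d + m + nat b"
  obtain T where T: "transversal T (U d) (U (d + int m))" "finite T" "card T = q ^ m"
    using U_transversal[of d "d + int m"] by auto
  obtain T' where T': "transversal T' (A 0) (A (int (2 * j)))" "finite T'" "card T' \<le> q ^ (2 * (2 * j))"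
    using A_transversal by blast
  \<comment> \<open>\<open>A (2 * j)\<close> is \<open>A 0\<close> scaled by the \<open>j\<close>-th
    power of the uniformizer, so the bound on coordinates scales too.\<close>
  have A_coord: "x i \<in> U (int j - b)" if "x \<in> A (int (2 * j))" for x i
  proof -
    define y where "y = (\<lambda>i. \<pi> powi (- int j) * x i)"
    have xV: "x \<in> V" using that by (simp add: A_def)
    have ne: "\<pi> powi (- int j) \<noteq> 0" by simp
    have "y \<in> A 0" unfolding y_def
      using that by (subst A_smult_iff[OF ne xV]) (simp only: ord_\<pi>, simp)
    then have "y i \<in> U (- b)" by (rule b(2))
    then have "\<pi> powi int j * y i \<in> U (int j + - b)" using U_ord[of "\<pi> powi int j"] by (intro U_mult) (simp only: ord_\<pi>)
    moreover have "\<pi> powi int j * y i = x i" by (simp add: y_def power_int_minus)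
    ultimately show ?thesis by simp
  qed
  define E where "E = (\<lambda>g i. if i < n then g i else (0::'f)) ` (Pi\<^sub>E {..<n} (\<lambda>_. T))"
  have inj: "inj_on (\<lambda>g i. if i < n then g i else (0::'f)) (Pi\<^sub>E {..<n} (\<lambda>_. T))"
  proof (rule inj_onI)
    fix g h assume gh: "g \<in> Pi\<^sub>E {..<n} (\<lambda>_. T)" "h \<in> Pi\<^sub>E {..<n} (\<lambda>_. T)"
      "(\<lambda>i. if i < n then g i else 0) = (\<lambda>i. if i < n then h i else (0::'f))"
    show "g = h"
    proof (rule PiE_ext[OF gh(1,2)])
      fix i assume "i \<in> {..<n}"
      then show "g i = h i" using fun_cong[OF gh(3), of i] by simp
    qed
  qed
  have card_E: "card E = q ^ (m * n)"
    using card_image[OF inj] T(3) by (simp add: E_def card_PiE power_mult)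
  have E_g: "\<exists>g \<in> Pi\<^sub>E {..<n} (\<lambda>_. T). x = (\<lambda>i. if i < n then g i else 0)" if "x \<in> E" for x
    using that unfolding E_def image_iff .
  have E_T: "x i \<in> T" if "x \<in> E" "i < n" for x i
  proof -
    from E_g[OF that(1)] obtain g where "g \<in> Pi\<^sub>E {..<n} (\<lambda>_. T)" "x = (\<lambda>i. if i < n then g i else 0)" by blast
    then show ?thesis using that(2) PiE_mem[of g "{..<n}" "\<lambda>_. T" i] by simp
  qed
  have E_V: "x \<in> V" if "x \<in> E" for x
  proof -
    from E_g[OF that] obtain g where "x = (\<lambda>i. if i < n then g i else 0)" by blast
    then show ?thesis by (simp add: V_def)
  qed
  have E_A: "x \<in> A 0" if "x \<in> E" for x
  proof -
    have "c i * (x i)\<^sup>2 \<in> U 0" if i: "i < n" for i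
    proof -
      have "x i \<in> U d" using E_T[OF \<open>x \<in> E\<close> i] transversal_subset[OF T(1)] by blast
      then have "c i * (x i * x i) \<in> U (- d + (d + d))" using d(2)[OF i] by (intro U_mult) auto
      then show ?thesis unfolding power2_eq_square by (rule U_monoD) (use d in simp)
    qed
    then have "Q x \<in> U 0" unfolding Q_def by (intro U_sum) auto
    then show ?thesis using E_V[OF that] by (simp add: A_def)
  qed
  have "\<exists>t. t \<in> T' \<and> x - t \<in> A (int (2 * j))" if "x \<in> E" for x
    by (rule transversal_obtain[OF T'(1) E_A[OF that]]) blast
  then have "\<forall>x. \<exists>t. x \<in> E \<longrightarrow> t \<in> T' \<and> x - t \<in> A (int (2 * j))" by blast
  from choice[OF this] obtain f where f: "\<And>x. x \<in> E \<Longrightarrow> f x \<in> T' \<and> x - f x \<in> A (int (2 * j))" by blast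
  have "inj_on f E"
  proof (rule inj_onI)
    fix x y assume xy: "x \<in> E" "y \<in> E" "f x = f y"
    have "(x - f x) - (y - f y) \<in> A (int (2 * j))" by (rule add_subgroup_diff[OF A_subgroup]) (use f[OF xy(1)] f[OF xy(2)] in auto)
    then have "x - y \<in> A (int (2 * j))" using xy(3) by simp
    then have *: "(x - y) i \<in> U (d + int m)" for i
      using A_coord[of "x - y" i] b d by (simp add: j_def)
    show "x = y"
    proof
      fix i show "x i = y i"
      proof (cases "i < n")
        case True
        then show ?thesis using transversal_unique[OF T(1) U_subgroup] E_T xy *[of i] by simp
      next
        case False
        then show ?thesis using E_V[OF xy(1)] E_V[OF xy(2)] by (simp add: V_def)
      qed
    qed
  qed
  then have "card E \<le> card T'" using f T'(2) by (intro card_inj_on_le[of f]) auto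
  then have "q ^ (m * n) \<le> q ^ (4 * j)" using card_E T'(3) by simp
  then have "m * n \<le> 4 * j" using q_ge_2 by simp
  moreover have "m * 5 \<le> m * n" using n by (intro mult_left_mono) auto
  moreover have "4 * j = 4 * m + 4 * nat (d + b)" using b d by (simp add: j_def nat_add_distrib)
  ultimately show False by (simp add: m_def)
qed

end

context local_field
begin

lemma isotropic_8_even:
  fixes c :: "nat \<Rightarrow> 'f"
  assumes "(2::'f) \<noteq> 0" "v 2 < 1"
  shows "\<exists>x. (\<exists>i<8. x i \<noteq> 0) \<and> (\<Sum>i<8. c i * (x i)\<^sup>2) = 0"
proof (rule ccontr)
  assume *: "\<not> ?thesis"
  interpret anisotropic_form v 8 c
    by unfold_locales (use assms * in auto)
  show False using variables_le_4 by simp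
qed

text \<open>The form is the orthogonal sum of two copies of the norm form of a quaternion algebra.\<close>

lemma quaternion_form_isotropic:
  fixes a b :: 'f
  assumes "(2::'f) \<noteq> 0" "a \<noteq> 0" "b \<noteq> 0"
  shows "\<exists>r s t u r' s' t' u'. \<not> (r = 0 \<and> s = 0 \<and> t = 0 \<and> u = 0 \<and> r' = 0 \<and> s' = 0 \<and> t' = 0 \<and> u' = 0) \<and>
    (r\<^sup>2 - a * s\<^sup>2) - b * (t\<^sup>2 - a * u\<^sup>2) + ((r'\<^sup>2 - a * s'\<^sup>2) - b * (t'\<^sup>2 - a * u'\<^sup>2)) = 0"
proof (cases "v 2 < 1")
  case True
  define c where "c i = [1, - a, - b, a * b, 1, - a, - b, a * b] ! i" for i
  obtain x where x: "\<exists>i<8. x i \<noteq> 0" "(\<Sum>i<8. c i * (x i)\<^sup>2) = 0"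
    using isotropic_8_even[OF assms(1) True] by blast
  have eight: "{..<8::nat} = {0, 1, 2, 3, 4, 5, 6, 7}" by auto
  have "\<not> (x 0 = 0 \<and> x 1 = 0 \<and> x 2 = 0 \<and> x 3 = 0 \<and> x 4 = 0 \<and> x 5 = 0 \<and> x 6 = 0 \<and> x 7 = 0)"
  proof -
    have "\<exists>i\<in>{..<8}. x i \<noteq> 0" using x(1) by auto
    then show ?thesis unfolding eight by auto
  qed
  moreover have "((x 0)\<^sup>2 - a * (x 1)\<^sup>2) - b * ((x 2)\<^sup>2 - a * (x 3)\<^sup>2) + (((x 4)\<^sup>2 - a * (x 5)\<^sup>2) - b * ((x 6)\<^sup>2 - a * (x 7)\<^sup>2)) = 0"
    using x(2) unfolding eight by (simp add: c_def algebra_simps)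
  ultimately show ?thesis by blast
next
  case False
  then have v2: "v 2 = 1" using v_of_nat_le_1[of 2] by simp
  \<comment> \<open>A square factor makes \<open>d\<close> a unit, and units are sums of two squares
    when 2 is a unit.\<close>
  have sq: "\<exists>x z w. w \<noteq> 0 \<and> x\<^sup>2 + z\<^sup>2 = d * w\<^sup>2" if d: "d \<noteq> 0" "even (ord d)" for d
  proof -
    obtain k where k: "ord d = 2 * k" using d(2) by blast
    define w where "w = \<pi> powi (- k)"
    have w: "w \<noteq> 0" "ord w = - k" by (simp_all add: w_def ord_\<pi> del: power_int_minus)
    then have "ord (d * w\<^sup>2) = 0" using d(1) k by (simp add: ord_mult power2_eq_square)
    then have "v (d * w\<^sup>2) = 1" using v_eq_ord[of "d * w\<^sup>2"] d(1) w(1) by simp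
    then show ?thesis using sum_two_squares[OF _ v2] w(1) by metis
  qed
  \<comment> \<open>If \<open>a\<close> and \<open>b\<close> both have odd order, their product has
    even order. The coefficient of even order cancels against the two coefficients 1, one from each
    copy of the form.\<close>
  have "even (ord a) \<or> even (ord b) \<or> even (ord (- (a * b)))"
    using assms by (auto simp: ord_mult)
  moreover have "- (a * b) \<noteq> 0" using assms by simp
  ultimately have "(\<exists>x z w. w \<noteq> 0 \<and> x\<^sup>2 + z\<^sup>2 = a * w\<^sup>2) \<or> (\<exists>x z w. w \<noteq> 0 \<and> x\<^sup>2 + z\<^sup>2 = b * w\<^sup>2)
    \<or> (\<exists>x z w. w \<noteq> 0 \<and> x\<^sup>2 + z\<^sup>2 = - (a * b) * w\<^sup>2)"
    using sq[of a] sq[of b] sq[of "- (a * b)"] assms by blast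
  then consider x z w where "w \<noteq> 0" "x\<^sup>2 + z\<^sup>2 = a * w\<^sup>2"
    | x z w where "w \<noteq> 0" "x\<^sup>2 + z\<^sup>2 = b * w\<^sup>2"
    | x z w where "w \<noteq> 0" "x\<^sup>2 + z\<^sup>2 = - (a * b) * w\<^sup>2"
    by blast
  then show ?thesis
  proof cases
    case 1
    then show ?thesis
      by - (rule exI[of _ x], rule exI[of _ w], rule exI[of _ 0], rule exI[of _ 0], rule exI[of _ z], rule exI[of _ 0], rule exI[of _ 0], rule exI[of _ 0], simp add: algebra_simps)
  next
    case 2
    then show ?thesis
      by - (rule exI[of _ x], rule exI[of _ 0], rule exI[of _ w], rule exI[of _ 0], rule exI[of _ z], rule exI[of _ 0], rule exI[of _ 0], rule exI[of _ 0], simp add: algebra_simps)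
  next
    case 3
    then have "x\<^sup>2 + z\<^sup>2 + a * (b * w\<^sup>2) = 0" by simp
    with 3(1) show ?thesis
      by - (rule exI[of _ x], rule exI[of _ 0], rule exI[of _ 0], rule exI[of _ w], rule exI[of _ z], rule exI[of _ 0], rule exI[of _ 0], rule exI[of _ 0], simp add: algebra_simps)
  qed
qed

end

lemma tsum_restrict:
  assumes "add_subgroup G" "add_subgroup G0" "add_subgroup H" "H \<subseteq> G0" "G0 \<subseteq> G"
    and "transversal T G H" "finite T"
    and per: "\<And>g h. g \<in> G \<Longrightarrow> h \<in> H \<Longrightarrow> f (g + h) = f g"
    and zero: "\<And>g. g \<in> G \<Longrightarrow> g \<notin> G0 \<Longrightarrow> f g = 0"
  shows "tsum G H f = tsum G0 H f"
proof -
  have T0: "transversal (T \<inter> G0) G0 H"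
  proof (rule transversalI[OF _ assms(3)])
    fix g assume g: "g \<in> G0"
    then obtain t where t: "t \<in> T" "g - t \<in> H" using transversal_obtain[OF assms(6)] assms(5) by blast
    have "g - (g - t) \<in> G0" using g t assms(4) by (blast intro: add_subgroup_diff[OF assms(2)])
    then show "\<exists>t\<in>T \<inter> G0. g - t \<in> H" using t by auto
  qed (use transversal_unique[OF assms(6,3)] in auto)
  have "tsum G H f = sum f T" by (rule tsum_eq[OF assms(6,3) per])
  also have "\<dots> = sum f (T \<inter> G0)"
    using transversal_subset[OF assms(6)] zero assms(7) by (intro sum.mono_neutral_right) auto
  also have "\<dots> = tsum G0 H f"
    by (rule tsum_eq[OF T0 assms(3), symmetric]) (use per assms(5) in blast)
  finally show ?thesis .
qed

text \<open>Integer powers of a unit \<open>a\<close> with inverse \<open>b\<close>, in a ring that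
  has no division; at most one of the two factors differs from 1.\<close>

definition unit_powi :: "'r::comm_ring_1 \<Rightarrow> 'r \<Rightarrow> int \<Rightarrow> 'r" where
  "unit_powi a b k = a ^ nat k * b ^ nat (- k)"

lemma unit_powi_eq:
  assumes "a * b = 1" "int m - int n = k" shows "unit_powi a b k = a ^ m * b ^ n"
proof -
  define t where "t = min m n"
  have "m = nat k + t" "n = nat (- k) + t" using assms(2) by (auto simp: t_def)
  then have "a ^ m * b ^ n = unit_powi a b k * (a * b) ^ t"
    by (simp add: unit_powi_def power_add power_mult_distrib)
  then show ?thesis by (simp add: assms(1))
qed

lemma unit_powi_add:
  assumes "a * b = 1" shows "unit_powi a b (j + k) = unit_powi a b j * unit_powi a b k"
proof -
  have "unit_powi a b (j + k) = a ^ (nat j + nat k) * b ^ (nat (- j) + nat (- k))"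
    by (rule unit_powi_eq[OF assms]) simp
  then show ?thesis by (simp add: unit_powi_def power_add)
qed

lemma unit_powi_0 [simp]: "unit_powi a b 0 = 1"
  by (simp add: unit_powi_def)

lemma unit_powi_of_nat: "unit_powi a b (int n) = a ^ n"
  by (simp add: unit_powi_def)

lemma unit_powi_unit:
  assumes "a * b = 1" shows "unit_powi a b k * unit_powi a b (- k) = 1"
  using unit_powi_add[OF assms, of k "- k"] by simp

section \<open>Gauss sums\<close>

locale gauss_sums = local_field v for v :: "'f::field \<Rightarrow> real" +
  fixes chi :: "'f \<Rightarrow> 'r::idom" and iq sq :: 'r
  assumes two: "(2::'f) \<noteq> 0"
    and chi: "smooth_character v chi" "\<exists>x. chi x \<noteq> 1"
    and iq: "of_nat q * iq = 1" and sq: "sq\<^sup>2 = of_nat q"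
begin

lemma chi_unit: "chi x dvd 1" and chi_add: "chi (x + y) = chi x * chi y"
  using chi(1) by (auto simp: smooth_character_def)

lemma chi_nonzero: "chi x \<noteq> 0"
  using chi_unit[of x] by auto

lemma chi_0 [simp]: "chi 0 = 1"
  using chi_add[of 0 0] chi_nonzero[of 0] by simp

lemma chi_minus: "chi x * chi (- x) = 1"
  using chi_add[of x "- x"] by simp

lemma conductor_exists: "\<exists>d. (\<forall>x\<in>U d. chi x = 1) \<and> (\<exists>x\<in>U (d - 1). chi x \<noteq> 1)"
proof -
  have "openin (field_topology v) {x. chi x = 1}" using chi(1) by (simp add: smooth_character_def)
  moreover have "0 \<in> {x. chi x = 1}" by simp
  ultimately obtain r where r: "r > 0" "\<And>y. v (0 - y) < r \<Longrightarrow> y \<in> {x. chi x = 1}"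
    unfolding openin_field_iff by blast
  obtain k where k: "v \<pi> powi k < r" using powi_v_\<pi>_small[OF r(1)] by blast
  have Uk: "chi x = 1" if "x \<in> U k" for x using r(2)[of x] k that by (simp add: U_def)
  obtain x where x: "chi x \<noteq> 1" using chi(2) by blast
  define P where "P n \<longleftrightarrow> (\<exists>x\<in>U (k - int n). chi x \<noteq> 1)" for n
  have "x \<in> U (k - int (nat (k - ord x)))" by (rule U_monoD[OF U_ord]) auto
  then have "P (nat (k - ord x))" using x by (auto simp: P_def)
  moreover have "\<not> P 0" using Uk by (auto simp: P_def)
  ultimately obtain n where "\<not> P n" "P (Suc n)" using ex_least_nat_less[of P] by blast
  then show ?thesis by (intro exI[of _ "k - int n"]) (auto simp: P_def algebra_simps)
qed

text \<open>The conductor exponent of \<open>chi\<close>: \<open>U d\<close> is the largest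
  fractional ideal on which it is trivial.\<close>

definition d :: int where "d = (SOME d. (\<forall>x\<in>U d. chi x = 1) \<and> (\<exists>x\<in>U (d - 1). chi x \<noteq> 1))"

lemma chi_U: "x \<in> U d \<Longrightarrow> chi x = 1" and chi_nontrivial: "\<exists>x\<in>U (d - 1). chi x \<noteq> 1"
proof -
  have "(\<forall>x\<in>U d. chi x = 1) \<and> (\<exists>x\<in>U (d - 1). chi x \<noteq> 1)"
    unfolding d_def by (rule someI_ex[OF conductor_exists])
  then show "x \<in> U d \<Longrightarrow> chi x = 1" "\<exists>x\<in>U (d - 1). chi x \<noteq> 1" by auto
qed

text \<open>The pairing \<open>chi (x * y)\<close> makes \<open>U (d - j)\<close> the annihilator of
  \<open>U j\<close>: an element of smaller order multiplies \<open>U j\<close> onto an ideal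
  containing \<open>U (d - 1)\<close>.\<close>

lemma chi_annihilator: "(\<forall>u\<in>U j. chi (y * u) = 1) \<longleftrightarrow> y \<in> U (d - j)"
proof
  assume "y \<in> U (d - j)"
  then show "\<forall>u\<in>U j. chi (y * u) = 1" using U_mult[of y "d - j" _ j] chi_U by simp
next
  assume triv: "\<forall>u\<in>U j. chi (y * u) = 1"
  show "y \<in> U (d - j)"
  proof (rule ccontr)
    assume y: "y \<notin> U (d - j)"
    then have y0: "y \<noteq> 0" and o: "ord y < d - j" by (auto simp: U_iff_ord)
    obtain x where x: "x \<in> U (d - 1)" "chi x \<noteq> 1" using chi_nontrivial by blast
    have "x \<in> U (j + ord y)" using x(1) by (rule U_monoD) (use o in simp)
    then have "x / y \<in> U j" using U_mult_iff[OF y0, of "x / y" "j + ord y"] y0 by simp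
    then show False using triv x(2) y0 by force
  qed
qed

definition qz :: "int \<Rightarrow> 'r" where "qz = unit_powi (of_nat q) iq"
text \<open>Powers of the square root of \<open>q\<close>, that is, half-integral powers of
  \<open>q\<close>; the inverse of \<open>sq\<close> is \<open>sq * iq\<close>.\<close>

definition sz :: "int \<Rightarrow> 'r" where "sz = unit_powi sq (sq * iq)"

lemma sq_unit: "sq * (sq * iq) = 1"
  using iq sq by (simp add: power2_eq_square mult.assoc[symmetric])

lemmas qz_add = unit_powi_add[OF iq, folded qz_def]
  and sz_add = unit_powi_add[OF sq_unit, folded sz_def]
  and qz_unit = unit_powi_unit[OF iq, folded qz_def]
  and sz_unit = unit_powi_unit[OF sq_unit, folded sz_def]

lemma qz_0 [simp]: "qz 0 = 1" and sz_0 [simp]: "sz 0 = 1"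
  by (simp_all add: qz_def sz_def)

lemma qz_nat: "0 \<le> k \<Longrightarrow> qz k = of_nat (q ^ nat k)"
  using unit_powi_of_nat[of "of_nat q" iq "nat k"] by (simp add: qz_def)

lemma qz_nonzero: "qz k \<noteq> 0" and sz_nonzero: "sz k \<noteq> 0"
  using qz_unit[of k] sz_unit[of k] by auto

lemma sz_double: "sz (k + k) = qz k"
proof -
  have "sz (k + k) = sz k * sz k" by (rule sz_add)
  also have "\<dots> = (sq\<^sup>2) ^ nat k * ((sq * iq)\<^sup>2) ^ nat (- k)"
    by (simp add: sz_def unit_powi_def power2_eq_square power_mult_distrib ac_simps)
  also have "(sq * iq)\<^sup>2 = (of_nat q * iq) * iq"
    by (simp add: power_mult_distrib sq) (simp add: power2_eq_square mult.assoc)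
  finally show ?thesis by (simp add: sq iq qz_def unit_powi_def)
qed

lemma tsum_const:
  assumes "j \<le> k" shows "tsum (U j) (U k) (\<lambda>_. c) = qz (k - j) * c"
proof -
  obtain T where T: "transversal T (U j) (U k)" using transversal_exists U_subgroup by blast
  have "tsum (U j) (U k) (\<lambda>_. c) = (\<Sum>_\<in>T. c)" by (rule tsum_eq[OF T U_subgroup]) simp
  then show ?thesis using U_transversal_finite[OF T assms] assms by (simp add: qz_nat)
qed

lemma tsum_U_restrict:
  assumes "j \<le> m" "m \<le> k" "\<And>g h. g \<in> U j \<Longrightarrow> h \<in> U k \<Longrightarrow> f (g + h) = f g"
    and "\<And>g. g \<in> U j \<Longrightarrow> g \<notin> U m \<Longrightarrow> f g = 0"
  shows "tsum (U j) (U k) f = tsum (U m) (U k) f"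
proof -
  obtain T where T: "transversal T (U j) (U k)" using transversal_exists U_subgroup by blast
  show ?thesis
    by (rule tsum_restrict[OF U_subgroup U_subgroup U_subgroup _ _ T])
      (use assms U_transversal_finite[OF T] U_mono in auto)
qed

text \<open>Orthogonality of characters. The assumption on \<open>y\<close> says that the summand is
  periodic modulo \<open>U k\<close>.\<close>

lemma tsum_linear:
  assumes "j \<le> k" "y \<in> U (d - k)"
  shows "tsum (U j) (U k) (\<lambda>s. chi (y * s)) = (if y \<in> U (d - j) then qz (k - j) else 0)"
proof (cases "y \<in> U (d - j)")
  case True
  then have "\<forall>s\<in>U j. chi (y * s) = 1" using chi_annihilator by blast
  then have "tsum (U j) (U k) (\<lambda>s. chi (y * s)) = tsum (U j) (U k) (\<lambda>_. 1)"
    by (intro tsum_cong U_subgroup) blast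
  then show ?thesis using True assms(1) by (simp add: tsum_const)
next
  case False
  obtain u where u: "u \<in> U j" "chi (y * u) \<noteq> 1" using False chi_annihilator by blast
  obtain T where T: "transversal T (U j) (U k)" using transversal_exists U_subgroup by blast
  have k1: "chi (y * h) = 1" if "h \<in> U k" for h using assms(2) that chi_annihilator by blast
  have "tsum (U j) (U k) (\<lambda>s. chi (y * s)) = (\<Sum>s\<in>T. chi (y * s))"
    by (rule tsum_eq[OF T U_subgroup]) (simp add: distrib_left chi_add k1)
  also have "\<dots> = 0"
    by (rule character_sum_eq_0[where \<xi>="\<lambda>s. chi (y * s)" and u=u, OF T U_subgroup U_subgroup U_mono[OF assms(1)]])
      (use u k1 in \<open>auto simp: distrib_left chi_add\<close>)
  finally show ?thesis using False by simp
qed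

section \<open>Oscillatory integrals of Gaussian type\<close>

definition mean :: "int \<Rightarrow> int \<Rightarrow> ('f \<Rightarrow> 'r) \<Rightarrow> 'r" where
  "mean j k f = qz (- k) * tsum (U j) (U k) f"

text \<open>The integral over the whole field, as the stable value of the integrals over
  \<open>U j\<close> computed with mesh \<open>U k\<close>, where \<open>U 0\<close> has volume 1.
  The quantifiers are nested because the mesh required depends on the domain.\<close>

definition J :: "('f \<Rightarrow> 'r) \<Rightarrow> 'r" where
  "J f = (THE r. \<exists>j0. \<forall>j\<le>j0. \<exists>k0. \<forall>k\<ge>k0. mean j k f = r)"

text \<open>For the pairing \<open>chi (2 * c * x * y)\<close> attached to the Gaussian, the
  annihilator of \<open>U m\<close> is \<open>U (radius c - m)\<close>.\<close>

definition radius :: "'f \<Rightarrow> int" where "radius c = d - ord (2 * c)"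
text \<open>On this lattice \<open>chi (c * u\<^sup>2)\<close> is trivial and a test function of
  period \<open>U N\<close> does not vary, so a Gaussian integrand changes by a linear character
  only.\<close>

definition mesh :: "'f \<Rightarrow> int \<Rightarrow> int" where "mesh c N = max N (\<bar>d\<bar> + \<bar>ord c\<bar>)"
text \<open>The first two inequalities let \<open>U j\<close> contain the mesh lattice and its
  annihilator, outside which cosets cancel. The other two make \<open>U k\<close> fine enough for
  the integrand to be periodic on \<open>U j\<close>.\<close>

definition adequate :: "'f \<Rightarrow> int \<Rightarrow> int \<Rightarrow> int \<Rightarrow> bool" where
  "adequate c N j k \<longleftrightarrow> j \<le> mesh c N \<and> j \<le> radius c - mesh c N \<and> mesh c N \<le> k \<and> radius c - j \<le> k"

lemma adequate_exists: "\<exists>j0. \<forall>j\<le>j0. \<exists>k0. \<forall>k\<ge>k0. adequate c N j k"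
proof (intro exI allI impI)
  fix j k assume "j \<le> min (mesh c N) (radius c - mesh c N)" "max (mesh c N) (radius c - j) \<le> k"
  then show "adequate c N j k" by (simp add: adequate_def)
qed

lemma chi_square_mesh:
  assumes "c \<noteq> 0" "u \<in> U k" "mesh c N \<le> k" shows "chi (c * u\<^sup>2) = 1"
proof (rule chi_U)
  have "c * (u * u) \<in> U (ord c + (k + k))" using assms by (intro U_mult U_ord)
  then show "c * u\<^sup>2 \<in> U d" unfolding power2_eq_square
    by (rule U_monoD) (use assms(3) in \<open>(simp add: mesh_def, linarith)\<close>)
qed

definition periodic :: "int \<Rightarrow> ('f \<Rightarrow> 'r) \<Rightarrow> bool" where
  "periodic N \<psi> \<longleftrightarrow> (\<forall>s. \<forall>u\<in>U N. \<psi> (s + u) = \<psi> s)"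

lemma gaussian_shift:
  assumes "c \<noteq> 0" "periodic N \<psi>" "mesh c N \<le> k" "u \<in> U k"
  shows "chi (c * (g + u)\<^sup>2) * \<psi> (g + u) = (chi (c * g\<^sup>2) * \<psi> g) * chi ((2 * c * g) * u)"
proof -
  have "u \<in> U N" using assms(4) by (rule U_monoD) (use assms(3) in \<open>simp add: mesh_def\<close>)
  then have "\<psi> (g + u) = \<psi> g" using assms(2) by (simp add: periodic_def)
  moreover have "c * (g + u)\<^sup>2 = c * g\<^sup>2 + (2 * c * g) * u + c * u\<^sup>2"
    by (simp add: algebra_simps power2_eq_square)
  ultimately show ?thesis using chi_square_mesh[OF assms(1,4,3)] by (simp add: chi_add)
qed

lemma two_c_in_U:
  assumes "c \<noteq> 0" shows "2 * c * g \<in> U (d - k) \<longleftrightarrow> g \<in> U (radius c - k)"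
  using U_mult_iff[of "2 * c" g "d - k"] assms two by (simp add: radius_def algebra_simps)

lemma gaussian_periodic:
  assumes "c \<noteq> 0" "periodic N \<psi>" "adequate c N j k" "g \<in> U j" "h \<in> U k"
  shows "chi (c * (g + h)\<^sup>2) * \<psi> (g + h) = chi (c * g\<^sup>2) * \<psi> g"
proof -
  have "g \<in> U (radius c - k)" using assms(4) by (rule U_monoD) (use assms(3) in \<open>simp add: adequate_def\<close>)
  then have "2 * c * g \<in> U (d - k)" using two_c_in_U[OF assms(1)] by blast
  then have "chi ((2 * c * g) * h) = 1" using assms(5) chi_annihilator by blast
  then show ?thesis
    using gaussian_shift[OF assms(1,2) _ assms(5), of g] assms(3) by (simp add: adequate_def)
qed

text \<open>Every adequate pair is compared with one standard pair. Shrinking the domain is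
  \<open>tsum_oscillating\<close>, with the linear character of \<open>gaussian_shift\<close>;
  coarsening the mesh only repeats each value, which the factor \<open>qz (- k)\<close>
  compensates.\<close>

lemma mean_eq:
  assumes "c \<noteq> 0" "periodic N \<psi>" "adequate c N j k"
  defines "m \<equiv> mesh c N" and "j0 \<equiv> min (mesh c N) (radius c - mesh c N)"
  shows "mean j k (\<lambda>s. chi (c * s\<^sup>2) * \<psi> s) = mean j0 (max m (radius c - j0)) (\<lambda>s. chi (c * s\<^sup>2) * \<psi> s)"
proof -
  define f where "f = (\<lambda>s. chi (c * s\<^sup>2) * \<psi> s)"
  have le: "j \<le> j0" "j0 \<le> m" "m \<le> k" "radius c - j \<le> k" "j0 \<le> radius c - m"
    using assms(3) by (auto simp: adequate_def m_def j0_def)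
  obtain T where T: "transversal T (U j) (U m)" using transversal_exists U_subgroup by blast
  have fT: "finite T" using U_transversal_finite[OF T] le by simp
  have "tsum (U j) (U k) f = tsum (U j0) (U k) f"
  proof (rule tsum_oscillating[OF U_subgroup U_subgroup U_subgroup U_subgroup _ _ _ T fT,
        where \<xi>="\<lambda>g u. chi ((2 * c * g) * u)"])
    show "U k \<subseteq> U m" "U m \<subseteq> U j0" "U j0 \<subseteq> U j" using le by (auto intro: U_monoD)
    fix g u u'
    show "chi (2 * c * g * (u + u')) = chi (2 * c * g * u) * chi (2 * c * g * u')"
      by (simp add: distrib_left chi_add)
    show "f (g + u) = f g * chi (2 * c * g * u)" if "u \<in> U m"
      unfolding f_def by (rule gaussian_shift[OF assms(1,2) _ that]) (simp add: m_def)
    show "chi (2 * c * g * u) = 1" if "g \<in> U j" "u \<in> U k"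
    proof -
      have "g \<in> U (radius c - k)" using that(1) by (rule U_monoD) (use le in simp)
      then show ?thesis using two_c_in_U[OF assms(1)] chi_annihilator that(2) by blast
    qed
    show "\<exists>u\<in>U m. chi (2 * c * g * u) \<noteq> 1" if "g \<notin> U j0"
    proof -
      have "g \<notin> U (radius c - m)" using that le(5) U_monoD by blast
      then show ?thesis using two_c_in_U[OF assms(1), of g m] chi_annihilator[of m "2 * c * g"] by blast
    qed
  qed
  also have "\<dots> = qz (k - max m (radius c - j0)) * tsum (U j0) (U (max m (radius c - j0))) f"
  proof -
    define k' where "k' = max m (radius c - j0)"
    have le': "j0 \<le> k'" "k' \<le> k" using le by (auto simp: k'_def)
    have ad: "adequate c N j0 k'" by (auto simp: adequate_def j0_def k'_def m_def)
    have per: "f (g + h) = f g" if "g \<in> U j0" "h \<in> U k'" for g h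
      unfolding f_def by (rule gaussian_periodic[OF assms(1,2) ad that])
    obtain T1 where T1: "transversal T1 (U j0) (U k')" using transversal_exists U_subgroup by blast
    obtain T2 where T2: "transversal T2 (U k') (U k)" using transversal_exists U_subgroup by blast
    have "tsum (U j0) (U k) f = (\<Sum>a\<in>T1. \<Sum>b\<in>T2. f (a + b))"
      by (rule tsum_tower[OF T1 T2 U_subgroup U_subgroup U_subgroup])
        (use le' per U_mono[OF le'(2)] in \<open>auto intro: U_monoD\<close>)
    also have "\<dots> = (\<Sum>a\<in>T1. \<Sum>b\<in>T2. f a)"
      using per transversal_subset[OF T1] transversal_subset[OF T2] by (intro sum.cong) auto
    also have "\<dots> = of_nat (card T2) * sum f T1" by (simp add: sum_distrib_left)
    also have "sum f T1 = tsum (U j0) (U k') f" by (rule tsum_eq[OF T1 U_subgroup per, symmetric])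
    finally show ?thesis using U_transversal_finite[OF T2 le'(2)] le' by (simp add: k'_def[symmetric] qz_nat)
  qed
  finally have "mean j k f = (qz (- k) * qz (k - max m (radius c - j0))) * tsum (U j0) (U (max m (radius c - j0))) f"
    by (simp add: mean_def mult.assoc)
  then show ?thesis
    unfolding f_def[symmetric] by (simp add: mean_def qz_add[symmetric])
qed

lemma J_eq:
  assumes "c \<noteq> 0" "periodic N \<psi>" "adequate c N j k"
  shows "J (\<lambda>s. chi (c * s\<^sup>2) * \<psi> s) = mean j k (\<lambda>s. chi (c * s\<^sup>2) * \<psi> s)"
  unfolding J_def
proof (rule the_equality)
  let ?f = "\<lambda>s. chi (c * s\<^sup>2) * \<psi> s"
  have eq: "mean j' k' ?f = mean j k ?f" if "adequate c N j' k'" for j' k'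
    using mean_eq[OF assms(1,2) that] mean_eq[OF assms] by simp
  obtain j1 where j1: "\<forall>j\<le>j1. \<exists>k0. \<forall>k\<ge>k0. adequate c N j k" using adequate_exists by blast
  show "\<exists>j0. \<forall>i\<le>j0. \<exists>k0. \<forall>l\<ge>k0. mean i l ?f = mean j k ?f"
  proof (rule exI[of _ j1], intro allI impI)
    fix i assume "i \<le> j1"
    then obtain k0 where k0: "\<forall>k\<ge>k0. adequate c N i k" using j1 by blast
    show "\<exists>k0. \<forall>l\<ge>k0. mean i l ?f = mean j k ?f"
      by (rule exI[of _ k0], intro allI impI, rule eq) (use k0 in simp)
  qed
  show "r = mean j k ?f" if r: "\<exists>j0. \<forall>j\<le>j0. \<exists>k0. \<forall>k\<ge>k0. mean j k ?f = r" for r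
  proof -
    obtain j0 where j0: "\<forall>j\<le>j0. \<exists>k0. \<forall>k\<ge>k0. mean j k ?f = r" using r by blast
    obtain k0 where k0: "\<forall>k\<ge>k0. mean (min j0 j1) k ?f = r" using j0 by (meson min.cobounded1)
    obtain k1 where k1: "\<forall>k\<ge>k1. adequate c N (min j0 j1) k" using j1 by (meson min.cobounded2)
    show ?thesis using k0[rule_format, of "max k0 k1"] eq[OF k1[rule_format, of "max k0 k1"]] by simp
  qed
qed

definition G :: "'f \<Rightarrow> 'r" where "G c = J (\<lambda>s. chi (c * s\<^sup>2))"

lemma periodic_const: "periodic N (\<lambda>_. a)"
  by (simp add: periodic_def)

lemma G_eq: "c \<noteq> 0 \<Longrightarrow> adequate c N j k \<Longrightarrow> G c = mean j k (\<lambda>s. chi (c * s\<^sup>2))"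
  using J_eq[OF _ periodic_const, of c N j k 1] by (simp add: G_def)

text \<open>The shifted integrand is again a Gaussian times a periodic function, so both sides are
  finite sums over one pair \<open>j\<close>, \<open>k\<close>; with \<open>a \<in> U j\<close> the
  shift merely permutes cosets.\<close>

lemma J_shift:
  assumes "c \<noteq> 0" "periodic N \<psi>"
  shows "J (\<lambda>s. chi (c * (s + a)\<^sup>2) * \<psi> (s + a)) = J (\<lambda>s. chi (c * s\<^sup>2) * \<psi> s)"
proof -
  define \<psi>' where "\<psi>' s = chi (2 * c * a * s) * chi (c * a\<^sup>2) * \<psi> (s + a)" for s
  \<comment> \<open>Beyond the period of \<open>\<psi>\<close>, this makes the linear phase
    \<open>chi (2 * c * a * s)\<close> periodic.\<close>
  define N' where "N' = max N (radius c - ord a)"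
  have per: "periodic N' \<psi>'"
    unfolding periodic_def
  proof (intro allI ballI)
    fix s u assume u: "u \<in> U N'"
    then have "u \<in> U N" by (rule U_monoD) (simp add: N'_def)
    then have 1: "\<psi> (s + u + a) = \<psi> (s + a)" using assms(2) unfolding periodic_def by (metis add.commute add.left_commute)
    have "a \<in> U (radius c - N')" by (rule U_monoD[OF U_ord]) (simp add: N'_def)
    then have "chi (2 * c * a * u) = 1" using two_c_in_U[OF assms(1)] chi_annihilator u by blast
    then show "\<psi>' (s + u) = \<psi>' s" using 1 by (simp add: \<psi>'_def distrib_left chi_add)
  qed
  have f: "chi (c * (s + a)\<^sup>2) * \<psi> (s + a) = chi (c * s\<^sup>2) * \<psi>' s" for s
  proof -
    have "c * (s + a)\<^sup>2 = c * s\<^sup>2 + 2 * c * a * s + c * a\<^sup>2" by (simp add: algebra_simps power2_eq_square)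
    then show ?thesis by (simp add: \<psi>'_def chi_add ac_simps)
  qed
  obtain j0 where j0: "\<forall>j\<le>j0. \<exists>k0. \<forall>k\<ge>k0. adequate c N j k" using adequate_exists by blast
  obtain j1 where j1: "\<forall>j\<le>j1. \<exists>k0. \<forall>k\<ge>k0. adequate c N' j k" using adequate_exists by blast
  define j where "j = min (ord a) (min j0 j1)"
  have "j \<le> j0" "j \<le> j1" by (auto simp: j_def)
  then obtain k0 k1 where k: "\<forall>k\<ge>k0. adequate c N j k" "\<forall>k\<ge>k1. adequate c N' j k"
    using j0 j1 by blast
  define k where "k = max k0 k1"
  have ad: "adequate c N j k" "adequate c N' j k" using k by (auto simp: k_def)
  have a: "a \<in> U j" by (rule U_monoD[OF U_ord]) (simp add: j_def)
  have "J (\<lambda>s. chi (c * (s + a)\<^sup>2) * \<psi> (s + a)) = mean j k (\<lambda>s. chi (c * (s + a)\<^sup>2) * \<psi> (s + a))"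
    unfolding f by (rule J_eq[OF assms(1) per ad(2)])
  also have "\<dots> = mean j k (\<lambda>s. chi (c * s\<^sup>2) * \<psi> s)"
    unfolding mean_def
    by (subst tsum_shift[OF U_subgroup U_subgroup a, of _ "\<lambda>s. chi (c * s\<^sup>2) * \<psi> s"])
      (use gaussian_periodic[OF assms ad(1)] in auto)
  also have "\<dots> = J (\<lambda>s. chi (c * s\<^sup>2) * \<psi> s)" by (rule J_eq[OF assms ad(1), symmetric])
  finally show ?thesis .
qed

lemma J_linear_phase:
  assumes "c \<noteq> 0"
  shows "J (\<lambda>s. chi (c * s\<^sup>2 - 2 * b * s)) = chi (- b\<^sup>2 / c) * G c"
proof -
  have e: "chi (c * (s + - b / c)\<^sup>2) = chi (c * s\<^sup>2) * (chi (- 2 * b * s) * chi (b\<^sup>2 / c))" for s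
  proof -
    have "c * (s + - b / c)\<^sup>2 = c * s\<^sup>2 + (- 2 * b * s + b\<^sup>2 / c)"
      using assms by (simp add: power2_eq_square field_simps)
    then show ?thesis by (simp only: chi_add)
  qed
  have G: "G c = J (\<lambda>s. chi (c * s\<^sup>2) * (chi (- 2 * b * s) * chi (b\<^sup>2 / c)))"
    using J_shift[OF assms periodic_const[of 0 1], of "- b / c"] by (simp only: G_def e mult_1_right)
  define N where "N = d - ord (- 2 * b)"
  have one: "chi (- 2 * b * u) = 1" if "u \<in> U N" for u
    by (rule chi_U) (use U_mult[OF U_ord that, of "- 2 * b"] in \<open>simp add: N_def\<close>)
  have per: "periodic N (\<lambda>s. chi (- 2 * b * s) * a)" for a
    unfolding periodic_def by (intro allI ballI) (simp only: distrib_left chi_add one mult_1_right)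
  obtain j k where ad: "adequate c N j k" using adequate_exists by (meson order_refl)
  have "J (\<lambda>s. chi (c * s\<^sup>2 - 2 * b * s)) = J (\<lambda>s. chi (c * s\<^sup>2) * (chi (- 2 * b * s) * 1))"
    by (simp add: chi_add[symmetric])
  also have "\<dots> = mean j k (\<lambda>s. chi (c * s\<^sup>2) * (chi (- 2 * b * s) * 1))"
    by (rule J_eq[OF assms per ad])
  also have "\<dots> = (chi (b\<^sup>2 / c) * chi (- (b\<^sup>2 / c))) * mean j k (\<lambda>s. chi (c * s\<^sup>2) * (chi (- 2 * b * s) * 1))"
    by (simp only: chi_minus mult_1)
  also have "\<dots> = chi (- (b\<^sup>2 / c)) * mean j k (\<lambda>s. chi (c * s\<^sup>2) * (chi (- 2 * b * s) * chi (b\<^sup>2 / c)))"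
  proof -
    have "mean j k (\<lambda>s. chi (c * s\<^sup>2) * (chi (- 2 * b * s) * chi (b\<^sup>2 / c)))
      = chi (b\<^sup>2 / c) * mean j k (\<lambda>s. chi (c * s\<^sup>2) * (chi (- 2 * b * s) * 1))"
      unfolding mean_def by (subst mult.left_commute, subst tsum_mult_left[symmetric]) (simp add: ac_simps)
    then show ?thesis by (simp add: ac_simps)
  qed
  also have "mean j k (\<lambda>s. chi (c * s\<^sup>2) * (chi (- 2 * b * s) * chi (b\<^sup>2 / c))) = G c"
    unfolding G by (rule J_eq[OF assms per ad, symmetric])
  finally show ?thesis by simp
qed

text \<open>The change of variable \<open>s\<close> to \<open>b * s\<close> multiplies the volume by
  the absolute value of \<open>b\<close>, whose inverse is \<open>qz (ord b)\<close>.\<close>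

lemma G_scale:
  assumes "a \<noteq> 0" "b \<noteq> 0" shows "G (a * b\<^sup>2) = qz (ord b) * G a"
proof -
  obtain j0 where j0: "\<forall>j\<le>j0. \<exists>k0. \<forall>k\<ge>k0. adequate (a * b\<^sup>2) 0 j k" using adequate_exists by blast
  obtain j1 where j1: "\<forall>j\<le>j1. \<exists>k0. \<forall>k\<ge>k0. adequate a 0 j k" using adequate_exists by blast
  define j where "j = min j0 (j1 - ord b)"
  have "j \<le> j0" "ord b + j \<le> j1" by (auto simp: j_def)
  then obtain k0 k1 where k: "\<forall>k\<ge>k0. adequate (a * b\<^sup>2) 0 j k" "\<forall>k\<ge>k1. adequate a 0 (ord b + j) k"
    using j0 j1 by blast
  define k where "k = max k0 (k1 - ord b)"
  have ad: "adequate (a * b\<^sup>2) 0 j k" "adequate a 0 (ord b + j) (ord b + k)" using k by (auto simp: k_def)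
  have "tsum ((*) b ` U j) ((*) b ` U k) (\<lambda>s. chi (a * s\<^sup>2)) = tsum (U j) (U k) (\<lambda>s. chi (a * (b * s)\<^sup>2))"
  proof (rule tsum_image)
    show "add_subgroup ((*) b ` U k)" using U_image_mult[OF assms(2)] U_subgroup by simp
    fix x y assume "x \<in> (*) b ` U j" "y \<in> (*) b ` U k"
    then show "chi (a * (x + y)\<^sup>2) = chi (a * x\<^sup>2)"
      using gaussian_periodic[OF assms(1) periodic_const ad(2), of x y 1] U_image_mult[OF assms(2)] by simp
  qed (use assms(2) U_subgroup in \<open>auto simp: right_diff_distrib inj_def\<close>)
  then have "tsum (U (ord b + j)) (U (ord b + k)) (\<lambda>s. chi (a * s\<^sup>2)) = tsum (U j) (U k) (\<lambda>s. chi ((a * b\<^sup>2) * s\<^sup>2))"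
    using U_image_mult[OF assms(2)] by (simp add: power_mult_distrib mult.assoc)
  then have "mean j k (\<lambda>s. chi ((a * b\<^sup>2) * s\<^sup>2)) = qz (ord b) * mean (ord b + j) (ord b + k) (\<lambda>s. chi (a * s\<^sup>2))"
    by (simp add: mean_def mult.assoc[symmetric] qz_add[symmetric])
  then show ?thesis using G_eq[OF _ ad(1)] G_eq[OF assms(1) ad(2)] assms by simp
qed

lemma radius_minus: "radius (- c) = radius c" and mesh_minus: "mesh (- c) N = mesh c N"
  by (simp_all add: radius_def mesh_def)

text \<open>Fourier inversion. With \<open>u = s + t\<close> the phase
  \<open>c * s\<^sup>2 - c * t\<^sup>2\<close> becomes \<open>2 * c * u * s - c * u\<^sup>2\<close>,
  linear in \<open>s\<close>. Summation over \<open>s\<close> confines \<open>u\<close> to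
  \<open>U (radius c - j)\<close>, where \<open>\<Theta>\<close> is constant and the other phase
  trivial. The condition \<open>j \<le> radius c - j\<close> keeps that lattice inside the
  domain.\<close>

lemma gaussian_inversion:
  assumes "c \<noteq> 0" "periodic N \<Theta>" "adequate c N j k" "j \<le> radius c - j"
  shows "mean j k (\<lambda>s. chi (c * s\<^sup>2) * mean j k (\<lambda>t. chi (- c * t\<^sup>2) * \<Theta> (s + t))) = qz (- radius c) * \<Theta> 0"
proof -
  have "mesh c N \<le> k" "radius c - j \<le> k" "mesh c N \<le> radius c - j"
    using assms(3) unfolding adequate_def by linarith+
  moreover have "N \<le> mesh c N" by (simp add: mesh_def)
  ultimately have le: "mesh c N \<le> k" "radius c - j \<le> k" "mesh c N \<le> radius c - j" "N \<le> mesh c N" .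
  have ad': "adequate (- c) N j k" using assms(3) by (simp add: adequate_def radius_minus mesh_minus)
  have inner: "tsum (U j) (U k) (\<lambda>t. chi (- c * t\<^sup>2) * \<Theta> (s + t))
      = tsum (U j) (U k) (\<lambda>u. chi (- c * (u - s)\<^sup>2) * \<Theta> u)" if s: "s \<in> U j" for s
  proof -
    have per: "periodic N (\<lambda>t. \<Theta> (s + t))" using assms(2) by (simp add: periodic_def add.assoc[symmetric])
    show ?thesis
      using tsum_shift[OF U_subgroup U_subgroup U_minus[OF s], of k "\<lambda>t. chi (- c * t\<^sup>2) * \<Theta> (s + t)"]
        gaussian_periodic[OF _ per ad'] assms(1) by simp
  qed
  have sq: "chi (c * s\<^sup>2) * chi (- c * (u - s)\<^sup>2) = chi (2 * c * u * s) * chi (- c * u\<^sup>2)" for s u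
    unfolding chi_add[symmetric] by (intro arg_cong[of _ _ chi]) (simp add: algebra_simps power2_eq_square)
  have "tsum (U j) (U k) (\<lambda>s. chi (c * s\<^sup>2) * tsum (U j) (U k) (\<lambda>t. chi (- c * t\<^sup>2) * \<Theta> (s + t)))
    = tsum (U j) (U k) (\<lambda>s. tsum (U j) (U k) (\<lambda>u. (chi (c * s\<^sup>2) * chi (- c * (u - s)\<^sup>2)) * \<Theta> u))"
    by (intro tsum_cong U_subgroup) (simp only: inner tsum_mult_left[symmetric] mult.assoc)
  also have "\<dots> = tsum (U j) (U k) (\<lambda>u. tsum (U j) (U k) (\<lambda>s. (chi (- c * u\<^sup>2) * \<Theta> u) * chi (2 * c * u * s)))"
    unfolding sq by (subst tsum_swap) (simp add: ac_simps)
  also have "\<dots> = tsum (U j) (U k) (\<lambda>u. (chi (- c * u\<^sup>2) * \<Theta> u) * (if u \<in> U (radius c - j) then qz (k - j) else 0))"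
  proof (intro tsum_cong U_subgroup)
    fix u assume u: "u \<in> U j"
    have "u \<in> U (radius c - k)" using u by (rule U_monoD) (use le in simp)
    then have "2 * c * u \<in> U (d - k)" using two_c_in_U[OF assms(1)] by blast
    then have "tsum (U j) (U k) (\<lambda>s. chi (2 * c * u * s)) = (if 2 * c * u \<in> U (d - j) then qz (k - j) else 0)"
      using assms(4) le by (intro tsum_linear) auto
    then show "tsum (U j) (U k) (\<lambda>s. (chi (- c * u\<^sup>2) * \<Theta> u) * chi (2 * c * u * s))
      = (chi (- c * u\<^sup>2) * \<Theta> u) * (if u \<in> U (radius c - j) then qz (k - j) else 0)"
      by (simp add: tsum_mult_left two_c_in_U[OF assms(1)])
  qed
  also have "\<dots> = tsum (U j) (U k) (\<lambda>u. if u \<in> U (radius c - j) then qz (k - j) * \<Theta> 0 else 0)"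
  proof (intro tsum_cong U_subgroup)
    fix u assume "u \<in> U j"
    show "(chi (- c * u\<^sup>2) * \<Theta> u) * (if u \<in> U (radius c - j) then qz (k - j) else 0)
      = (if u \<in> U (radius c - j) then qz (k - j) * \<Theta> 0 else 0)"
    proof (cases "u \<in> U (radius c - j)")
      case True
      have "chi (- c * u\<^sup>2) = 1"
        using chi_square_mesh[of "- c" u "radius c - j" N] True le assms(1) by (simp add: mesh_minus)
      moreover have "u \<in> U N" using True by (rule U_monoD) (use le in simp)
      then have "\<Theta> u = \<Theta> 0" using assms(2) unfolding periodic_def by (metis add_0)
      ultimately show ?thesis using True by simp
    qed simp
  qed
  also have "\<dots> = tsum (U (radius c - j)) (U k) (\<lambda>u. if u \<in> U (radius c - j) then qz (k - j) * \<Theta> 0 else 0)"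
  proof (rule tsum_U_restrict[OF assms(4) le(2)])
    fix g h assume "h \<in> U k"
    then have "h \<in> U (radius c - j)" using le U_monoD by blast
    then have "g + h \<in> U (radius c - j) \<longleftrightarrow> g \<in> U (radius c - j)" using U_add U_diff[of "g + h" _ h] by auto
    then show "(if g + h \<in> U (radius c - j) then qz (k - j) * \<Theta> 0 else 0) = (if g \<in> U (radius c - j) then qz (k - j) * \<Theta> 0 else 0)"
      by simp
  qed simp
  also have "\<dots> = tsum (U (radius c - j)) (U k) (\<lambda>u. qz (k - j) * \<Theta> 0)"
    by (intro tsum_cong U_subgroup) simp
  also have "\<dots> = qz (k - (radius c - j)) * (qz (k - j) * \<Theta> 0)"
    by (rule tsum_const) (use le in simp)
  finally have "tsum (U j) (U k) (\<lambda>s. chi (c * s\<^sup>2) * tsum (U j) (U k) (\<lambda>t. chi (- c * t\<^sup>2) * \<Theta> (s + t)))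
    = qz (k - (radius c - j) + (k - j)) * \<Theta> 0" by (simp only: qz_add mult.assoc)
  moreover have "mean j k (\<lambda>s. chi (c * s\<^sup>2) * mean j k (\<lambda>t. chi (- c * t\<^sup>2) * \<Theta> (s + t)))
    = qz (- k) * (qz (- k) * tsum (U j) (U k) (\<lambda>s. chi (c * s\<^sup>2) * tsum (U j) (U k) (\<lambda>t. chi (- c * t\<^sup>2) * \<Theta> (s + t))))"
    unfolding mean_def by (subst tsum_mult_left[symmetric]) (simp add: ac_simps)
  ultimately have "mean j k (\<lambda>s. chi (c * s\<^sup>2) * mean j k (\<lambda>t. chi (- c * t\<^sup>2) * \<Theta> (s + t)))
    = qz (- k) * (qz (- k) * (qz (k - (radius c - j) + (k - j)) * \<Theta> 0))" by simp
  also have "\<dots> = qz (- k + - k + (k - (radius c - j) + (k - j))) * \<Theta> 0"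
    by (simp only: mult.assoc qz_add)
  also have "- k + - k + (k - (radius c - j) + (k - j)) = - radius c" by simp
  finally show ?thesis .
qed

lemma inversion_adequate_exists: "\<exists>j0. \<forall>j\<le>j0. \<exists>k0. \<forall>k\<ge>k0. adequate c N j k \<and> j \<le> radius c - j"
proof -
  obtain j0 where j0: "\<forall>j\<le>j0. \<exists>k0. \<forall>k\<ge>k0. adequate c N j k" using adequate_exists by blast
  have "j \<le> radius c - j" if "j \<le> - \<bar>radius c\<bar>" for j using that by linarith
  then show ?thesis using j0 by (intro exI[of _ "min j0 (- \<bar>radius c\<bar>)"]) auto
qed

text \<open>Inversion applied to the constant function 1. It shows that Gauss sums are units of
  \<open>R\<close>.\<close>

lemma G_mult_G_minus:
  assumes "c \<noteq> 0" shows "G c * G (- c) = qz (- radius c)"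
proof -
  obtain j k where jk: "adequate c 0 j k" "j \<le> radius c - j" using inversion_adequate_exists by (meson order_refl)
  have ad': "adequate (- c) 0 j k" using jk(1) by (simp add: adequate_def radius_minus mesh_minus)
  have "qz (- radius c) = mean j k (\<lambda>s. chi (c * s\<^sup>2) * mean j k (\<lambda>t. chi (- c * t\<^sup>2)))"
    using gaussian_inversion[OF assms periodic_const jk, of 1] by simp
  also have "\<dots> = mean j k (\<lambda>s. G (- c) * chi (c * s\<^sup>2))"
    using G_eq[OF _ ad'] assms by (simp add: mult.commute)
  also have "\<dots> = G (- c) * mean j k (\<lambda>s. chi (c * s\<^sup>2))"
    by (simp add: mean_def tsum_mult_left ac_simps)
  also have "\<dots> = G (- c) * G c" using G_eq[OF assms jk(1)] by simp
  finally show ?thesis by (simp add: mult.commute)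
qed

lemma G_nonzero: "c \<noteq> 0 \<Longrightarrow> G c \<noteq> 0"
  using G_mult_G_minus[of c] qz_nonzero by force

lemma G_unit: "c \<noteq> 0 \<Longrightarrow> G c dvd 1"
proof -
  assume "c \<noteq> 0"
  then have "G c * (G (- c) * qz (radius c)) = 1"
    using G_mult_G_minus[of c] qz_unit[of "radius c"] by (simp add: mult.assoc[symmetric] mult.commute)
  then show ?thesis by (metis dvdI)
qed

end

context gauss_sums
begin

subsection \<open>Binary forms\<close>

definition binary :: "'f \<Rightarrow> 'f \<Rightarrow> 'f \<Rightarrow> 'f \<times> 'f \<Rightarrow> 'f" where
  "binary a h e p = a * (fst p)\<^sup>2 + 2 * h * fst p * snd p + e * (snd p)\<^sup>2"

definition bpairing :: "'f \<Rightarrow> 'f \<Rightarrow> 'f \<Rightarrow> 'f \<times> 'f \<Rightarrow> 'f \<times> 'f \<Rightarrow> 'f" where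
  "bpairing a h e p u = 2 * (a * fst p + h * snd p) * fst u + 2 * (h * fst p + e * snd p) * snd u"

text \<open>The annihilator of \<open>U m \<times> U m\<close> under the polar form. It is the
  region of summation for \<open>tsum_binary\<close>, symmetric in the two variables.\<close>

definition bdual :: "'f \<Rightarrow> 'f \<Rightarrow> 'f \<Rightarrow> int \<Rightarrow> ('f \<times> 'f) set" where
  "bdual a h e m = {p. 2 * (a * fst p + h * snd p) \<in> U (d - m) \<and> 2 * (h * fst p + e * snd p) \<in> U (d - m)}"

text \<open>The image of \<open>U j \<times> U j\<close> under \<open>(x, y)\<close> to
  \<open>(x - r * y, y)\<close>; for \<open>r = h / a\<close> these coordinates diagonalise the
  form.\<close>

definition sheared :: "'f \<Rightarrow> int \<Rightarrow> ('f \<times> 'f) set" where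
  "sheared r j = {p. fst p + r * snd p \<in> U j \<and> snd p \<in> U j}"

lemma binary_add: "binary a h e (p + u) = binary a h e p + bpairing a h e p u + binary a h e u"
  by (simp add: binary_def bpairing_def algebra_simps power2_eq_square)

lemma bpairing_add: "bpairing a h e p (u + u') = bpairing a h e p u + bpairing a h e p u'"
  by (simp add: bpairing_def algebra_simps)

lemma add_subgroup_Times: "add_subgroup A \<Longrightarrow> add_subgroup B \<Longrightarrow> add_subgroup (A \<times> B)"
  by (auto simp: add_subgroup_def zero_prod_def)

lemma add_subgroup_sheared: "add_subgroup (sheared r j)"
  unfolding add_subgroup_def
proof (intro conjI ballI)
  show "0 \<in> sheared r j" by (simp add: sheared_def U_0)
  fix p u assume pu: "p \<in> sheared r j" "u \<in> sheared r j"
  have "(fst p + r * snd p) - (fst u + r * snd u) \<in> U j" using pu by (intro U_diff) (auto simp: sheared_def)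
  moreover have "snd p - snd u \<in> U j" using pu U_diff by (auto simp: sheared_def)
  ultimately show "p - u \<in> sheared r j" by (simp add: sheared_def algebra_simps)
qed

lemma add_subgroup_bdual: "add_subgroup (bdual a h e m)"
  unfolding add_subgroup_def
proof (intro conjI ballI)
  show "0 \<in> bdual a h e m" by (simp add: bdual_def U_0)
  fix p u assume pu: "p \<in> bdual a h e m" "u \<in> bdual a h e m"
  have "2 * (a * fst p + h * snd p) - 2 * (a * fst u + h * snd u) \<in> U (d - m)"
    "2 * (h * fst p + e * snd p) - 2 * (h * fst u + e * snd u) \<in> U (d - m)"
    using pu U_diff by (auto simp: bdual_def)
  then show "p - u \<in> bdual a h e m" by (simp add: bdual_def algebra_simps)
qed

lemma bpairing_trivial_iff:
  "(\<forall>u\<in>U m \<times> U m. chi (bpairing a h e p u) = 1) \<longleftrightarrow> p \<in> bdual a h e m"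
proof
  assume triv: "\<forall>u\<in>U m \<times> U m. chi (bpairing a h e p u) = 1"
  have "\<forall>x\<in>U m. chi (2 * (a * fst p + h * snd p) * x) = 1"
  proof
    fix x assume "x \<in> U m"
    then show "chi (2 * (a * fst p + h * snd p) * x) = 1" using bspec[OF triv, of "(x, 0)"] U_0 by (simp add: bpairing_def)
  qed
  moreover have "\<forall>x\<in>U m. chi (2 * (h * fst p + e * snd p) * x) = 1"
  proof
    fix x assume "x \<in> U m"
    then show "chi (2 * (h * fst p + e * snd p) * x) = 1" using bspec[OF triv, of "(0, x)"] U_0 by (simp add: bpairing_def)
  qed
  ultimately show "p \<in> bdual a h e m" unfolding chi_annihilator by (simp add: bdual_def)
next
  assume p: "p \<in> bdual a h e m"
  show "\<forall>u\<in>U m \<times> U m. chi (bpairing a h e p u) = 1"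
  proof
    fix u assume "u \<in> U m \<times> U m"
    then have "chi (2 * (a * fst p + h * snd p) * fst u) = 1" "chi (2 * (h * fst p + e * snd p) * snd u) = 1"
      using p chi_annihilator unfolding bdual_def by (auto simp: mem_Times_iff)
    then show "chi (bpairing a h e p u) = 1" by (simp add: bpairing_def chi_add)
  qed
qed

lemma transversal_sheared:
  assumes T: "transversal T (U j) (U k)" and r: "j \<le> ord r + k" "j \<le> k"
  shows "transversal ((\<lambda>(x, y). (x - r * y, y)) ` (T \<times> T)) (sheared r j) (U k \<times> U k)"
proof (rule transversalI)
  note TU = transversal_subset[OF T]
  show "(\<lambda>(x, y). (x - r * y, y)) ` (T \<times> T) \<subseteq> sheared r j" using TU by (auto simp: sheared_def)
  show "add_subgroup (U k \<times> U k)" by (intro add_subgroup_Times U_subgroup)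
next
  fix p assume "p \<in> sheared r j"
  then have p: "fst p + r * snd p \<in> U j" "snd p \<in> U j" by (auto simp: sheared_def)
  obtain y where y: "y \<in> T" "snd p - y \<in> U k" using transversal_obtain[OF T p(2)] by blast
  have "r * (snd p - y) \<in> U (ord r + k)" by (intro U_mult U_ord y)
  then have "r * (snd p - y) \<in> U j" using U_monoD r(1) by blast
  then have "(fst p + r * snd p) - r * (snd p - y) \<in> U j" by (rule U_diff[OF p(1)])
  then have "fst p + r * y \<in> U j" by (simp add: algebra_simps)
  then obtain x where x: "x \<in> T" "fst p + r * y - x \<in> U k" using transversal_obtain[OF T] by blast
  have "p - (x - r * y, y) \<in> U k \<times> U k" using x y by (simp add: mem_Times_iff algebra_simps)
  then show "\<exists>t\<in>(\<lambda>(x, y). (x - r * y, y)) ` (T \<times> T). p - t \<in> U k \<times> U k"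
    using x(1) y(1) by (intro bexI[of _ "(x - r * y, y)"]) auto
next
  fix t t' assume t: "t \<in> (\<lambda>(x, y). (x - r * y, y)) ` (T \<times> T)" "t' \<in> (\<lambda>(x, y). (x - r * y, y)) ` (T \<times> T)"
    "t - t' \<in> U k \<times> U k"
  obtain x y where xy: "x \<in> T" "y \<in> T" "t = (x - r * y, y)" using t(1) by auto
  obtain x' y' where xy': "x' \<in> T" "y' \<in> T" "t' = (x' - r * y', y')" using t(2) by auto
  have "y = y'" using transversal_unique[OF T U_subgroup xy(2) xy'(2)] t(3) xy xy' by (simp add: mem_Times_iff)
  moreover from this have "x = x'" using transversal_unique[OF T U_subgroup xy(1) xy'(1)] t(3) xy xy' by (simp add: mem_Times_iff)
  ultimately show "t = t'" using xy xy' by simp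
qed

lemma square_periodic:
  assumes "c \<noteq> 0" "adequate c 0 j k" "g \<in> U j" "h \<in> U k"
  shows "chi (c * (g + h)\<^sup>2) = chi (c * g\<^sup>2)"
  using gaussian_periodic[OF assms(1) periodic_const[of 0 1] assms(2-4)] by simp

text \<open>Complete the square in the first variable. The lattice \<open>bdual a h e m\<close> does not depend on
  which variable is chosen.\<close>

lemma tsum_binary:
  assumes a: "a \<noteq> 0" and \<delta>: "a * e - h\<^sup>2 \<noteq> 0"
    and m: "\<forall>u\<in>U m \<times> U m. chi (binary a h e u) = 1" "U m \<times> U m \<subseteq> bdual a h e m"
  shows "\<exists>k0. \<forall>k\<ge>k0. qz (- k) * qz (- k) * tsum (bdual a h e m) (U k \<times> U k) (\<lambda>p. chi (binary a h e p))
    = G a * G ((a * e - h\<^sup>2) / a)"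
proof -
  define \<delta> where "\<delta> = a * e - h\<^sup>2"
  define r where "r = h / a"
  have d0: "\<delta> \<noteq> 0" "\<delta> / a \<noteq> 0" using \<delta> a by (auto simp: \<delta>_def)
  obtain j1 where j1: "\<forall>j\<le>j1. \<exists>k0. \<forall>k\<ge>k0. adequate a 0 j k" using adequate_exists by blast
  obtain j2 where j2: "\<forall>j\<le>j2. \<exists>k0. \<forall>k\<ge>k0. adequate (\<delta> / a) 0 j k" using adequate_exists by blast
  \<comment> \<open>\<open>j3\<close> and \<open>j4\<close> bound the two coordinates on the dual
    lattice: Cramer's rule expresses them by two elements of \<open>U (d - m)\<close> with
    denominator \<open>2 * \<delta>\<close>.\<close>
  define j3 where "j3 = min (ord (e / (2 * \<delta>))) (ord (h / (2 * \<delta>))) + (d - m)"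
  define j4 where "j4 = min (ord (a / (2 * \<delta>))) (ord (h / (2 * \<delta>))) + (d - m)"
  define j where "j = min (min j1 j2) (min (min j3 (j4 + ord r)) j4)"
  have jle: "j \<le> j1" "j \<le> j2" "j \<le> j3" "j \<le> j4" "j \<le> j4 + ord r" by (auto simp: j_def)
  obtain k1 where k1: "\<forall>k\<ge>k1. adequate a 0 j k" using j1 jle by blast
  obtain k2 where k2: "\<forall>k\<ge>k2. adequate (\<delta> / a) 0 j k" using j2 jle by blast
  have sub: "bdual a h e m \<subseteq> sheared r j"
  proof
    fix p assume p: "p \<in> bdual a h e m"
    define s t where "s = 2 * (a * fst p + h * snd p)" and "t = 2 * (h * fst p + e * snd p)"
    have st: "s \<in> U (d - m)" "t \<in> U (d - m)" using p by (auto simp: bdual_def s_def t_def)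
    have "2 * \<delta> * fst p = e * s - h * t"
      by (simp add: s_def t_def \<delta>_def algebra_simps power2_eq_square)
    then have "fst p = (e * s - h * t) / (2 * \<delta>)" using two d0 by (simp add: field_simps)
    then have fp: "fst p = e / (2 * \<delta>) * s - h / (2 * \<delta>) * t" by (simp add: diff_divide_distrib)
    have "2 * \<delta> * snd p = a * t - h * s"
      by (simp add: s_def t_def \<delta>_def algebra_simps power2_eq_square)
    then have "snd p = (a * t - h * s) / (2 * \<delta>)" using two d0 by (simp add: field_simps)
    then have sp: "snd p = a / (2 * \<delta>) * t - h / (2 * \<delta>) * s" by (simp add: diff_divide_distrib)
    have mul: "x * y \<in> U i" if "y \<in> U (d - m)" "i \<le> ord x + (d - m)" for x y i
      using U_mult[OF U_ord that(1)] that(2) U_monoD by blast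
    have "fst p \<in> U j3" unfolding fp by (intro U_diff mul st) (auto simp: j3_def)
    then have fpj: "fst p \<in> U j" using jle U_monoD by blast
    have sp4: "snd p \<in> U j4" unfolding sp by (intro U_diff mul st) (auto simp: j4_def)
    then have spj: "snd p \<in> U j" using jle U_monoD by blast
    have "r * snd p \<in> U (ord r + j4)" by (intro U_mult U_ord sp4)
    then have "r * snd p \<in> U j" using jle U_monoD by (metis add.commute)
    then show "p \<in> sheared r j" using fpj spj U_add by (simp add: sheared_def)
  qed
  show ?thesis
  proof (rule exI, intro allI impI)
    fix k assume k: "max (max (max k1 k2) (max m j)) (max (j - ord r) (radius a - j - ord r)) \<le> k"
    have ad: "adequate a 0 j k" "adequate (\<delta> / a) 0 j k" using k k1 k2 by auto
    have le: "m \<le> k" "j \<le> k" "j \<le> ord r + k" using k by auto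
    obtain T where T: "transversal T (U j) (U k)" using transversal_exists U_subgroup by blast
    have fT: "finite T" using U_transversal_finite[OF T] le by simp
    note TS = transversal_sheared[OF T le(3,2)]
    have inj: "inj_on (\<lambda>(x, y). (x - r * y, y)) (T \<times> T)" by (auto simp: inj_on_def)
    obtain TM where TM: "transversal TM (sheared r j) (U m \<times> U m)"
      using transversal_exists[OF add_subgroup_sheared add_subgroup_Times[OF U_subgroup U_subgroup]] by blast
    have subk: "U k \<times> U k \<subseteq> U m \<times> U m" using U_mono[OF le(1)] by blast
    have fTM: "finite TM"
      by (rule transversal_finite_coarser[OF TS _ TM add_subgroup_Times[OF U_subgroup U_subgroup] subk])
        (use fT in simp)
    have sq: "chi (binary a h e (x - r * y, y)) = chi (a * x\<^sup>2) * chi (\<delta> / a * y\<^sup>2)" for x y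
    proof -
      have "binary a h e (x - r * y, y) = a * x\<^sup>2 + \<delta> / a * y\<^sup>2"
        using a by (simp add: binary_def r_def \<delta>_def field_simps power2_eq_square)
      then show ?thesis by (simp add: chi_add)
    qed
    \<comment> \<open>Periodicity holds on the whole sheared lattice because it lies in the
      annihilator of \<open>U k \<times> U k\<close>.\<close>
    have per: "chi (binary a h e (p + u)) = chi (binary a h e p)" if p: "p \<in> sheared r j" and u: "u \<in> U k \<times> U k" for p u
    proof -
      obtain x y where xy: "p = (x - r * y, y)" "x \<in> U j" "y \<in> U j"
        using p by (intro that[of "fst p + r * snd p" "snd p"]) (auto simp: sheared_def)
      obtain u1 u2 where uu: "u = (u1, u2)" "u1 \<in> U k" "u2 \<in> U k" using u by auto
      have x1: "2 * a * x \<in> U (ord (2 * a) + j)" by (intro U_mult U_ord xy)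
      have ra: "ord (2 * a) = d - radius a" by (simp add: radius_def)
      have x2: "2 * a * x \<in> U (d - k)"
        using x1 by (rule U_monoD) (use ad(1) ra in \<open>simp add: adequate_def\<close>)
      have "r * (2 * a * x) \<in> U (ord r + (ord (2 * a) + j))" by (intro U_mult U_ord x1)
      then have x3: "r * (2 * a * x) \<in> U (d - k)" by (rule U_monoD) (use k ra in simp)
      have "y \<in> U (radius (\<delta> / a) - k)"
        using xy(3) by (rule U_monoD) (use ad(2) in \<open>simp add: adequate_def\<close>)
      then have "2 * (\<delta> / a) * y \<in> U (d - k)" using two_c_in_U[OF d0(2)] by blast
      then have "r * (2 * a * x) + 2 * (\<delta> / a) * y \<in> U (d - k)" by (rule U_add[OF x3])
      moreover have "2 * (h * fst p + e * snd p) = r * (2 * a * x) + 2 * (\<delta> / a) * y"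
        using a by (simp add: xy(1) r_def \<delta>_def field_simps power2_eq_square)
      moreover have "2 * (a * fst p + h * snd p) = 2 * a * x"
        using a by (simp add: xy(1) r_def field_simps)
      ultimately have "p \<in> bdual a h e k" using x2 by (simp add: bdual_def)
      then have "chi (bpairing a h e p u) = 1" using bpairing_trivial_iff u by blast
      moreover have "chi (binary a h e u) = 1" using m(1) subk u by blast
      ultimately show ?thesis by (simp add: binary_add chi_add)
    qed
    have sub1: "add_subgroup (U i \<times> U i)" for i by (intro add_subgroup_Times U_subgroup)
    have "tsum (sheared r j) (U k \<times> U k) (\<lambda>p. chi (binary a h e p))
      = tsum (bdual a h e m) (U k \<times> U k) (\<lambda>p. chi (binary a h e p))"
    proof (rule tsum_oscillating[OF add_subgroup_sheared add_subgroup_bdual sub1 sub1 subk m(2) sub TM fTM,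
          where \<xi>="\<lambda>p u. chi (bpairing a h e p u)"])
      fix p u u' assume p: "p \<in> sheared r j"
      show "chi (bpairing a h e p (u + u')) = chi (bpairing a h e p u) * chi (bpairing a h e p u')"
        by (simp add: bpairing_add chi_add)
      show "chi (binary a h e (p + u)) = chi (binary a h e p) * chi (bpairing a h e p u)" if "u \<in> U m \<times> U m"
      proof -
        have "chi (binary a h e u) = 1" using m(1) that by blast
        then show ?thesis by (simp add: binary_add chi_add)
      qed
      show "chi (bpairing a h e p u) = 1" if "u \<in> U k \<times> U k"
      proof -
        have "chi (binary a h e u) = 1" using m(1) subk that by blast
        then have "chi (binary a h e p) * chi (bpairing a h e p u) = chi (binary a h e p)"
          using per[OF p that] by (simp add: binary_add chi_add)
        then show ?thesis using chi_nonzero by simp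
      qed
      show "\<exists>u\<in>U m \<times> U m. chi (bpairing a h e p u) \<noteq> 1" if "p \<notin> bdual a h e m"
        using bpairing_trivial_iff that by blast
    qed
    then have "tsum (bdual a h e m) (U k \<times> U k) (\<lambda>p. chi (binary a h e p))
      = (\<Sum>p\<in>(\<lambda>(x, y). (x - r * y, y)) ` (T \<times> T). chi (binary a h e p))"
      using tsum_eq[OF TS sub1 per] by simp
    also have "\<dots> = (\<Sum>(x, y)\<in>T \<times> T. chi (a * x\<^sup>2) * chi (\<delta> / a * y\<^sup>2))"
      by (subst sum.reindex[OF inj]) (simp add: case_prod_unfold sq)
    also have "\<dots> = (\<Sum>x\<in>T. chi (a * x\<^sup>2)) * (\<Sum>y\<in>T. chi (\<delta> / a * y\<^sup>2))"
      by (simp add: sum.cartesian_product[symmetric] sum_product)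
    also have "(\<Sum>x\<in>T. chi (a * x\<^sup>2)) = tsum (U j) (U k) (\<lambda>x. chi (a * x\<^sup>2))"
      by (intro tsum_eq[OF T U_subgroup, symmetric] square_periodic[OF a ad(1)])
    also have "(\<Sum>y\<in>T. chi (\<delta> / a * y\<^sup>2)) = tsum (U j) (U k) (\<lambda>y. chi (\<delta> / a * y\<^sup>2))"
      by (intro tsum_eq[OF T U_subgroup, symmetric] square_periodic[OF d0(2) ad(2)])
    finally have fin: "qz (- k) * qz (- k) * tsum (bdual a h e m) (U k \<times> U k) (\<lambda>p. chi (binary a h e p))
      = mean j k (\<lambda>x. chi (a * x\<^sup>2)) * mean j k (\<lambda>y. chi (\<delta> / a * y\<^sup>2))"
      by (simp add: mean_def ac_simps)
    show "qz (- k) * qz (- k) * tsum (bdual a h e m) (U k \<times> U k) (\<lambda>p. chi (binary a h e p)) = G a * G ((a * e - h\<^sup>2) / a)"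
      unfolding fin \<delta>_def[symmetric] G_eq[OF a ad(1)] G_eq[OF d0(2) ad(2)] ..
  qed
qed

text \<open>Both sides evaluate the same sum over the dual lattice, with the square completed in the
  first or in the second variable; swapping the coordinates exchanges the two computations.\<close>

lemma G_binary:
  assumes "a \<noteq> 0" "e \<noteq> 0" "a * e - h\<^sup>2 \<noteq> 0"
  shows "G a * G ((a * e - h\<^sup>2) / a) = G e * G ((a * e - h\<^sup>2) / e)"
proof -
  define M where "M = \<bar>d\<bar> + \<bar>ord a\<bar> + \<bar>ord h\<bar> + \<bar>ord e\<bar> + \<bar>ord 2\<bar>"
  have M: "0 \<le> M" "\<bar>d\<bar> \<le> M" "- ord a \<le> M" "- ord h \<le> M" "- ord e \<le> M" "- ord 2 \<le> M" by (auto simp: M_def)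
  \<comment> \<open>\<open>M\<close> dominates the orders of all constants, and three times it makes
    the form trivial on \<open>U m \<times> U m\<close> and puts that lattice inside its own
    dual.\<close>
  define m where "m = 3 * M"
  have mul: "c * x \<in> U (m - M)" if "x \<in> U m" "- ord c \<le> M" for c x
    using U_mult[OF U_ord that(1), of c] U_monoD that(2) by (metis add.commute add_le_cancel_left diff_conv_add_uminus minus_le_iff)
  have mul2: "2 * x \<in> U (d - m)" if "x \<in> U (m - M)" for x
    using U_mult[OF U_ord that, of 2] by (rule U_monoD) (use M in \<open>simp add: m_def\<close>)
  have bin: "chi (binary a h e u) = 1" if u: "u \<in> U m \<times> U m" and c: "- ord a \<le> M" "- ord h \<le> M" "- ord e \<le> M" for a h e u
  proof (rule chi_U)
    have u12: "fst u \<in> U m" "snd u \<in> U m" using u by auto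
    have p: "x * y \<in> U d" if "x \<in> U (m - M)" "y \<in> U m" for x y
      using U_mult[OF that] by (rule U_monoD) (use M in \<open>simp add: m_def\<close>)
    have two': "2 * (h * fst u * snd u) \<in> U d"
    proof -
      have "h * fst u * snd u \<in> U (m - M + m)" by (rule U_mult[OF mul[OF u12(1) c(2)] u12(2)])
      then have "2 * (h * fst u * snd u) \<in> U (ord 2 + (m - M + m))" by (rule U_mult[OF U_ord])
      then show ?thesis by (rule U_monoD) (use M in \<open>simp add: m_def\<close>)
    qed
    have "a * fst u * fst u + 2 * (h * fst u * snd u) + e * snd u * snd u \<in> U d"
      by (intro U_add p mul u12 c two')
    then show "binary a h e u \<in> U d" by (simp add: binary_def power2_eq_square mult.assoc)
  qed
  have dual: "U m \<times> U m \<subseteq> bdual a h e m" if c: "- ord a \<le> M" "- ord h \<le> M" "- ord e \<le> M" for a h e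
  proof
    fix u assume "u \<in> U m \<times> U m"
    then have u12: "fst u \<in> U m" "snd u \<in> U m" by auto
    show "u \<in> bdual a h e m" unfolding bdual_def by (intro CollectI conjI mul2 U_add mul u12 c)
  qed
  have one: "\<forall>u\<in>U m \<times> U m. chi (binary a h e u) = 1" "\<forall>u\<in>U m \<times> U m. chi (binary e h a u) = 1"
    by (intro ballI bin M; assumption)+
  obtain k1 where k1: "\<forall>k\<ge>k1. qz (- k) * qz (- k) * tsum (bdual a h e m) (U k \<times> U k) (\<lambda>p. chi (binary a h e p))
    = G a * G ((a * e - h\<^sup>2) / a)"
    using tsum_binary[OF assms(1,3) one(1) dual[OF M(3,4,5)]] by blast
  have "e * a - h\<^sup>2 \<noteq> 0" using assms(3) by (simp add: mult.commute)
  then obtain k2 where k2: "\<forall>k\<ge>k2. qz (- k) * qz (- k) * tsum (bdual e h a m) (U k \<times> U k) (\<lambda>p. chi (binary e h a p))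
    = G e * G ((e * a - h\<^sup>2) / e)"
    using tsum_binary[OF assms(2) _ one(2) dual[OF M(5,4,3)]] by blast
  define k where "k = max (max k1 k2) m"
  have k: "k1 \<le> k" "k2 \<le> k" "m \<le> k" by (auto simp: k_def)
  have sw: "prod.swap ` bdual a h e m = bdual e h a m" "prod.swap ` (U k \<times> U k) = U k \<times> U k"
    by (auto simp: bdual_def image_iff algebra_simps intro!: bexI[of _ "prod.swap _"])
  have per: "chi (binary e h a (x + y)) = chi (binary e h a x)" if xy: "x \<in> bdual e h a m" "y \<in> U k \<times> U k" for x y
  proof -
    have y: "y \<in> U m \<times> U m" using xy(2) U_mono[OF k(3)] by auto
    have "chi (bpairing e h a x y) = 1" by (rule bspec[OF iffD2[OF bpairing_trivial_iff xy(1)] y])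
    moreover have "chi (binary e h a y) = 1" by (rule bspec[OF one(2) y])
    ultimately show ?thesis by (simp add: binary_add chi_add)
  qed
  have "tsum (prod.swap ` bdual a h e m) (prod.swap ` (U k \<times> U k)) (\<lambda>p. chi (binary e h a p))
    = tsum (bdual a h e m) (U k \<times> U k) (\<lambda>p. chi (binary e h a (prod.swap p)))"
  proof (rule tsum_image)
    show "prod.swap (x - y) = prod.swap x - prod.swap y" for x y :: "'f \<times> 'f" by (simp add: prod_eq_iff)
    show "inj (prod.swap :: 'f \<times> 'f \<Rightarrow> _)" by simp
    show "add_subgroup (bdual a h e m)" by (rule add_subgroup_bdual)
    show "add_subgroup (U k \<times> U k)" by (intro add_subgroup_Times U_subgroup)
    then show "add_subgroup (prod.swap ` (U k \<times> U k))" by (simp only: sw)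
    show "chi (binary e h a (x + y)) = chi (binary e h a x)"
      if "x \<in> prod.swap ` bdual a h e m" "y \<in> prod.swap ` (U k \<times> U k)" for x y
      using per that by (simp only: sw)
  qed
  also have "(\<lambda>p. chi (binary e h a (prod.swap p))) = (\<lambda>p. chi (binary a h e p))"
    by (rule ext) (simp add: binary_def algebra_simps)
  finally have "tsum (bdual e h a m) (U k \<times> U k) (\<lambda>p. chi (binary e h a p))
    = tsum (bdual a h e m) (U k \<times> U k) (\<lambda>p. chi (binary a h e p))" by (simp only: sw)
  then show ?thesis using k1[rule_format, OF k(1)] k2[rule_format, OF k(2)] by (simp add: mult.commute)
qed

subsection \<open>Weil indices\<close>

text \<open>The Weil index of \<open>c * x\<^sup>2\<close> up to a factor independent of
  \<open>c\<close>. The half-integral power makes it invariant under square factors; in exchange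
  \<open>\<gamma> c * \<gamma> (- c)\<close> is the constant \<open>qz (ord 2 - d)\<close> in place
  of 1.\<close>

definition \<gamma> :: "'f \<Rightarrow> 'r" where "\<gamma> c = G c * sz (- ord c)"

lemma \<gamma>_scale:
  assumes "a \<noteq> 0" "b \<noteq> 0" shows "\<gamma> (a * b\<^sup>2) = \<gamma> a"
proof -
  have "ord (a * b\<^sup>2) = ord a + (ord b + ord b)" using assms by (simp add: ord_mult power2_eq_square)
  then have "sz (- ord (a * b\<^sup>2)) = sz (- ord a) * sz (- ord b + - ord b)" by (simp add: sz_add[symmetric])
  also have "sz (- ord b + - ord b) = qz (- ord b)" by (rule sz_double)
  finally show ?thesis
    using G_scale[OF assms] qz_unit[of "ord b"] by (simp add: \<gamma>_def mult.assoc)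
qed

lemma \<gamma>_minus: "c \<noteq> 0 \<Longrightarrow> \<gamma> c * \<gamma> (- c) = qz (ord 2 - d)"
proof -
  assume c: "c \<noteq> 0"
  have "\<gamma> c * \<gamma> (- c) = (G c * G (- c)) * (sz (- ord c) * sz (- ord c))" by (simp add: \<gamma>_def)
  also have "sz (- ord c) * sz (- ord c) = qz (- ord c)" by (simp only: sz_add[symmetric] sz_double)
  also have "G c * G (- c) = qz (ord 2 + ord c - d)"
    using G_mult_G_minus[OF c] ord_mult[OF two c] by (simp add: radius_def)
  also have "qz (ord 2 + ord c - d) * qz (- ord c) = qz (ord 2 - d)" by (simp add: qz_add[symmetric])
  finally show ?thesis .
qed

text \<open>The isometry between the diagonal forms with entries \<open>a, b\<close> and
  \<open>c, a * b * c\<close>. The form \<open>a * (x + r * y)\<^sup>2 + b * (s * y)\<^sup>2\<close>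
  has diagonal coefficients \<open>a\<close> and \<open>c\<close> and determinant
  \<open>a * b * s\<^sup>2\<close>, so \<open>G_binary\<close> compares its two
  diagonalisations.\<close>

lemma \<gamma>_represents:
  assumes ab: "a \<noteq> 0" "b \<noteq> 0" and c: "c = a * r\<^sup>2 + b * s\<^sup>2" "c \<noteq> 0"
  shows "\<gamma> c * \<gamma> (a * b * c) = \<gamma> a * \<gamma> b"
proof (cases "s = 0")
  case True
  with c have r: "r \<noteq> 0" "c = a * r\<^sup>2" by auto
  have e: "a * b * c = b * (a * r)\<^sup>2" by (simp add: r(2) power2_eq_square)
  have "\<gamma> (a * b * c) = \<gamma> b" unfolding e by (rule \<gamma>_scale) (use ab r(1) in auto)
  moreover have "\<gamma> c = \<gamma> a" unfolding r(2) by (rule \<gamma>_scale[OF ab(1) r(1)])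
  ultimately show ?thesis by simp
next
  case False
  define \<delta> where "\<delta> = a * b * s\<^sup>2"
  have \<delta>: "a * c - (a * r)\<^sup>2 = \<delta>" "\<delta> \<noteq> 0"
    using ab False by (auto simp: \<delta>_def c(1) algebra_simps power2_eq_square)
  have G: "G a * G (\<delta> / a) = G c * G (\<delta> / c)"
    using G_binary[OF ab(1) c(2), of "a * r"] \<delta> by simp
  have o: "sz (- ord x) * sz (- ord (\<delta> / x)) = sz (- ord \<delta>)" if "x \<noteq> 0" for x
    using that \<delta>(2) by (simp add: sz_add[symmetric] ord_divide)
  have "\<gamma> a * \<gamma> (\<delta> / a) = (G a * G (\<delta> / a)) * (sz (- ord a) * sz (- ord (\<delta> / a)))" by (simp add: \<gamma>_def)
  also have "\<dots> = (G c * G (\<delta> / c)) * (sz (- ord c) * sz (- ord (\<delta> / c)))"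
    using G o[OF ab(1)] o[OF c(2)] by simp
  also have "\<dots> = \<gamma> c * \<gamma> (\<delta> / c)" by (simp add: \<gamma>_def)
  finally have eq: "\<gamma> a * \<gamma> (\<delta> / a) = \<gamma> c * \<gamma> (\<delta> / c)" .
  have "\<delta> / a = b * s\<^sup>2" using ab by (simp add: \<delta>_def)
  then have 1: "\<gamma> (\<delta> / a) = \<gamma> b" using \<gamma>_scale[OF ab(2) False] by simp
  have "\<delta> / c = (a * b * c) * (s / c)\<^sup>2" using c(2) by (simp add: \<delta>_def power2_eq_square)
  then have 2: "\<gamma> (\<delta> / c) = \<gamma> (a * b * c)" using \<gamma>_scale[of "a * b * c" "s / c"] ab c(2) False by simp
  show ?thesis using eq 1 2 by simp
qed

text \<open>\<open>\<gamma>\<close> is a character up to sign. The quotient of the two sides is the Weil index \<open>\<epsilon>\<close> of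
  the quaternion norm form \<open>\<langle>1, - a, - b, a b\<rangle>\<close>. Since twice this form is isotropic, the form
  represents some \<open>c\<close> and \<open>- c\<close>, so it is isometric to its multiples by \<open>c\<close> and \<open>- c\<close>, whose
  indices are mutually inverse.\<close>

lemma \<gamma>_mult:
  assumes a: "a \<noteq> 0" and b: "b \<noteq> 0"
  shows "(\<gamma> a * \<gamma> b)\<^sup>2 = (\<gamma> 1 * \<gamma> (a * b))\<^sup>2"
proof -
  define m where "m = qz (ord 2 - d)"
  have m: "\<gamma> c * \<gamma> (- c) = m" if "c \<noteq> 0" for c using \<gamma>_minus[OF that] by (simp add: m_def)
  have m0: "m \<noteq> 0" using qz_nonzero by (simp add: m_def)
  \<comment> \<open>The index of \<open>c\<close> times the norm form with entries
    \<open>1, - a\<close>; thus \<open>A 1 * A (- b)\<close> belongs to the quaternion norm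
    form.\<close>
  define A where "A c = \<gamma> c * \<gamma> (- c * a)" for c
  have AA: "A c * A (- c) = m\<^sup>2" if "c \<noteq> 0" for c
  proof -
    have "A c * A (- c) = (\<gamma> c * \<gamma> (- c)) * (\<gamma> (c * a) * \<gamma> (- (c * a)))" by (simp add: A_def)
    then show ?thesis using m[OF that] m[of "c * a"] that a by (simp add: power2_eq_square)
  qed
  have A_scale: "A (c * y\<^sup>2) = A c" if "c \<noteq> 0" "y \<noteq> 0" for c y
    using \<gamma>_scale[OF that] \<gamma>_scale[of "- c * a" y] that a by (simp add: A_def mult.assoc mult.left_commute mult.commute)
  \<comment> \<open>Multiplication by a nonzero norm is a similitude of the norm form.\<close>
  have A_norm: "A (x * n) = A x" if "x \<noteq> 0" "n \<noteq> 0" "n = r\<^sup>2 - a * s\<^sup>2" for x n r s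
  proof -
    have "x * n = x * r\<^sup>2 + (- x * a) * s\<^sup>2" by (simp add: that(3) algebra_simps)
    then have "\<gamma> (x * n) * \<gamma> (x * (- x * a) * (x * n)) = \<gamma> x * \<gamma> (- x * a)"
      using that a by (intro \<gamma>_represents) auto
    moreover have "x * (- x * a) * (x * n) = (- (x * n) * a) * x\<^sup>2" by (simp add: power2_eq_square)
    moreover have "\<gamma> ((- (x * n) * a) * x\<^sup>2) = \<gamma> (- (x * n) * a)"
      by (rule \<gamma>_scale) (use that(1,2) a in auto)
    ultimately show ?thesis by (simp only: A_def)
  qed
  define good where "good \<longleftrightarrow> ((A 1 * A (- b))\<^sup>2 = (m\<^sup>2)\<^sup>2)"
  \<comment> \<open>Here \<open>a\<close> is a square, the norm form is hyperbolic, and its index is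
    the constant \<open>m\<close>.\<close>
  have square: "good" if "r\<^sup>2 = a * s\<^sup>2" "\<not> (r = 0 \<and> s = 0)" for r s
  proof -
    have s: "s \<noteq> 0" "r \<noteq> 0" using that a by auto
    have "A c = m" if "c \<noteq> 0" for c
    proof -
      have "- c * a = - c * (r / s)\<^sup>2" using \<open>r\<^sup>2 = a * s\<^sup>2\<close> s by (simp add: power_divide)
      then show ?thesis using \<gamma>_scale[of "- c" "r / s"] m[OF that] s that by (simp add: A_def)
    qed
    then show ?thesis using b by (simp add: good_def power2_eq_square)
  qed
  \<comment> \<open>A value \<open>c\<close> of the quaternion norm form is a similitude factor of
    it. After \<open>1\<close> and \<open>- b\<close> are replaced by \<open>n1\<close> and
    \<open>- b * n2\<close>, the four entries are regrouped into two binary forms that represent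
    \<open>c\<close> and \<open>- a * c\<close>.\<close>
  have represents: "A 1 * A (- b) = A c * A (- b * c)"
    if ns: "\<And>r s. r\<^sup>2 = a * s\<^sup>2 \<Longrightarrow> r = 0 \<and> s = 0"
      and n: "n1 = r\<^sup>2 - a * s\<^sup>2" "n2 = t\<^sup>2 - a * u\<^sup>2" and c: "c = n1 - b * n2" "c \<noteq> 0" for n1 n2 r s t u c
  proof -
    consider "n1 = 0" | "n1 \<noteq> 0" "n2 = 0" | "n1 \<noteq> 0" "n2 \<noteq> 0" by blast
    then show ?thesis
    proof cases
      case 1
      then have n2: "n2 \<noteq> 0" "c = - b * n2" using c by auto
      have "A c = A (- b)" using A_norm[OF _ n2(1) n(2), of "- b"] b n2 by simp
      moreover have "- b * c = n2 * b\<^sup>2" by (simp add: n2(2) power2_eq_square)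
      then have "A (- b * c) = A n2" using A_scale[OF n2(1) b] by simp
      moreover have "A n2 = A 1" using A_norm[OF _ n2(1) n(2), of 1] by simp
      ultimately show ?thesis by (simp add: mult.commute)
    next
      case 2
      then have cn: "c = n1" using c by simp
      show ?thesis using A_norm[OF _ 2(1) n(1), of 1] A_norm[OF _ 2(1) n(1), of "- b"] b cn by simp
    next
      case 3
      have bn: "- b * n2 \<noteq> 0" "- a * n1 \<noteq> 0" "a * b * n2 \<noteq> 0" "- a * c \<noteq> 0" using a b 3 c(2) by auto
      have "A 1 * A (- b) = A n1 * A (- b * n2)"
        using A_norm[OF _ 3(1) n(1), of 1] A_norm[OF _ 3(2) n(2), of "- b"] b by simp
      also have "\<dots> = (\<gamma> n1 * \<gamma> (- b * n2)) * (\<gamma> (- a * n1) * \<gamma> (a * b * n2))"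
        by (simp add: A_def ac_simps)
      also have "\<gamma> n1 * \<gamma> (- b * n2) = \<gamma> c * \<gamma> (n1 * (- b * n2) * c)"
        using \<gamma>_represents[OF 3(1) bn(1) _ c(2), of 1 1] c(1) by simp
      also have "\<gamma> (- a * n1) * \<gamma> (a * b * n2) = \<gamma> (- a * c) * \<gamma> ((- a * n1) * (a * b * n2) * (- a * c))"
      proof -
        have "n1 = c + b * n2" using c(1) by simp
        then have e: "- a * c = - a * n1 * 1\<^sup>2 + a * b * n2 * 1\<^sup>2" by (simp only: power_one) (simp add: algebra_simps)
        show ?thesis by (rule \<gamma>_represents[OF bn(2,3) e bn(4), symmetric])
      qed
      also have "(- a * n1) * (a * b * n2) * (- a * c) = (a * b * c * n1 * n2) * a\<^sup>2"
        by (simp add: power2_eq_square ac_simps)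
      also have "\<gamma> ((a * b * c * n1 * n2) * a\<^sup>2) = \<gamma> (a * b * c * n1 * n2)"
        using a b c(2) 3 by (intro \<gamma>_scale) auto
      also have "(\<gamma> c * \<gamma> (n1 * (- b * n2) * c)) * (\<gamma> (- a * c) * \<gamma> (a * b * c * n1 * n2))
        = A c * A ((- b * c * n1) * n2)" by (simp add: A_def ac_simps)
      also have "A ((- b * c * n1) * n2) = A ((- b * c) * n1)"
        using b c(2) 3 by (intro A_norm[OF _ 3(2) n(2)]) auto
      also have "A ((- b * c) * n1) = A (- b * c)"
        using b c(2) by (intro A_norm[OF _ 3(1) n(1)]) auto
      finally show ?thesis .
    qed
  qed
  have "good"
  proof (cases "\<exists>r s. r\<^sup>2 = a * s\<^sup>2 \<and> \<not> (r = 0 \<and> s = 0)")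
    case True then show ?thesis using square by blast
  next
    case False
    then have ns: "r = 0 \<and> s = 0" if "r\<^sup>2 = a * s\<^sup>2" for r s using that by blast
    \<comment> \<open>If the quaternion form itself is isotropic, then \<open>b\<close> is a
      quotient of norms, so \<open>A (- b) = A (- 1)\<close>.\<close>
    have degenerate: "good" if "\<not> (r = 0 \<and> s = 0 \<and> t = 0 \<and> u = 0)" "(r\<^sup>2 - a * s\<^sup>2) - b * (t\<^sup>2 - a * u\<^sup>2) = 0" for r s t u
    proof -
      define n1 n2 where "n1 = r\<^sup>2 - a * s\<^sup>2" and "n2 = t\<^sup>2 - a * u\<^sup>2"
      have e: "n1 = b * n2" using that(2) by (simp add: n1_def n2_def)
      have n2: "n2 \<noteq> 0"
      proof
        assume "n2 = 0"
        then have "r\<^sup>2 = a * s\<^sup>2" "t\<^sup>2 = a * u\<^sup>2" using e by (simp_all add: n1_def n2_def)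
        then show False using ns that(1) by blast
      qed
      then have n1: "n1 \<noteq> 0" using e b by simp
      have "A (- b) = A (- b * n2)" using A_norm[OF _ n2 n2_def, of "- b"] b by simp
      also have "- b * n2 = - 1 * n1" using e by simp
      also have "A (- 1 * n1) = A (- 1)" by (rule A_norm[OF _ n1 n1_def]) simp
      finally show ?thesis using AA[of 1] by (simp add: good_def)
    qed
    obtain r s t u r' s' t' u' where
      nz: "\<not> (r = 0 \<and> s = 0 \<and> t = 0 \<and> u = 0 \<and> r' = 0 \<and> s' = 0 \<and> t' = 0 \<and> u' = 0)" and
      sum: "(r\<^sup>2 - a * s\<^sup>2) - b * (t\<^sup>2 - a * u\<^sup>2) + ((r'\<^sup>2 - a * s'\<^sup>2) - b * (t'\<^sup>2 - a * u'\<^sup>2)) = 0"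
      using quaternion_form_isotropic[OF two a b] by blast
    \<comment> \<open>The isotropic vector of the double form shows that the quaternion form takes
      the values \<open>c\<close> and \<open>- c\<close>.\<close>
    define c where "c = (r\<^sup>2 - a * s\<^sup>2) - b * (t\<^sup>2 - a * u\<^sup>2)"
    have c': "- c = (r'\<^sup>2 - a * s'\<^sup>2) - b * (t'\<^sup>2 - a * u'\<^sup>2)"
      using sum unfolding c_def[symmetric] by (metis minus_unique)
    show ?thesis
    proof (cases "c = 0")
      case True
      then show ?thesis using degenerate[of r s t u] degenerate[of r' s' t' u'] nz c_def c' by auto
    next
      case False
      have 1: "A 1 * A (- b) = A c * A (- b * c)" by (rule represents[OF ns refl refl c_def False])
      have c0: "- c \<noteq> 0" by (rule notI) (use False in \<open>simp only: neg_equal_0_iff_equal\<close>)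
      have 2: "A 1 * A (- b) = A (- c) * A (- b * - c)" by (rule represents[OF ns refl refl c' c0])
      have "(A 1 * A (- b))\<^sup>2 = (A c * A (- c)) * (A (b * c) * A (- (b * c)))"
        unfolding power2_eq_square by (subst (2) 2, subst 1) (simp add: ac_simps)
      then show ?thesis using AA[OF False] AA[of "b * c"] b False by (simp add: good_def power2_eq_square)
    qed
  qed
  then have "(A 1 * A (- b))\<^sup>2 = (m\<^sup>2)\<^sup>2" by (simp add: good_def)
  moreover have "(\<gamma> a * \<gamma> b) * (A 1 * A (- b)) = (\<gamma> 1 * \<gamma> (a * b)) * m\<^sup>2"
  proof -
    have "(\<gamma> a * \<gamma> b) * (A 1 * A (- b)) = (\<gamma> 1 * \<gamma> (a * b)) * ((\<gamma> a * \<gamma> (- a)) * (\<gamma> b * \<gamma> (- b)))"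
      by (simp add: A_def ac_simps)
    then show ?thesis using m[OF a] m[OF b] by (simp add: power2_eq_square)
  qed
  then have "(\<gamma> a * \<gamma> b)\<^sup>2 * (A 1 * A (- b))\<^sup>2 = (\<gamma> 1 * \<gamma> (a * b))\<^sup>2 * (m\<^sup>2)\<^sup>2"
    by (simp only: power_mult_distrib[symmetric])
  ultimately show ?thesis using m0 by simp
qed

text \<open>The half-integral powers of \<open>q\<close> relating \<open>G\<close> to
  \<open>\<gamma>\<close> agree on the two sides. This is the form in which the multiplicativity
  enters \<open>Rel_mult\<close>.\<close>

lemma G_mult:
  assumes "a \<noteq> 0" "b \<noteq> 0"
  shows "(G a * G b)\<^sup>2 = (G 1 * G (a * b))\<^sup>2"
proof -
  have G: "G c = \<gamma> c * sz (ord c)" for c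
    using sz_unit[of "ord c"] by (simp add: \<gamma>_def mult.assoc mult.commute[of "sz (ord c)"])
  have "G a * G b = (\<gamma> a * \<gamma> b) * sz (ord a + ord b)" by (simp add: G sz_add ac_simps)
  moreover have "G 1 * G (a * b) = (\<gamma> 1 * \<gamma> (a * b)) * sz (ord a + ord b)"
    using assms by (simp add: G ord_mult ac_simps)
  ultimately show ?thesis using \<gamma>_mult[OF assms] by (simp add: power_mult_distrib)
qed

end

section \<open>Schwartz functions\<close>

locale weil = gauss_sums v chi iq sq + finite_dimensional_vector_space smul Basis
  for v :: "'f::field \<Rightarrow> real" and chi :: "'f \<Rightarrow> 'r::idom" and iq sq
    and smul :: "'f \<Rightarrow> 'x::ab_group_add \<Rightarrow> 'x" and Basis
begin

text \<open>The basis chosen in \<open>X_topology\<close>, so that the coordinates \<open>co\<close>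
  are those defining the topology.\<close>

definition E :: "'x set" where "E = extend_basis {}"

lemma E_independent: "independent E" and E_span: "span E = UNIV" and E_finite: "finite E"
proof -
  have "independent {}" by (rule independent_empty)
  then show "independent E" "span E = UNIV" unfolding E_def by (rule independent_extend_basis, rule span_extend_basis)
  then show "finite E" using finiteI_independent by blast
qed

definition co :: "'x \<Rightarrow> 'x \<Rightarrow> 'f" where "co b x = representation E x b"

lemma co_add: "co b (x + y) = co b x + co b y" and co_smul: "co b (smul a x) = a * co b x"
  and co_minus: "co b (- x) = - co b x"
  unfolding co_def using E_independent E_span
  by (simp_all add: representation_add representation_scale representation_neg)

lemma co_0 [simp]: "co b 0 = 0"
  by (simp add: co_def representation_zero)

lemma co_diff: "co b (x - y) = co b x - co b y"
  using co_add[of b x "- y"] by (simp add: co_minus)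

lemma co_sum: "co b (\<Sum>i\<in>I. f i) = (\<Sum>i\<in>I. co b (f i))"
  by (induction I rule: infinite_finite_induct) (auto simp: co_add)

lemma co_basis: "b' \<in> E \<Longrightarrow> co b b' = (if b = b' then 1 else 0)"
  unfolding co_def using representation_basis[OF E_independent] by auto

lemma co_expand: "(\<Sum>b\<in>E. smul (co b x) b) = x"
  unfolding co_def by (rule sum_representation_eq[OF E_independent]) (use E_span E_finite in auto)

lemma co_combination: "b \<in> E \<Longrightarrow> co b (\<Sum>c\<in>E. smul (g c) c) = g b"
proof -
  assume b: "b \<in> E"
  have "co b (\<Sum>c\<in>E. smul (g c) c) = (\<Sum>c\<in>E. if c = b then g c else 0)"
    unfolding co_sum by (intro sum.cong) (auto simp: co_smul co_basis)
  also have "\<dots> = g b" using E_finite b by simp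
  finally show ?thesis .
qed

lemma co_eqI: "(\<And>b. b \<in> E \<Longrightarrow> co b x = co b y) \<Longrightarrow> x = y"
  using co_expand[of x] co_expand[of y] by (metis (no_types, lifting) sum.cong)

text \<open>The standard lattices. They form a base of neighbourhoods of 0 and exhaust the
  space.\<close>

definition L :: "int \<Rightarrow> 'x set" where "L k = {x. \<forall>b\<in>E. co b x \<in> U k}"

lemma L_subgroup: "add_subgroup (L k)"
  by (auto simp: add_subgroup_def L_def U_0 co_diff intro: U_diff)

lemmas L_0 = add_subgroup_0[OF L_subgroup]
  and L_add = add_subgroup_add[OF L_subgroup]
  and L_diff = add_subgroup_diff[OF L_subgroup]
  and L_minus = add_subgroup_minus[OF L_subgroup]

lemma L_mono: "j \<le> k \<Longrightarrow> L k \<subseteq> L j"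
  using U_mono[of j k] by (auto simp: L_def)

lemma L_monoD: "x \<in> L k \<Longrightarrow> j \<le> k \<Longrightarrow> x \<in> L j"
  using L_mono by blast

lemma L_smul: "s \<in> U i \<Longrightarrow> x \<in> L k \<Longrightarrow> smul s x \<in> L (i + k)"
  by (auto simp: L_def co_smul intro: U_mult)

text \<open>Each property is assumed for all sufficiently small indices, so the minimum of finitely
  many bounds serves everywhere.\<close>

lemma common_bound:
  assumes "finite I" "\<And>i. i \<in> I \<Longrightarrow> \<exists>k::int. \<forall>j\<le>k. P i j"
  obtains k where "\<And>i. i \<in> I \<Longrightarrow> P i k"
proof -
  have "\<exists>k. \<forall>i\<in>I. \<forall>j\<le>k. P i j"
    using assms
  proof (induction I)
    case (insert i I)
    then obtain k1 where k1: "\<forall>i\<in>I. \<forall>j\<le>k1. P i j" by blast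
    obtain k2 where k2: "\<forall>j\<le>k2. P i j" using insert.prems by blast
    show ?case by (rule exI[of _ "min k1 k2"]) (use k1 k2 in auto)
  qed simp
  then show ?thesis using that by blast
qed

lemma U_below: "\<exists>k. \<forall>j\<le>k. x \<in> U j"
  by (rule exI[of _ "ord x"], intro allI impI, rule U_monoD[OF U_ord])

lemma L_exists: "\<exists>k. x \<in> L k"
proof -
  obtain k where "\<And>b. b \<in> E \<Longrightarrow> co b x \<in> U k"
    using common_bound[OF E_finite, of "\<lambda>b k. co b x \<in> U k"] U_below by blast
  then show ?thesis by (auto simp: L_def)
qed

section \<open>Linear and symmetric bilinear forms, and their continuity\<close>

definition bilin :: "('x \<Rightarrow> 'x \<Rightarrow> 'f) \<Rightarrow> bool" where
  "bilin \<beta> \<longleftrightarrow> (\<forall>x y z. \<beta> (x + y) z = \<beta> x z + \<beta> y z) \<and> (\<forall>a x z. \<beta> (smul a x) z = a * \<beta> x z)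
     \<and> (\<forall>x y. \<beta> x y = \<beta> y x)"

lemma dual_iff: "x' \<in> dual_space smul \<longleftrightarrow> (\<forall>x y. x' (x + y) = x' x + x' y) \<and> (\<forall>a x. x' (smul a x) = a * x' x)"
proof -
  have "vector_space ((*) :: 'f \<Rightarrow> 'f \<Rightarrow> 'f)" by unfold_locales (auto simp: algebra_simps)
  then show ?thesis
    unfolding dual_space_def mem_Collect_eq Vector_Spaces.linear_iff using vector_space_axioms by blast
qed

lemma dual_add: "x' \<in> dual_space smul \<Longrightarrow> x' (x + y) = x' x + x' y"
  and dual_smul: "x' \<in> dual_space smul \<Longrightarrow> x' (smul a x) = a * x' x"
  by (auto simp: dual_iff)

lemma dual_0: "x' \<in> dual_space smul \<Longrightarrow> x' 0 = 0"
  using dual_smul[of x' 0 0] by simp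

lemma dual_minus: "x' \<in> dual_space smul \<Longrightarrow> x' (- x) = - x' x"
  using dual_add[of x' x "- x"] dual_0[of x'] by (simp add: eq_neg_iff_add_eq_0 add.commute)

lemma dual_diff: "x' \<in> dual_space smul \<Longrightarrow> x' (x - y) = x' x - x' y"
  using dual_add[of x' x "- y"] dual_minus[of x' y] by simp

lemma co_dual: "co b \<in> dual_space smul"
  by (simp add: dual_iff co_add co_smul)

lemma bilin_dual: "bilin \<beta> \<Longrightarrow> \<beta> x \<in> dual_space smul"
  unfolding dual_iff bilin_def by metis

lemma bilin_sym: "bilin \<beta> \<Longrightarrow> \<beta> x y = \<beta> y x"
  by (simp add: bilin_def)

lemma bilin_sym_dual: "bilin \<beta> \<Longrightarrow> (\<lambda>x. \<beta> x y) \<in> dual_space smul"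
  unfolding dual_iff bilin_def by metis

lemma dual_sum: "x' \<in> dual_space smul \<Longrightarrow> x' (\<Sum>i\<in>I. f i) = (\<Sum>i\<in>I. x' (f i))"
  by (induction I rule: infinite_finite_induct) (auto simp: dual_add dual_0)

lemma sum_in_U: "(\<And>i. i \<in> I \<Longrightarrow> f i \<in> U k) \<Longrightarrow> sum f I \<in> U k"
  by (induction I rule: infinite_finite_induct) (auto simp: U_0 intro: U_add)

lemma dual_bound:
  assumes "x' \<in> dual_space smul" shows "\<exists>B. \<forall>k. \<forall>x\<in>L k. x' x \<in> U (k + B)"
proof -
  obtain B where B: "\<And>b. b \<in> E \<Longrightarrow> x' b \<in> U B"
    using common_bound[OF E_finite, of "\<lambda>b k. x' b \<in> U k"] U_below by blast
  have "x' x \<in> U (k + B)" if "x \<in> L k" for k x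
  proof -
    have "x' x = (\<Sum>b\<in>E. co b x * x' b)"
      using dual_sum[OF assms, of "\<lambda>b. smul (co b x) b" E] by (simp add: co_expand dual_smul[OF assms])
    also have "\<dots> \<in> U (k + B)" using that B by (intro sum_in_U U_mult) (auto simp: L_def)
    finally show ?thesis .
  qed
  then show ?thesis by blast
qed

lemma bilin_bound:
  assumes "bilin \<beta>" shows "\<exists>B. \<forall>i k. \<forall>x\<in>L i. \<forall>y\<in>L k. \<beta> x y \<in> U (i + k + B)"
proof -
  have "\<exists>B. \<forall>j\<le>B. \<forall>k. \<forall>y\<in>L k. \<beta> b y \<in> U (k + j)" for b
  proof -
    obtain B where "\<forall>k. \<forall>y\<in>L k. \<beta> b y \<in> U (k + B)" using dual_bound[OF bilin_dual[OF assms]] by blast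
    then have "\<forall>k. \<forall>y\<in>L k. \<beta> b y \<in> U (k + j)" if "j \<le> B" for j
      using U_mono[of "_ + j" "_ + B"] that by (meson add_left_mono subsetD)
    then show ?thesis by blast
  qed
  then obtain B where B: "\<And>b. b \<in> E \<Longrightarrow> \<forall>k. \<forall>y\<in>L k. \<beta> b y \<in> U (k + B)"
    using common_bound[OF E_finite, of "\<lambda>b B. \<forall>k. \<forall>y\<in>L k. \<beta> b y \<in> U (k + B)"] by blast
  have "\<beta> x y \<in> U (i + k + B)" if "x \<in> L i" "y \<in> L k" for i k x y
  proof -
    have "\<beta> x y = (\<Sum>b\<in>E. co b x * \<beta> b y)"
      using dual_sum[OF bilin_sym_dual[OF assms, of y], of "\<lambda>b. smul (co b x) b" E]
      by (simp add: co_expand dual_smul[OF bilin_sym_dual[OF assms, of y]])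
    also have "\<dots> \<in> U (i + (k + B))" using that B by (intro sum_in_U U_mult) (auto simp: L_def)
    finally show ?thesis by (simp add: add.assoc)
  qed
  then show ?thesis by blast
qed

text \<open>Periodicity under \<open>L k\<close> and support in \<open>L j\<close>, a lattice
  description of Schwartz functions that the topology enters only through
  \<open>Schwartz_iff\<close>.\<close>

definition test :: "int \<Rightarrow> int \<Rightarrow> ('x \<Rightarrow> 'r) \<Rightarrow> bool" where
  "test j k \<Phi> \<longleftrightarrow> (\<forall>x. \<forall>u\<in>L k. \<Phi> (x + u) = \<Phi> x) \<and> (\<forall>x. x \<notin> L j \<longrightarrow> \<Phi> x = 0)"

lemma test_mono: "test j k \<Phi> \<Longrightarrow> j' \<le> j \<Longrightarrow> k \<le> k' \<Longrightarrow> test j' k' \<Phi>"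
  unfolding test_def using L_mono[of j' j] L_mono[of k k'] by blast

subsection \<open>The topology of \<open>X\<close>\<close>

definition coords :: "'x \<Rightarrow> 'x \<Rightarrow> 'f" where "coords x = (\<lambda>b\<in>E. representation E x b)"

lemma coords_apply: "b \<in> E \<Longrightarrow> coords x b = co b x"
  by (simp add: coords_def co_def)

lemma coords_surj:
  assumes "g \<in> extensional E" shows "coords (\<Sum>b\<in>E. smul (g b) b) = g"
proof
  fix b show "coords (\<Sum>b\<in>E. smul (g b) b) b = g b"
  proof (cases "b \<in> E")
    case True
    then show ?thesis by (simp add: coords_apply co_combination)
  next
    case False
    then show ?thesis using assms by (simp add: coords_def extensional_def)
  qed
qed

lemma coords_inj: "coords x = coords y \<Longrightarrow> x = y"
  by (rule co_eqI) (metis coords_apply)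

abbreviation "XT \<equiv> X_topology v smul"
abbreviation "PT \<equiv> product_topology (\<lambda>_. field_topology v) E"

lemma XT_eq: "XT = pullback_topology UNIV coords PT"
  by (simp add: X_topology_def Let_def E_def coords_def[abs_def])

lemma topspace_field [simp]: "topspace (field_topology v) = UNIV"
  by (simp add: field_topology_eq)

lemma topspace_PT: "topspace PT = extensional E"
  by (simp add: PiE_UNIV_domain PiE_def)

lemma topspace_XT [simp]: "topspace XT = UNIV"
  unfolding XT_eq topspace_pullback_topology topspace_PT by (auto simp: coords_def)

lemma open_field_U: "openin (field_topology v) S \<Longrightarrow> s \<in> S \<Longrightarrow> \<exists>k. \<forall>u\<in>U k. s + u \<in> S"
proof -
  assume "openin (field_topology v) S" "s \<in> S"
  then obtain r where r: "r > 0" "\<And>y. v (s - y) < r \<Longrightarrow> y \<in> S" unfolding openin_field_iff by blast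
  obtain k where "v \<pi> powi k < r" using powi_v_\<pi>_small[OF r(1)] by blast
  then have "\<forall>u\<in>U k. s + u \<in> S" using r(2) by (auto simp: U_def)
  then show ?thesis ..
qed

lemma open_U_coset: "openin (field_topology v) {t. t - s \<in> U k}"
  unfolding openin_field_iff
proof
  fix x assume x: "x \<in> {t. t - s \<in> U k}"
  have "y \<in> {t. t - s \<in> U k}" if "v (x - y) < v \<pi> powi k" for y
  proof -
    have "x - y \<in> U k" using that by (simp add: U_def)
    then have "(x - s) - (x - y) \<in> U k" using x U_diff by blast
    then show ?thesis by simp
  qed
  then show "\<exists>r>0. \<forall>y. v (x - y) < r \<longrightarrow> y \<in> {t. t - s \<in> U k}" using powi_v_\<pi>_pos[of k] by blast
qed

lemma openin_XT_iff: "openin XT S \<longleftrightarrow> (\<forall>x\<in>S. \<exists>k. \<forall>u\<in>L k. x + u \<in> S)"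
proof
  assume "openin XT S"
  then obtain W where W: "openin PT W" "S = coords -` W" unfolding XT_eq openin_pullback_topology by auto
  show "\<forall>x\<in>S. \<exists>k. \<forall>u\<in>L k. x + u \<in> S"
  proof
    fix x assume "x \<in> S"
    then have "coords x \<in> W" using W(2) by simp
    then obtain V where V: "\<forall>b\<in>E. openin (field_topology v) (V b)" "coords x \<in> PiE E V" "PiE E V \<subseteq> W"
      using W(1) unfolding openin_product_topology_alt by blast
    \<comment> \<open>The sign turns a condition on all fine lattices into one on all small indices,
      as \<open>common_bound\<close> requires.\<close>
    have "\<exists>k. \<forall>j\<le>k. \<forall>u\<in>U (- j). co b x + u \<in> V b" if b: "b \<in> E" for b
    proof -
      have "co b x \<in> V b" using PiE_mem[OF V(2) b] coords_apply[OF b] by simp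
      then obtain k where k: "\<forall>u\<in>U k. co b x + u \<in> V b" using open_field_U V(1) b by blast
      show ?thesis by (rule exI[of _ "- k"]) (use k U_monoD[of _ _ k] in auto)
    qed
    then obtain k where k: "\<And>b. b \<in> E \<Longrightarrow> \<forall>u\<in>U (- k). co b x + u \<in> V b"
      using common_bound[OF E_finite, of "\<lambda>b j. \<forall>u\<in>U (- j). co b x + u \<in> V b"] by blast
    have "x + u \<in> S" if u: "u \<in> L (- k)" for u
    proof -
      have "coords (x + u) \<in> PiE E V"
      proof (rule PiE_I)
        fix b assume b: "b \<in> E"
        then show "coords (x + u) b \<in> V b" using k[OF b] u by (simp add: coords_apply co_add L_def)
      qed (simp add: coords_def)
      then show ?thesis using V(3) W(2) by auto
    qed
    then show "\<exists>k. \<forall>u\<in>L k. x + u \<in> S" by blast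
  qed
next
  assume S: "\<forall>x\<in>S. \<exists>k. \<forall>u\<in>L k. x + u \<in> S"
  have "openin PT (coords ` S)"
    unfolding openin_product_topology_alt
  proof
    fix w assume "w \<in> coords ` S"
    then obtain x where x: "x \<in> S" "w = coords x" by blast
    obtain k where k: "\<forall>u\<in>L k. x + u \<in> S" using S x(1) by blast
    define V where "V b = {t. t - co b x \<in> U k}" for b
    have "PiE E V \<subseteq> coords ` S"
    proof
      fix g assume g: "g \<in> PiE E V"
      define y where "y = (\<Sum>b\<in>E. smul (g b) b)"
      have y: "coords y = g" unfolding y_def by (rule coords_surj) (use g in \<open>auto simp: PiE_def\<close>)
      have "y - x \<in> L k"
        unfolding L_def using PiE_mem[OF g] by (auto simp: V_def co_diff y_def co_combination)
      then have "x + (y - x) \<in> S" using k by blast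
      then have "y \<in> S" by simp
      then show "g \<in> coords ` S" using y by blast
    qed
    moreover have "w \<in> PiE E V" using x(2) by (auto simp: V_def coords_apply U_0 coords_def co_def)
    moreover have "finite {i \<in> E. V i \<noteq> topspace (field_topology v)}" using E_finite by simp
    moreover have "\<forall>b\<in>E. openin (field_topology v) (V b)" using open_U_coset by (simp add: V_def)
    ultimately show "\<exists>U. finite {i \<in> E. U i \<noteq> topspace (field_topology v)} \<and> (\<forall>i\<in>E. openin (field_topology v) (U i)) \<and> w \<in> Pi\<^sub>E E U \<and> Pi\<^sub>E E U \<subseteq> coords ` S"
      by blast
  qed
  moreover have "S = coords -` (coords ` S) \<inter> UNIV" using coords_inj by auto
  ultimately show "openin XT S" unfolding XT_eq openin_pullback_topology by blast
qed

lemma open_L_coset: "openin XT {y. y - x \<in> L k}"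
  unfolding openin_XT_iff using L_add by (metis (no_types, lifting) add_diff_eq diff_add_eq mem_Collect_eq)

lemma compact_U: "compactin (field_topology v) (U k)"
  unfolding field_topology_eq M.compactin_sequentially
proof (intro conjI allI impI)
  fix \<sigma> :: "nat \<Rightarrow> 'f" assume \<sigma>: "range \<sigma> \<subseteq> U k"
  then have "v (\<sigma> n) \<le> v \<pi> powi k" for n by (auto simp: U_def)
  then obtain l r where lr: "v l \<le> v \<pi> powi k" "strict_mono (r::nat\<Rightarrow>nat)" "\<forall>e>0. \<exists>N. \<forall>n\<ge>N. v (\<sigma> (r n) - l) < e"
    using bounded_subsequence by blast
  have "limitin M.mtopology (\<sigma> \<circ> r) l sequentially"
    using lr(3) unfolding M.limitin_metric eventually_sequentially by auto
  then show "\<exists>l r. l \<in> U k \<and> strict_mono r \<and> limitin M.mtopology (\<sigma> \<circ> r) l sequentially"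
    using lr by (auto simp: U_def)
qed simp

text \<open>In coordinates the lattice is a finite product of compact balls.\<close>

lemma compact_L: "compactin XT (L k)"
proof -
  define g where "g h = (\<Sum>b\<in>E. smul (h b) b)" for h :: "'x \<Rightarrow> 'f"
  have "continuous_map PT PT (coords \<circ> g)"
    by (rule continuous_map_eq[OF continuous_map_id]) (auto simp: g_def coords_surj PiE_def)
  then have "continuous_map PT XT g" unfolding XT_eq by (rule continuous_map_pullback') auto
  moreover have "compactin PT (PiE E (\<lambda>_. U k))"
    unfolding compactin_PiE using compact_U by blast
  ultimately have "compactin XT (g ` PiE E (\<lambda>_. U k))" using image_compactin by blast
  moreover have "g ` PiE E (\<lambda>_. U k) = L k"
  proof
    show "g ` PiE E (\<lambda>_. U k) \<subseteq> L k" by (auto simp: L_def g_def co_combination PiE_mem)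
    show "L k \<subseteq> g ` PiE E (\<lambda>_. U k)"
    proof
      fix x assume x: "x \<in> L k"
      have "coords x \<in> PiE E (\<lambda>_. U k)" using x by (auto simp: L_def coords_apply coords_def co_def)
      moreover have "g (coords x) = x"
        using co_expand[of x] by (simp add: g_def coords_apply cong: sum.cong)
      ultimately show "x \<in> g ` PiE E (\<lambda>_. U k)" by (metis imageI)
    qed
  qed
  ultimately show ?thesis by simp
qed

lemma compactin_XT_subset_L:
  assumes "compactin XT K" shows "\<exists>j. K \<subseteq> L j"
proof -
  have op: "openin XT (L j)" for j using open_L_coset[of 0 j] by simp
  have "K \<subseteq> \<Union> (range L)" using L_exists by blast
  moreover have "\<forall>W\<in>range L. openin XT W" using op by blast
  ultimately obtain \<F> where F: "finite \<F>" "\<F> \<subseteq> range L" "K \<subseteq> \<Union> \<F>"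
    using assms unfolding compactin_def by meson
  obtain C where C: "finite C" "\<F> = L ` C" using finite_subset_image[OF F(1,2)] by blast
  obtain j where j: "\<forall>k\<in>C. j \<le> k"
  proof (cases "C = {}")
    case False
    then show ?thesis using that[of "Min C"] C(1) by simp
  qed simp
  have "K \<subseteq> L j"
  proof
    fix x assume "x \<in> K"
    then obtain k where "k \<in> C" "x \<in> L k" using F(3) C(2) by blast
    then show "x \<in> L j" using j L_monoD by blast
  qed
  then show ?thesis ..
qed

text \<open>Compactness of the support makes both bounds uniform: finitely many cosets on which the
  function is constant cover the support, the finest of their lattices is a period, and the
  exhausting lattices bound the support. Conversely the lattices are open and compact.\<close>

lemma Schwartz_iff: "\<Phi> \<in> Schwartz v smul \<longleftrightarrow> (\<exists>j k. test j k \<Phi>)"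
proof
  assume S: "\<Phi> \<in> Schwartz v smul"
  define K where "K = XT closure_of {x. \<Phi> x \<noteq> 0}"
  have K: "compactin XT K" using S by (simp add: Schwartz_def K_def)
  have supp: "\<Phi> x = 0" if "x \<notin> K" for x
    using that closure_of_subset[of "{x. \<Phi> x \<noteq> 0}" XT] by (auto simp: K_def)
  have "\<exists>k. \<forall>u\<in>L k. \<Phi> (x + u) = \<Phi> x" for x
  proof -
    obtain W where W: "openin XT W" "x \<in> W" "\<forall>y\<in>W. \<Phi> y = \<Phi> x"
      using S unfolding Schwartz_def locally_constant_def by auto
    then obtain k where "\<forall>u\<in>L k. x + u \<in> W" unfolding openin_XT_iff by blast
    then show ?thesis using W(3) by blast
  qed
  then obtain n where n: "\<And>x u. u \<in> L (n x) \<Longrightarrow> \<Phi> (x + u) = \<Phi> x" by metis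
  define N where "N x = {y. y - x \<in> L (n x)}" for x
  have "K \<subseteq> \<Union> (N ` K)" using L_0 by (auto simp: N_def)
  moreover have "\<forall>W\<in>N ` K. openin XT W" using open_L_coset by (auto simp: N_def)
  ultimately obtain \<F> where F: "finite \<F>" "\<F> \<subseteq> N ` K" "K \<subseteq> \<Union> \<F>"
    using K unfolding compactin_def by meson
  obtain C where C: "finite C" "\<F> = N ` C" using finite_subset_image[OF F(1,2)] by blast
  obtain k where k: "\<forall>x\<in>C. n x \<le> k"
  proof (cases "C = {}")
    case False
    then show ?thesis using that[of "Max (n ` C)"] C(1) by simp
  qed simp
  have perK: "\<Phi> (y + u) = \<Phi> y" if yu: "y \<in> K" "u \<in> L k" for y u
  proof -
    have "y \<in> \<Union> (N ` C)" using yu(1) F(3) C(2) by blast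
    then obtain x where x: "x \<in> C" "y - x \<in> L (n x)" by (auto simp: N_def)
    have "u \<in> L (n x)" using L_monoD[OF yu(2)] k x(1) by blast
    then have "y - x + u \<in> L (n x)" using L_add x(2) by blast
    then show ?thesis using n[OF x(2)] n[of "y - x + u" x] by (simp add: add.assoc[symmetric])
  qed
  \<comment> \<open>A point outside the support can be moved into it by \<open>u\<close>; then
    periodicity is applied to \<open>- u\<close>.\<close>
  have per: "\<Phi> (y + u) = \<Phi> y" if "u \<in> L k" for y u
  proof -
    consider "y \<in> K" | "y + u \<in> K" | "y \<notin> K" "y + u \<notin> K" by blast
    then show ?thesis
    proof cases
      case 1 then show ?thesis using perK that by blast
    next
      case 2 then show ?thesis using perK[OF 2 L_minus[OF that]] by simp
    next
      case 3 then show ?thesis using supp by simp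
    qed
  qed
  obtain j where "K \<subseteq> L j" using compactin_XT_subset_L[OF K] by blast
  then have "\<Phi> x = 0" if "x \<notin> L j" for x using that supp by blast
  then have "test j k \<Phi>" using per unfolding test_def by blast
  then show "\<exists>j k. test j k \<Phi>" by blast
next
  assume "\<exists>j k. test j k \<Phi>"
  then obtain j k where jk: "test j k \<Phi>" by blast
  have "locally_constant XT \<Phi>"
    unfolding locally_constant_def
  proof
    fix x
    have "\<Phi> y = \<Phi> x" if "y - x \<in> L k" for y
    proof -
      have "\<Phi> (x + (y - x)) = \<Phi> x" using jk that unfolding test_def by blast
      then show ?thesis by simp
    qed
    note const = this
    show "\<exists>U. openin XT U \<and> x \<in> U \<and> (\<forall>y\<in>U. \<Phi> y = \<Phi> x)"
    proof (intro exI conjI ballI)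
      show "openin XT {y. y - x \<in> L k}" by (rule open_L_coset)
      show "x \<in> {y. y - x \<in> L k}" using L_0[of k] by simp
      show "\<Phi> y = \<Phi> x" if "y \<in> {y. y - x \<in> L k}" for y using const that by simp
    qed
  qed
  moreover have "compactin XT (XT closure_of {x. \<Phi> x \<noteq> 0})"
  proof (rule closed_compactin[OF compact_L])
    have "openin XT (- L j)"
      unfolding openin_XT_iff
    proof (intro ballI exI)
      fix x u assume "x \<in> - L j" "u \<in> L j"
      then show "x + u \<in> - L j" using L_diff[of "x + u" j u] by auto
    qed
    then have "closedin XT (L j)" by (simp add: closedin_def Compl_eq_Diff_UNIV)
    moreover have "{x. \<Phi> x \<noteq> 0} \<subseteq> L j" using jk by (auto simp: test_def)
    ultimately show "XT closure_of {x. \<Phi> x \<noteq> 0} \<subseteq> L j" by (rule closure_of_minimal[rotated])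
  qed simp
  ultimately show "\<Phi> \<in> Schwartz v smul" by (simp add: Schwartz_def)
qed

subsection \<open>The Haar integral\<close>

lemma L_transversal:
  assumes "j \<le> k"
  shows "\<exists>T. transversal T (L j) (L k) \<and> finite T \<and> card T = (q ^ nat (k - j)) ^ card E"
proof -
  obtain T where T: "transversal T (U j) (U k)" "finite T" "card T = q ^ nat (k - j)"
    using U_transversal[OF assms] by blast
  define g where "g h = (\<Sum>b\<in>E. smul (h b) b)" for h :: "'x \<Rightarrow> 'f"
  have g: "co b (g h) = h b" if "b \<in> E" for b h unfolding g_def by (rule co_combination[OF that])
  have inj: "inj_on g (PiE E (\<lambda>_. T))"
    by (rule inj_onI) (metis PiE_ext g)
  have "transversal (g ` PiE E (\<lambda>_. T)) (L j) (L k)"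
  proof (rule transversalI[OF _ L_subgroup])
    show "g ` PiE E (\<lambda>_. T) \<subseteq> L j"
      using transversal_subset[OF T(1)] by (auto simp: L_def g PiE_mem subset_iff)
    fix x assume x: "x \<in> L j"
    have "\<exists>t. t \<in> T \<and> co b x - t \<in> U k" if "b \<in> E" for b
      by (rule transversal_obtain[OF T(1), of "co b x"]) (use x that in \<open>auto simp: L_def\<close>)
    then have "\<forall>b. \<exists>t. b \<in> E \<longrightarrow> t \<in> T \<and> co b x - t \<in> U k" by blast
    from choice[OF this] obtain h where h: "\<And>b. b \<in> E \<Longrightarrow> h b \<in> T \<and> co b x - h b \<in> U k" by blast
    have "restrict h E \<in> PiE E (\<lambda>_. T)" using h by auto
    moreover have "x - g (restrict h E) \<in> L k" using h by (auto simp: L_def co_diff g)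
    ultimately show "\<exists>t\<in>g ` PiE E (\<lambda>_. T). x - t \<in> L k" by blast
  next
    fix t t' assume t: "t \<in> g ` PiE E (\<lambda>_. T)" "t' \<in> g ` PiE E (\<lambda>_. T)" "t - t' \<in> L k"
    then obtain h h' where h: "h \<in> PiE E (\<lambda>_. T)" "t = g h" "h' \<in> PiE E (\<lambda>_. T)" "t' = g h'" by blast
    have "h b = h' b" if b: "b \<in> E" for b
      by (rule transversal_unique[OF T(1) U_subgroup])
        (use h t(3) b PiE_mem in \<open>auto simp: L_def co_diff g\<close>)
    then have "h = h'" using PiE_ext[OF h(1,3)] by blast
    then show "t = t'" using h by simp
  qed
  moreover have "finite (g ` PiE E (\<lambda>_. T))" using T(2) E_finite by (intro finite_imageI finite_PiE) auto
  moreover have "card (g ` PiE E (\<lambda>_. T)) = (q ^ nat (k - j)) ^ card E"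
    using card_image[OF inj] T(3) E_finite by (simp add: card_PiE)
  ultimately show ?thesis by blast
qed

definition vol :: "int \<Rightarrow> 'r" where "vol k = qz (- k) ^ card E"

lemma vol_nonzero: "vol k \<noteq> 0"
  using qz_nonzero by (simp add: vol_def)

text \<open>A larger domain adds zeros and a finer mesh repeats values, which the volume factor
  undoes; the integral \<open>I\<close> therefore does not depend on the lattices chosen for
  it.\<close>

lemma tsum_L_extend:
  assumes "test j k \<Phi>" "j' \<le> j" "k \<le> k'" "j \<le> k"
  shows "vol k' * tsum (L j') (L k') \<Phi> = vol k * tsum (L j) (L k) \<Phi>"
proof -
  have per: "\<Phi> (x + u) = \<Phi> x" if "u \<in> L k" for x u using assms(1) that by (simp add: test_def)
  have k': "L k' \<subseteq> L k" "L k \<subseteq> L j" "L j \<subseteq> L j'" using assms L_mono by auto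
  obtain T where T: "transversal T (L j') (L k')" "finite T" using L_transversal[of j' k'] assms by auto
  have "tsum (L j') (L k') \<Phi> = tsum (L j) (L k') \<Phi>"
    by (rule tsum_restrict[OF L_subgroup L_subgroup L_subgroup _ _ T])
      (use k' per assms(1) in \<open>auto simp: test_def\<close>)
  also have "\<dots> = of_nat ((q ^ nat (k' - k)) ^ card E) * tsum (L j) (L k) \<Phi>"
  proof -
    obtain T1 where T1: "transversal T1 (L j) (L k)" using transversal_exists L_subgroup by blast
    obtain T2 where T2: "transversal T2 (L k) (L k')" "card T2 = (q ^ nat (k' - k)) ^ card E"
      using L_transversal[OF assms(3)] by blast
    have "tsum (L j) (L k') \<Phi> = (\<Sum>a\<in>T1. \<Sum>b\<in>T2. \<Phi> (a + b))"
      by (rule tsum_tower[OF T1 T2(1) L_subgroup L_subgroup L_subgroup k'(1,2)]) (use per k' in auto)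
    also have "\<dots> = (\<Sum>a\<in>T1. \<Sum>b\<in>T2. \<Phi> a)"
      using per transversal_subset[OF T2(1)] by (intro sum.cong) auto
    also have "\<dots> = of_nat ((q ^ nat (k' - k)) ^ card E) * sum \<Phi> T1"
      by (simp add: sum_distrib_left T2(2))
    also have "sum \<Phi> T1 = tsum (L j) (L k) \<Phi>"
      by (rule tsum_eq[OF T1 L_subgroup, symmetric]) (use per in auto)
    finally show ?thesis .
  qed
  also have "of_nat ((q ^ nat (k' - k)) ^ card E) = qz (k' - k) ^ card E" using assms(3) by (simp add: qz_nat)
  finally show ?thesis
    by (simp add: vol_def mult.assoc[symmetric] power_mult_distrib[symmetric] qz_add[symmetric])
qed

text \<open>The Haar integral giving \<open>L 0\<close> volume 1, computed with an arbitrary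
  admissible pair of lattices; \<open>I_eq\<close> shows that any such pair gives the same
  value.\<close>

definition I :: "('x \<Rightarrow> 'r) \<Rightarrow> 'r" where
  "I \<Phi> = (let p = (SOME p. test (fst p) (snd p) \<Phi> \<and> fst p \<le> snd p)
    in vol (snd p) * tsum (L (fst p)) (L (snd p)) \<Phi>)"

lemma I_eq:
  assumes "test j k \<Phi>" "j \<le> k" shows "I \<Phi> = vol k * tsum (L j) (L k) \<Phi>"
proof -
  define p where "p = (SOME p. test (fst p) (snd p) \<Phi> \<and> fst p \<le> snd p)"
  have p: "test (fst p) (snd p) \<Phi> \<and> fst p \<le> snd p"
    unfolding p_def by (rule someI[of _ "(j, k)"]) (use assms in simp)
  have "vol (snd p) * tsum (L (fst p)) (L (snd p)) \<Phi> = vol (max k (snd p)) * tsum (L (min j (fst p))) (L (max k (snd p))) \<Phi>"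
    by (rule tsum_L_extend[symmetric]) (use p in auto)
  also have "\<dots> = vol k * tsum (L j) (L k) \<Phi>" by (rule tsum_L_extend) (use assms in auto)
  finally show ?thesis by (simp add: I_def Let_def p_def[symmetric])
qed

lemma test_add: "test j k \<Phi> \<Longrightarrow> test j k \<Psi> \<Longrightarrow> test j k (\<lambda>x. \<Phi> x + \<Psi> x)"
  and test_mult_left: "test j k \<Phi> \<Longrightarrow> test j k (\<lambda>x. r * \<Phi> x)"
  by (simp_all add: test_def)

lemma test_sum: "(\<And>i. i \<in> A \<Longrightarrow> test j k (f i)) \<Longrightarrow> test j k (\<lambda>x. \<Sum>i\<in>A. f i x)"
  by (auto simp: test_def intro!: sum.cong sum.neutral)

lemma I_mult_left: "test j k \<Phi> \<Longrightarrow> I (\<lambda>x. r * \<Phi> x) = r * I \<Phi>"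
proof -
  assume "test j k \<Phi>"
  then have "test (min j k) k \<Phi>" by (rule test_mono) auto
  then show ?thesis
    using I_eq[of "min j k" k \<Phi>] I_eq[OF test_mult_left, of "min j k" k \<Phi> r]
    by (simp add: tsum_mult_left mult.left_commute)
qed

lemma I_sum:
  assumes "\<And>i. i \<in> A \<Longrightarrow> test j k (f i)"
  shows "I (\<lambda>x. \<Sum>i\<in>A. f i x) = (\<Sum>i\<in>A. I (f i))"
proof -
  have t: "test (min j k) k (f i)" if "i \<in> A" for i using assms[OF that] by (rule test_mono) auto
  have "I (\<lambda>x. \<Sum>i\<in>A. f i x) = vol k * tsum (L (min j k)) (L k) (\<lambda>x. \<Sum>i\<in>A. f i x)"
    by (rule I_eq[OF test_sum[OF t]]) auto
  also have "\<dots> = (\<Sum>i\<in>A. vol k * tsum (L (min j k)) (L k) (f i))"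
    unfolding tsum_def by (subst sum.swap) (simp add: sum_distrib_left)
  also have "\<dots> = (\<Sum>i\<in>A. I (f i))" by (intro sum.cong refl I_eq[OF t, symmetric]) auto
  finally show ?thesis .
qed

lemma test_shift:
  assumes "test j k \<Phi>" "y \<in> L i" "i \<le> j" shows "test i k (\<lambda>x. \<Phi> (x + y))"
  unfolding test_def
proof (intro conjI allI ballI impI)
  fix x u assume "u \<in> L k"
  then show "\<Phi> (x + u + y) = \<Phi> (x + y)"
    using assms(1) unfolding test_def by (metis add.assoc add.commute)
next
  fix x assume "x \<notin> L i"
  then have "x + y \<notin> L j" using L_diff[of "x + y" i y] L_monoD[OF _ assms(3)] assms(2) by auto
  then show "\<Phi> (x + y) = 0" using assms(1) by (simp add: test_def)
qed

lemma I_shift: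
  assumes "test j k \<Phi>" shows "I (\<lambda>x. \<Phi> (x + y)) = I \<Phi>"
proof -
  obtain i0 where i0: "y \<in> L i0" using L_exists by blast
  define i where "i = min i0 (min j k)"
  have y: "y \<in> L i" using i0 by (rule L_monoD) (simp add: i_def)
  have i: "i \<le> j" "i \<le> k" by (auto simp: i_def)
  have t: "test i k \<Phi>" using assms by (rule test_mono) (use i in auto)
  have "I (\<lambda>x. \<Phi> (x + y)) = vol k * tsum (L i) (L k) (\<lambda>x. \<Phi> (x + y))"
    by (rule I_eq[OF test_shift[OF t y]]) (use i in auto)
  also have "tsum (L i) (L k) (\<lambda>x. \<Phi> (x + y)) = tsum (L i) (L k) \<Phi>"
    by (rule tsum_shift[OF L_subgroup L_subgroup y]) (use t in \<open>auto simp: test_def\<close>)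
  also have "vol k * tsum (L i) (L k) \<Phi> = I \<Phi>" by (rule I_eq[OF t i(2), symmetric])
  finally show ?thesis .
qed

definition ind :: "int \<Rightarrow> 'x \<Rightarrow> 'r" where "ind k x = (if x \<in> L k then 1 else 0)"

lemma test_ind: "test k k (ind k)"
proof -
  have "x + u \<in> L k \<longleftrightarrow> x \<in> L k" if "u \<in> L k" for x u
    using L_add[OF _ that] L_diff[OF _ that, of "x + u"] by auto
  then show ?thesis by (auto simp: test_def ind_def)
qed

lemma I_ind: "I (ind k) = vol k"
proof -
  have "transversal {0} (L k) (L k)" by (rule transversalI) (auto simp: L_0 L_subgroup)
  then have "tsum (L k) (L k) (ind k) = (\<Sum>x\<in>{0}. ind k x)"
    by (rule tsum_eq[OF _ L_subgroup]) (use test_ind in \<open>auto simp: test_def\<close>)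
  then show ?thesis using I_eq[OF test_ind] by (simp add: ind_def L_0)
qed

end

section \<open>The metaplectic group\<close>

lemma Bij_closed: "f \<in> Bij S \<Longrightarrow> x \<in> S \<Longrightarrow> f x \<in> S"
  using Bij_imp_funcset by blast

lemma BijGroup_mult_apply: "f \<in> Bij S \<Longrightarrow> g \<in> Bij S \<Longrightarrow> x \<in> S \<Longrightarrow> (f \<otimes>\<^bsub>BijGroup S\<^esub> g) x = f (g x)"
  by (simp add: BijGroup_def compose_def)

lemma BijGroup_inv:
  assumes "f \<in> Bij S" "x \<in> S"
  shows "(inv\<^bsub>BijGroup S\<^esub> f) x \<in> S" "f ((inv\<^bsub>BijGroup S\<^esub> f) x) = x" "(inv\<^bsub>BijGroup S\<^esub> f) (f x) = x"
proof -
  have bij: "bij_betw f S S" using assms(1) by (simp add: Bij_def)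
  have fx: "f x \<in> S" by (rule Bij_closed[OF assms])
  have eq: "(inv\<^bsub>BijGroup S\<^esub> f) y = inv_into S f y" if "y \<in> S" for y
    using that by (simp add: inv_BijGroup[OF assms(1)])
  show "(inv\<^bsub>BijGroup S\<^esub> f) x \<in> S" unfolding eq[OF assms(2)] by (rule Bij_inv_into_mem[OF assms])
  show "f ((inv\<^bsub>BijGroup S\<^esub> f) x) = x" unfolding eq[OF assms(2)] by (rule bij_betw_inv_into_right[OF bij assms(2)])
  show "(inv\<^bsub>BijGroup S\<^esub> f) (f x) = x" unfolding eq[OF fx] by (rule bij_betw_inv_into_left[OF bij assms(2)])
qed

lemma carrier_BijGroup: "carrier (BijGroup S) = Bij S"
  by (simp add: BijGroup_def)

lemmas BijGroup_mult_closed = monoid.m_closed[OF group.is_monoid[OF group_BijGroup], unfolded carrier_BijGroup]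
  and BijGroup_inv_closed = group.inv_closed[OF group_BijGroup, unfolded carrier_BijGroup]

lemma Bij_restrictI:
  assumes "\<And>x. x \<in> S \<Longrightarrow> f x \<in> S" "\<And>x. x \<in> S \<Longrightarrow> g x \<in> S"
    "\<And>x. x \<in> S \<Longrightarrow> g (f x) = x" "\<And>x. x \<in> S \<Longrightarrow> f (g x) = x"
  shows "restrict f S \<in> Bij S"
proof -
  have "bij_betw f S S"
  proof (rule bij_betwI)
    show "f \<in> S \<rightarrow> S" "g \<in> S \<rightarrow> S" using assms(1,2) by blast+
    show "g (f x) = x" if "x \<in> S" for x by (rule assms(3)[OF that])
    show "f (g x) = x" if "x \<in> S" for x by (rule assms(4)[OF that])
  qed
  then have "bij_betw (restrict f S) S S"
    by (rule iffD1[OF bij_betw_cong, rotated]) (rule restrict_apply'[symmetric])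
  then show ?thesis by (simp add: Bij_def)
qed

lemma Bij_eqI: "f \<in> Bij S \<Longrightarrow> g \<in> Bij S \<Longrightarrow> (\<And>x. x \<in> S \<Longrightarrow> f x = g x) \<Longrightarrow> f = g"
  by (rule extensionalityI[of f S g]) (auto simp: Bij_def)

lemma Bij_inj: "f \<in> Bij S \<Longrightarrow> x \<in> S \<Longrightarrow> y \<in> S \<Longrightarrow> f x = f y \<Longrightarrow> x = y"
  by (auto simp: Bij_def bij_betw_def inj_on_def)

lemma subgroup_BijGroupI:
  assumes "\<And>f. P f \<Longrightarrow> f \<in> Bij S" "P (\<lambda>x\<in>S. x)"
    "\<And>f g. P f \<Longrightarrow> P g \<Longrightarrow> P (f \<otimes>\<^bsub>BijGroup S\<^esub> g)" "\<And>f. P f \<Longrightarrow> P (inv\<^bsub>BijGroup S\<^esub> f)"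
  shows "subgroup {f. P f} (BijGroup S)"
proof (rule group.subgroupI[OF group_BijGroup])
  show "{f. P f} \<subseteq> carrier (BijGroup S)" using assms(1) by (auto simp: carrier_BijGroup)
  show "{f. P f} \<noteq> {}" using assms(2) by blast
  show "inv\<^bsub>BijGroup S\<^esub> f \<in> {f. P f}" if "f \<in> {f. P f}" for f using assms(4) that by blast
  show "f \<otimes>\<^bsub>BijGroup S\<^esub> g \<in> {f. P f}" if "f \<in> {f. P f}" "g \<in> {f. P f}" for f g using assms(3) that by blast
qed

context weil
begin

section \<open>The symplectic group as a group of bijections\<close>

abbreviation "W \<equiv> W_space smul"
abbreviation \<S> :: "('x \<Rightarrow> 'r) set" where "\<S> \<equiv> Schwartz v smul"

lemma W_iff: "w \<in> W \<longleftrightarrow> snd w \<in> dual_space smul"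
  by (cases w) (simp add: W_space_def)

lemma W_add: "w \<in> W \<Longrightarrow> w' \<in> W \<Longrightarrow> w + w' \<in> W"
  by (auto simp: W_iff dual_iff algebra_simps)

lemma W_smul: "w \<in> W \<Longrightarrow> W_smul smul a w \<in> W"
  by (auto simp: W_iff dual_iff W_smul_def algebra_simps)

definition symp :: "'x \<times> ('x \<Rightarrow> 'f) \<Rightarrow> 'x \<times> ('x \<Rightarrow> 'f) \<Rightarrow> 'f" where
  "symp w w' = B_form w w' - B_form w' w"

definition is_Sp where
  "is_Sp \<sigma> \<longleftrightarrow> \<sigma> \<in> Bij W \<and> (\<forall>w\<^sub>1\<in>W. \<forall>w\<^sub>2\<in>W. \<sigma> (w\<^sub>1 + w\<^sub>2) = \<sigma> w\<^sub>1 + \<sigma> w\<^sub>2) \<and>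
     (\<forall>a. \<forall>w\<in>W. \<sigma> (W_smul smul a w) = W_smul smul a (\<sigma> w)) \<and>
     (\<forall>w\<^sub>1\<in>W. \<forall>w\<^sub>2\<in>W. symp (\<sigma> w\<^sub>1) (\<sigma> w\<^sub>2) = symp w\<^sub>1 w\<^sub>2)"

lemma Sp_eq: "Sp smul = BijGroup W \<lparr>carrier := {\<sigma>. is_Sp \<sigma>}\<rparr>"
  unfolding Sp_def is_Sp_def symp_def by (rule refl)

lemma is_SpD:
  assumes "is_Sp \<sigma>"
  shows "\<sigma> \<in> Bij W" "w \<in> W \<Longrightarrow> \<sigma> w \<in> W" "w \<in> W \<Longrightarrow> w' \<in> W \<Longrightarrow> \<sigma> (w + w') = \<sigma> w + \<sigma> w'"
    "w \<in> W \<Longrightarrow> \<sigma> (W_smul smul a w) = W_smul smul a (\<sigma> w)"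
    "w \<in> W \<Longrightarrow> w' \<in> W \<Longrightarrow> symp (\<sigma> w) (\<sigma> w') = symp w w'"
  using assms Bij_closed[of \<sigma> W w] unfolding is_Sp_def by auto

lemma Sp_subgroup: "subgroup {\<sigma>. is_Sp \<sigma>} (BijGroup W)"
proof (rule subgroup_BijGroupI)
  show "is_Sp (\<lambda>x\<in>W. x)" using id_Bij W_add W_smul by (auto simp: is_Sp_def)
next
  fix f g assume f: "is_Sp f" and g: "is_Sp g"
  have b: "f \<in> Bij W" "g \<in> Bij W" using f g is_SpD(1) by auto
  have c: "(f \<otimes>\<^bsub>BijGroup W\<^esub> g) w = f (g w)" if "w \<in> W" for w by (rule BijGroup_mult_apply[OF b that])
  have "f \<otimes>\<^bsub>BijGroup W\<^esub> g \<in> Bij W" by (rule BijGroup_mult_closed[OF b])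
  moreover have gW: "g w \<in> W" if "w \<in> W" for w by (rule is_SpD(2)[OF g that])
  have "(f \<otimes>\<^bsub>BijGroup W\<^esub> g) (w + w') = (f \<otimes>\<^bsub>BijGroup W\<^esub> g) w + (f \<otimes>\<^bsub>BijGroup W\<^esub> g) w'"
    if "w \<in> W" "w' \<in> W" for w w'
    unfolding c[OF W_add[OF that]] c[OF that(1)] c[OF that(2)] is_SpD(3)[OF g that]
    by (rule is_SpD(3)[OF f gW[OF that(1)] gW[OF that(2)]])
  moreover have "(f \<otimes>\<^bsub>BijGroup W\<^esub> g) (W_smul smul a w) = W_smul smul a ((f \<otimes>\<^bsub>BijGroup W\<^esub> g) w)"
    if "w \<in> W" for a w
    unfolding c[OF W_smul[OF that]] c[OF that] is_SpD(4)[OF g that] by (rule is_SpD(4)[OF f gW[OF that]])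
  moreover have "symp ((f \<otimes>\<^bsub>BijGroup W\<^esub> g) w) ((f \<otimes>\<^bsub>BijGroup W\<^esub> g) w') = symp w w'"
    if "w \<in> W" "w' \<in> W" for w w'
    unfolding c[OF that(1)] c[OF that(2)] is_SpD(5)[OF f gW[OF that(1)] gW[OF that(2)]] by (rule is_SpD(5)[OF g that])
  ultimately show "is_Sp (f \<otimes>\<^bsub>BijGroup W\<^esub> g)"
    unfolding is_Sp_def by blast
next
  fix f assume f: "is_Sp f"
  let ?g = "inv\<^bsub>BijGroup W\<^esub> f"
  note b = is_SpD(1)[OF f]
  note i = BijGroup_inv[OF b]
  have "?g \<in> Bij W" by (rule BijGroup_inv_closed[OF b])
  moreover have "?g (w + w') = ?g w + ?g w'" if "w \<in> W" "w' \<in> W" for w w'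
    by (rule Bij_inj[OF b i(1)[OF W_add[OF that]] W_add[OF i(1)[OF that(1)] i(1)[OF that(2)]]])
      (simp only: i(2)[OF W_add[OF that]] is_SpD(3)[OF f i(1)[OF that(1)] i(1)[OF that(2)]] i(2)[OF that(1)] i(2)[OF that(2)])
  moreover have "?g (W_smul smul a w) = W_smul smul a (?g w)" if "w \<in> W" for w a
    by (rule Bij_inj[OF b i(1)[OF W_smul[OF that]] W_smul[OF i(1)[OF that]]])
      (simp only: i(2)[OF W_smul[OF that]] is_SpD(4)[OF f i(1)[OF that]] i(2)[OF that])
  moreover have "symp (?g w) (?g w') = symp w w'" if "w \<in> W" "w' \<in> W" for w w'
    using is_SpD(5)[OF f i(1)[OF that(1)] i(1)[OF that(2)]] i(2)[OF that(1)] i(2)[OF that(2)] by simp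
  ultimately show "is_Sp ?g" unfolding is_Sp_def by blast
qed (simp add: is_Sp_def)

lemma Sp_group: "group (Sp smul)"
  unfolding Sp_eq by (rule subgroup.subgroup_is_group[OF Sp_subgroup group_BijGroup])

lemma carrier_Sp [simp]: "carrier (Sp smul) = {\<sigma>. is_Sp \<sigma>}"
  by (simp add: Sp_eq)

lemma Sp_mult_apply: "is_Sp \<sigma> \<Longrightarrow> is_Sp \<tau> \<Longrightarrow> w \<in> W \<Longrightarrow> (\<sigma> \<otimes>\<^bsub>Sp smul\<^esub> \<tau>) w = \<sigma> (\<tau> w)"
  using BijGroup_mult_apply[OF is_SpD(1) is_SpD(1)] by (simp add: Sp_eq)

lemma Sp_one: "\<one>\<^bsub>Sp smul\<^esub> = (\<lambda>w\<in>W. w)"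
  by (simp add: Sp_eq BijGroup_def)

lemma Sp_inv:
  assumes "is_Sp \<sigma>" "w \<in> W"
  shows "(inv\<^bsub>Sp smul\<^esub> \<sigma>) w \<in> W" "\<sigma> ((inv\<^bsub>Sp smul\<^esub> \<sigma>) w) = w" "(inv\<^bsub>Sp smul\<^esub> \<sigma>) (\<sigma> w) = w"
proof -
  have "inv\<^bsub>Sp smul\<^esub> \<sigma> = inv\<^bsub>BijGroup W\<^esub> \<sigma>"
    unfolding Sp_eq using group.m_inv_consistent[OF group_BijGroup Sp_subgroup, of \<sigma>] assms by simp
  then show "(inv\<^bsub>Sp smul\<^esub> \<sigma>) w \<in> W" "\<sigma> ((inv\<^bsub>Sp smul\<^esub> \<sigma>) w) = w" "(inv\<^bsub>Sp smul\<^esub> \<sigma>) (\<sigma> w) = w"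
    using BijGroup_inv[OF is_SpD(1)[OF assms(1)] assms(2)] by simp_all
qed

section \<open>Automorphisms of the Schwartz space\<close>

lemma Schwartz_add: "\<Phi> \<in> \<S> \<Longrightarrow> \<Psi> \<in> \<S> \<Longrightarrow> \<Phi> + \<Psi> \<in> \<S>"
proof -
  assume "\<Phi> \<in> \<S>" "\<Psi> \<in> \<S>"
  then obtain j k j' k' where t: "test j k \<Phi>" "test j' k' \<Psi>" unfolding Schwartz_iff by blast
  have "test (min j j') (max k k') \<Phi>" "test (min j j') (max k k') \<Psi>"
    using test_mono[OF t(1)] test_mono[OF t(2)] by simp_all
  then have "test (min j j') (max k k') (\<lambda>x. \<Phi> x + \<Psi> x)" by (rule test_add)
  moreover have "(\<lambda>x. \<Phi> x + \<Psi> x) = \<Phi> + \<Psi>" by (simp add: fun_eq_iff)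
  ultimately show ?thesis unfolding Schwartz_iff by auto
qed

lemma Schwartz_mult: "\<Phi> \<in> \<S> \<Longrightarrow> (\<lambda>x. r * \<Phi> x) \<in> \<S>"
  unfolding Schwartz_iff using test_mult_left by blast

definition is_Aut where
  "is_Aut s \<longleftrightarrow> s \<in> Bij \<S> \<and> (\<forall>\<Phi>\<in>\<S>. \<forall>\<Psi>\<in>\<S>. s (\<Phi> + \<Psi>) = s \<Phi> + s \<Psi>) \<and>
     (\<forall>r. \<forall>\<Phi>\<in>\<S>. s (\<lambda>x. r * \<Phi> x) = (\<lambda>x. r * s \<Phi> x))"

lemma Aut_eq: "Aut_S v smul = BijGroup \<S> \<lparr>carrier := {s. is_Aut s}\<rparr>"
  unfolding Aut_S_def is_Aut_def by (rule refl)

lemma is_AutD: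
  assumes "is_Aut s"
  shows "s \<in> Bij \<S>" "\<Phi> \<in> \<S> \<Longrightarrow> s \<Phi> \<in> \<S>" "\<Phi> \<in> \<S> \<Longrightarrow> \<Psi> \<in> \<S> \<Longrightarrow> s (\<Phi> + \<Psi>) = s \<Phi> + s \<Psi>"
    "\<Phi> \<in> \<S> \<Longrightarrow> s (\<lambda>x. r * \<Phi> x) = (\<lambda>x. r * s \<Phi> x)"
  using assms Bij_closed[of s \<S> \<Phi>] unfolding is_Aut_def by auto

lemma Aut_subgroup: "subgroup {s. is_Aut s} (BijGroup \<S>)"
proof (rule subgroup_BijGroupI)
  show "is_Aut (\<lambda>x\<in>\<S>. x)" using id_Bij Schwartz_add Schwartz_mult by (auto simp: is_Aut_def)
next
  fix f g assume f: "is_Aut f" and g: "is_Aut g"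
  have b: "f \<in> Bij \<S>" "g \<in> Bij \<S>" using f g is_AutD(1) by auto
  have c: "(f \<otimes>\<^bsub>BijGroup \<S>\<^esub> g) w = f (g w)" if "w \<in> \<S>" for w by (rule BijGroup_mult_apply[OF b that])
  have "f \<otimes>\<^bsub>BijGroup \<S>\<^esub> g \<in> Bij \<S>" by (rule BijGroup_mult_closed[OF b])
  moreover have gS: "g w \<in> \<S>" if "w \<in> \<S>" for w by (rule is_AutD(2)[OF g that])
  have "(f \<otimes>\<^bsub>BijGroup \<S>\<^esub> g) (w + w') = (f \<otimes>\<^bsub>BijGroup \<S>\<^esub> g) w + (f \<otimes>\<^bsub>BijGroup \<S>\<^esub> g) w'"
    if "w \<in> \<S>" "w' \<in> \<S>" for w w'
    unfolding c[OF Schwartz_add[OF that]] c[OF that(1)] c[OF that(2)] is_AutD(3)[OF g that]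
    by (rule is_AutD(3)[OF f gS[OF that(1)] gS[OF that(2)]])
  moreover have "(f \<otimes>\<^bsub>BijGroup \<S>\<^esub> g) (\<lambda>x. a * w x) = (\<lambda>x. a * (f \<otimes>\<^bsub>BijGroup \<S>\<^esub> g) w x)"
    if "w \<in> \<S>" for a w
    unfolding c[OF Schwartz_mult[OF that]] c[OF that] is_AutD(4)[OF g that] by (rule is_AutD(4)[OF f gS[OF that]])
  ultimately show "is_Aut (f \<otimes>\<^bsub>BijGroup \<S>\<^esub> g)"
    unfolding is_Aut_def by blast
next
  fix f assume f: "is_Aut f"
  let ?g = "inv\<^bsub>BijGroup \<S>\<^esub> f"
  note b = is_AutD(1)[OF f]
  note i = BijGroup_inv[OF b]
  have "?g \<in> Bij \<S>" by (rule BijGroup_inv_closed[OF b])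
  moreover have "?g (w + w') = ?g w + ?g w'" if "w \<in> \<S>" "w' \<in> \<S>" for w w'
    by (rule Bij_inj[OF b i(1)[OF Schwartz_add[OF that]] Schwartz_add[OF i(1)[OF that(1)] i(1)[OF that(2)]]])
      (simp only: i(2)[OF Schwartz_add[OF that]] is_AutD(3)[OF f i(1)[OF that(1)] i(1)[OF that(2)]] i(2)[OF that(1)] i(2)[OF that(2)])
  moreover have "?g (\<lambda>x. r * w x) = (\<lambda>x. r * ?g w x)" if "w \<in> \<S>" for w r
    by (rule Bij_inj[OF b i(1)[OF Schwartz_mult[OF that]] Schwartz_mult[OF i(1)[OF that]]])
      (simp only: i(2)[OF Schwartz_mult[OF that]] is_AutD(4)[OF f i(1)[OF that]] i(2)[OF that])
  ultimately show "is_Aut ?g" unfolding is_Aut_def by blast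
qed (simp add: is_Aut_def)

lemma Aut_group: "group (Aut_S v smul :: (('x \<Rightarrow> 'r) \<Rightarrow> ('x \<Rightarrow> 'r)) monoid)"
  unfolding Aut_eq by (rule subgroup.subgroup_is_group[OF Aut_subgroup group_BijGroup])

lemma carrier_Aut [simp]: "carrier (Aut_S v smul) = {s. is_Aut s}"
  by (simp add: Aut_eq)

lemma Aut_mult_apply: "is_Aut s \<Longrightarrow> is_Aut t \<Longrightarrow> \<Phi> \<in> \<S> \<Longrightarrow> (s \<otimes>\<^bsub>Aut_S v smul\<^esub> t) \<Phi> = s (t \<Phi>)"
  using BijGroup_mult_apply[OF is_AutD(1) is_AutD(1)] by (simp add: Aut_eq)

lemma Aut_one: "\<one>\<^bsub>Aut_S v smul\<^esub> = (\<lambda>\<Phi>\<in>\<S>. \<Phi>)"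
  by (simp add: Aut_eq BijGroup_def)

lemma Aut_mult_closed: "is_Aut s \<Longrightarrow> is_Aut t \<Longrightarrow> is_Aut (s \<otimes>\<^bsub>Aut_S v smul\<^esub> t)"
  using group.subgroup_self[OF Aut_group] monoid.m_closed[OF group.is_monoid[OF Aut_group], of s t] by simp

lemma Aut_inv:
  assumes "is_Aut s" "\<Phi> \<in> \<S>"
  shows "is_Aut (inv\<^bsub>Aut_S v smul\<^esub> s)" "(inv\<^bsub>Aut_S v smul\<^esub> s) \<Phi> \<in> \<S>" "s ((inv\<^bsub>Aut_S v smul\<^esub> s) \<Phi>) = \<Phi>"
    "(inv\<^bsub>Aut_S v smul\<^esub> s) (s \<Phi>) = \<Phi>"
proof -
  have eq: "inv\<^bsub>Aut_S v smul\<^esub> s = inv\<^bsub>BijGroup \<S>\<^esub> s"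
    unfolding Aut_eq using group.m_inv_consistent[OF group_BijGroup Aut_subgroup, of s] assms by simp
  show "is_Aut (inv\<^bsub>Aut_S v smul\<^esub> s)" using group.inv_closed[OF Aut_group, of s] assms(1) by simp
  show "(inv\<^bsub>Aut_S v smul\<^esub> s) \<Phi> \<in> \<S>" "s ((inv\<^bsub>Aut_S v smul\<^esub> s) \<Phi>) = \<Phi>" "(inv\<^bsub>Aut_S v smul\<^esub> s) (s \<Phi>) = \<Phi>"
    unfolding eq using BijGroup_inv[OF is_AutD(1)[OF assms(1)] assms(2)] by simp_all
qed

lemma is_AutI:
  assumes "\<And>\<Phi>. \<Phi> \<in> \<S> \<Longrightarrow> f \<Phi> \<in> \<S>" "\<And>\<Phi>. \<Phi> \<in> \<S> \<Longrightarrow> g \<Phi> \<in> \<S>"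
    "\<And>\<Phi>. \<Phi> \<in> \<S> \<Longrightarrow> g (f \<Phi>) = \<Phi>" "\<And>\<Phi>. \<Phi> \<in> \<S> \<Longrightarrow> f (g \<Phi>) = \<Phi>"
    "\<And>\<Phi> \<Psi>. \<Phi> \<in> \<S> \<Longrightarrow> \<Psi> \<in> \<S> \<Longrightarrow> f (\<Phi> + \<Psi>) = f \<Phi> + f \<Psi>"
    "\<And>r \<Phi>. \<Phi> \<in> \<S> \<Longrightarrow> f (\<lambda>x. r * \<Phi> x) = (\<lambda>x. r * f \<Phi> x)"
  shows "is_Aut (restrict f \<S>)"
  unfolding is_Aut_def using Bij_restrictI[of \<S> f g] assms Schwartz_add Schwartz_mult by simp

lemma Aut_eqI: "is_Aut s \<Longrightarrow> is_Aut t \<Longrightarrow> (\<And>\<Phi>. \<Phi> \<in> \<S> \<Longrightarrow> s \<Phi> = t \<Phi>) \<Longrightarrow> s = t"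
  using Bij_eqI[OF is_AutD(1) is_AutD(1)] by blast

lemma Sp_eqI: "is_Sp s \<Longrightarrow> is_Sp t \<Longrightarrow> (\<And>w. w \<in> W \<Longrightarrow> s w = t w) \<Longrightarrow> s = t"
  using Bij_eqI[OF is_SpD(1) is_SpD(1)] by blast

text \<open>The Heisenberg operator \<open>U (w, 1)\<close> as a total function, without the
  restriction to the Schwartz space, so that products of operators are pointwise identities.\<close>

definition op :: "'x \<times> ('x \<Rightarrow> 'f) \<Rightarrow> ('x \<Rightarrow> 'r) \<Rightarrow> 'x \<Rightarrow> 'r" where
  "op w \<Phi> = (\<lambda>x. \<Phi> (x + fst w) * chi (snd w x))"

lemma U_op_eq: "\<Phi> \<in> \<S> \<Longrightarrow> U_op v smul chi (w, t) \<Phi> = (\<lambda>x. t * op w \<Phi> x)"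
  by (cases w) (simp add: U_op_def op_def mult.assoc)

lemma op_test:
  assumes "w \<in> W" "test j k \<Phi>" shows "\<exists>j' k'. test j' k' (op w \<Phi>)"
proof -
  have w: "snd w \<in> dual_space smul" using assms(1) by (simp add: W_iff)
  obtain B where B: "\<forall>k. \<forall>x\<in>L k. snd w x \<in> U (k + B)" using dual_bound[OF w] by blast
  obtain i where i: "fst w \<in> L i" using L_exists by blast
  define i' where "i' = min i j"
  have t: "test i' k (\<lambda>x. \<Phi> (x + fst w))"
    by (rule test_shift[OF assms(2)]) (use i L_monoD in \<open>auto simp: i'_def\<close>)
  have "test i' (max k (d - B)) (op w \<Phi>)"
    unfolding test_def op_def
  proof (intro conjI allI ballI impI)
    fix x u assume u: "u \<in> L (max k (d - B))"
    then have "u \<in> L k" by (rule L_monoD) simp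
    moreover have "snd w u \<in> U (max k (d - B) + B)" using B u by blast
    then have "snd w u \<in> U d" by (rule U_monoD) simp
    then have "chi (snd w u) = 1" by (rule chi_U)
    ultimately show "\<Phi> (x + u + fst w) * chi (snd w (x + u)) = \<Phi> (x + fst w) * chi (snd w x)"
      using t by (simp add: test_def dual_add[OF w] chi_add)
  next
    fix x assume "x \<notin> L i'"
    then show "\<Phi> (x + fst w) * chi (snd w x) = 0" using t by (simp add: test_def)
  qed
  then show ?thesis by blast
qed

lemma op_Schwartz: "w \<in> W \<Longrightarrow> \<Phi> \<in> \<S> \<Longrightarrow> op w \<Phi> \<in> \<S>"
  unfolding Schwartz_iff using op_test by blast

lemma op_add: "op w (\<Phi> + \<Psi>) = op w \<Phi> + op w \<Psi>" and op_mult: "op w (\<lambda>x. r * \<Phi> x) = (\<lambda>x. r * op w \<Phi> x)"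
  by (simp_all add: op_def fun_eq_iff algebra_simps)

lemma op_op: "w \<in> W \<Longrightarrow> w' \<in> W \<Longrightarrow> op w (op w' \<Phi>) = (\<lambda>x. chi (B_form w w') * op (w + w') \<Phi> x)"
  by (rule ext) (simp add: op_def W_iff dual_add B_form_def chi_add ac_simps)

lemma op_0: "op 0 \<Phi> = \<Phi>"
  by (simp add: op_def)

lemma W_uminus: "w \<in> W \<Longrightarrow> - w \<in> W"
  by (auto simp: W_iff dual_iff)

lemma op_inverse: "w \<in> W \<Longrightarrow> op w (op (- w) \<Phi>) = (\<lambda>x. chi (B_form w (- w)) * \<Phi> x)"
  using op_op[of w "- w"] by (simp add: W_uminus op_0)

lemma unit_inverse: "t dvd 1 \<Longrightarrow> \<exists>t'. t' dvd 1 \<and> t * t' = (1::'r)"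
  by (metis dvd_def dvd_triv_right)

lemma U_op_Aut:
  assumes "w \<in> W" "t dvd 1" shows "is_Aut (U_op v smul chi (w, t))"
proof -
  obtain t' where t': "t * t' = 1" using unit_inverse[OF assms(2)] by blast
  define c where "c = chi (- B_form w (- w))"
  have c: "chi (B_form w (- w)) * c = 1" unfolding c_def by (rule chi_minus)
  have cc: "B_form (- w) w = B_form w (- w)"
    using assms(1) by (simp add: B_form_def W_iff dual_minus)
  have eq: "U_op v smul chi (w, t) = restrict (\<lambda>\<Phi> x. t * op w \<Phi> x) \<S>"
    by (rule extensionalityI[of _ \<S>]) (auto simp: U_op_def op_def mult.assoc split: prod.split)
  show ?thesis
    unfolding eq
  proof (rule is_AutI[where g="\<lambda>\<Phi> x. t' * c * op (- w) \<Phi> x"])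
    fix \<Phi> assume \<Phi>: "\<Phi> \<in> \<S>"
    show "(\<lambda>x. t * op w \<Phi> x) \<in> \<S>" "(\<lambda>x. t' * c * op (- w) \<Phi> x) \<in> \<S>"
      using op_Schwartz[OF assms(1) \<Phi>] op_Schwartz[OF W_uminus[OF assms(1)] \<Phi>] Schwartz_mult by auto
    have "op (- w) (op w \<Phi>) = (\<lambda>x. chi (B_form w (- w)) * \<Phi> x)"
      using op_inverse[OF W_uminus[OF assms(1)], of \<Phi>] by (simp add: cc)
    then have 1: "(\<lambda>x. t' * c * op (- w) (\<lambda>x. t * op w \<Phi> x) x) = (\<lambda>x. (t * t') * (chi (B_form w (- w)) * c) * \<Phi> x)"
      unfolding op_mult by (simp add: ac_simps)
    show "(\<lambda>x. t' * c * op (- w) (\<lambda>x. t * op w \<Phi> x) x) = \<Phi>" unfolding 1 t' c by simp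
    have 2: "(\<lambda>x. t * op w (\<lambda>x. t' * c * op (- w) \<Phi> x) x) = (\<lambda>x. (t * t') * (chi (B_form w (- w)) * c) * \<Phi> x)"
      unfolding op_mult by (simp add: op_inverse[OF assms(1)] ac_simps)
    show "(\<lambda>x. t * op w (\<lambda>x. t' * c * op (- w) \<Phi> x) x) = \<Phi>" unfolding 2 t' c by simp
  qed (simp_all add: op_add op_mult fun_eq_iff algebra_simps)
qed

lemma ind_Schwartz: "ind k \<in> \<S>"
  unfolding Schwartz_iff using test_ind by blast

lemma L_separates: "x \<noteq> 0 \<Longrightarrow> \<exists>k. x \<notin> L k"
proof -
  assume "x \<noteq> 0"
  then obtain b where b: "b \<in> E" "co b x \<noteq> 0" using co_eqI[of x 0] by auto
  then have "x \<notin> L (ord (co b x) + 1)" by (auto simp: L_def U_iff_ord)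
  then show ?thesis ..
qed

text \<open>Indicators of small lattices detect the translation part. Once it is known, two distinct
  functionals differ on a suitable vector by an element at which \<open>chi\<close> is not
  1.\<close>

lemma U_op_inj: "inj_on (U_op v smul chi) (W \<times> {t. t dvd 1})"
proof (rule inj_onI)
  fix a a' assume a: "a \<in> W \<times> {t. t dvd 1}" "a' \<in> W \<times> {t. t dvd 1}" "U_op v smul chi a = U_op v smul chi a'"
  obtain w t w' t' where at: "a = (w, t)" "a' = (w', t')" by fastforce
  have t: "t \<noteq> 0" using a(1) at by auto
  have W: "snd w \<in> dual_space smul" "snd w' \<in> dual_space smul" using a(1,2) at by (auto simp: W_iff)
  have eq: "t * (\<Phi> (x + fst w) * chi (snd w x)) = t' * (\<Phi> (x + fst w') * chi (snd w' x))" if "\<Phi> \<in> \<S>" for \<Phi> x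
    using fun_cong[OF fun_cong[OF a(3), of \<Phi>], of x] that by (simp add: at U_op_eq op_def)
  have f: "fst w = fst w'"
  proof (rule ccontr)
    assume "fst w \<noteq> fst w'"
    then obtain k where k: "fst w' - fst w \<notin> L k" using L_separates[of "fst w' - fst w"] by auto
    show False using eq[OF ind_Schwartz[of k], of "- fst w"] k L_0[of k] t chi_nonzero by (simp add: ind_def)
  qed
  have e2: "t * chi (snd w x) = t' * chi (snd w' x)" for x
  proof -
    obtain k where "x + fst w \<in> L k" using L_exists by blast
    then show ?thesis using eq[OF ind_Schwartz[of k], of x] f by (simp add: ind_def)
  qed
  have tt: "t = t'" using e2[of 0] by (simp add: dual_0 W)
  have "snd w x = snd w' x" for x
  proof (rule ccontr)
    assume ne: "snd w x \<noteq> snd w' x"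
    obtain c where c: "chi c \<noteq> 1" using chi(2) by blast
    define r where "r = c / (snd w x - snd w' x)"
    have "snd w (smul r x) = snd w' (smul r x) + c"
      using ne by (simp add: dual_smul W r_def field_simps)
    then have "chi (snd w' (smul r x)) * chi c = chi (snd w' (smul r x))"
      using e2[of "smul r x"] tt t by (simp add: chi_add)
    then show False using c chi_nonzero by simp
  qed
  then show "a = a'" using f tt at by (auto simp: prod_eq_iff)
qed

text \<open>The equation of \<open>mu_map\<close> and \<open>pi0_map\<close> with the inverses
  cleared: moving \<open>s\<close> past the operator of \<open>w\<close> turns it into the operator
  of \<open>\<sigma> w\<close>, with the phase prescribed by \<open>f_sigma\<close>. Linearity takes
  care of the scalars \<open>t\<close>.\<close>

definition intertwines where
  "intertwines \<sigma> s \<longleftrightarrow> (\<forall>w\<in>W. \<forall>\<Phi>\<in>\<S>. s (op w \<Phi>) = (\<lambda>x. chi (f_sigma \<sigma> w) * op (\<sigma> w) (s \<Phi>) x))"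

lemma intertwines_U:
  assumes "is_Aut s" "is_Sp \<sigma>" "intertwines \<sigma> s" "w \<in> W" "\<Phi> \<in> \<S>"
  shows "s (U_op v smul chi (w, t) \<Phi>) = U_op v smul chi (\<sigma> w, chi (f_sigma \<sigma> w) * t) (s \<Phi>)"
  using assms by (simp add: U_op_eq is_AutD op_Schwartz intertwines_def ac_simps)

lemma carrier_A: "carrier (A_grp smul chi) = W \<times> {t. t dvd 1}"
  by (simp add: A_grp_def)

lemma AA_subset: "AA v smul chi \<subseteq> {s. is_Aut s}"
  using U_op_Aut by (auto simp: AA_def carrier_A)

lemma conj_eq:
  assumes "is_Aut s" "is_Sp \<sigma>" "intertwines \<sigma> s" "w \<in> W" "t dvd 1"
  shows "s \<otimes>\<^bsub>Aut_S v smul\<^esub> U_op v smul chi (w, t) \<otimes>\<^bsub>Aut_S v smul\<^esub> inv\<^bsub>Aut_S v smul\<^esub> s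
    = U_op v smul chi (\<sigma> w, chi (f_sigma \<sigma> w) * t)"
proof -
  have u: "is_Aut (U_op v smul chi (w, t))" by (rule U_op_Aut[OF assms(4,5)])
  have "chi (f_sigma \<sigma> w) * t dvd 1" using chi_unit assms(5) by (metis mult_dvd_mono mult_1)
  then have u': "is_Aut (U_op v smul chi (\<sigma> w, chi (f_sigma \<sigma> w) * t))"
    by (intro U_op_Aut is_SpD[OF assms(2)] assms)
  have i: "is_Aut (inv\<^bsub>Aut_S v smul\<^esub> s)" using group.inv_closed[OF Aut_group, of s] assms(1) by simp
  have su: "is_Aut (s \<otimes>\<^bsub>Aut_S v smul\<^esub> U_op v smul chi (w, t))" by (rule Aut_mult_closed[OF assms(1) u])
  show ?thesis
  proof (rule Aut_eqI[OF Aut_mult_closed[OF su i] u'])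
    fix \<Phi> assume \<Phi>: "\<Phi> \<in> \<S>"
    note inv = Aut_inv[OF assms(1) \<Phi>]
    show "(s \<otimes>\<^bsub>Aut_S v smul\<^esub> U_op v smul chi (w, t) \<otimes>\<^bsub>Aut_S v smul\<^esub> inv\<^bsub>Aut_S v smul\<^esub> s) \<Phi>
      = U_op v smul chi (\<sigma> w, chi (f_sigma \<sigma> w) * t) \<Phi>"
      using inv intertwines_U[OF assms(1-4) inv(2), of t]
      by (simp add: Aut_mult_apply[OF su i \<Phi>] Aut_mult_apply[OF assms(1) u])
  qed
qed

lemma coset_conj_eq:
  "g <#\<^bsub>G\<^esub> H #>\<^bsub>G\<^esub> h = (\<lambda>x. g \<otimes>\<^bsub>G\<^esub> x \<otimes>\<^bsub>G\<^esub> h) ` H" for g h and G (structure)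
  by (auto simp: l_coset_def r_coset_def)

lemma mem_normalizer:
  "s \<in> normalizer (Aut_S v smul) (AA v smul chi) \<longleftrightarrow> is_Aut s \<and>
    (\<lambda>x. s \<otimes>\<^bsub>Aut_S v smul\<^esub> x \<otimes>\<^bsub>Aut_S v smul\<^esub> inv\<^bsub>Aut_S v smul\<^esub> s) ` AA v smul chi = AA v smul chi"
  using AA_subset by (simp add: normalizer_def stabilizer_def coset_conj_eq)

text \<open>Membership becomes an identity of operators, with no \<open>inv_into\<close> and no
  normalizer left: an intertwining \<open>s\<close> normalises the Heisenberg operators since
  \<open>\<sigma>\<close> is bijective, and \<open>U_op_inj\<close> recovers the automorphism from
  the conjugation.\<close>

lemma carrier_Mp_iff:
  "(\<sigma>, s) \<in> carrier (Mp v smul chi) \<longleftrightarrow> is_Sp \<sigma> \<and> is_Aut s \<and> intertwines \<sigma> s"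
proof
  assume "(\<sigma>, s) \<in> carrier (Mp v smul chi)"
  then have \<sigma>: "is_Sp \<sigma>" and s: "s \<in> normalizer (Aut_S v smul) (AA v smul chi)"
    and eq: "mu_map smul chi \<sigma> = pi0_map v smul chi s" by (auto simp: Mp_def BB0_grp_def)
  have A: "is_Aut s" using s mem_normalizer by blast
  have "intertwines \<sigma> s"
    unfolding intertwines_def
  proof (intro ballI)
    fix w \<Phi> assume w: "w \<in> W" and \<Phi>: "\<Phi> \<in> \<S>"
    let ?c = "s \<otimes>\<^bsub>Aut_S v smul\<^esub> U_op v smul chi (w, 1) \<otimes>\<^bsub>Aut_S v smul\<^esub> inv\<^bsub>Aut_S v smul\<^esub> s"
    have a: "(w, 1 :: 'r) \<in> W \<times> {t. t dvd 1}" using w by simp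
    have "U_op v smul chi (w, 1) \<in> AA v smul chi" unfolding AA_def carrier_A by (rule imageI[OF a])
    then have "?c \<in> (\<lambda>x. s \<otimes>\<^bsub>Aut_S v smul\<^esub> x \<otimes>\<^bsub>Aut_S v smul\<^esub> inv\<^bsub>Aut_S v smul\<^esub> s) ` AA v smul chi"
      by (rule imageI)
    also have "\<dots> = AA v smul chi" using s unfolding mem_normalizer by (rule conjunct2)
    finally have "?c \<in> AA v smul chi" .
    then have c: "?c \<in> U_op v smul chi ` (W \<times> {t. t dvd 1})" by (simp add: AA_def carrier_A)
    have "mu_map smul chi \<sigma> (w, 1) = (\<sigma> w, chi (f_sigma \<sigma> w))"
      using a by (simp add: mu_map_def carrier_A)
    moreover have "pi0_map v smul chi s (w, 1) = inv_into (W \<times> {t. t dvd 1}) (U_op v smul chi) ?c"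
      using a by (simp add: pi0_map_def carrier_A)
    ultimately have "U_op v smul chi (\<sigma> w, chi (f_sigma \<sigma> w)) = ?c"
      using f_inv_into_f[OF c] eq by simp
    then have e: "U_op v smul chi (\<sigma> w, chi (f_sigma \<sigma> w)) (s \<Phi>) = ?c (s \<Phi>)" by simp
    have u: "is_Aut (U_op v smul chi (w, 1))" by (rule U_op_Aut[OF w]) simp
    have i: "is_Aut (inv\<^bsub>Aut_S v smul\<^esub> s)" using Aut_inv(1)[OF A \<Phi>] .
    have "?c (s \<Phi>) = s (U_op v smul chi (w, 1) \<Phi>)"
      using Aut_mult_apply[OF Aut_mult_closed[OF A u] i is_AutD(2)[OF A \<Phi>]] Aut_inv(4)[OF A \<Phi>] Aut_mult_apply[OF A u \<Phi>] by simp
    then show "s (op w \<Phi>) = (\<lambda>x. chi (f_sigma \<sigma> w) * op (\<sigma> w) (s \<Phi>) x)"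
      using e \<Phi> is_AutD(2)[OF A \<Phi>] by (simp add: U_op_eq)
  qed
  then show "is_Sp \<sigma> \<and> is_Aut s \<and> intertwines \<sigma> s" using \<sigma> A by blast
next
  assume *: "is_Sp \<sigma> \<and> is_Aut s \<and> intertwines \<sigma> s"
  then have \<sigma>: "is_Sp \<sigma>" and A: "is_Aut s" and int: "intertwines \<sigma> s" by auto
  note conj = conj_eq[OF A \<sigma> int]
  let ?f = "\<lambda>x. s \<otimes>\<^bsub>Aut_S v smul\<^esub> x \<otimes>\<^bsub>Aut_S v smul\<^esub> inv\<^bsub>Aut_S v smul\<^esub> s"
  have unit: "chi y * t dvd 1" if "t dvd 1" for t y using chi_unit[of y] that by (metis mult_dvd_mono mult_1)
  have "?f ` AA v smul chi = AA v smul chi"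
  proof
    show "?f ` AA v smul chi \<subseteq> AA v smul chi"
      using conj unit is_SpD(2)[OF \<sigma>] by (auto simp: AA_def carrier_A)
    show "AA v smul chi \<subseteq> ?f ` AA v smul chi"
    proof
      fix x assume "x \<in> AA v smul chi"
      then obtain w t where wt: "w \<in> W" "t dvd 1" "x = U_op v smul chi (w, t)" by (auto simp: AA_def carrier_A)
      define w' where "w' = (inv\<^bsub>Sp smul\<^esub> \<sigma>) w"
      have w': "w' \<in> W" "\<sigma> w' = w" using Sp_inv[OF \<sigma> wt(1)] by (auto simp: w'_def)
      \<comment> \<open>Compensates the phase that conjugation introduces.\<close>
      define t' where "t' = chi (- f_sigma \<sigma> w') * t"
      have t': "t' dvd 1" "chi (f_sigma \<sigma> w') * t' = t"
        using unit[OF wt(2)] chi_minus[of "f_sigma \<sigma> w'"] by (auto simp: t'_def mult.assoc[symmetric])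
      have "?f (U_op v smul chi (w', t')) = x" using conj[OF w'(1) t'(1)] w' t' wt(3) by simp
      moreover have "U_op v smul chi (w', t') \<in> AA v smul chi" using w' t' by (auto simp: AA_def carrier_A)
      ultimately show "x \<in> ?f ` AA v smul chi" by blast
    qed
  qed
  then have n: "s \<in> normalizer (Aut_S v smul) (AA v smul chi)" using A mem_normalizer by blast
  have "mu_map smul chi \<sigma> = pi0_map v smul chi s"
  proof
    fix a show "mu_map smul chi \<sigma> a = pi0_map v smul chi s a"
    proof (cases "a \<in> W \<times> {t. t dvd 1}")
      case True
      then obtain w t where a: "a = (w, t)" "w \<in> W" "t dvd 1" by auto
      have m: "(\<sigma> w, chi (f_sigma \<sigma> w) * t) \<in> W \<times> {t. t dvd 1}"
        using a is_SpD(2)[OF \<sigma>] unit by simp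
      have "pi0_map v smul chi s a = inv_into (W \<times> {t. t dvd 1}) (U_op v smul chi) (U_op v smul chi (\<sigma> w, chi (f_sigma \<sigma> w) * t))"
        using True conj[OF a(2,3)] by (simp add: pi0_map_def carrier_A a(1))
      also have "\<dots> = (\<sigma> w, chi (f_sigma \<sigma> w) * t)" by (rule inv_into_f_f[OF U_op_inj m])
      finally show ?thesis using True by (simp add: mu_map_def carrier_A a(1))
    qed (simp add: mu_map_def pi0_map_def carrier_A)
  qed
  then show "(\<sigma>, s) \<in> carrier (Mp v smul chi)" using \<sigma> n by (simp add: Mp_def BB0_grp_def)
qed

text \<open>The cocycle rule that makes the phases in \<open>intertwines\<close> compose.\<close>

lemma f_sigma_mult: "is_Sp \<sigma> \<Longrightarrow> is_Sp \<tau> \<Longrightarrow> w \<in> W \<Longrightarrow> f_sigma (\<sigma> \<otimes>\<^bsub>Sp smul\<^esub> \<tau>) w = f_sigma \<sigma> (\<tau> w) + f_sigma \<tau> w"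
  by (simp add: f_sigma_def Sp_mult_apply add_divide_distrib[symmetric])

lemma Mp_eq: "Mp v smul chi = (Sp smul \<times>\<times> Aut_S v smul) \<lparr>carrier := carrier (Mp v smul chi)\<rparr>"
  by (simp add: Mp_def BB0_grp_def DirProd_def)

lemma Mp_subgroup: "subgroup (carrier (Mp v smul chi)) (Sp smul \<times>\<times> Aut_S v smul)"
proof (rule group.subgroupI[OF DirProd_group[OF Sp_group Aut_group]])
  show "carrier (Mp v smul chi) \<subseteq> carrier (Sp smul \<times>\<times> Aut_S v smul)" using carrier_Mp_iff by auto
  have "is_Sp (\<lambda>w\<in>W. w)" using group.is_monoid[OF Sp_group, THEN monoid.one_closed] by (simp add: Sp_one)
  moreover have "is_Aut (\<lambda>\<Phi>\<in>\<S>. \<Phi>)" using group.is_monoid[OF Aut_group, THEN monoid.one_closed] by (simp add: Aut_one)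
  moreover have "intertwines (\<lambda>w\<in>W. w) (\<lambda>\<Phi>\<in>\<S>. \<Phi>)"
    by (simp add: intertwines_def op_Schwartz f_sigma_def)
  ultimately show "carrier (Mp v smul chi) \<noteq> {}" using carrier_Mp_iff by blast
next
  fix a b assume a: "a \<in> carrier (Mp v smul chi)" and b: "b \<in> carrier (Mp v smul chi)"
  obtain \<sigma> s \<tau> t where ab: "a = (\<sigma>, s)" "b = (\<tau>, t)" by fastforce
  have s: "is_Sp \<sigma>" "is_Aut s" "intertwines \<sigma> s" and t: "is_Sp \<tau>" "is_Aut t" "intertwines \<tau> t"
    using a b ab carrier_Mp_iff by auto
  have "intertwines (\<sigma> \<otimes>\<^bsub>Sp smul\<^esub> \<tau>) (s \<otimes>\<^bsub>Aut_S v smul\<^esub> t)"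
    unfolding intertwines_def
  proof (intro ballI)
    fix w \<Phi> assume w: "w \<in> W" "\<Phi> \<in> \<S>"
    have tw: "\<tau> w \<in> W" "t \<Phi> \<in> \<S>" using w is_SpD(2)[OF t(1)] is_AutD(2)[OF t(2)] by auto
    have "(s \<otimes>\<^bsub>Aut_S v smul\<^esub> t) (op w \<Phi>) = s (t (op w \<Phi>))" by (rule Aut_mult_apply[OF s(2) t(2) op_Schwartz[OF w]])
    also have "t (op w \<Phi>) = (\<lambda>x. chi (f_sigma \<tau> w) * op (\<tau> w) (t \<Phi>) x)" using t(3) w by (simp add: intertwines_def)
    also have "s (\<lambda>x. chi (f_sigma \<tau> w) * op (\<tau> w) (t \<Phi>) x) = (\<lambda>x. chi (f_sigma \<tau> w) * s (op (\<tau> w) (t \<Phi>)) x)"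
      by (rule is_AutD(4)[OF s(2) op_Schwartz[OF tw]])
    also have "s (op (\<tau> w) (t \<Phi>)) = (\<lambda>x. chi (f_sigma \<sigma> (\<tau> w)) * op (\<sigma> (\<tau> w)) (s (t \<Phi>)) x)"
      using s(3) tw by (simp add: intertwines_def)
    finally show "(s \<otimes>\<^bsub>Aut_S v smul\<^esub> t) (op w \<Phi>) = (\<lambda>x. chi (f_sigma (\<sigma> \<otimes>\<^bsub>Sp smul\<^esub> \<tau>) w)
        * op ((\<sigma> \<otimes>\<^bsub>Sp smul\<^esub> \<tau>) w) ((s \<otimes>\<^bsub>Aut_S v smul\<^esub> t) \<Phi>) x)"
      using w by (simp add: f_sigma_mult[OF s(1) t(1)] Sp_mult_apply[OF s(1) t(1)] Aut_mult_apply[OF s(2) t(2)] chi_add ac_simps)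
  qed
  moreover have "is_Sp (\<sigma> \<otimes>\<^bsub>Sp smul\<^esub> \<tau>)" using monoid.m_closed[OF group.is_monoid[OF Sp_group], of \<sigma> \<tau>] s t by simp
  ultimately show "a \<otimes>\<^bsub>Sp smul \<times>\<times> Aut_S v smul\<^esub> b \<in> carrier (Mp v smul chi)"
    using Aut_mult_closed[OF s(2) t(2)] by (simp add: ab carrier_Mp_iff)
next
  fix a assume a: "a \<in> carrier (Mp v smul chi)"
  obtain \<sigma> s where ab: "a = (\<sigma>, s)" by fastforce
  have s: "is_Sp \<sigma>" "is_Aut s" "intertwines \<sigma> s" using a ab carrier_Mp_iff by auto
  let ?\<sigma> = "inv\<^bsub>Sp smul\<^esub> \<sigma>" and ?s = "inv\<^bsub>Aut_S v smul\<^esub> s"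
  have i: "is_Sp ?\<sigma>" "is_Aut ?s"
    using group.inv_closed[OF Sp_group, of \<sigma>] group.inv_closed[OF Aut_group, of s] s by simp_all
  have "intertwines ?\<sigma> ?s"
    unfolding intertwines_def
  proof (intro ballI)
    fix w \<Phi> assume w: "w \<in> W" "\<Phi> \<in> \<S>"
    note sw = Sp_inv[OF s(1) w(1)] and ss = Aut_inv[OF s(2) w(2)]
    have f: "f_sigma ?\<sigma> w = - f_sigma \<sigma> (?\<sigma> w)"
      by (simp add: f_sigma_def sw minus_divide_left)
    have cl: "(\<lambda>x. chi (f_sigma ?\<sigma> w) * op (?\<sigma> w) (?s \<Phi>) x) \<in> \<S>" by (intro Schwartz_mult op_Schwartz sw ss)
    show "?s (op w \<Phi>) = (\<lambda>x. chi (f_sigma ?\<sigma> w) * op (?\<sigma> w) (?s \<Phi>) x)"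
    proof (rule Bij_inj[OF is_AutD(1)[OF s(2)] _ cl])
      show "?s (op w \<Phi>) \<in> \<S>" by (intro is_AutD[OF i(2)] op_Schwartz w)
      have "s (\<lambda>x. chi (f_sigma ?\<sigma> w) * op (?\<sigma> w) (?s \<Phi>) x) = (\<lambda>x. chi (f_sigma ?\<sigma> w) * s (op (?\<sigma> w) (?s \<Phi>)) x)"
        by (rule is_AutD(4)[OF s(2)]) (intro op_Schwartz sw ss)
      also have "s (op (?\<sigma> w) (?s \<Phi>)) = (\<lambda>x. chi (f_sigma \<sigma> (?\<sigma> w)) * op w \<Phi> x)"
        using s(3) sw ss by (simp add: intertwines_def)
      also have "(\<lambda>x. chi (f_sigma ?\<sigma> w) * (chi (f_sigma \<sigma> (?\<sigma> w)) * op w \<Phi> x)) = op w \<Phi>"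
      proof -
        have "chi (f_sigma ?\<sigma> w) * chi (f_sigma \<sigma> (?\<sigma> w)) = 1"
          unfolding f using chi_minus[of "f_sigma \<sigma> (?\<sigma> w)"] by (simp add: mult.commute)
        then show ?thesis by (simp only: mult.assoc[symmetric] mult_1)
      qed
      finally show "s (?s (op w \<Phi>)) = s (\<lambda>x. chi (f_sigma ?\<sigma> w) * op (?\<sigma> w) (?s \<Phi>) x)"
        using Aut_inv(3)[OF s(2) op_Schwartz[OF w]] by simp
    qed
  qed
  then show "inv\<^bsub>Sp smul \<times>\<times> Aut_S v smul\<^esub> a \<in> carrier (Mp v smul chi)"
    using i s by (simp add: ab carrier_Mp_iff inv_DirProd[OF Sp_group Aut_group])
qed

lemma Mp_group: "group (Mp v smul chi)"
  by (subst Mp_eq) (rule subgroup.subgroup_is_group[OF Mp_subgroup DirProd_group[OF Sp_group Aut_group]])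

lemma Mp_mult: "(\<sigma>, s) \<otimes>\<^bsub>Mp v smul chi\<^esub> (\<tau>, t) = (\<sigma> \<otimes>\<^bsub>Sp smul\<^esub> \<tau>, s \<otimes>\<^bsub>Aut_S v smul\<^esub> t)"
  by (subst Mp_eq) simp

lemma Mp_one: "\<one>\<^bsub>Mp v smul chi\<^esub> = (\<lambda>w\<in>W. w, \<lambda>\<Phi>\<in>\<S>. \<Phi>)"
  by (subst Mp_eq) (simp add: DirProd_def Sp_one Aut_one)


subsection \<open>Schur's lemma\<close>

lemma Schwartz_0: "(\<lambda>_. 0) \<in> \<S>"
  unfolding Schwartz_iff by (intro exI[of _ 0]) (simp add: test_def)

lemma Aut_0: "is_Aut s \<Longrightarrow> s (\<lambda>_. 0) = (\<lambda>_. 0)"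
  using is_AutD(4)[OF _ Schwartz_0, of s 0] by simp

lemma Schwartz_sum: "(\<And>i. i \<in> A \<Longrightarrow> f i \<in> \<S>) \<Longrightarrow> (\<lambda>x. \<Sum>i\<in>A. f i x) \<in> \<S>"
proof (induction A rule: infinite_finite_induct)
  case (insert i A)
  have "(\<lambda>x. \<Sum>i\<in>insert i A. f i x) = f i + (\<lambda>x. \<Sum>i\<in>A. f i x)"
    using insert.hyps by (simp add: fun_eq_iff)
  then show ?case using insert by (simp add: Schwartz_add)
qed (simp_all add: Schwartz_0)

lemma Aut_sum:
  assumes "is_Aut s" "finite A" "\<And>i. i \<in> A \<Longrightarrow> f i \<in> \<S>"
  shows "s (\<lambda>x. \<Sum>i\<in>A. f i x) = (\<lambda>x. \<Sum>i\<in>A. s (f i) x)"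
  using assms(2,3)
proof (induction A)
  case empty
  then show ?case using Aut_0[OF assms(1)] by simp
next
  case (insert i A)
  have "(\<lambda>x. \<Sum>i\<in>insert i A. f i x) = f i + (\<lambda>x. \<Sum>i\<in>A. f i x)"
    using insert.hyps by (simp add: fun_eq_iff)
  then have "s (\<lambda>x. \<Sum>i\<in>insert i A. f i x) = s (f i) + s (\<lambda>x. \<Sum>i\<in>A. f i x)"
    using is_AutD(3)[OF assms(1), of "f i" "\<lambda>x. \<Sum>i\<in>A. f i x"] insert.prems by (simp add: Schwartz_sum)
  also have "\<dots> = (\<lambda>x. \<Sum>i\<in>insert i A. s (f i) x)"
    using insert by (simp add: fun_eq_iff)
  finally show ?case .
qed

definition cut :: "'x \<Rightarrow> int \<Rightarrow> ('x \<Rightarrow> 'r) \<Rightarrow> 'x \<Rightarrow> 'r" where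
  "cut b N \<Phi> = (\<lambda>x. if co b x \<in> U N then \<Phi> x else 0)"

text \<open>By orthogonality of characters, restriction of the support in one coordinate is a finite
  average of multiplications by characters, hence of Heisenberg operators. Whatever commutes with
  those commutes with \<open>cut\<close>.\<close>

lemma cut_eq:
  assumes "test j k \<Phi>" "b \<in> E" "j \<le> N" "transversal T (U (d - N)) (U (d - j))"
  shows "cut b N \<Phi> = (\<lambda>x. \<Sum>t\<in>T. qz (- (N - j)) * op (0, \<lambda>x. t * co b x) \<Phi> x)"
proof
  fix x
  have sum: "(\<Sum>t\<in>T. qz (- (N - j)) * op (0, \<lambda>x. t * co b x) \<Phi> x) = qz (- (N - j)) * (\<Sum>t\<in>T. chi (co b x * t)) * \<Phi> x"
    by (simp add: op_def sum_distrib_left sum_distrib_right ac_simps)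
  show "cut b N \<Phi> x = (\<Sum>t\<in>T. qz (- (N - j)) * op (0, \<lambda>x. t * co b x) \<Phi> x)"
  proof (cases "x \<in> L j")
    case True
    then have y: "co b x \<in> U (d - (d - j))" using assms(2) by (simp add: L_def)
    have per: "chi (co b x * (g + h)) = chi (co b x * g)" if "h \<in> U (d - j)" for g h
    proof -
      have "chi (co b x * h) = 1" using y that chi_annihilator by blast
      then show ?thesis by (simp add: distrib_left chi_add)
    qed
    have "(\<Sum>t\<in>T. chi (co b x * t)) = tsum (U (d - N)) (U (d - j)) (\<lambda>t. chi (co b x * t))"
      by (rule tsum_eq[OF assms(4) U_subgroup, symmetric]) (rule per)
    also have "\<dots> = (if co b x \<in> U N then qz (N - j) else 0)"
      using tsum_linear[OF _ y, of "d - N"] assms(3) by simp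
    finally have T: "(\<Sum>t\<in>T. chi (co b x * t)) = (if co b x \<in> U N then qz (N - j) else 0)" .
    show ?thesis unfolding sum T using qz_unit[of "- (N - j)"] by (simp add: cut_def)
  next
    case False
    then show ?thesis unfolding sum using assms(1) by (simp add: cut_def test_def)
  qed
qed

lemma common_test: "\<Phi> \<in> \<S> \<Longrightarrow> \<Psi> \<in> \<S> \<Longrightarrow> \<exists>j k. j \<le> n \<and> test j k \<Phi> \<and> test j k \<Psi>"
proof -
  assume "\<Phi> \<in> \<S>" "\<Psi> \<in> \<S>"
  then obtain j k j' k' where t: "test j k \<Phi>" "test j' k' \<Psi>" unfolding Schwartz_iff by blast
  have "test (min n (min j j')) (max k k') \<Phi>" "test (min n (min j j')) (max k k') \<Psi>"
    using test_mono[OF t(1)] test_mono[OF t(2)] by simp_all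
  moreover have "min n (min j j') \<le> n" by simp
  ultimately show ?thesis by blast
qed

lemma scaled_co_W: "(0, \<lambda>x. t * co b x) \<in> W"
  by (simp add: W_iff dual_iff co_add co_smul algebra_simps)

lemma cut_Schwartz: "b \<in> E \<Longrightarrow> \<Phi> \<in> \<S> \<Longrightarrow> cut b N \<Phi> \<in> \<S>"
proof -
  assume b: "b \<in> E" and \<Phi>: "\<Phi> \<in> \<S>"
  obtain j k where jk: "j \<le> N" "test j k \<Phi>" using common_test[OF \<Phi> \<Phi>] by blast
  obtain T where T: "transversal T (U (d - N)) (U (d - j))" using transversal_exists U_subgroup by blast
  show ?thesis unfolding cut_eq[OF jk(2) b jk(1) T]
    by (intro Schwartz_sum Schwartz_mult op_Schwartz scaled_co_W \<Phi>)
qed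

lemma commute_cut:
  assumes s: "is_Aut s" and comm: "\<And>w \<Phi>. w \<in> W \<Longrightarrow> \<Phi> \<in> \<S> \<Longrightarrow> s (op w \<Phi>) = op w (s \<Phi>)"
    and b: "b \<in> E" and \<Phi>: "\<Phi> \<in> \<S>"
  shows "s (cut b N \<Phi>) = cut b N (s \<Phi>)"
proof -
  obtain j k where jk: "j \<le> N" "test j k \<Phi>" "test j k (s \<Phi>)" using common_test[OF \<Phi> is_AutD(2)[OF s \<Phi>]] by blast
  obtain T where T: "transversal T (U (d - N)) (U (d - j))" using transversal_exists U_subgroup by blast
  have fT: "finite T" using U_transversal_finite[OF T] jk by simp
  have "s (cut b N \<Phi>) = (\<lambda>x. \<Sum>t\<in>T. s (\<lambda>x. qz (- (N - j)) * op (0, \<lambda>x. t * co b x) \<Phi> x) x)"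
    unfolding cut_eq[OF jk(2) b jk(1) T]
    by (rule Aut_sum[OF s fT]) (intro Schwartz_mult op_Schwartz scaled_co_W \<Phi>)
  also have "\<dots> = cut b N (s \<Phi>)"
    unfolding cut_eq[OF jk(3) b jk(1) T] is_AutD(4)[OF s op_Schwartz[OF scaled_co_W \<Phi>]] comm[OF scaled_co_W \<Phi>] ..
  finally show ?thesis .
qed

definition cuts :: "'x set \<Rightarrow> int \<Rightarrow> ('x \<Rightarrow> 'r) \<Rightarrow> 'x \<Rightarrow> 'r" where
  "cuts A N \<Phi> = (\<lambda>x. if \<forall>b\<in>A. co b x \<in> U N then \<Phi> x else 0)"

lemma commute_cuts:
  assumes s: "is_Aut s" and comm: "\<And>w \<Phi>. w \<in> W \<Longrightarrow> \<Phi> \<in> \<S> \<Longrightarrow> s (op w \<Phi>) = op w (s \<Phi>)"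
    and \<Phi>: "\<Phi> \<in> \<S>"
  shows "s (cuts E N \<Phi>) = cuts E N (s \<Phi>)"
proof -
  have "finite A \<Longrightarrow> A \<subseteq> E \<Longrightarrow> cuts A N \<Phi> \<in> \<S> \<and> s (cuts A N \<Phi>) = cuts A N (s \<Phi>)" for A
  proof (induction A rule: finite_induct)
    case empty
    then show ?case using \<Phi> by (simp add: cuts_def)
  next
    case (insert b A)
    have e: "cuts (insert b A) N \<Psi> = cut b N (cuts A N \<Psi>)" for \<Psi>
      by (rule ext) (simp add: cuts_def cut_def)
    have b: "b \<in> E" and IH: "cuts A N \<Phi> \<in> \<S>" "s (cuts A N \<Phi>) = cuts A N (s \<Phi>)" using insert by auto
    show ?case unfolding e using commute_cut[OF s comm b IH(1), of N] cut_Schwartz[OF b IH(1)] IH(2) by simp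
  qed
  then show ?thesis using E_finite by blast
qed

lemma id_f_sigma: "w \<in> W \<Longrightarrow> f_sigma (\<lambda>w\<in>W. w) w = 0"
  by (simp add: f_sigma_def)

text \<open>Commuting with \<open>cuts\<close> shows that \<open>s \<Phi> 0\<close> is
  \<open>\<Phi> 0\<close> times the value of \<open>s (ind N)\<close> at 0, for any lattice
  \<open>L N\<close> on which \<open>\<Phi>\<close> is constant. That factor does not depend on
  \<open>N\<close>, and translations carry the statement from 0 to every point.\<close>

lemma schur:
  assumes s: "is_Aut s" and int: "intertwines (\<lambda>w\<in>W. w) s"
  shows "\<exists>t. t dvd 1 \<and> s = (\<lambda>\<Phi>\<in>\<S>. \<lambda>x. t * \<Phi> x)"
proof -
  have comm: "s (op w \<Phi>) = op w (s \<Phi>)" if "w \<in> W" "\<Phi> \<in> \<S>" for w \<Phi>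
    using int that by (simp add: intertwines_def id_f_sigma)
  have cuts_ind: "cuts E N \<Phi> = (\<lambda>x. \<Phi> 0 * ind N x)" if "\<And>x. x \<in> L N \<Longrightarrow> \<Phi> x = \<Phi> 0" for \<Phi> N
    by (rule ext) (use that in \<open>auto simp: cuts_def ind_def L_def\<close>)
  have cuts_0: "cuts E N \<Phi> 0 = \<Phi> 0" for \<Phi> N by (simp add: cuts_def U_0)
  have step: "s \<Phi> 0 = \<Phi> 0 * s (ind N) 0" if \<Phi>: "\<Phi> \<in> \<S>" "\<And>x. x \<in> L N \<Longrightarrow> \<Phi> x = \<Phi> 0" for \<Phi> N
  proof -
    have eq: "cuts E N \<Phi> = (\<lambda>x. \<Phi> 0 * ind N x)" by (rule cuts_ind) (rule \<Phi>(2))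
    have "s \<Phi> 0 = cuts E N (s \<Phi>) 0" by (simp only: cuts_0)
    also have "\<dots> = s (cuts E N \<Phi>) 0" using commute_cuts[OF s comm \<Phi>(1), of N] by simp
    also have "\<dots> = s (\<lambda>x. \<Phi> 0 * ind N x) 0" by (simp only: eq)
    also have "\<dots> = \<Phi> 0 * s (ind N) 0" by (simp only: is_AutD(4)[OF s ind_Schwartz])
    finally show ?thesis .
  qed
  define t where "t = s (ind 0) 0"
  have ind: "s (ind N) 0 = t" for N
  proof -
    \<comment> \<open>A lattice containing both \<open>L 0\<close> and \<open>L N\<close> links
      their indicators.\<close>
    have "s (ind (min 0 N)) 0 = ind (min 0 N) 0 * s (ind M) 0" if "min 0 N \<le> M" for M
      by (rule step[OF ind_Schwartz]) (use L_mono[OF that] L_0 in \<open>auto simp: ind_def\<close>)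
    from this[of 0] this[of N] show ?thesis by (simp add: t_def ind_def L_0)
  qed
  have eq: "s \<Phi> x = t * \<Phi> x" if \<Phi>: "\<Phi> \<in> \<S>" for \<Phi> x
  proof -
    obtain j k where jk: "test j k \<Phi>" using \<Phi> unfolding Schwartz_iff by blast
    have x: "(x, \<lambda>_. 0) \<in> W" by (simp add: W_iff dual_iff)
    have o: "op (x, \<lambda>_. 0) \<Psi> = (\<lambda>y. \<Psi> (y + x))" for \<Psi> by (simp add: op_def)
    have "s \<Phi> x = op (x, \<lambda>_. 0) (s \<Phi>) 0" by (simp add: o)
    also have "\<dots> = s (op (x, \<lambda>_. 0) \<Phi>) 0" by (simp only: comm[OF x \<Phi>])
    also have "\<dots> = op (x, \<lambda>_. 0) \<Phi> 0 * s (ind k) 0"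
    proof (rule step[OF op_Schwartz[OF x \<Phi>]])
      fix y assume "y \<in> L k"
      then have "\<Phi> (x + y) = \<Phi> x" using jk by (simp add: test_def)
      then show "op (x, \<lambda>_. 0) \<Phi> y = op (x, \<lambda>_. 0) \<Phi> 0" by (simp add: o add.commute)
    qed
    finally show ?thesis by (simp add: ind o mult.commute)
  qed
  \<comment> \<open>Surjectivity of \<open>s\<close> provides the inverse of the scalar.\<close>
  define \<Phi> where "\<Phi> = (inv\<^bsub>Aut_S v smul\<^esub> s) (ind 0)"
  have "\<Phi> \<in> \<S>" "s \<Phi> = ind 0" using Aut_inv[OF s ind_Schwartz] by (auto simp: \<Phi>_def)
  then have "t * \<Phi> 0 = 1" using eq[of \<Phi> 0] by (simp add: ind_def L_0)
  then have "t dvd 1" by (metis dvdI)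
  moreover have "s = (\<lambda>\<Phi>\<in>\<S>. \<lambda>x. t * \<Phi> x)"
    by (rule extensionalityI[of _ \<S>]) (use eq is_AutD(1)[OF s] in \<open>auto simp: Bij_def\<close>)
  ultimately show ?thesis by blast
qed

subsection \<open>Multiplication by characters of the second degree\<close>

definition mulq :: "('x \<Rightarrow> 'x \<Rightarrow> 'f) \<Rightarrow> ('x \<Rightarrow> 'r) \<Rightarrow> 'x \<Rightarrow> 'r" where
  "mulq \<beta> \<Phi> = (\<lambda>x. chi (\<beta> x x) * \<Phi> x)"

lemma bilin_add_left: "bilin \<beta> \<Longrightarrow> \<beta> (x + y) z = \<beta> x z + \<beta> y z"
  and bilin_smul_left: "bilin \<beta> \<Longrightarrow> \<beta> (smul a x) z = a * \<beta> x z"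
  unfolding bilin_def by blast+

lemma bilin_0: "bilin (\<lambda>_ _. 0)"
  by (simp add: bilin_def)

lemma bilin_plus:
  assumes "bilin \<beta>" "bilin \<beta>'" shows "bilin (\<lambda>x y. \<beta> x y + \<beta>' x y)"
  unfolding bilin_def[of "\<lambda>x y. \<beta> x y + \<beta>' x y"]
proof (intro conjI allI)
  show "\<beta> x y + \<beta>' x y = \<beta> y x + \<beta>' y x" for x y
    by (simp only: bilin_sym[OF assms(1), of x y] bilin_sym[OF assms(2), of x y])
qed (simp_all add: bilin_add_left[OF assms(1)] bilin_add_left[OF assms(2)] bilin_smul_left[OF assms(1)]
    bilin_smul_left[OF assms(2)] distrib_left)

lemma bilin_mult:
  assumes "bilin \<beta>" shows "bilin (\<lambda>x y. a * \<beta> x y)"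
  unfolding bilin_def[of "\<lambda>x y. a * \<beta> x y"]
proof (intro conjI allI)
  show "a * \<beta> x y = a * \<beta> y x" for x y by (simp only: bilin_sym[OF assms, of x y])
qed (simp_all add: bilin_add_left[OF assms] bilin_smul_left[OF assms] distrib_left)

lemma bilin_rank1: "\<phi> \<in> dual_space smul \<Longrightarrow> bilin (\<lambda>x y. a * \<phi> x * \<phi> y)"
  by (simp add: bilin_def dual_iff algebra_simps)

lemma bilin_uminus: "bilin \<beta> \<Longrightarrow> bilin (\<lambda>x y. - \<beta> x y)"
  using bilin_mult[of \<beta> "- 1"] by simp

lemma bilin_add_right: "bilin \<beta> \<Longrightarrow> \<beta> x (y + z) = \<beta> x y + \<beta> x z"
  by (rule dual_add[OF bilin_dual])

lemma bilin_smul_right: "bilin \<beta> \<Longrightarrow> \<beta> x (smul a y) = a * \<beta> x y"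
  by (rule dual_smul[OF bilin_dual])

lemma bilin_square: "bilin \<beta> \<Longrightarrow> \<beta> (x + y) (x + y) = \<beta> x x + 2 * \<beta> x y + \<beta> y y"
  using bilin_sym[of \<beta> y x] by (simp add: bilin_add_left bilin_add_right)

text \<open>On the bounded support the cross term \<open>2 * \<beta> x u\<close> and the term
  \<open>\<beta> u u\<close> become trivial for \<open>u\<close> in a fine lattice. The period
  worsens, but the support does not grow.\<close>

lemma mulq_test:
  assumes \<beta>: "bilin \<beta>" and t: "test j k \<Phi>" shows "\<exists>k'. test j k' (mulq \<beta> \<Phi>)"
proof -
  obtain B where B: "\<forall>i k. \<forall>x\<in>L i. \<forall>y\<in>L k. \<beta> x y \<in> U (i + k + B)" using bilin_bound[OF \<beta>] by blast
  define k' where "k' = max (max j k) (max (d - B - j - ord 2) (\<bar>d\<bar> + \<bar>B\<bar>))"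
  have le: "j \<le> k'" "k \<le> k'" "d \<le> ord 2 + (j + k' + B)" "\<bar>d\<bar> + \<bar>B\<bar> \<le> k'" by (auto simp: k'_def)
  have le': "d \<le> k' + k' + B" using le(4) by linarith
  have "test j k' (mulq \<beta> \<Phi>)"
    unfolding test_def
  proof (intro conjI allI ballI impI)
    fix x u assume u: "u \<in> L k'"
    have per: "\<Phi> (x + u) = \<Phi> x" using t L_monoD[OF u le(2)] by (simp add: test_def)
    show "mulq \<beta> \<Phi> (x + u) = mulq \<beta> \<Phi> x"
    proof (cases "x \<in> L j")
      case True
      have "\<beta> x u \<in> U (j + k' + B)" "\<beta> u u \<in> U (k' + k' + B)" using B True u by blast+
      then have "2 * \<beta> x u \<in> U (ord 2 + (j + k' + B))" "\<beta> u u \<in> U d"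
        using U_mult[OF U_ord] U_monoD le' by blast+
      then have "chi (2 * \<beta> x u) = 1" "chi (\<beta> u u) = 1" using chi_U U_monoD le(3) by blast+
      then show ?thesis using per by (simp add: mulq_def bilin_square[OF \<beta>] chi_add)
    next
      case False
      then show ?thesis using per t by (simp add: mulq_def test_def)
    qed
  next
    fix x assume "x \<notin> L j"
    then show "mulq \<beta> \<Phi> x = 0" using t by (simp add: mulq_def test_def)
  qed
  then show ?thesis ..
qed

lemma mulq_Schwartz: "bilin \<beta> \<Longrightarrow> \<Phi> \<in> \<S> \<Longrightarrow> mulq \<beta> \<Phi> \<in> \<S>"
  unfolding Schwartz_iff using mulq_test by blast

lemma mulq_mulq: "mulq \<beta> (mulq \<beta>' \<Phi>) = mulq (\<lambda>x y. \<beta> x y + \<beta>' x y) \<Phi>"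
  by (simp add: mulq_def chi_add fun_eq_iff)

lemma mulq_0: "mulq (\<lambda>_ _. 0) \<Phi> = \<Phi>"
  by (simp add: mulq_def)

definition Mop where "Mop \<beta> = restrict (mulq \<beta>) \<S>"

lemma Mop_Aut: "bilin \<beta> \<Longrightarrow> is_Aut (Mop \<beta>)"
  unfolding Mop_def
proof (rule is_AutI[where g="mulq (\<lambda>x y. - \<beta> x y)"])
  assume \<beta>: "bilin \<beta>"
  show "mulq \<beta> \<Phi> \<in> \<S>" "mulq (\<lambda>x y. - \<beta> x y) \<Phi> \<in> \<S>" if "\<Phi> \<in> \<S>" for \<Phi>
    using mulq_Schwartz[OF \<beta> that] mulq_Schwartz[OF bilin_uminus[OF \<beta>] that] by blast+
  show "mulq (\<lambda>x y. - \<beta> x y) (mulq \<beta> \<Phi>) = \<Phi>" "mulq \<beta> (mulq (\<lambda>x y. - \<beta> x y) \<Phi>) = \<Phi>" for \<Phi>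
    by (simp_all add: mulq_mulq mulq_0)
qed (simp_all add: mulq_def fun_eq_iff algebra_simps)

lemma is_SpI:
  assumes "\<And>w. w \<in> W \<Longrightarrow> f w \<in> W" "\<And>w. w \<in> W \<Longrightarrow> g w \<in> W"
    "\<And>w. w \<in> W \<Longrightarrow> g (f w) = w" "\<And>w. w \<in> W \<Longrightarrow> f (g w) = w"
    "\<And>w w'. w \<in> W \<Longrightarrow> w' \<in> W \<Longrightarrow> f (w + w') = f w + f w'"
    "\<And>a w. w \<in> W \<Longrightarrow> f (W_smul smul a w) = W_smul smul a (f w)"
    "\<And>w w'. w \<in> W \<Longrightarrow> w' \<in> W \<Longrightarrow> symp (f w) (f w') = symp w w'"
  shows "is_Sp (restrict f W)"
  unfolding is_Sp_def using Bij_restrictI[of W f g] assms W_add W_smul by simp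

text \<open>The Siegel unipotent determined by \<open>Mop \<beta>\<close>. The factor 2 is the
  derivative of \<open>\<beta> x x\<close>, and the sign comes from the convention that Heisenberg
  operators translate by \<open>x + v\<close>.\<close>

definition nq :: "('x \<Rightarrow> 'x \<Rightarrow> 'f) \<Rightarrow> 'x \<times> ('x \<Rightarrow> 'f) \<Rightarrow> 'x \<times> ('x \<Rightarrow> 'f)" where
  "nq \<beta> w = (fst w, \<lambda>x. snd w x - 2 * \<beta> (fst w) x)"

lemma nq_W: "bilin \<beta> \<Longrightarrow> w \<in> W \<Longrightarrow> nq \<beta> w \<in> W"
  by (simp add: W_iff nq_def dual_iff bilin_add_right bilin_smul_right algebra_simps)

lemma nq_Sp: "bilin \<beta> \<Longrightarrow> is_Sp (restrict (nq \<beta>) W)"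
proof (rule is_SpI[where g="nq (\<lambda>x y. - \<beta> x y)"])
  assume \<beta>: "bilin \<beta>"
  show "nq \<beta> w \<in> W" "nq (\<lambda>x y. - \<beta> x y) w \<in> W" if "w \<in> W" for w
    using nq_W[OF \<beta> that] nq_W[OF bilin_uminus[OF \<beta>] that] by blast+
  show "nq (\<lambda>x y. - \<beta> x y) (nq \<beta> w) = w" "nq \<beta> (nq (\<lambda>x y. - \<beta> x y) w) = w" for w
    by (simp_all add: nq_def)
  show "nq \<beta> (w + w') = nq \<beta> w + nq \<beta> w'" for w w'
    by (simp add: nq_def prod_eq_iff fun_eq_iff bilin_add_left[OF \<beta>] algebra_simps)
  show "nq \<beta> (W_smul smul a w) = W_smul smul a (nq \<beta> w)" for w a
    by (simp add: nq_def W_smul_def fun_eq_iff bilin_smul_left[OF \<beta>] algebra_simps)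
  show "symp (nq \<beta> w) (nq \<beta> w') = symp w w'" for w w'
    using bilin_sym[OF \<beta>, of "fst w" "fst w'"] by (simp add: symp_def B_form_def nq_def)
qed

lemma nq_intertwines: "bilin \<beta> \<Longrightarrow> intertwines (restrict (nq \<beta>) W) (Mop \<beta>)"
  unfolding intertwines_def
proof (intro ballI)
  fix w \<Phi> assume \<beta>: "bilin \<beta>" and w: "w \<in> W" and \<Phi>: "\<Phi> \<in> \<S>"
  have f: "f_sigma (restrict (nq \<beta>) W) w = - \<beta> (fst w) (fst w)"
    using w two by (simp add: f_sigma_def B_form_def nq_def)
  have sq: "- \<beta> (fst w) (fst w) + (\<beta> (x + fst w) (x + fst w) + (snd w x - 2 * \<beta> (fst w) x)) = \<beta> x x + snd w x" for x
    using bilin_sym[OF \<beta>, of "fst w" x] by (simp add: bilin_square[OF \<beta>])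
  have "chi (\<beta> x x) * chi (snd w x)
    = chi (- \<beta> (fst w) (fst w)) * (chi (\<beta> (x + fst w) (x + fst w)) * chi (snd w x - 2 * \<beta> (fst w) x))" for x
    by (simp only: chi_add[symmetric] sq)
  then show "Mop \<beta> (op w \<Phi>) = (\<lambda>x. chi (f_sigma (restrict (nq \<beta>) W) w) * op (restrict (nq \<beta>) W w) (Mop \<beta> \<Phi>) x)"
    unfolding f using op_Schwartz[OF w \<Phi>] \<Phi> w by (simp add: Mop_def mulq_def op_def nq_def fun_eq_iff ac_simps)
qed

subsection \<open>Convolution along a line\<close>

text \<open>The inverse of the Gauss sum. For \<open>y = 0\<close> this scaling makes the
  convolution the identity.\<close>

definition nrm :: "'f \<Rightarrow> 'r" where "nrm c = (SOME r. G c * r = 1)"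

lemma nrm: "c \<noteq> 0 \<Longrightarrow> G c * nrm c = 1"
  unfolding nrm_def using unit_inverse[OF G_unit, of c] by (metis (mono_tags, lifting) someI_ex)

definition conv :: "'x \<Rightarrow> 'f \<Rightarrow> ('x \<Rightarrow> 'r) \<Rightarrow> 'x \<Rightarrow> 'r" where
  "conv y c \<Phi> = (\<lambda>x. nrm c * J (\<lambda>s. chi (c * s\<^sup>2) * \<Phi> (x + smul s y)))"

lemma line_periodic:
  assumes "test j k \<Phi>" "y \<in> L i" shows "periodic (k - i) (\<lambda>s. \<Phi> (x + smul s y))"
  unfolding periodic_def
proof (intro allI ballI)
  fix s u assume "u \<in> U (k - i)"
  then have "smul u y \<in> L (k - i + i)" using assms(2) by (rule L_smul)
  then have "\<Phi> (x + smul s y + smul u y) = \<Phi> (x + smul s y)" using assms(1) by (simp add: test_def)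
  then show "\<Phi> (x + smul (s + u) y) = \<Phi> (x + smul s y)" by (simp add: scale_left_distrib add.assoc)
qed

lemma conv_eq:
  assumes "c \<noteq> 0" "test j k \<Phi>" "y \<in> L i" "adequate c (k - i) j' k'"
  shows "conv y c \<Phi> x = nrm c * mean j' k' (\<lambda>s. chi (c * s\<^sup>2) * \<Phi> (x + smul s y))"
  unfolding conv_def using J_eq[OF assms(1) line_periodic[OF assms(2,3)] assms(4)] by simp

text \<open>Only parameters in one fixed lattice contribute to the integral, so the support grows by
  a bounded amount, and the period is inherited.\<close>

lemma conv_test:
  assumes c: "c \<noteq> 0" and t: "test j k \<Phi>" shows "\<exists>j'\<le>j. test j' k (conv y c \<Phi>)"
proof -
  obtain i where i: "y \<in> L i" using L_exists by blast
  obtain j1 where j1: "\<forall>j\<le>j1. \<exists>k0. \<forall>k'\<ge>k0. adequate c (k - i) j k'" using adequate_exists by blast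
  then obtain k1 where "\<forall>k'\<ge>k1. adequate c (k - i) j1 k'" by blast
  then have ad: "adequate c (k - i) j1 k1" by simp
  have "test (min j (j1 + i)) k (conv y c \<Phi>)"
    unfolding test_def
  proof (intro conjI allI ballI impI)
    fix x u assume u: "u \<in> L k"
    have "\<Phi> (x + u + smul s y) = \<Phi> (x + smul s y)" for s
    proof -
      have "\<Phi> (x + smul s y + u) = \<Phi> (x + smul s y)" using t u by (simp add: test_def)
      then show ?thesis by (simp add: add.assoc add.commute[of u])
    qed
    then show "conv y c \<Phi> (x + u) = conv y c \<Phi> x" by (simp add: conv_def)
  next
    fix x assume x: "x \<notin> L (min j (j1 + i))"
    have z: "\<Phi> (x + smul s y) = 0" if "s \<in> U j1" for s
    proof -
      have s: "smul s y \<in> L (min j (j1 + i))" using L_smul[OF that i] by (rule L_monoD) simp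
      have "x + smul s y \<notin> L j"
      proof
        assume "x + smul s y \<in> L j"
        then have "x + smul s y \<in> L (min j (j1 + i))" by (rule L_monoD) simp
        from L_diff[OF this s] show False using x by simp
      qed
      then show ?thesis using t by (simp add: test_def)
    qed
    have "mean j1 k1 (\<lambda>s. chi (c * s\<^sup>2) * \<Phi> (x + smul s y)) = qz (- k1) * tsum (U j1) (U k1) (\<lambda>s. 0 * 0)"
      unfolding mean_def by (subst tsum_cong[OF U_subgroup U_subgroup, of j1 _ "\<lambda>s. 0 * 0"]) (simp_all add: z)
    also have "\<dots> = 0" by (subst tsum_mult_left) simp
    finally show "conv y c \<Phi> x = 0" using conv_eq[OF c t i ad] by simp
  qed
  moreover have "min j (j1 + i) \<le> j" by simp
  ultimately show ?thesis by blast
qed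

lemma conv_Schwartz: "c \<noteq> 0 \<Longrightarrow> \<Phi> \<in> \<S> \<Longrightarrow> conv y c \<Phi> \<in> \<S>"
  unfolding Schwartz_iff using conv_test by blast

lemma mean_mult: "mean j k (\<lambda>s. r * f s) = r * mean j k f"
  by (simp add: mean_def tsum_mult_left mult.left_commute)

text \<open>This is \<open>gaussian_inversion\<close> along the line of \<open>y\<close>; its
  constant equals \<open>G c * G (- c)\<close> and is cancelled by the two normalisations.\<close>

lemma conv_inverse:
  assumes c: "c \<noteq> 0" and \<Phi>: "\<Phi> \<in> \<S>" shows "conv y c (conv y (- c) \<Phi>) = \<Phi>"
proof
  fix x
  obtain j k where t: "test j k \<Phi>" using \<Phi> unfolding Schwartz_iff by blast
  have c': "- c \<noteq> 0" using c by simp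
  obtain j' where t': "test j' k (conv y (- c) \<Phi>)" using conv_test[OF c' t] by blast
  obtain i where i: "y \<in> L i" using L_exists by blast
  obtain j0 where "\<forall>j\<le>j0. \<exists>k0. \<forall>k'\<ge>k0. adequate c (k - i) j k' \<and> j \<le> radius c - j"
    using inversion_adequate_exists by blast
  then obtain k0 where "\<forall>k'\<ge>k0. adequate c (k - i) j0 k' \<and> j0 \<le> radius c - j0" by blast
  then have ad: "adequate c (k - i) j0 k0" "j0 \<le> radius c - j0" by auto
  have ad': "adequate (- c) (k - i) j0 k0" using ad(1) by (simp add: adequate_def radius_minus mesh_minus)
  have "conv y c (conv y (- c) \<Phi>) x = nrm c * mean j0 k0 (\<lambda>s. chi (c * s\<^sup>2) *
      (nrm (- c) * mean j0 k0 (\<lambda>t. chi (- c * t\<^sup>2) * \<Phi> (x + smul s y + smul t y))))"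
    unfolding conv_eq[OF c t' i ad(1)] conv_eq[OF c' t i ad'] ..
  also have "\<dots> = nrm c * nrm (- c) * mean j0 k0 (\<lambda>s. chi (c * s\<^sup>2) *
      mean j0 k0 (\<lambda>t. chi (- c * t\<^sup>2) * \<Phi> (x + smul (s + t) y)))"
  proof -
    have "mean j0 k0 (\<lambda>s. chi (c * s\<^sup>2) * (nrm (- c) * f s)) = nrm (- c) * mean j0 k0 (\<lambda>s. chi (c * s\<^sup>2) * f s)" for f
      unfolding mean_mult[symmetric] by (simp only: mult.left_commute)
    then show ?thesis by (simp only: scale_left_distrib add.assoc mult.assoc)
  qed
  also have "mean j0 k0 (\<lambda>s. chi (c * s\<^sup>2) * mean j0 k0 (\<lambda>t. chi (- c * t\<^sup>2) * \<Phi> (x + smul (s + t) y)))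
    = qz (- radius c) * \<Phi> (x + smul 0 y)"
    by (rule gaussian_inversion[OF c line_periodic[OF t i] ad])
  also have "qz (- radius c) = G c * G (- c)" by (rule G_mult_G_minus[OF c, symmetric])
  also have "nrm c * nrm (- c) * (G c * G (- c) * \<Phi> (x + smul 0 y)) = (G c * nrm c) * (G (- c) * nrm (- c)) * \<Phi> x"
    by (simp add: ac_simps)
  also have "\<dots> = \<Phi> x" using nrm[OF c] nrm[OF c'] by simp
  finally show "conv y c (conv y (- c) \<Phi>) x = \<Phi> x" .
qed

definition Cop where "Cop y c = restrict (conv y c) \<S>"

lemma mean_add: "mean j k (\<lambda>s. f s + g s) = mean j k f + mean j k g"
  by (simp add: mean_def tsum_add distrib_left)

lemma Cop_Aut:
  assumes c: "c \<noteq> 0" shows "is_Aut (Cop y c)"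
  unfolding Cop_def
proof (rule is_AutI[where g="conv y (- c)"])
  have c': "- c \<noteq> 0" using c by simp
  show "conv y c \<Phi> \<in> \<S>" "conv y (- c) \<Phi> \<in> \<S>" if "\<Phi> \<in> \<S>" for \<Phi>
    using conv_Schwartz[OF c that] conv_Schwartz[OF c' that] by blast+
  show "conv y (- c) (conv y c \<Phi>) = \<Phi>" "conv y c (conv y (- c) \<Phi>) = \<Phi>" if "\<Phi> \<in> \<S>" for \<Phi>
    using conv_inverse[OF c' that] conv_inverse[OF c that] by simp_all
  obtain i where i: "y \<in> L i" using L_exists by blast
  show "conv y c (\<Phi> + \<Psi>) = conv y c \<Phi> + conv y c \<Psi>" if S: "\<Phi> \<in> \<S>" "\<Psi> \<in> \<S>" for \<Phi> \<Psi>
  proof -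
    obtain j k where t: "test j k \<Phi>" "test j k \<Psi>" using common_test[OF S] by blast
    have ts: "test j k (\<Phi> + \<Psi>)" using test_add[OF t] by (simp add: test_def)
    obtain j0 where "\<forall>j\<le>j0. \<exists>k0. \<forall>k'\<ge>k0. adequate c (k - i) j k'" using adequate_exists by blast
    then obtain k0 where "\<forall>k'\<ge>k0. adequate c (k - i) j0 k'" by blast
    then have ad: "adequate c (k - i) j0 k0" by simp
    show ?thesis
      by (rule ext) (simp add: conv_eq[OF c ts i ad] conv_eq[OF c t(1) i ad] conv_eq[OF c t(2) i ad] mean_add distrib_left)
  qed
  show "conv y c (\<lambda>x. r * \<Phi> x) = (\<lambda>x. r * conv y c \<Phi> x)" if S: "\<Phi> \<in> \<S>" for \<Phi> r
  proof -
    obtain j k where t: "test j k \<Phi>" using common_test[OF S S] by blast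
    obtain j0 where "\<forall>j\<le>j0. \<exists>k0. \<forall>k'\<ge>k0. adequate c (k - i) j k'" using adequate_exists by blast
    then obtain k0 where "\<forall>k'\<ge>k0. adequate c (k - i) j0 k'" by blast
    then have ad: "adequate c (k - i) j0 k0" by simp
    show ?thesis
      by (rule ext) (simp add: conv_eq[OF c test_mult_left[OF t] i ad] conv_eq[OF c t i ad] mult.left_commute[of _ r] mean_mult)
  qed
qed

definition tv :: "'x \<Rightarrow> 'f \<Rightarrow> 'x \<times> ('x \<Rightarrow> 'f) \<Rightarrow> 'x \<times> ('x \<Rightarrow> 'f)" where
  "tv y a w = (fst w - smul (a * snd w y) y, snd w)"

lemma tv_Sp: "is_Sp (restrict (tv y a) W)"
proof (rule is_SpI[where g="tv y (- a)"])
  show "tv y a w \<in> W" "tv y (- a) w \<in> W" if "w \<in> W" for w using that by (simp_all add: W_iff tv_def)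
  show "tv y (- a) (tv y a w) = w" "tv y a (tv y (- a) w) = w" for w by (simp_all add: tv_def prod_eq_iff)
  show "tv y a (w + w') = tv y a w + tv y a w'" for w w'
    by (simp add: tv_def prod_eq_iff distrib_left scale_left_distrib)
  show "tv y a (W_smul smul b w) = W_smul smul b (tv y a w)" for w b
    by (simp add: tv_def W_smul_def scale_right_diff_distrib mult.left_commute)
  show "symp (tv y a w) (tv y a w') = symp w w'" if "w \<in> W" "w' \<in> W" for w w'
    using that by (simp add: symp_def B_form_def tv_def W_iff dual_diff dual_smul mult.commute mult.left_commute)
qed

lemma J_mult:
  assumes "c \<noteq> 0" "periodic N \<psi>"
  shows "J (\<lambda>s. chi (c * s\<^sup>2) * (r * \<psi> s)) = r * J (\<lambda>s. chi (c * s\<^sup>2) * \<psi> s)"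
proof -
  have per: "periodic N (\<lambda>s. r * \<psi> s)" using assms(2) by (simp add: periodic_def)
  obtain j0 where "\<forall>j\<le>j0. \<exists>k0. \<forall>k'\<ge>k0. adequate c N j k'" using adequate_exists by blast
  then obtain k0 where "\<forall>k'\<ge>k0. adequate c N j0 k'" by blast
  then have ad: "adequate c N j0 k0" by simp
  show ?thesis
    unfolding J_eq[OF assms(1) per ad] J_eq[OF assms ad] mean_mult[symmetric] by (simp only: mult.left_commute)
qed

text \<open>The character in the Heisenberg operator contributes a term linear in \<open>s\<close>.
  Completing the square shifts \<open>s\<close> by \<open>\<kappa>\<close>, which is the translation
  along \<open>y\<close> performed by the transvection.\<close>

lemma tv_intertwines:
  assumes c: "c \<noteq> 0" shows "intertwines (restrict (tv y (1 / (2 * c))) W) (Cop y c)"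
  unfolding intertwines_def
proof (intro ballI)
  fix w \<Phi> assume w: "w \<in> W" and \<Phi>: "\<Phi> \<in> \<S>"
  define \<sigma> where "\<sigma> = restrict (tv y (1 / (2 * c))) W"
  define \<kappa> where "\<kappa> = snd w y / (2 * c)"
  have w': "snd w \<in> dual_space smul" using w by (simp add: W_iff)
  have \<kappa>: "snd w y = 2 * c * \<kappa>" using c two by (simp add: \<kappa>_def)
  have \<sigma>: "\<sigma> w = (fst w - smul \<kappa> y, snd w)" using w by (simp add: \<sigma>_def tv_def \<kappa>_def)
  have f: "f_sigma \<sigma> w = - c * \<kappa>\<^sup>2"
    using two by (simp add: f_sigma_def B_form_def \<sigma> dual_diff[OF w'] dual_smul[OF w'] \<kappa> power2_eq_square)
  obtain j k where t: "test j k \<Phi>" using common_test[OF \<Phi> \<Phi>] by blast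
  obtain i where i: "y \<in> L i" using L_exists by blast
  have "conv y c (op w \<Phi>) x = chi (- c * \<kappa>\<^sup>2) * op (fst w - smul \<kappa> y, snd w) (conv y c \<Phi>) x" for x
  proof -
    define \<psi> where "\<psi> = (\<lambda>s. \<Phi> ((x + (fst w - smul \<kappa> y)) + smul s y))"
    have per: "periodic (k - i) \<psi>" unfolding \<psi>_def by (rule line_periodic[OF t i])
    have per': "periodic (k - i) (\<lambda>s. r * \<psi> s)" for r using per by (simp add: periodic_def)
    have e: "chi (c * s\<^sup>2) * op w \<Phi> (x + smul s y)
      = chi (c * (s + \<kappa>)\<^sup>2) * ((chi (- c * \<kappa>\<^sup>2) * chi (snd w x)) * \<psi> (s + \<kappa>))" for s
    proof -
      have "x + smul s y + fst w = (x + (fst w - smul \<kappa> y)) + smul (s + \<kappa>) y"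
        by (simp add: scale_left_distrib algebra_simps)
      moreover have "c * s\<^sup>2 + (snd w x + s * snd w y) = c * (s + \<kappa>)\<^sup>2 + (- c * \<kappa>\<^sup>2 + snd w x)"
        by (simp add: \<kappa> power2_eq_square algebra_simps)
      then have "chi (c * s\<^sup>2) * chi (snd w x + s * snd w y) = chi (c * (s + \<kappa>)\<^sup>2) * (chi (- c * \<kappa>\<^sup>2) * chi (snd w x))"
        by (simp only: chi_add[symmetric])
      ultimately have e: "x + smul s y + fst w = (x + (fst w - smul \<kappa> y)) + smul (s + \<kappa>) y"
        "chi (c * s\<^sup>2) * chi (snd w x + s * snd w y) = chi (c * (s + \<kappa>)\<^sup>2) * (chi (- c * \<kappa>\<^sup>2) * chi (snd w x))" .
      have "chi (c * s\<^sup>2) * op w \<Phi> (x + smul s y) = \<psi> (s + \<kappa>) * (chi (c * s\<^sup>2) * chi (snd w x + s * snd w y))"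
        by (simp only: op_def \<psi>_def dual_add[OF w'] dual_smul[OF w'] e(1) mult.left_commute)
      also have "\<dots> = chi (c * (s + \<kappa>)\<^sup>2) * ((chi (- c * \<kappa>\<^sup>2) * chi (snd w x)) * \<psi> (s + \<kappa>))"
        by (simp only: e(2) ac_simps)
      finally show ?thesis .
    qed
    have "J (\<lambda>s. chi (c * s\<^sup>2) * op w \<Phi> (x + smul s y))
      = J (\<lambda>s. chi (c * s\<^sup>2) * ((chi (- c * \<kappa>\<^sup>2) * chi (snd w x)) * \<psi> s))"
      unfolding e by (rule J_shift[OF c per'])
    also have "\<dots> = (chi (- c * \<kappa>\<^sup>2) * chi (snd w x)) * J (\<lambda>s. chi (c * s\<^sup>2) * \<psi> s)" by (rule J_mult[OF c per])
    finally have "conv y c (op w \<Phi>) x = nrm c * ((chi (- c * \<kappa>\<^sup>2) * chi (snd w x)) * J (\<lambda>s. chi (c * s\<^sup>2) * \<psi> s))"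
      by (simp only: conv_def)
    then show ?thesis by (simp add: op_def conv_def \<psi>_def ac_simps)
  qed
  then show "Cop y c (op w \<Phi>) = (\<lambda>x. chi (f_sigma (restrict (tv y (1 / (2 * c))) W) w) * op (restrict (tv y (1 / (2 * c))) W w) (Cop y c \<Phi>) x)"
    unfolding \<sigma>_def[symmetric] f \<sigma> using op_Schwartz[OF w \<Phi>] \<Phi> by (simp add: Cop_def fun_eq_iff)
qed


subsection \<open>Integration against a character of the second degree\<close>

lemma Schwartz_shift: "\<Phi> \<in> \<S> \<Longrightarrow> (\<lambda>x. \<Phi> (x + z)) \<in> \<S>"
  using op_Schwartz[of "(z, \<lambda>_. 0)" \<Phi>] by (simp add: W_iff dual_iff op_def)

lemma common_test_finite:
  assumes "finite A" "\<And>i. i \<in> A \<Longrightarrow> f i \<in> \<S>" shows "\<exists>j k. \<forall>i\<in>A. test j k (f i)"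
  using assms
proof (induction A)
  case (insert i A)
  then obtain j k where jk: "\<forall>i\<in>A. test j k (f i)" by auto
  have "f i \<in> \<S>" using insert.prems by simp
  then obtain j' k' where j'k': "test j' k' (f i)" unfolding Schwartz_iff by blast
  have "\<forall>i\<in>insert i A. test (min j j') (max k k') (f i)"
    using jk j'k' test_mono by (metis insert_iff max.cobounded1 max.cobounded2 min.cobounded1 min.cobounded2)
  then show ?case by blast
qed simp

lemma I_linear_combination:
  assumes "finite A" "\<And>i. i \<in> A \<Longrightarrow> f i \<in> \<S>"
  shows "I (\<lambda>x. \<Sum>i\<in>A. r i * f i x) = (\<Sum>i\<in>A. r i * I (f i))"
proof -
  obtain j k where jk: "\<forall>i\<in>A. test j k (f i)" using common_test_finite[of A f, OF assms] by blast
  have "I (\<lambda>x. \<Sum>i\<in>A. r i * f i x) = (\<Sum>i\<in>A. I (\<lambda>x. r i * f i x))"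
    by (rule I_sum[of _ j k]) (use jk test_mult_left in blast)
  also have "\<dots> = (\<Sum>i\<in>A. r i * I (f i))"
    by (rule sum.cong[OF refl]) (use jk I_mult_left in blast)
  finally show ?thesis .
qed

lemma I_mult: "\<Phi> \<in> \<S> \<Longrightarrow> I (\<lambda>x. r * \<Phi> x) = r * I \<Phi>"
  unfolding Schwartz_iff using I_mult_left by blast

definition Psi :: "('x \<Rightarrow> 'x \<Rightarrow> 'f) \<Rightarrow> ('x \<Rightarrow> 'r) \<Rightarrow> 'r" where
  "Psi \<beta> \<Phi> = I (mulq \<beta> \<Phi>)"

lemma Psi_mulq: "Psi \<beta> (mulq \<beta>' \<Phi>) = Psi (\<lambda>x y. \<beta> x y + \<beta>' x y) \<Phi>"
  by (simp add: Psi_def mulq_mulq)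

text \<open>The form left over when the square in \<open>s\<close> is completed in
  \<open>c * s\<^sup>2 + \<beta> (x - s y) (x - s y)\<close>. Equivalently, the transvection carries
  the graph of its double to the graph of the double of \<open>\<beta>\<close>.\<close>

definition reduce :: "'x \<Rightarrow> 'f \<Rightarrow> ('x \<Rightarrow> 'x \<Rightarrow> 'f) \<Rightarrow> 'x \<Rightarrow> 'x \<Rightarrow> 'f" where
  "reduce y c \<beta> = (\<lambda>u z. \<beta> u z - \<beta> u y * \<beta> z y / (c + \<beta> y y))"

lemma bilin_reduce: "bilin \<beta> \<Longrightarrow> bilin (reduce y c \<beta>)"
proof -
  assume \<beta>: "bilin \<beta>"
  have "bilin (\<lambda>u z. \<beta> u z + (- 1 / (c + \<beta> y y)) * \<beta> u y * \<beta> z y)"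
    by (rule bilin_plus[OF \<beta> bilin_rank1[OF bilin_sym_dual[OF \<beta>]]])
  moreover have "reduce y c \<beta> = (\<lambda>u z. \<beta> u z + (- 1 / (c + \<beta> y y)) * \<beta> u y * \<beta> z y)"
    by (simp add: reduce_def fun_eq_iff)
  ultimately show ?thesis by simp
qed

text \<open>Exchange the two integrations and complete the square in the variable of the convolution.\<close>

lemma Psi_conv:
  assumes c: "c \<noteq> 0" and \<beta>: "bilin \<beta>" and e: "c + \<beta> y y \<noteq> 0" and \<Phi>: "\<Phi> \<in> \<S>"
  shows "G c * Psi \<beta> (conv y c \<Phi>) = G (c + \<beta> y y) * Psi (reduce y c \<beta>) \<Phi>"
proof -
  define e where "e = c + \<beta> y y"
  have e0: "e \<noteq> 0" using e by (simp add: e_def)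
  obtain j1 k1 where t: "test j1 k1 \<Phi>" using \<Phi> unfolding Schwartz_iff by blast
  obtain i where i: "y \<in> L i" using L_exists by blast
  obtain B where B: "\<forall>i k. \<forall>x\<in>L i. \<forall>y\<in>L k. \<beta> x y \<in> U (i + k + B)" using bilin_bound[OF \<beta>] by blast
  \<comment> \<open>A common period of the linear phases for all \<open>x\<close> in the support of
    \<open>\<Phi>\<close>, so that one pair \<open>j\<close>, \<open>k\<close> computes the
    convolution integral at every point.\<close>
  define N where "N = d - ord 2 - (j1 + i + B)"
  have per: "periodic N (\<lambda>s. chi (- 2 * \<beta> x y * s))" if "x \<in> L j1" for x
    unfolding periodic_def
  proof (intro allI ballI)
    fix s u assume u: "u \<in> U N"
    have "\<beta> x y \<in> U (j1 + i + B)" using B that i by blast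
    then have "2 * (\<beta> x y * u) \<in> U (ord 2 + ((j1 + i + B) + N))" using U_mult[OF U_ord U_mult[OF _ u]] by blast
    then have "- (2 * (\<beta> x y * u)) \<in> U d" by (simp add: N_def)
    then have "chi (- (2 * (\<beta> x y * u))) = 1" by (rule chi_U)
    then show "chi (- 2 * \<beta> x y * (s + u)) = chi (- 2 * \<beta> x y * s)"
      using chi_add[of "- 2 * \<beta> x y * s" "- (2 * (\<beta> x y * u))"] by (simp add: algebra_simps)
  qed
  obtain ja where ja: "\<forall>j\<le>ja. \<exists>k0. \<forall>k\<ge>k0. adequate c (k1 - i) j k" using adequate_exists by blast
  obtain jb where jb: "\<forall>j\<le>jb. \<exists>k0. \<forall>k\<ge>k0. adequate e N j k" using adequate_exists by blast
  define j where "j = min ja jb"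
  obtain ka kb where kk: "\<forall>k\<ge>ka. adequate c (k1 - i) j k" "\<forall>k\<ge>kb. adequate e N j k"
    using ja[rule_format, of j] jb[rule_format, of j] by (auto simp: j_def)
  define k where "k = max j (max ka kb)"
  have ad: "adequate c (k1 - i) j k" "adequate e N j k" using kk by (auto simp: k_def)
  define T where "T = (SOME T. transversal T (U j) (U k))"
  have T: "transversal T (U j) (U k)" unfolding T_def using transversal_exists[OF U_subgroup U_subgroup] by (rule someI_ex)
  have finT: "finite T" using U_transversal_finite[OF T] by (simp add: k_def)
  have mean: "mean j k f = (\<Sum>s\<in>T. qz (- k) * f s)" for f
    by (simp add: mean_def tsum_def T_def sum_distrib_left)
  define r where "r s = nrm c * (qz (- k) * chi (c * s\<^sup>2))" for s
  define f where "f s = mulq \<beta> (\<lambda>x. \<Phi> (x + smul s y))" for s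
  \<comment> \<open>The translate of \<open>f s\<close> in which \<open>\<Phi>\<close> is evaluated
    at \<open>x\<close> for every \<open>s\<close>; the whole dependence on \<open>s\<close> then
    sits in a quadratic phase.\<close>
  define g where "g s = (\<lambda>x. f s (x + - smul s y))" for s
  have fS: "f s \<in> \<S>" for s unfolding f_def by (rule mulq_Schwartz[OF \<beta> Schwartz_shift[OF \<Phi>]])
  have gS: "g s \<in> \<S>" for s unfolding g_def by (rule Schwartz_shift[OF fS])
  have Ig: "I (g s) = I (f s)" for s
    using fS[of s] I_shift unfolding Schwartz_iff g_def by blast
  have g: "g s x = chi (\<beta> y y * s\<^sup>2 + (- 2 * \<beta> x y * s)) * (chi (\<beta> x x) * \<Phi> x)" for s x
  proof -
    have "\<beta> (x + - smul s y) (x + - smul s y) = (\<beta> y y * s\<^sup>2 + (- 2 * \<beta> x y * s)) + \<beta> x x"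
      unfolding scale_minus_left[symmetric] bilin_square[OF \<beta>] bilin_smul_left[OF \<beta>] bilin_smul_right[OF \<beta>]
      by (simp add: power2_eq_square)
    then show ?thesis by (simp only: g_def f_def mulq_def chi_add) (simp add: mult.assoc)
  qed
  have "Psi \<beta> (conv y c \<Phi>) = I (\<lambda>x. \<Sum>s\<in>T. r s * f s x)"
    unfolding Psi_def mulq_def conv_eq[OF c t i ad(1)] mean f_def r_def
    by (simp add: sum_distrib_left ac_simps)
  also have "\<dots> = (\<Sum>s\<in>T. r s * I (g s))" unfolding Ig by (rule I_linear_combination[OF finT fS])
  also have "\<dots> = I (\<lambda>x. \<Sum>s\<in>T. r s * g s x)" by (rule I_linear_combination[OF finT gS, symmetric])
  also have "(\<lambda>x. \<Sum>s\<in>T. r s * g s x) = (\<lambda>x. (nrm c * G e) * mulq (reduce y c \<beta>) \<Phi> x)"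
  proof
    fix x
    have "r s * g s x = nrm c * (qz (- k) * (chi (e * s\<^sup>2) * chi (- 2 * \<beta> x y * s))) * (chi (\<beta> x x) * \<Phi> x)" for s
      by (simp only: g r_def e_def distrib_right chi_add ac_simps)
    then have sum: "(\<Sum>s\<in>T. r s * g s x) = nrm c * mean j k (\<lambda>s. chi (e * s\<^sup>2) * chi (- 2 * \<beta> x y * s)) * (chi (\<beta> x x) * \<Phi> x)"
      by (simp add: mean sum_distrib_left sum_distrib_right)
    show "(\<Sum>s\<in>T. r s * g s x) = (nrm c * G e) * mulq (reduce y c \<beta>) \<Phi> x"
    proof (cases "x \<in> L j1")
      case True
      have "mean j k (\<lambda>s. chi (e * s\<^sup>2) * chi (- 2 * \<beta> x y * s)) = J (\<lambda>s. chi (e * s\<^sup>2) * chi (- 2 * \<beta> x y * s))"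
        by (rule J_eq[OF e0 per[OF True] ad(2), symmetric])
      also have "\<dots> = J (\<lambda>s. chi (e * s\<^sup>2 - 2 * \<beta> x y * s))"
        by (simp only: chi_add[symmetric]) (simp add: algebra_simps)
      also have "\<dots> = chi (- (\<beta> x y)\<^sup>2 / e) * G e" by (rule J_linear_phase[OF e0])
      finally have m: "mean j k (\<lambda>s. chi (e * s\<^sup>2) * chi (- 2 * \<beta> x y * s)) = chi (- (\<beta> x y)\<^sup>2 / e) * G e" .
      have "reduce y c \<beta> x x = - (\<beta> x y)\<^sup>2 / e + \<beta> x x" by (simp add: reduce_def e_def power2_eq_square)
      then have "chi (reduce y c \<beta> x x) = chi (- (\<beta> x y)\<^sup>2 / e) * chi (\<beta> x x)" by (simp only: chi_add)
      then show ?thesis unfolding sum m by (simp add: mulq_def ac_simps)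
    next
      case False
      then have "\<Phi> x = 0" using t by (simp add: test_def)
      then show ?thesis unfolding sum by (simp add: mulq_def)
    qed
  qed
  also have "I (\<lambda>x. (nrm c * G e) * mulq (reduce y c \<beta>) \<Phi> x) = nrm c * G e * Psi (reduce y c \<beta>) \<Phi>"
    unfolding Psi_def by (rule I_mult[OF mulq_Schwartz[OF bilin_reduce[OF \<beta>] \<Phi>]])
  finally have "G c * Psi \<beta> (conv y c \<Phi>) = (G c * nrm c) * G e * Psi (reduce y c \<beta>) \<Phi>"
    by (simp add: mult.assoc)
  then show ?thesis using nrm[OF c] by (simp add: e_def)
qed

end

section \<open>Determinants of endomorphisms\<close>

text \<open>The matrix determinant lemma: the block matrix with diagonal blocks 1 and off-diagonal
  blocks \<open>- B\<close> and \<open>A\<close> factors in two ways, and its determinant is read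
  off from either.\<close>

lemma det_one_plus_rank_one:
  fixes u w :: "nat \<Rightarrow> 'a::field"
  shows "Determinant.det (mat n n (\<lambda>(i, j). (if i = j then 1 else 0) + u i * w j)) = 1 + (\<Sum>k<n. w k * u k)"
proof -
  define A where "A = mat n 1 (\<lambda>(i, j). u i)"
  define B where "B = mat 1 n (\<lambda>(i, j). w j)"
  have A: "A \<in> carrier_mat n 1" and B: "B \<in> carrier_mat 1 n" by (auto simp: A_def B_def)
  define P where "P = four_block_mat (1\<^sub>m 1) (0\<^sub>m 1 n) A (1\<^sub>m n)"
  define Q where "Q = four_block_mat (1\<^sub>m 1) (- B) (0\<^sub>m n 1) (1\<^sub>m n + A * B)"
  define R where "R = four_block_mat (1\<^sub>m 1 + B * A) (- B) (0\<^sub>m n 1) (1\<^sub>m n)"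
  have c: "P \<in> carrier_mat (1 + n) (1 + n)" "Q \<in> carrier_mat (1 + n) (1 + n)" "R \<in> carrier_mat (1 + n) (1 + n)"
    unfolding P_def Q_def R_def using A B by (auto intro!: four_block_carrier_mat)
  have "P * Q = four_block_mat (1\<^sub>m 1) (- B) A (1\<^sub>m n)"
    unfolding P_def Q_def
    by (subst mult_four_block_mat[where ?nr1.0=1 and ?n1.0=1 and ?n2.0=n and ?nr2.0=n and ?nc1.0=1 and ?nc2.0=n])
      (use A B in \<open>auto intro!: arg_cong4[where f=four_block_mat] eq_matI simp: scalar_prod_def A_def B_def\<close>)
  also have "\<dots> = R * P"
    unfolding P_def R_def
    by (subst mult_four_block_mat[where ?nr1.0=1 and ?n1.0=1 and ?n2.0=n and ?nr2.0=n and ?nc1.0=1 and ?nc2.0=n])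
      (use A B in \<open>auto intro!: arg_cong4[where f=four_block_mat] eq_matI simp: scalar_prod_def A_def B_def sum_negf\<close>)
  finally have "Determinant.det P * Determinant.det Q = Determinant.det R * Determinant.det P"
    using Determinant.det_mult[OF c(1,2)] Determinant.det_mult[OF c(3,1)] by metis
  moreover have "Determinant.det P = 1"
    unfolding P_def using det_four_block_mat_upper_right_zero[of "1\<^sub>m 1" 1 "0\<^sub>m 1 n" n A "1\<^sub>m n"] A by simp
  moreover have "Determinant.det Q = Determinant.det (1\<^sub>m n + A * B)"
    unfolding Q_def using det_four_block_mat_lower_left_zero[of "1\<^sub>m 1" 1 "- B" n "0\<^sub>m n 1" "1\<^sub>m n + A * B"] A B by simp
  moreover have "Determinant.det R = Determinant.det (1\<^sub>m 1 + B * A)"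
    unfolding R_def using det_four_block_mat_lower_left_zero[of "1\<^sub>m 1 + B * A" 1 "- B" n "0\<^sub>m n 1" "1\<^sub>m n"] A B by simp
  moreover have "1\<^sub>m n + A * B = mat n n (\<lambda>(i, j). (if i = j then 1 else 0) + u i * w j)"
    by (rule eq_matI) (auto simp: A_def B_def scalar_prod_def)
  moreover have "1\<^sub>m 1 + B * A = mat 1 1 (\<lambda>_. 1 + (\<Sum>k<n. w k * u k))"
    by (rule eq_matI) (auto simp: A_def B_def scalar_prod_def lessThan_atLeast0)
  moreover have "Determinant.det (mat 1 1 (\<lambda>_. r)) = r" for r :: 'a
    by (simp add: det_single)
  ultimately show ?thesis by simp
qed

context weil
begin

definition lin :: "('x \<Rightarrow> 'x) \<Rightarrow> bool" where
  "lin A \<longleftrightarrow> (\<forall>x y. A (x + y) = A x + A y) \<and> (\<forall>a x. A (smul a x) = smul a (A x))"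

lemma lin_sum: "lin A \<Longrightarrow> A (\<Sum>i\<in>K. smul (g i) (f i)) = (\<Sum>i\<in>K. smul (g i) (A (f i)))"
proof (induction K rule: infinite_finite_induct)
  case (insert i K)
  then show ?case by (simp add: lin_def)
next
  have "A 0 = 0" if "lin A" using that unfolding lin_def by (metis scale_zero_left)
  then show "lin A \<Longrightarrow> A (\<Sum>i\<in>{}. smul (g i) (f i)) = (\<Sum>i\<in>{}. smul (g i) (A (f i)))"
    "infinite K \<Longrightarrow> lin A \<Longrightarrow> A (\<Sum>i\<in>K. smul (g i) (f i)) = (\<Sum>i\<in>K. smul (g i) (A (f i)))" for K by auto
qed

definition enum where "enum = (SOME e. bij_betw e {0..<card E} E)"

lemma enum: "bij_betw enum {0..<card E} E"
  unfolding enum_def using ex_bij_betw_nat_finite[OF E_finite] by (rule someI_ex)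

lemma sum_enum: "(\<Sum>b\<in>E. f b) = (\<Sum>k<card E. f (enum k))"
  using sum.reindex_bij_betw[OF enum, of f] by (simp add: lessThan_atLeast0)

definition matrix where "matrix A = mat (card E) (card E) (\<lambda>(i, j). co (enum i) (A (enum j)))"

text \<open>The determinant of an endomorphism in the basis \<open>E\<close>, by way of index
  matrices; \<open>enum\<close> supplies the order of the basis.\<close>

definition D :: "('x \<Rightarrow> 'x) \<Rightarrow> 'f" where "D A = Determinant.det (matrix A)"

lemma D_comp:
  assumes "lin A" shows "D (\<lambda>x. A (B x)) = D A * D B"
proof -
  have "matrix (\<lambda>x. A (B x)) = matrix A * matrix B"
  proof (rule eq_matI)
    fix i j assume "i < dim_row (matrix A * matrix B)" "j < dim_col (matrix A * matrix B)"
    then have ij: "i < card E" "j < card E" by (simp_all add: matrix_def)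
    have "A (B (enum j)) = (\<Sum>b\<in>E. smul (co b (B (enum j))) (A b))"
      using lin_sum[OF assms, of "\<lambda>b. co b (B (enum j))" "\<lambda>b. b" E] by (simp add: co_expand)
    then have "co (enum i) (A (B (enum j))) = (\<Sum>k<card E. co (enum k) (B (enum j)) * co (enum i) (A (enum k)))"
      by (simp add: co_sum co_smul sum_enum)
    then show "matrix (\<lambda>x. A (B x)) $$ (i, j) = (matrix A * matrix B) $$ (i, j)"
      using ij by (simp add: matrix_def scalar_prod_def lessThan_atLeast0 mult.commute)
  qed (simp_all add: matrix_def)
  then show ?thesis unfolding D_def using Determinant.det_mult[of "matrix A" "card E" "matrix B"] by (simp add: matrix_def)
qed

lemma co_enum: "i < card E \<Longrightarrow> j < card E \<Longrightarrow> co (enum i) (enum j) = (if i = j then 1 else 0)"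
proof -
  assume ij: "i < card E" "j < card E"
  then have "enum j \<in> E" using enum by (auto simp: bij_betw_def)
  moreover have "enum i = enum j \<longleftrightarrow> i = j"
    using enum ij by (auto simp: bij_betw_def inj_on_def)
  ultimately show ?thesis by (simp add: co_basis)
qed

lemma D_transvection:
  assumes "\<phi> \<in> dual_space smul" shows "D (\<lambda>x. x + smul (\<phi> x) y) = 1 + \<phi> y"
proof -
  have "matrix (\<lambda>x. x + smul (\<phi> x) y)
    = mat (card E) (card E) (\<lambda>(i, j). (if i = j then 1 else 0) + co (enum i) y * \<phi> (enum j))"
    by (rule eq_matI) (auto simp: matrix_def co_add co_smul co_enum)
  then have "D (\<lambda>x. x + smul (\<phi> x) y) = 1 + (\<Sum>k<card E. \<phi> (enum k) * co (enum k) y)"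
    unfolding D_def by (simp only: det_one_plus_rank_one)
  also have "(\<Sum>k<card E. \<phi> (enum k) * co (enum k) y) = (\<Sum>b\<in>E. \<phi> (smul (co b y) b))"
    by (simp add: sum_enum dual_smul[OF assms] mult.commute)
  also have "\<dots> = \<phi> y" by (simp only: dual_sum[OF assms, symmetric] co_expand)
  finally show ?thesis .
qed

lemma D_id: "D (\<lambda>x. x) = 1"
  using D_transvection[of "\<lambda>_. 0" 0] by (simp add: dual_iff)

end

section \<open>The determinant character modulo signs\<close>

text \<open>\<open>f\<close> agrees with a rational function that is regular at \<open>0\<close>, wherever a denominator of it does not vanish.\<close>

definition rat0 :: "('f::field \<Rightarrow> 'f) \<Rightarrow> bool" where
  "rat0 f \<longleftrightarrow> (\<exists>P Q. poly Q 0 \<noteq> 0 \<and> (\<forall>t. poly Q t \<noteq> 0 \<longrightarrow> f t = poly P t / poly Q t))"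

lemma rat0I: "poly Q 0 \<noteq> 0 \<Longrightarrow> (\<And>t. poly Q t \<noteq> 0 \<Longrightarrow> f t = poly P t / poly Q t) \<Longrightarrow> rat0 f"
  unfolding rat0_def by blast

lemma rat0E:
  assumes "rat0 f" obtains P Q where "poly Q 0 \<noteq> 0" "\<And>t. poly Q t \<noteq> 0 \<Longrightarrow> f t = poly P t / poly Q t"
  using assms unfolding rat0_def by blast

lemma rat0_const: "rat0 (\<lambda>_. a)"
  by (rule rat0I[of 1 _ "[:a:]"]) auto

lemma rat0_id: "rat0 (\<lambda>t. t)"
  by (rule rat0I[of 1 _ "[:0, 1:]"]) auto

lemma rat0_add:
  assumes "rat0 f" "rat0 g" shows "rat0 (\<lambda>t. f t + g t)"
proof -
  obtain P Q where f: "poly Q 0 \<noteq> 0" "\<And>t. poly Q t \<noteq> 0 \<Longrightarrow> f t = poly P t / poly Q t" using rat0E[OF assms(1)] by metis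
  obtain R S where g: "poly S 0 \<noteq> 0" "\<And>t. poly S t \<noteq> 0 \<Longrightarrow> g t = poly R t / poly S t" using rat0E[OF assms(2)] by metis
  show ?thesis by (rule rat0I[of "Q * S" _ "P * S + R * Q"]) (use f g in \<open>auto simp: add_frac_eq\<close>)
qed

lemma rat0_mult:
  assumes "rat0 f" "rat0 g" shows "rat0 (\<lambda>t. f t * g t)"
proof -
  obtain P Q where f: "poly Q 0 \<noteq> 0" "\<And>t. poly Q t \<noteq> 0 \<Longrightarrow> f t = poly P t / poly Q t" using rat0E[OF assms(1)] by metis
  obtain R S where g: "poly S 0 \<noteq> 0" "\<And>t. poly S t \<noteq> 0 \<Longrightarrow> g t = poly R t / poly S t" using rat0E[OF assms(2)] by metis
  show ?thesis by (rule rat0I[of "Q * S" _ "P * R"]) (use f g in auto)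
qed

lemma rat0_diff: "rat0 f \<Longrightarrow> rat0 g \<Longrightarrow> rat0 (\<lambda>t. f t - g t)"
  using rat0_add[OF _ rat0_mult[OF rat0_const[of "- 1"]], of f g] by simp

lemma rat0_divide:
  assumes "rat0 f" "rat0 g" "g 0 \<noteq> 0" shows "rat0 (\<lambda>t. f t / g t)"
proof -
  obtain P Q where f: "poly Q 0 \<noteq> 0" "\<And>t. poly Q t \<noteq> 0 \<Longrightarrow> f t = poly P t / poly Q t" using rat0E[OF assms(1)] by metis
  obtain R S where g: "poly S 0 \<noteq> 0" "\<And>t. poly S t \<noteq> 0 \<Longrightarrow> g t = poly R t / poly S t" using rat0E[OF assms(2)] by metis
  have "poly R 0 \<noteq> 0" using g(2)[OF g(1)] assms(3) by auto
  then show ?thesis by (intro rat0I[of "Q * R * S" _ "P * S * S"]) (use f g in auto)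
qed

lemma rat0_finite_zeros:
  assumes "rat0 f" "f 0 \<noteq> 0" shows "finite {t. f t = 0}"
proof -
  obtain P Q where f: "poly Q 0 \<noteq> 0" "\<And>t. poly Q t \<noteq> 0 \<Longrightarrow> f t = poly P t / poly Q t" using rat0E[OF assms(1)] by metis
  have "poly P 0 \<noteq> 0" using f(2)[OF f(1)] assms(2) by auto
  then have "P \<noteq> 0" "Q \<noteq> 0" using f(1) by auto
  then have "finite ({t. poly P t = 0} \<union> {t. poly Q t = 0})" using poly_roots_finite by blast
  moreover have "{t. f t = 0} \<subseteq> {t. poly P t = 0} \<union> {t. poly Q t = 0}" using f(2) by auto
  ultimately show ?thesis by (rule rev_finite_subset)
qed

context weil
begin

text \<open>Rational one-parameter families of forms. They test largeness, taking the place of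
  polynomial functions on the space of all symmetric forms.\<close>

definition curve :: "('f \<Rightarrow> 'x \<Rightarrow> 'x \<Rightarrow> 'f) \<Rightarrow> bool" where
  "curve \<beta> \<longleftrightarrow> (\<forall>t. bilin (\<beta> t)) \<and> (\<forall>x y. rat0 (\<lambda>t. \<beta> t x y))"

text \<open>A substitute for nonempty Zariski open sets of symmetric bilinear forms.\<close>

definition Large :: "('x \<Rightarrow> 'x \<Rightarrow> 'f) set \<Rightarrow> bool" where
  "Large S \<longleftrightarrow> S \<subseteq> {\<beta>. bilin \<beta>} \<and> S \<noteq> {} \<and> (\<forall>\<beta>. curve \<beta> \<longrightarrow> \<beta> 0 \<in> S \<longrightarrow> finite {t. \<beta> t \<notin> S})"

lemma LargeD:
  assumes "Large S"
  shows "\<beta> \<in> S \<Longrightarrow> bilin \<beta>" "S \<noteq> {}" "curve \<delta> \<Longrightarrow> \<delta> 0 \<in> S \<Longrightarrow> finite {t. \<delta> t \<notin> S}"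
  using assms unfolding Large_def by blast+

lemma Large_bilin: "Large {\<beta>. bilin \<beta>}"
  unfolding Large_def using bilin_0 by (auto simp: curve_def)

lemma curve_line: "bilin \<beta> \<Longrightarrow> bilin \<beta>' \<Longrightarrow> curve (\<lambda>t x y. \<beta> x y + t * (\<beta>' x y + - \<beta> x y))"
  unfolding curve_def
  by (intro conjI allI bilin_plus bilin_mult bilin_uminus rat0_add rat0_mult rat0_const rat0_id)

text \<open>A line joins a point of \<open>S\<close> to a point of \<open>S'\<close>. Read from
  either end it is a curve starting in the corresponding set, so each set misses finitely many
  parameters only, and the field is infinite.\<close>

lemma Large_Int:
  assumes "Large S" "Large S'" shows "Large (S \<inter> S')"
proof -
  obtain \<beta> \<beta>' where \<beta>: "\<beta> \<in> S" "\<beta>' \<in> S'" using LargeD(2)[OF assms(1)] LargeD(2)[OF assms(2)] by blast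
  have b: "bilin \<beta>" "bilin \<beta>'" using \<beta> LargeD(1)[OF assms(1)] LargeD(1)[OF assms(2)] by blast+
  define l where "l = (\<lambda>t x y. \<beta> x y + t * (\<beta>' x y + - \<beta> x y))"
  define m where "m = (\<lambda>t x y. \<beta>' x y + t * (\<beta> x y + - \<beta>' x y))"
  have lm: "m t = l (1 - t)" for t by (simp add: l_def m_def fun_eq_iff algebra_simps)
  have "finite {t. l t \<notin> S}" using LargeD(3)[OF assms(1), of l] curve_line[OF b] \<beta> by (simp add: l_def)
  moreover have "finite {t. m t \<notin> S'}" using LargeD(3)[OF assms(2), of m] curve_line[OF b(2,1)] \<beta> by (simp add: m_def)
  then have "finite ((\<lambda>t. 1 - t) ` {t. m t \<notin> S'})" by blast
  then have "finite {t. l t \<notin> S'}" by (rule rev_finite_subset) (auto simp: lm image_iff intro!: exI[of _ "1 - _"])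
  ultimately have "finite ({t. l t \<notin> S} \<union> {t. l t \<notin> S'})" by blast
  then obtain t where "t \<notin> {t. l t \<notin> S} \<union> {t. l t \<notin> S'}" using infinite_F by (metis UNIV_eq_I)
  then have "S \<inter> S' \<noteq> {}" by blast
  moreover have "finite {t. \<delta> t \<notin> S \<inter> S'}" if "curve \<delta>" "\<delta> 0 \<in> S \<inter> S'" for \<delta>
  proof -
    have "finite ({t. \<delta> t \<notin> S} \<union> {t. \<delta> t \<notin> S'})"
      using LargeD(3)[OF assms(1) that(1)] LargeD(3)[OF assms(2) that(1)] that(2) by blast
    then show ?thesis by (rule rev_finite_subset) blast
  qed
  ultimately show ?thesis using LargeD(1)[OF assms(1)] unfolding Large_def by blast
qed

lemma Large_denominator: "c \<noteq> 0 \<Longrightarrow> Large {\<beta>. bilin \<beta> \<and> c + \<beta> y y \<noteq> 0}"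
  unfolding Large_def
proof (intro conjI allI impI)
  assume "c \<noteq> 0"
  then have "(\<lambda>_ _. 0) \<in> {\<beta>. bilin \<beta> \<and> c + \<beta> y y \<noteq> 0}" using bilin_0 by simp
  then show "{\<beta>. bilin \<beta> \<and> c + \<beta> y y \<noteq> 0} \<noteq> {}" by blast
next
  fix \<delta> assume \<delta>: "curve \<delta>" "\<delta> 0 \<in> {\<beta>. bilin \<beta> \<and> c + \<beta> y y \<noteq> 0}"
  have "rat0 (\<lambda>t. c + \<delta> t y y)" using \<delta>(1) by (intro rat0_add rat0_const) (simp add: curve_def)
  then have "finite {t. c + \<delta> t y y = 0}" by (rule rat0_finite_zeros) (use \<delta>(2) in simp)
  then show "finite {t. \<delta> t \<notin> {\<beta>. bilin \<beta> \<and> c + \<beta> y y \<noteq> 0}}"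
    by (rule rev_finite_subset) (use \<delta>(1) in \<open>auto simp: curve_def\<close>)
qed blast

text \<open>The map \<open>x \<mapsto> (x, 2\<beta>'(x, \<cdot>))\<close> parametrises a Lagrangian; \<open>\<sigma>\<close> carries it to the one of \<open>\<beta>\<close> by the matrix \<open>A\<close>.
  The functional \<open>Psi \<beta>\<close> spans the invariants of that Lagrangian, so \<open>j\<close> is forced, and it is normalised against
  \<open>det A\<close>.\<close>

definition Rel where
  "Rel \<sigma> s \<beta> \<beta>' \<longleftrightarrow> (\<exists>A j. lin A \<and> D A \<noteq> 0 \<and> (\<forall>x. \<sigma> (x, \<lambda>z. 2 * \<beta>' x z) = (A x, \<lambda>z. 2 * \<beta> (A x) z)) \<and>
     (j * G 1)\<^sup>2 = (G (1 / D A))\<^sup>2 \<and> (\<forall>\<Phi>\<in>\<S>. Psi \<beta> (s \<Phi>) = j * Psi \<beta>' \<Phi>))"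

lemma RelI:
  assumes "lin A" "D A \<noteq> 0" "\<And>x. \<sigma> (x, \<lambda>z. 2 * \<beta>' x z) = (A x, \<lambda>z. 2 * \<beta> (A x) z)"
    "(j * G 1)\<^sup>2 = (G (1 / D A))\<^sup>2" "\<And>\<Phi>. \<Phi> \<in> \<S> \<Longrightarrow> Psi \<beta> (s \<Phi>) = j * Psi \<beta>' \<Phi>"
  shows "Rel \<sigma> s \<beta> \<beta>'"
  unfolding Rel_def using assms by blast

lemma graph_W: "bilin \<beta> \<Longrightarrow> (x, \<lambda>z. 2 * \<beta> x z) \<in> W"
  by (simp add: W_iff dual_iff bilin_add_right bilin_smul_right distrib_left)

text \<open>Both the matrices and the scalars multiply. \<open>G_mult\<close> replaces the product
  of the Gauss sums of the determinants by that of the product of determinants, up to a factor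
  \<open>G 1\<close> that cancels.\<close>

lemma Rel_mult:
  assumes "Rel \<sigma> s \<beta> \<beta>'" "Rel \<tau> t \<beta>' \<beta>''" "bilin \<beta>''"
    and Sp: "is_Sp \<sigma>" "is_Sp \<tau>" and Aut: "is_Aut s" "is_Aut t"
  shows "Rel (\<sigma> \<otimes>\<^bsub>Sp smul\<^esub> \<tau>) (s \<otimes>\<^bsub>Aut_S v smul\<^esub> t) \<beta> \<beta>''"
proof -
  obtain A j where A: "lin A" "D A \<noteq> 0" "\<And>x. \<sigma> (x, \<lambda>z. 2 * \<beta>' x z) = (A x, \<lambda>z. 2 * \<beta> (A x) z)"
    "(j * G 1)\<^sup>2 = (G (1 / D A))\<^sup>2" "\<And>\<Phi>. \<Phi> \<in> \<S> \<Longrightarrow> Psi \<beta> (s \<Phi>) = j * Psi \<beta>' \<Phi>"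
    using assms(1) unfolding Rel_def by blast
  obtain B k where B: "lin B" "D B \<noteq> 0" "\<And>x. \<tau> (x, \<lambda>z. 2 * \<beta>'' x z) = (B x, \<lambda>z. 2 * \<beta>' (B x) z)"
    "(k * G 1)\<^sup>2 = (G (1 / D B))\<^sup>2" "\<And>\<Phi>. \<Phi> \<in> \<S> \<Longrightarrow> Psi \<beta>' (t \<Phi>) = k * Psi \<beta>'' \<Phi>"
    using assms(2) unfolding Rel_def by blast
  have D: "D (\<lambda>x. A (B x)) = D A * D B" by (rule D_comp[OF A(1)])
  show ?thesis
  proof (rule RelI[where A="\<lambda>x. A (B x)" and j="j * k"])
    show "lin (\<lambda>x. A (B x))" using A(1) B(1) by (simp add: lin_def)
    show "D (\<lambda>x. A (B x)) \<noteq> 0" using A(2) B(2) D by simp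
    show "(\<sigma> \<otimes>\<^bsub>Sp smul\<^esub> \<tau>) (x, \<lambda>z. 2 * \<beta>'' x z) = (A (B x), \<lambda>z. 2 * \<beta> (A (B x)) z)" for x
      by (simp add: Sp_mult_apply[OF Sp graph_W[OF assms(3)]] A(3) B(3))
    have "(j * k * G 1)\<^sup>2 * (G 1)\<^sup>2 = (j * G 1)\<^sup>2 * (k * G 1)\<^sup>2" by (simp add: power2_eq_square)
    also have "\<dots> = (G (1 / D A) * G (1 / D B))\<^sup>2" unfolding A(4) B(4) by (simp add: power_mult_distrib)
    also have "\<dots> = (G 1 * G (1 / D A * (1 / D B)))\<^sup>2" by (rule G_mult) (use A(2) B(2) in simp_all)
    also have "\<dots> = (G (1 / D (\<lambda>x. A (B x))))\<^sup>2 * (G 1)\<^sup>2" by (simp add: D power_mult_distrib)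
    finally show "(j * k * G 1)\<^sup>2 = (G (1 / D (\<lambda>x. A (B x))))\<^sup>2" using G_nonzero[of 1] by simp
    show "Psi \<beta> ((s \<otimes>\<^bsub>Aut_S v smul\<^esub> t) \<Phi>) = j * k * Psi \<beta>'' \<Phi>" if "\<Phi> \<in> \<S>" for \<Phi>
      using that A(5)[OF is_AutD(2)[OF Aut(2)]] B(5) by (simp add: Aut_mult_apply[OF Aut])
  qed
qed

text \<open>\<open>Rel\<close> is required on a large set together with a rational map
  \<open>\<phi>\<close> giving the source form. The condition on curves makes preimages of large
  sets behave like open sets, and the last one, that the image of \<open>\<phi>\<close> meets every
  large set, makes them nonempty. Hence a product is again defined on a large set.\<close>

definition good where
  "good \<sigma> s \<longleftrightarrow> is_Sp \<sigma> \<and> is_Aut s \<and> (\<exists>S \<phi>. Large S \<and> (\<forall>\<beta>\<in>S. Rel \<sigma> s \<beta> (\<phi> \<beta>)) \<and>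
     (\<forall>\<delta>. curve \<delta> \<longrightarrow> \<delta> 0 \<in> S \<longrightarrow> curve (\<lambda>t. \<phi> (\<delta> t))) \<and> (\<forall>\<beta>. bilin \<beta> \<longrightarrow> bilin (\<phi> \<beta>)) \<and>
     (\<forall>S'. Large S' \<longrightarrow> (\<exists>\<beta>\<in>S. \<phi> \<beta> \<in> S')))"

lemma goodI:
  assumes "is_Sp \<sigma>" "is_Aut s" "Large S" "\<And>\<beta>. \<beta> \<in> S \<Longrightarrow> Rel \<sigma> s \<beta> (\<phi> \<beta>)"
    "\<And>\<delta>. curve \<delta> \<Longrightarrow> \<delta> 0 \<in> S \<Longrightarrow> curve (\<lambda>t. \<phi> (\<delta> t))" "\<And>\<beta>. bilin \<beta> \<Longrightarrow> bilin (\<phi> \<beta>)"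
    "\<And>S'. Large S' \<Longrightarrow> \<exists>\<beta>\<in>S. \<phi> \<beta> \<in> S'"
  shows "good \<sigma> s"
  unfolding good_def using assms by blast

lemma good_mult:
  assumes "good \<sigma> s" "good \<tau> t"
  shows "good (\<sigma> \<otimes>\<^bsub>Sp smul\<^esub> \<tau>) (s \<otimes>\<^bsub>Aut_S v smul\<^esub> t)"
proof -
  obtain S1 \<phi>1 where 1: "is_Sp \<sigma>" "is_Aut s" "Large S1" "\<And>\<beta>. \<beta> \<in> S1 \<Longrightarrow> Rel \<sigma> s \<beta> (\<phi>1 \<beta>)"
    "\<And>\<delta>. curve \<delta> \<Longrightarrow> \<delta> 0 \<in> S1 \<Longrightarrow> curve (\<lambda>t. \<phi>1 (\<delta> t))" "\<And>\<beta>. bilin \<beta> \<Longrightarrow> bilin (\<phi>1 \<beta>)"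
    "\<And>S'. Large S' \<Longrightarrow> \<exists>\<beta>\<in>S1. \<phi>1 \<beta> \<in> S'"
    using assms(1) unfolding good_def by blast
  obtain S2 \<phi>2 where 2: "is_Sp \<tau>" "is_Aut t" "Large S2" "\<And>\<beta>. \<beta> \<in> S2 \<Longrightarrow> Rel \<tau> t \<beta> (\<phi>2 \<beta>)"
    "\<And>\<delta>. curve \<delta> \<Longrightarrow> \<delta> 0 \<in> S2 \<Longrightarrow> curve (\<lambda>t. \<phi>2 (\<delta> t))" "\<And>\<beta>. bilin \<beta> \<Longrightarrow> bilin (\<phi>2 \<beta>)"
    "\<And>S'. Large S' \<Longrightarrow> \<exists>\<beta>\<in>S2. \<phi>2 \<beta> \<in> S'"
    using assms(2) unfolding good_def by blast
  \<comment> \<open>The domain of a composite of two such maps is large.\<close>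
  have preimage: "Large {\<beta>\<in>S. \<phi> \<beta> \<in> S'}"
    if L: "Large S" "Large S'" and curve: "\<And>\<delta>. curve \<delta> \<Longrightarrow> \<delta> 0 \<in> S \<Longrightarrow> curve (\<lambda>t. \<phi> (\<delta> t))"
      and hit: "\<And>S'. Large S' \<Longrightarrow> \<exists>\<beta>\<in>S. \<phi> \<beta> \<in> S'" for S S' \<phi>
    unfolding Large_def
  proof (intro conjI allI impI)
    show "{\<beta>\<in>S. \<phi> \<beta> \<in> S'} \<subseteq> {\<beta>. bilin \<beta>}" using LargeD(1)[OF L(1)] by blast
    show "{\<beta>\<in>S. \<phi> \<beta> \<in> S'} \<noteq> {}" using hit[OF L(2)] by blast
    fix \<delta> assume \<delta>: "curve \<delta>" "\<delta> 0 \<in> {\<beta>\<in>S. \<phi> \<beta> \<in> S'}"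
    have "finite {t. \<delta> t \<notin> S}" "finite {t. \<phi> (\<delta> t) \<notin> S'}"
      using LargeD(3)[OF L(1) \<delta>(1)] LargeD(3)[OF L(2) curve[OF \<delta>(1)]] \<delta>(2) by simp_all
    then have "finite ({t. \<delta> t \<notin> S} \<union> {t. \<phi> (\<delta> t) \<notin> S'})" by blast
    then show "finite {t. \<delta> t \<notin> {\<beta>\<in>S. \<phi> \<beta> \<in> S'}}" by (rule rev_finite_subset) blast
  qed
  show ?thesis
  proof (rule goodI[where S="{\<beta>\<in>S1. \<phi>1 \<beta> \<in> S2}" and \<phi>="\<lambda>\<beta>. \<phi>2 (\<phi>1 \<beta>)"])
    show "is_Sp (\<sigma> \<otimes>\<^bsub>Sp smul\<^esub> \<tau>)" using monoid.m_closed[OF group.is_monoid[OF Sp_group], of \<sigma> \<tau>] 1(1) 2(1) by simp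
    show "is_Aut (s \<otimes>\<^bsub>Aut_S v smul\<^esub> t)" by (rule Aut_mult_closed[OF 1(2) 2(2)])
    show "Large {\<beta>\<in>S1. \<phi>1 \<beta> \<in> S2}" by (rule preimage[OF 1(3) 2(3) 1(5) 1(7)])
    show "Rel (\<sigma> \<otimes>\<^bsub>Sp smul\<^esub> \<tau>) (s \<otimes>\<^bsub>Aut_S v smul\<^esub> t) \<beta> (\<phi>2 (\<phi>1 \<beta>))" if "\<beta> \<in> {\<beta>\<in>S1. \<phi>1 \<beta> \<in> S2}" for \<beta>
      by (rule Rel_mult[OF 1(4) 2(4) 2(6)[OF LargeD(1)[OF 2(3)]] 1(1) 2(1) 1(2) 2(2)]) (use that in auto)
    show "curve (\<lambda>t. \<phi>2 (\<phi>1 (\<delta> t)))" if "curve \<delta>" "\<delta> 0 \<in> {\<beta>\<in>S1. \<phi>1 \<beta> \<in> S2}" for \<delta>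
      by (rule 2(5)[OF 1(5)[OF that(1)]]) (use that(2) in auto)
    show "bilin (\<phi>2 (\<phi>1 \<beta>))" if "bilin \<beta>" for \<beta> by (rule 2(6)[OF 1(6)[OF that]])
    show "\<exists>\<beta>\<in>{\<beta>\<in>S1. \<phi>1 \<beta> \<in> S2}. \<phi>2 (\<phi>1 \<beta>) \<in> S'" if "Large S'" for S'
      using 1(7)[OF preimage[OF 2(3) that 2(5) 2(7)]] by blast
  qed
qed

lemma lin_id: "lin (\<lambda>x. x)"
  by (simp add: lin_def)

lemma id_Sp: "is_Sp (\<lambda>w\<in>W. w)"
  using monoid.one_closed[OF group.is_monoid[OF Sp_group]] by (simp add: Sp_one)

lemma good_sign:
  assumes t: "t\<^sup>2 = 1" "t dvd 1" shows "good (\<lambda>w\<in>W. w) (\<lambda>\<Phi>\<in>\<S>. \<lambda>x. t * \<Phi> x)"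
proof (rule goodI[where S="{\<beta>. bilin \<beta>}" and \<phi>="\<lambda>\<beta>. \<beta>"])
  show "is_Sp (\<lambda>w\<in>W. w)" by (rule id_Sp)
  have "t * (t * a) = a" for a using t(1) by (simp add: power2_eq_square mult.assoc[symmetric])
  then show "is_Aut (\<lambda>\<Phi>\<in>\<S>. \<lambda>x. t * \<Phi> x)"
    by (intro is_AutI[where g="\<lambda>\<Phi> x. t * \<Phi> x"]) (auto simp: Schwartz_mult fun_eq_iff distrib_left)
  show "Rel (\<lambda>w\<in>W. w) (\<lambda>\<Phi>\<in>\<S>. \<lambda>x. t * \<Phi> x) \<beta> \<beta>" if "\<beta> \<in> {\<beta>. bilin \<beta>}" for \<beta>
  proof (rule RelI[OF lin_id, where j=t])
    have \<beta>: "bilin \<beta>" using that by simp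
    show "(\<lambda>w\<in>W. w) (x, \<lambda>z. 2 * \<beta> x z) = (x, \<lambda>z. 2 * \<beta> x z)" for x using graph_W[OF \<beta>] by simp
    show "Psi \<beta> ((\<lambda>\<Phi>\<in>\<S>. \<lambda>x. t * \<Phi> x) \<Phi>) = t * Psi \<beta> \<Phi>" if "\<Phi> \<in> \<S>" for \<Phi>
    proof -
      have "mulq \<beta> (\<lambda>x. t * \<Phi> x) = (\<lambda>x. t * mulq \<beta> \<Phi> x)" by (simp add: mulq_def mult.left_commute)
      then show ?thesis using that I_mult[OF mulq_Schwartz[OF \<beta> that], of t] by (simp add: Psi_def)
    qed
  qed (use t in \<open>simp_all add: D_id power_mult_distrib\<close>)
  show "\<exists>\<beta>\<in>{\<beta>. bilin \<beta>}. \<beta> \<in> S'" if "Large S'" for S' using LargeD(1,2)[OF that] by blast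
qed (simp_all add: Large_bilin)

text \<open>Multiplication by a second-degree character only adds \<open>\<beta>0\<close> to the
  form: the base point of the graph does not move, so the matrix is the identity and
  \<open>j = 1\<close>.\<close>

lemma good_nq:
  assumes \<beta>0: "bilin \<beta>0" shows "good (restrict (nq \<beta>0) W) (Mop \<beta>0)"
proof (rule goodI[where S="{\<beta>. bilin \<beta>}" and \<phi>="\<lambda>\<beta> x y. \<beta> x y + \<beta>0 x y"])
  show "is_Sp (restrict (nq \<beta>0) W)" by (rule nq_Sp[OF \<beta>0])
  show "is_Aut (Mop \<beta>0)" by (rule Mop_Aut[OF \<beta>0])
  show "Large {\<beta>. bilin \<beta>}" by (rule Large_bilin)
  show "Rel (restrict (nq \<beta>0) W) (Mop \<beta>0) \<beta> (\<lambda>x y. \<beta> x y + \<beta>0 x y)" if "\<beta> \<in> {\<beta>. bilin \<beta>}" for \<beta>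
  proof (rule RelI[OF lin_id, where j=1])
    have \<beta>: "bilin \<beta>" using that by simp
    show "restrict (nq \<beta>0) W (x, \<lambda>z. 2 * (\<beta> x z + \<beta>0 x z)) = (x, \<lambda>z. 2 * \<beta> x z)" for x
      using graph_W[OF bilin_plus[OF \<beta> \<beta>0], of x] by (simp add: nq_def fun_eq_iff distrib_left)
    show "Psi \<beta> (Mop \<beta>0 \<Phi>) = 1 * Psi (\<lambda>x y. \<beta> x y + \<beta>0 x y) \<Phi>" if "\<Phi> \<in> \<S>" for \<Phi>
      using that by (simp add: Mop_def Psi_mulq)
  qed (simp_all add: D_id)
  show "bilin (\<lambda>x y. \<beta> x y + \<beta>0 x y)" if "bilin \<beta>" for \<beta> by (rule bilin_plus[OF that \<beta>0])
  show "curve (\<lambda>t x y. \<delta> t x y + \<beta>0 x y)" if "curve \<delta>" for \<delta>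
    using that \<beta>0 unfolding curve_def by (auto intro!: bilin_plus rat0_add rat0_const)
  show "\<exists>\<beta>\<in>{\<beta>. bilin \<beta>}. (\<lambda>x y. \<beta> x y + \<beta>0 x y) \<in> S'" if L: "Large S'" for S'
  proof -
    obtain \<beta> where \<beta>: "\<beta> \<in> S'" using LargeD(2)[OF L] by blast
    have "bilin (\<lambda>x y. \<beta> x y + - \<beta>0 x y)" by (rule bilin_plus[OF LargeD(1)[OF L \<beta>] bilin_uminus[OF \<beta>0]])
    moreover have "(\<lambda>x y. (\<beta> x y + - \<beta>0 x y) + \<beta>0 x y) \<in> S'" using \<beta> by simp
    ultimately show ?thesis by (intro bexI[of _ "\<lambda>x y. \<beta> x y + - \<beta>0 x y"]) auto
  qed
qed

text \<open>Reduction with parameter \<open>- c\<close> undoes the one with parameter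
  \<open>c\<close>, as the transvections are mutually inverse. This shows that
  \<open>reduce y c\<close> hits every large set.\<close>

lemma reduce_inverse:
  assumes \<beta>: "bilin \<beta>" and c: "c \<noteq> 0" and e: "- c + \<beta> y y \<noteq> 0"
  shows "c + reduce y (- c) \<beta> y y \<noteq> 0" "reduce y c (reduce y (- c) \<beta>) = \<beta>"
proof -
  have 1: "reduce y (- c) \<beta> u y = - c * \<beta> u y / (- c + \<beta> y y)" for u
    using e by (simp add: reduce_def field_simps)
  have 2: "c + reduce y (- c) \<beta> y y = - c\<^sup>2 / (- c + \<beta> y y)"
    unfolding 1 using e by (simp add: field_simps power2_eq_square)
  show "c + reduce y (- c) \<beta> y y \<noteq> 0" unfolding 2 using c e by simp
  show "reduce y c (reduce y (- c) \<beta>) = \<beta>"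
  proof (intro ext)
    fix u z
    have "reduce y c (reduce y (- c) \<beta>) u z = reduce y (- c) \<beta> u z
      - (- c * \<beta> u y / (- c + \<beta> y y)) * (- c * \<beta> z y / (- c + \<beta> y y)) / (- c\<^sup>2 / (- c + \<beta> y y))"
      by (subst reduce_def) (simp only: 2, simp only: 1)
    also have "(- c * \<beta> u y / (- c + \<beta> y y)) * (- c * \<beta> z y / (- c + \<beta> y y)) / (- c\<^sup>2 / (- c + \<beta> y y))
      = - (\<beta> u y * \<beta> z y / (- c + \<beta> y y))"
    proof -
      have "(- c * a / n) * (- c * b / n) / (- c\<^sup>2 / n) = - (a * b / n)" if "n \<noteq> 0" for a b n :: 'f
        using that c by (simp add: power2_eq_square)
      then show ?thesis using e by blast
    qed
    also have "reduce y (- c) \<beta> u z - - (\<beta> u y * \<beta> z y / (- c + \<beta> y y)) = \<beta> u z" by (simp add: reduce_def)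
    finally show "reduce y c (reduce y (- c) \<beta>) u z = \<beta> u z" .
  qed
qed

text \<open>Here \<open>A\<close> is \<open>x\<close> minus
  \<open>\<beta> x y / (c + \<beta> y y)\<close> times \<open>y\<close>, with determinant
  \<open>c / (c + \<beta> y y)\<close>, and \<open>Psi_conv\<close> gives
  \<open>j = G (c + \<beta> y y) / G c\<close>. The required relation is \<open>G_mult\<close> for
  \<open>c\<close> and \<open>(c + \<beta> y y) / c\<close>.\<close>

lemma good_tv:
  assumes c: "c \<noteq> 0" shows "good (restrict (tv y (1 / (2 * c))) W) (Cop y c)"
proof (rule goodI[where S="{\<beta>. bilin \<beta> \<and> c + \<beta> y y \<noteq> 0}" and \<phi>="reduce y c"])
  show "is_Sp (restrict (tv y (1 / (2 * c))) W)" by (rule tv_Sp)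
  show "is_Aut (Cop y c)" by (rule Cop_Aut[OF c])
  show "Large {\<beta>. bilin \<beta> \<and> c + \<beta> y y \<noteq> 0}" by (rule Large_denominator[OF c])
  show "bilin (reduce y c \<beta>)" if "bilin \<beta>" for \<beta> by (rule bilin_reduce[OF that])
  show "curve (\<lambda>t. reduce y c (\<delta> t))" if "curve \<delta>" "\<delta> 0 \<in> {\<beta>. bilin \<beta> \<and> c + \<beta> y y \<noteq> 0}" for \<delta>
    using that unfolding curve_def
    by (auto intro!: bilin_reduce rat0_diff rat0_divide rat0_mult rat0_add rat0_const simp: reduce_def[abs_def] bilin_reduce[unfolded reduce_def])
  show "\<exists>\<beta>\<in>{\<beta>. bilin \<beta> \<and> c + \<beta> y y \<noteq> 0}. reduce y c \<beta> \<in> S'" if L: "Large S'" for S'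
  proof -
    have c': "- c \<noteq> 0" using c by simp
    obtain \<beta> where \<beta>: "\<beta> \<in> S'" "bilin \<beta>" "- c + \<beta> y y \<noteq> 0"
      using LargeD(2)[OF Large_Int[OF L Large_denominator[OF c']]] by blast
    then show ?thesis
      using reduce_inverse[OF \<beta>(2) c \<beta>(3)] bilin_reduce[OF \<beta>(2), of y "- c"] by (intro bexI[of _ "reduce y (- c) \<beta>"]) auto
  qed
  show "Rel (restrict (tv y (1 / (2 * c))) W) (Cop y c) \<beta> (reduce y c \<beta>)"
    if "\<beta> \<in> {\<beta>. bilin \<beta> \<and> c + \<beta> y y \<noteq> 0}" for \<beta>
  proof -
    have \<beta>: "bilin \<beta>" and e: "c + \<beta> y y \<noteq> 0" using that by auto
    define \<phi> where "\<phi> x = (- 1 / (c + \<beta> y y)) * \<beta> x y" for x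
    define A where "A = (\<lambda>x. x + smul (\<phi> x) y)"
    have \<phi>: "\<phi> \<in> dual_space smul"
      unfolding \<phi>_def dual_iff using bilin_add_left[OF \<beta>] bilin_smul_left[OF \<beta>] by (simp add: distrib_left)
    have D: "D A = c / (c + \<beta> y y)"
    proof -
      have "D A = 1 + \<phi> y" unfolding A_def by (rule D_transvection[OF \<phi>])
      also have "\<dots> = c / (c + \<beta> y y)" using e by (simp add: \<phi>_def field_simps)
      finally show ?thesis .
    qed
    have red: "reduce y c \<beta> x z = \<beta> (A x) z" for x z
      unfolding reduce_def A_def \<phi>_def bilin_add_left[OF \<beta>] bilin_smul_left[OF \<beta>] bilin_sym[OF \<beta>, of y z] by simp
    have A: "x - smul (1 / (2 * c) * (2 * reduce y c \<beta> x y)) y = A x" for x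
    proof -
      have "reduce y c \<beta> x y = c * \<beta> x y / (c + \<beta> y y)" using e by (simp add: reduce_def field_simps)
      then have "1 / (2 * c) * (2 * reduce y c \<beta> x y) = - \<phi> x" using c two by (simp add: \<phi>_def)
      then show ?thesis by (simp add: A_def)
    qed
    show ?thesis
    proof (rule RelI[where A=A and j="nrm c * G (c + \<beta> y y)"])
      show "lin A" unfolding lin_def A_def
        by (simp add: dual_add[OF \<phi>] dual_smul[OF \<phi>] scale_left_distrib scale_right_distrib add_ac)
      show "D A \<noteq> 0" using D c e by simp
      show "restrict (tv y (1 / (2 * c))) W (x, \<lambda>z. 2 * reduce y c \<beta> x z) = (A x, \<lambda>z. 2 * \<beta> (A x) z)" for x
        using graph_W[OF bilin_reduce[OF \<beta>, of y c], of x] A[of x] by (simp add: tv_def red[symmetric])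
      have "(G c * G ((c + \<beta> y y) / c))\<^sup>2 = (G 1 * G (c + \<beta> y y))\<^sup>2"
        using G_mult[of c "(c + \<beta> y y) / c"] c e by simp
      then have "(nrm c)\<^sup>2 * (G c * G ((c + \<beta> y y) / c))\<^sup>2 = (nrm c)\<^sup>2 * (G 1 * G (c + \<beta> y y))\<^sup>2" by simp
      moreover have "(nrm c)\<^sup>2 * (G c * G ((c + \<beta> y y) / c))\<^sup>2 = (G c * nrm c)\<^sup>2 * (G ((c + \<beta> y y) / c))\<^sup>2"
        by (simp add: power_mult_distrib ac_simps)
      ultimately have "(G ((c + \<beta> y y) / c))\<^sup>2 = (nrm c)\<^sup>2 * (G 1 * G (c + \<beta> y y))\<^sup>2" using nrm[OF c] by simp
      then show "(nrm c * G (c + \<beta> y y) * G 1)\<^sup>2 = (G (1 / D A))\<^sup>2"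
        by (simp add: D power_mult_distrib ac_simps)
      show "Psi \<beta> (Cop y c \<Phi>) = nrm c * G (c + \<beta> y y) * Psi (reduce y c \<beta>) \<Phi>" if "\<Phi> \<in> \<S>" for \<Phi>
      proof -
        have "(G c * nrm c) * Psi \<beta> (conv y c \<Phi>) = nrm c * (G c * Psi \<beta> (conv y c \<Phi>))" by (simp add: ac_simps)
        then show ?thesis unfolding Psi_conv[of c \<beta> y, OF c \<beta> e that] using nrm[OF c] that by (simp add: Cop_def mult.assoc)
      qed
    qed
  qed
qed

text \<open>Over the identity the two graphs coincide, so \<open>A\<close> is the identity and
  \<open>\<phi> \<beta> = \<beta>\<close>. The normalisation then says \<open>j\<^sup>2 = 1\<close>,
  and a function with nonzero integral against \<open>\<beta>\<close> identifies \<open>t\<close>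
  with \<open>j\<close>.\<close>

lemma good_scalar:
  assumes "good (\<lambda>w\<in>W. w) (\<lambda>\<Phi>\<in>\<S>. \<lambda>x. t * \<Phi> x)" shows "t\<^sup>2 = 1"
proof -
  obtain S \<phi> where S: "Large S" "\<And>\<beta>. \<beta> \<in> S \<Longrightarrow> Rel (\<lambda>w\<in>W. w) (\<lambda>\<Phi>\<in>\<S>. \<lambda>x. t * \<Phi> x) \<beta> (\<phi> \<beta>)" "\<And>\<beta>. bilin \<beta> \<Longrightarrow> bilin (\<phi> \<beta>)"
    using assms unfolding good_def by blast
  obtain \<beta> where \<beta>: "\<beta> \<in> S" using LargeD(2)[OF S(1)] by blast
  have b: "bilin \<beta>" "bilin (\<phi> \<beta>)" using LargeD(1)[OF S(1) \<beta>] S(3) by auto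
  obtain A j where A: "\<And>x. (\<lambda>w\<in>W. w) (x, \<lambda>z. 2 * \<phi> \<beta> x z) = (A x, \<lambda>z. 2 * \<beta> (A x) z)"
    "(j * G 1)\<^sup>2 = (G (1 / D A))\<^sup>2" "\<And>\<Phi>. \<Phi> \<in> \<S> \<Longrightarrow> Psi \<beta> ((\<lambda>\<Phi>\<in>\<S>. \<lambda>x. t * \<Phi> x) \<Phi>) = j * Psi (\<phi> \<beta>) \<Phi>"
    using S(2)[OF \<beta>] unfolding Rel_def by blast
  have eq: "x = A x \<and> (\<lambda>z. 2 * \<phi> \<beta> x z) = (\<lambda>z. 2 * \<beta> (A x) z)" for x
    using A(1)[of x] graph_W[OF b(2), of x] by simp
  have "A = (\<lambda>x. x)" using eq by (simp add: fun_eq_iff)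
  then have "(j * G 1)\<^sup>2 = (G 1)\<^sup>2" using A(2) D_id by simp
  then have j: "j\<^sup>2 = 1" using G_nonzero[of 1] by (simp add: power_mult_distrib)
  have "2 * \<phi> \<beta> x z = 2 * \<beta> x z" for x z using eq[of x] by (metis (full_types))
  then have \<phi>: "\<phi> \<beta> = \<beta>" using two by (simp add: fun_eq_iff)
  \<comment> \<open>The phase cancels the one in \<open>Psi \<beta>\<close>, leaving the volume of a
    lattice.\<close>
  define \<Phi> where "\<Phi> = mulq (\<lambda>x y. - \<beta> x y) (ind 0)"
  have \<Phi>: "\<Phi> \<in> \<S>" unfolding \<Phi>_def by (rule mulq_Schwartz[OF bilin_uminus[OF b(1)] ind_Schwartz])
  have P: "Psi \<beta> \<Phi> = vol 0" by (simp add: \<Phi>_def Psi_mulq) (simp add: Psi_def mulq_0 I_ind)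
  have "mulq \<beta> (\<lambda>x. t * \<Phi> x) = (\<lambda>x. t * mulq \<beta> \<Phi> x)" by (simp add: mulq_def mult.left_commute)
  then have "Psi \<beta> (\<lambda>x. t * \<Phi> x) = t * Psi \<beta> \<Phi>"
    using I_mult[OF mulq_Schwartz[OF b(1) \<Phi>], of t] by (simp add: Psi_def)
  then have "t * vol 0 = j * vol 0" using A(3)[OF \<Phi>] \<Phi> P \<phi> by simp
  then show ?thesis using j vol_nonzero by simp
qed


section \<open>Generation of the symplectic group by transvections\<close>

lemma W_diff: "w \<in> W \<Longrightarrow> w' \<in> W \<Longrightarrow> w - w' \<in> W"
  using W_add[OF _ W_uminus, of w w'] by simp

lemma symp_add_left: "u \<in> W \<Longrightarrow> symp (w + w') u = symp w u + symp w' u"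
  and symp_add_right: "u \<in> W \<Longrightarrow> symp u (w + w') = symp u w + symp u w'"
  and symp_diff_right: "u \<in> W \<Longrightarrow> symp u (w - w') = symp u w - symp u w'"
  by (simp_all add: symp_def B_form_def W_iff dual_add dual_diff)

lemma symp_smul_right: "u \<in> W \<Longrightarrow> symp u (W_smul smul a w) = a * symp u w"
  by (simp add: symp_def B_form_def W_iff W_smul_def dual_smul right_diff_distrib)

lemma symp_self: "symp w w = 0"
  by (simp add: symp_def)

lemma symp_nondegenerate:
  assumes "u \<in> W" "u \<noteq> 0" shows "\<exists>z\<in>W. symp z u \<noteq> 0"
proof (cases "fst u = 0")
  case True
  then have "snd u \<noteq> 0" using assms(2) by (simp add: prod_eq_iff)
  then obtain x where "snd u x \<noteq> 0" by (auto simp: fun_eq_iff)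
  then have "symp (x, \<lambda>_. 0) u \<noteq> 0" by (simp add: symp_def B_form_def)
  moreover have "(x, \<lambda>_. 0) \<in> W" by (simp add: W_iff dual_iff)
  ultimately show ?thesis by blast
next
  case False
  then obtain b where b: "b \<in> E" "co b (fst u) \<noteq> 0" using co_eqI[of "fst u" 0] by auto
  have "snd u \<in> dual_space smul" using assms(1) by (simp add: W_iff)
  then have "symp (0, co b) u \<noteq> 0" using b by (simp add: symp_def B_form_def dual_0)
  moreover have "(0, co b) \<in> W" by (simp add: W_iff co_dual)
  ultimately show ?thesis by blast
qed

definition transvection :: "'x \<times> ('x \<Rightarrow> 'f) \<Rightarrow> 'f \<Rightarrow> 'x \<times> ('x \<Rightarrow> 'f) \<Rightarrow> 'x \<times> ('x \<Rightarrow> 'f)" where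
  "transvection u a = (\<lambda>z\<in>W. z + W_smul smul (a * symp z u) u)"

lemma Sp_closed:
  shows "is_Sp \<sigma> \<Longrightarrow> is_Sp \<tau> \<Longrightarrow> is_Sp (\<sigma> \<otimes>\<^bsub>Sp smul\<^esub> \<tau>)" "is_Sp \<sigma> \<Longrightarrow> is_Sp (inv\<^bsub>Sp smul\<^esub> \<sigma>)"
  using monoid.m_closed[OF group.is_monoid[OF Sp_group], of \<sigma> \<tau>] group.inv_closed[OF Sp_group, of \<sigma>] by simp_all

lemma transvection_tv: "transvection (y, \<lambda>_. 0) a = restrict (tv y a) W"
  unfolding transvection_def
  by (rule restrict_ext) (simp add: tv_def W_smul_def symp_def B_form_def prod_eq_iff fun_eq_iff)

lemma transvection_nq: "transvection (0, \<phi>) a = restrict (nq (\<lambda>x y. - a / 2 * \<phi> x * \<phi> y)) W"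
  unfolding transvection_def
proof (rule restrict_ext)
  fix w assume "w \<in> W"
  then have "snd w 0 = 0" by (simp add: W_iff dual_0)
  then show "w + W_smul smul (a * symp w (0, \<phi>)) (0, \<phi>) = nq (\<lambda>x y. - a / 2 * \<phi> x * \<phi> y) w"
    using two by (simp add: nq_def W_smul_def symp_def B_form_def prod_eq_iff fun_eq_iff)
qed

text \<open>Reduces transvections in an arbitrary direction to one representative direction in each
  orbit.\<close>

lemma transvection_conjugate:
  assumes g: "is_Sp g" and u: "u \<in> W" and T: "is_Sp (transvection u a)"
  shows "transvection (g u) a = g \<otimes>\<^bsub>Sp smul\<^esub> (transvection u a \<otimes>\<^bsub>Sp smul\<^esub> inv\<^bsub>Sp smul\<^esub> g)"
proof (rule extensionalityI[of _ W])
  have "is_Sp (g \<otimes>\<^bsub>Sp smul\<^esub> (transvection u a \<otimes>\<^bsub>Sp smul\<^esub> inv\<^bsub>Sp smul\<^esub> g))"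
    by (intro Sp_closed g T)
  then show "g \<otimes>\<^bsub>Sp smul\<^esub> (transvection u a \<otimes>\<^bsub>Sp smul\<^esub> inv\<^bsub>Sp smul\<^esub> g) \<in> extensional W"
    using is_SpD(1) by (auto simp: Bij_def)
  show "transvection (g u) a \<in> extensional W" by (simp add: transvection_def)
  fix w assume w: "w \<in> W"
  define z where "z = (inv\<^bsub>Sp smul\<^esub> g) w"
  have z: "z \<in> W" "g z = w" using Sp_inv[OF g w] by (simp_all add: z_def)
  have "(g \<otimes>\<^bsub>Sp smul\<^esub> (transvection u a \<otimes>\<^bsub>Sp smul\<^esub> inv\<^bsub>Sp smul\<^esub> g)) w = g (z + W_smul smul (a * symp z u) u)"
    unfolding Sp_mult_apply[OF g Sp_closed(1)[OF T Sp_closed(2)[OF g]] w] Sp_mult_apply[OF T Sp_closed(2)[OF g] w] z_def[symmetric]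
    using z(1) by (simp add: transvection_def)
  also have "\<dots> = g z + W_smul smul (a * symp z u) (g u)"
    using z(1) u by (simp add: is_SpD[OF g] W_smul)
  also have "\<dots> = transvection (g u) a w"
    using is_SpD(5)[OF g z(1) u] w z(2) by (simp add: transvection_def)
  finally show "transvection (g u) a w = (g \<otimes>\<^bsub>Sp smul\<^esub> (transvection u a \<otimes>\<^bsub>Sp smul\<^esub> inv\<^bsub>Sp smul\<^esub> g)) w" by simp
qed

text \<open>Symmetrise the product of \<open>\<psi>\<close> with a functional \<open>\<phi>\<close>
  equal to 1 at \<open>y\<close>, and subtract what is counted twice. The resulting Siegel unipotent
  moves \<open>(y, 0)\<close> to \<open>(y, \<psi>)\<close>.\<close>

lemma bilin_with_row:
  assumes "y \<noteq> 0" "\<psi> \<in> dual_space smul" shows "\<exists>\<beta>. bilin \<beta> \<and> (\<forall>z. - 2 * \<beta> y z = \<psi> z)"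
proof -
  obtain b where b: "b \<in> E" "co b y \<noteq> 0" using assms(1) co_eqI[of y 0] by auto
  define \<phi> where "\<phi> x = co b x / co b y" for x
  have \<phi>: "\<phi> \<in> dual_space smul" by (simp add: dual_iff \<phi>_def co_add co_smul add_divide_distrib)
  have 1: "\<phi> y = 1" using b by (simp add: \<phi>_def)
  define \<beta> where "\<beta> u z = (\<psi> u * \<phi> z + \<phi> u * \<psi> z - \<psi> y * \<phi> u * \<phi> z) / - 2" for u z
  have "bilin \<beta>"
    unfolding bilin_def \<beta>_def
    by (simp add: dual_add[OF \<phi>] dual_smul[OF \<phi>] dual_add[OF assms(2)] dual_smul[OF assms(2)]
        diff_divide_distrib add_divide_distrib algebra_simps)
  moreover have "- 2 * \<beta> y z = \<psi> z" for z using two by (simp add: \<beta>_def 1)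
  ultimately show ?thesis by blast
qed

lemma W_vector_space: "vector_space (W_smul smul)"
  by unfold_locales (simp_all add: W_smul_def prod_eq_iff fun_eq_iff scale_right_distrib scale_left_distrib distrib_left distrib_right)

lemma sum_apply: "(\<Sum>i\<in>A. f i) x = (\<Sum>i\<in>A. f i x)"
  by (induction A rule: infinite_finite_induct) simp_all

lemma W_finite_span: "\<exists>T. finite T \<and> W \<subseteq> module.span (W_smul smul) T"
proof -
  interpret Wv: vector_space "W_smul smul" by (rule W_vector_space)
  define T where "T = (\<lambda>b. (b, \<lambda>_. 0)) ` E \<union> (\<lambda>b. (0, co b)) ` E"
  have "w \<in> Wv.span T" if "w \<in> W" for w
  proof -
    have dual: "snd w \<in> dual_space smul" using that by (simp add: W_iff)
    have snd: "(\<Sum>b\<in>E. snd w b * co b x) = snd w x" for x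
      using dual_sum[OF dual, of "\<lambda>b. smul (co b x) b" E] by (simp add: co_expand dual_smul[OF dual] mult.commute)
    have "w = (\<Sum>b\<in>E. W_smul smul (co b (fst w)) (b, \<lambda>_. 0)) + (\<Sum>b\<in>E. W_smul smul (snd w b) (0, co b))"
      by (simp add: prod_eq_iff fst_sum snd_sum W_smul_def co_expand fun_eq_iff sum_apply snd)
    also have "\<dots> \<in> Wv.span T"
      by (intro Wv.span_add Wv.span_sum Wv.span_scale Wv.span_base) (auto simp: T_def)
    finally show ?thesis .
  qed
  moreover have "finite T" using E_finite by (simp add: T_def)
  ultimately show ?thesis by blast
qed

text \<open>Transvections are reached first: those in dual directions are Siegel unipotents, and all
  others are conjugate to a \<open>tv\<close>. Then the number of independent fixed vectors of
  \<open>\<sigma>\<close> is increased: when \<open>w\<close> and its image pair nontrivially, a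
  transvection along their difference carries \<open>w\<close> to its image and disturbs no vector
  already fixed.\<close>

lemma Sp_generation:
  assumes Sp: "\<And>\<sigma>. Q \<sigma> \<Longrightarrow> is_Sp \<sigma>"
    and one: "Q (\<lambda>w\<in>W. w)"
    and mult: "\<And>\<sigma> \<tau>. Q \<sigma> \<Longrightarrow> Q \<tau> \<Longrightarrow> Q (\<sigma> \<otimes>\<^bsub>Sp smul\<^esub> \<tau>)"
    and inv: "\<And>\<sigma>. Q \<sigma> \<Longrightarrow> Q (inv\<^bsub>Sp smul\<^esub> \<sigma>)"
    and tv: "\<And>y a. Q (restrict (tv y a) W)"
    and nq: "\<And>\<beta>. bilin \<beta> \<Longrightarrow> Q (restrict (nq \<beta>) W)"
    and \<sigma>: "is_Sp \<sigma>"
  shows "Q \<sigma>"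
proof -
  have T: "Q (transvection u a)" if u: "u \<in> W" for u a
  proof (cases "fst u = 0")
    case True
    then have "transvection u a = transvection (0, snd u) a" by (metis prod.collapse)
    then show ?thesis unfolding transvection_nq using u nq[OF bilin_rank1, of "snd u" "- a / 2"] by (simp add: W_iff)
  next
    case False
    obtain \<beta> where \<beta>: "bilin \<beta>" "\<And>z. - 2 * \<beta> (fst u) z = snd u z"
      using bilin_with_row[OF False, of "snd u"] u W_iff by blast
    have w: "(fst u, \<lambda>_. 0) \<in> W" by (simp add: W_iff dual_iff)
    have g: "restrict (nq \<beta>) W (fst u, \<lambda>_. 0) = u"
      using \<beta>(2) w by (simp add: nq_def prod_eq_iff fun_eq_iff)
    have t: "Q (transvection (fst u, \<lambda>_. 0) a)" unfolding transvection_tv by (rule tv)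
    have "transvection u a = restrict (nq \<beta>) W \<otimes>\<^bsub>Sp smul\<^esub> (transvection (fst u, \<lambda>_. 0) a \<otimes>\<^bsub>Sp smul\<^esub> inv\<^bsub>Sp smul\<^esub> (restrict (nq \<beta>) W))"
      using transvection_conjugate[OF nq_Sp[OF \<beta>(1)] w Sp[OF t]] unfolding g .
    then show ?thesis using mult[OF nq[OF \<beta>(1)] mult[OF t inv[OF nq[OF \<beta>(1)]]]] by simp
  qed
  interpret S: group "Sp smul" by (rule Sp_group)
  interpret Wv: vector_space "W_smul smul" by (rule W_vector_space)
  obtain B where B: "finite B" "W \<subseteq> Wv.span B" using W_finite_span by blast
  \<comment> \<open>\<open>A\<close> collects independent fixed vectors; the spanning set
    \<open>B\<close> bounds their number, so \<open>n\<close> decreases with each new one.\<close>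
  have "Q \<sigma>" if "is_Sp \<sigma>" "Wv.independent A" "A \<subseteq> W" "\<And>z. z \<in> A \<Longrightarrow> \<sigma> z = z" "n = card B - card A" for \<sigma> A n
    using that
  proof (induction n arbitrary: \<sigma> A rule: less_induct)
    case (less n)
    note \<sigma> = less.prems(1) and A = less.prems(2-4)
    have cancel: "transvection u a \<otimes>\<^bsub>Sp smul\<^esub> (inv\<^bsub>Sp smul\<^esub> transvection u a \<otimes>\<^bsub>Sp smul\<^esub> \<tau>) = \<tau>"
      "inv\<^bsub>Sp smul\<^esub> transvection u a \<otimes>\<^bsub>Sp smul\<^esub> (transvection u a \<otimes>\<^bsub>Sp smul\<^esub> \<tau>) = \<tau>"
      if "u \<in> W" "is_Sp \<tau>" for u a \<tau>
    proof -
      have c: "transvection u a \<in> carrier (Sp smul)" "\<tau> \<in> carrier (Sp smul)" using Sp[OF T[OF that(1), of a]] that(2) by simp_all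
      have i: "inv\<^bsub>Sp smul\<^esub> transvection u a \<in> carrier (Sp smul)" by (rule S.inv_closed[OF c(1)])
      show "transvection u a \<otimes>\<^bsub>Sp smul\<^esub> (inv\<^bsub>Sp smul\<^esub> transvection u a \<otimes>\<^bsub>Sp smul\<^esub> \<tau>) = \<tau>"
        unfolding S.m_assoc[OF c(1) i c(2), symmetric] S.r_inv[OF c(1)] by (rule S.l_one[OF c(2)])
      show "inv\<^bsub>Sp smul\<^esub> transvection u a \<otimes>\<^bsub>Sp smul\<^esub> (transvection u a \<otimes>\<^bsub>Sp smul\<^esub> \<tau>) = \<tau>"
        unfolding S.m_assoc[OF i c(1) c(2), symmetric] S.l_inv[OF c(1)] by (rule S.l_one[OF c(2)])
    qed
    have fixed: "transvection (\<sigma> w - w) a z = z" if "z \<in> W" "\<sigma> z = z" "w \<in> W" for z w a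
    proof -
      have "symp z (\<sigma> w - w) = 0"
        using is_SpD(5)[OF \<sigma> that(1,3)] that by (simp add: symp_diff_right)
      then show ?thesis using that(1) by (simp add: transvection_def W_smul_def zero_prod_def zero_fun_def)
    qed
    have step: "Q \<tau>"
      if \<tau>: "is_Sp \<tau>" "\<And>z. z \<in> A \<Longrightarrow> \<tau> z = z" and w: "w \<in> W" "symp w (\<tau> w) \<noteq> 0" for \<tau> w
    proof -
      define u where "u = \<tau> w - w"
      \<comment> \<open>The coefficient is chosen so that exactly \<open>u\<close> is added to
        \<open>w\<close>.\<close>
      define t where "t = transvection u (1 / symp w (\<tau> w))"
      have u: "u \<in> W" using is_SpD(2)[OF \<tau>(1) w(1)] w(1) by (simp add: u_def W_diff)
      have t: "Q t" "is_Sp t" using T[OF u] Sp by (auto simp: t_def)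
      have su: "symp w u = symp w (\<tau> w)" by (simp add: u_def symp_diff_right[OF w(1)] symp_self)
      have "W_smul smul 1 u = u" by (simp add: W_smul_def)
      then have tw: "t w = \<tau> w" using w su by (simp add: t_def transvection_def) (simp add: u_def)
      have tz: "t z = \<tau> z" if "z \<in> A" for z
      proof -
        have z: "z \<in> W" "\<tau> z = z" using that A(2) \<tau>(2) by auto
        have "symp z u = 0" using is_SpD(5)[OF \<tau>(1) z(1) w(1)] z by (simp add: u_def symp_diff_right)
        then show ?thesis using z by (simp add: t_def transvection_def W_smul_def zero_prod_def zero_fun_def)
      qed
      define \<rho> where "\<rho> = inv\<^bsub>Sp smul\<^esub> t \<otimes>\<^bsub>Sp smul\<^esub> \<tau>"
      have \<rho>: "is_Sp \<rho>" unfolding \<rho>_def by (intro Sp_closed t \<tau>)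
      have \<rho>_fix: "\<rho> z = z" if "z \<in> insert w A" for z
      proof -
        have z: "z \<in> W" "t z = \<tau> z" using that w(1) A(2) tw tz[of z] by blast+
        have "\<rho> z = (inv\<^bsub>Sp smul\<^esub> t) (\<tau> z)"
          unfolding \<rho>_def by (rule Sp_mult_apply[OF Sp_closed(2)[OF t(2)] \<tau>(1) z(1)])
        then show ?thesis using Sp_inv(3)[OF t(2) z(1)] z(2) by simp
      qed
      have "Wv.subspace {z \<in> W. \<tau> z = z}"
        unfolding Wv.subspace_def
      proof (intro conjI ballI allI)
        have 0: "0 \<in> W" by (simp add: W_iff dual_iff)
        then have "\<tau> 0 = 0" using is_SpD(3)[OF \<tau>(1) 0 0] by simp
        then show "0 \<in> {z \<in> W. \<tau> z = z}" using 0 by simp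
      qed (auto simp: is_SpD[OF \<tau>(1)] W_add W_smul)
      moreover have "A \<subseteq> {z \<in> W. \<tau> z = z}" using A(2) \<tau>(2) by auto
      ultimately have "Wv.span A \<subseteq> {z \<in> W. \<tau> z = z}" by (rule Wv.span_minimal[rotated])
      \<comment> \<open>A vector in the span would be fixed and hence would pair to 0 with its
        image.\<close>
      then have nin: "w \<notin> Wv.span A" using w(2) symp_self[of w] by auto
      then have ind: "Wv.independent (insert w A)" by (rule Wv.independent_insertI[OF _ A(1)])
      have "insert w A \<subseteq> Wv.span B" using A(2) w(1) B(2) by blast
      then have card: "finite (insert w A)" "card (insert w A) \<le> card B"
        using Wv.independent_span_bound[OF B(1) ind] by auto
      have "w \<notin> A" using nin Wv.span_base by blast
      then have "card B - card (insert w A) < n" using card less.prems(5) by simp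
      then have "Q \<rho>"
        by (rule less.IH[OF _ \<rho> ind]) (use A(2) w(1) \<rho>_fix in auto)
      then have "Q (t \<otimes>\<^bsub>Sp smul\<^esub> \<rho>)" by (rule mult[OF t(1)])
      then show "Q \<tau>" unfolding \<rho>_def t_def cancel(1)[OF u \<tau>(1)] .
    qed
    show "Q \<sigma>"
    proof (cases "\<exists>w\<in>W. \<sigma> w \<noteq> w")
      case False
      then have "\<sigma> = (\<lambda>w\<in>W. w)" by (intro Sp_eqI[OF \<sigma> id_Sp]) auto
      then show ?thesis using one by simp
    next
      case True
      then obtain w where w: "w \<in> W" "\<sigma> w \<noteq> w" by blast
      define u where "u = \<sigma> w - w"
      have u: "u \<in> W" "u \<noteq> 0" using is_SpD(2)[OF \<sigma> w(1)] w by (simp_all add: u_def W_diff)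
      obtain z2 where z2: "z2 \<in> W" "symp z2 u \<noteq> 0" using symp_nondegenerate[OF u] by blast
      define z1 where "z1 = (inv\<^bsub>Sp smul\<^esub> \<sigma>) z2"
      have z1: "z1 \<in> W" "symp (\<sigma> z1) u \<noteq> 0" using Sp_inv[OF \<sigma> z2(1)] z2(2) by (simp_all add: z1_def)
      \<comment> \<open>A space is not the union of two proper subspaces: if \<open>z1\<close> and
        \<open>z2\<close> each fail one condition, their sum meets both.\<close>
      have "\<exists>z\<in>W. symp (\<sigma> z) u \<noteq> 0 \<and> symp z u \<noteq> 0"
      proof (cases "symp z1 u = 0 \<and> symp (\<sigma> z2) u = 0")
        case True
        then have "symp (\<sigma> (z1 + z2)) u \<noteq> 0 \<and> symp (z1 + z2) u \<noteq> 0"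
          using z1 z2 by (simp add: is_SpD(3)[OF \<sigma>] symp_add_left[OF u(1)])
        then show ?thesis using W_add[OF z1(1) z2(1)] by blast
      qed (use z1 z2 in blast)
      then obtain z where z: "z \<in> W" "symp (\<sigma> z) u \<noteq> 0" "symp z u \<noteq> 0" by blast
      show ?thesis
      proof (cases "symp z (\<sigma> z) = 0")
        case False
        then show ?thesis using step[OF \<sigma> A(3) z(1)] by blast
      next
        case True
        \<comment> \<open>When \<open>z\<close> pairs to 0 with its image, this extra transvection
          repairs it: the new pairing is the product of the two nonzero values found for
          \<open>z\<close>, and the vectors of \<open>A\<close> remain fixed.\<close>
        define t where "t = transvection u 1"
        have t: "Q t" "is_Sp t" using T[OF u(1)] Sp by (auto simp: t_def)
        have app: "(t \<otimes>\<^bsub>Sp smul\<^esub> \<sigma>) x = t (\<sigma> x)" if "x \<in> W" for x by (rule Sp_mult_apply[OF t(2) \<sigma> that])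
        have "Q (t \<otimes>\<^bsub>Sp smul\<^esub> \<sigma>)"
        proof (rule step[OF Sp_closed(1)[OF t(2) \<sigma>] _ z(1)])
          show "(t \<otimes>\<^bsub>Sp smul\<^esub> \<sigma>) x = x" if "x \<in> A" for x
          proof -
            have x: "x \<in> W" "\<sigma> x = x" using that A(2,3) by auto
            show ?thesis by (simp only: app[OF x(1)] x(2)) (simp only: t_def u_def fixed[OF x w(1)])
          qed
          have t_\<sigma>: "t (\<sigma> z) = \<sigma> z + W_smul smul (symp (\<sigma> z) u) u"
            using is_SpD(2)[OF \<sigma> z(1)] by (simp add: t_def transvection_def)
          have "symp z ((t \<otimes>\<^bsub>Sp smul\<^esub> \<sigma>) z) = symp (\<sigma> z) u * symp z u"
            using True is_SpD(2)[OF \<sigma> z(1)] z(1)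
            by (simp add: app[OF z(1)] t_\<sigma> symp_add_right symp_smul_right)
          then show "symp z ((t \<otimes>\<^bsub>Sp smul\<^esub> \<sigma>) z) \<noteq> 0" using z by simp
        qed
        from mult[OF inv[OF t(1)] this] show ?thesis unfolding t_def cancel(2)[OF u(1) \<sigma>] .
      qed
    qed
  qed
  from this[OF \<sigma> Wv.independent_empty] show ?thesis by simp
qed

section \<open>The reduced metaplectic group\<close>

text \<open>The signs are put in by hand so that the kernel contains all of
  \<open>mu2\<close>.\<close>

definition Gens where
  "Gens = {(restrict (nq \<beta>) W, Mop \<beta>) |\<beta>. bilin \<beta>} \<union> {(restrict (tv y (1 / (2 * c))) W, Cop y c) |y c. c \<noteq> 0}
     \<union> unit_embedding v smul ` mu2"

definition Mp2 where "Mp2 = generate (Mp v smul chi) Gens"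

lemma unit_embedding_Mp:
  assumes "t \<in> mu2" shows "unit_embedding v smul t \<in> carrier (Mp v smul chi)"
proof -
  have "intertwines (\<lambda>w\<in>W. w) (\<lambda>\<Phi>\<in>\<S>. \<lambda>x. t * \<Phi> x)"
    unfolding intertwines_def by (simp add: id_f_sigma op_Schwartz op_mult)
  moreover have "is_Aut (\<lambda>\<Phi>\<in>\<S>. \<lambda>x. t * \<Phi> x)" using good_sign[of t] assms by (simp add: mu2_def good_def)
  ultimately show ?thesis unfolding unit_embedding_def carrier_Mp_iff using id_Sp by blast
qed

lemma Gens_Mp: "Gens \<subseteq> carrier (Mp v smul chi)"
proof
  fix g assume "g \<in> Gens"
  then consider \<beta> where "g = (restrict (nq \<beta>) W, Mop \<beta>)" "bilin \<beta>"
    | y c where "g = (restrict (tv y (1 / (2 * c))) W, Cop y c)" "c \<noteq> 0" | "g \<in> unit_embedding v smul ` mu2"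
    unfolding Gens_def by blast
  then show "g \<in> carrier (Mp v smul chi)"
  proof cases
    case 1
    then show ?thesis unfolding 1(1) carrier_Mp_iff using nq_Sp Mop_Aut nq_intertwines by blast
  next
    case 2
    then show ?thesis unfolding 2(1) carrier_Mp_iff using tv_Sp Cop_Aut tv_intertwines by blast
  next
    case 3
    then show ?thesis using unit_embedding_Mp by blast
  qed
qed

text \<open>\<open>good\<close> is known to pass to products; that generators have inverses among
  the generators extends it to the generated group.\<close>

lemma Gens_inverse:
  assumes "g \<in> Gens" shows "\<exists>h\<in>Gens. h \<otimes>\<^bsub>Mp v smul chi\<^esub> g = \<one>\<^bsub>Mp v smul chi\<^esub>"
proof -
  consider \<beta> where "g = (restrict (nq \<beta>) W, Mop \<beta>)" "bilin \<beta>"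
    | y c where "g = (restrict (tv y (1 / (2 * c))) W, Cop y c)" "c \<noteq> 0" | "g \<in> unit_embedding v smul ` mu2"
    using assms unfolding Gens_def by blast
  then show ?thesis
  proof cases
    case 1
    define \<beta>' where "\<beta>' = (\<lambda>x y. - \<beta> x y)"
    have \<beta>': "bilin \<beta>'" unfolding \<beta>'_def by (rule bilin_uminus[OF 1(2)])
    have "restrict (nq \<beta>') W \<otimes>\<^bsub>Sp smul\<^esub> restrict (nq \<beta>) W = (\<lambda>w\<in>W. w)"
    proof (rule Sp_eqI[OF Sp_closed(1)[OF nq_Sp[OF \<beta>'] nq_Sp[OF 1(2)]] id_Sp])
      fix w assume w: "w \<in> W"
      show "(restrict (nq \<beta>') W \<otimes>\<^bsub>Sp smul\<^esub> restrict (nq \<beta>) W) w = (\<lambda>w\<in>W. w) w"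
        using w nq_W[OF 1(2) w] unfolding Sp_mult_apply[OF nq_Sp[OF \<beta>'] nq_Sp[OF 1(2)] w] by (simp add: nq_def \<beta>'_def)
    qed
    moreover have "Mop \<beta>' \<otimes>\<^bsub>Aut_S v smul\<^esub> Mop \<beta> = (\<lambda>\<Phi>\<in>\<S>. \<Phi>)"
    proof (rule Aut_eqI[OF Aut_mult_closed[OF Mop_Aut[OF \<beta>'] Mop_Aut[OF 1(2)]]])
      show "is_Aut (\<lambda>\<Phi>\<in>\<S>. \<Phi>)" using monoid.one_closed[OF group.is_monoid[OF Aut_group]] by (simp add: Aut_one)
      fix \<Phi> assume \<Phi>: "\<Phi> \<in> \<S>"
      show "(Mop \<beta>' \<otimes>\<^bsub>Aut_S v smul\<^esub> Mop \<beta>) \<Phi> = (\<lambda>\<Phi>\<in>\<S>. \<Phi>) \<Phi>"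
        using \<Phi> mulq_Schwartz[OF 1(2) \<Phi>] unfolding Aut_mult_apply[OF Mop_Aut[OF \<beta>'] Mop_Aut[OF 1(2)] \<Phi>]
        by (simp add: Mop_def mulq_mulq \<beta>'_def mulq_0)
    qed
    moreover have "(restrict (nq \<beta>') W, Mop \<beta>') \<in> Gens" using \<beta>' unfolding Gens_def by blast
    ultimately have "(restrict (nq \<beta>') W, Mop \<beta>') \<otimes>\<^bsub>Mp v smul chi\<^esub> g = \<one>\<^bsub>Mp v smul chi\<^esub>" "(restrict (nq \<beta>') W, Mop \<beta>') \<in> Gens"
      unfolding 1(1) Mp_mult Mp_one by simp_all
    then show ?thesis by blast
  next
    case 2
    have c': "- c \<noteq> 0" using 2(2) by simp
    have "restrict (tv y (1 / (2 * - c))) W \<otimes>\<^bsub>Sp smul\<^esub> restrict (tv y (1 / (2 * c))) W = (\<lambda>w\<in>W. w)"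
    proof (rule Sp_eqI[OF Sp_closed(1)[OF tv_Sp tv_Sp] id_Sp])
      fix w assume w: "w \<in> W"
      have w': "tv y (1 / (2 * c)) w \<in> W" using w by (simp add: tv_def W_iff)
      show "(restrict (tv y (1 / (2 * - c))) W \<otimes>\<^bsub>Sp smul\<^esub> restrict (tv y (1 / (2 * c))) W) w = (\<lambda>w\<in>W. w) w"
        using w w' unfolding Sp_mult_apply[OF tv_Sp tv_Sp w] by (simp add: tv_def)
    qed
    moreover have "Cop y (- c) \<otimes>\<^bsub>Aut_S v smul\<^esub> Cop y c = (\<lambda>\<Phi>\<in>\<S>. \<Phi>)"
    proof (rule Aut_eqI[OF Aut_mult_closed[OF Cop_Aut[OF c'] Cop_Aut[OF 2(2)]]])
      show "is_Aut (\<lambda>\<Phi>\<in>\<S>. \<Phi>)" using monoid.one_closed[OF group.is_monoid[OF Aut_group]] by (simp add: Aut_one)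
      fix \<Phi> assume \<Phi>: "\<Phi> \<in> \<S>"
      show "(Cop y (- c) \<otimes>\<^bsub>Aut_S v smul\<^esub> Cop y c) \<Phi> = (\<lambda>\<Phi>\<in>\<S>. \<Phi>) \<Phi>"
        using \<Phi> conv_Schwartz[OF 2(2) \<Phi>, of y] conv_inverse[OF c' \<Phi>, of y]
        unfolding Aut_mult_apply[OF Cop_Aut[OF c'] Cop_Aut[OF 2(2)] \<Phi>] by (simp add: Cop_def)
    qed
    moreover have "(restrict (tv y (1 / (2 * - c))) W, Cop y (- c)) \<in> Gens" using c' unfolding Gens_def by blast
    ultimately have "(restrict (tv y (1 / (2 * - c))) W, Cop y (- c)) \<otimes>\<^bsub>Mp v smul chi\<^esub> g = \<one>\<^bsub>Mp v smul chi\<^esub>" "(restrict (tv y (1 / (2 * - c))) W, Cop y (- c)) \<in> Gens"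
      unfolding 2(1) Mp_mult Mp_one by simp_all
    then show ?thesis by blast
  next
    case 3
    then obtain t where t: "g = unit_embedding v smul t" "t \<in> mu2" by blast
    define s where "s = (\<lambda>\<Phi>\<in>\<S>. \<lambda>x. t * \<Phi> x)"
    have s: "is_Aut s" using unit_embedding_Mp[OF t(2)] by (simp add: unit_embedding_def carrier_Mp_iff s_def)
    have tt: "t * (t * a) = a" for a using t(2) by (simp add: mu2_def power2_eq_square mult.assoc[symmetric])
    have "(\<lambda>w\<in>W. w) \<otimes>\<^bsub>Sp smul\<^esub> (\<lambda>w\<in>W. w) = (\<lambda>w\<in>W. w)"
      using monoid.l_one[OF group.is_monoid[OF Sp_group], of "\<lambda>w\<in>W. w"] id_Sp by (simp add: Sp_one)
    moreover have "s \<otimes>\<^bsub>Aut_S v smul\<^esub> s = (\<lambda>\<Phi>\<in>\<S>. \<Phi>)"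
    proof (rule Aut_eqI[OF Aut_mult_closed[OF s s]])
      show "is_Aut (\<lambda>\<Phi>\<in>\<S>. \<Phi>)" using monoid.one_closed[OF group.is_monoid[OF Aut_group]] by (simp add: Aut_one)
      fix \<Phi> assume \<Phi>: "\<Phi> \<in> \<S>"
      show "(s \<otimes>\<^bsub>Aut_S v smul\<^esub> s) \<Phi> = (\<lambda>\<Phi>\<in>\<S>. \<Phi>) \<Phi>"
        using \<Phi> unfolding Aut_mult_apply[OF s s \<Phi>] by (simp add: s_def Schwartz_mult tt)
    qed
    ultimately have "g \<otimes>\<^bsub>Mp v smul chi\<^esub> g = \<one>\<^bsub>Mp v smul chi\<^esub>"
      unfolding t(1) unit_embedding_def s_def[symmetric] Mp_mult Mp_one by simp
    then show ?thesis using assms by blast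
  qed
qed

lemma Gens_good: "(\<sigma>, s) \<in> Gens \<Longrightarrow> good \<sigma> s"
  unfolding Gens_def using good_nq good_tv good_sign by (auto simp: unit_embedding_def mu2_def)

lemma Mp2_subgroup: "subgroup Mp2 (Mp v smul chi)"
  unfolding Mp2_def by (rule group.generate_is_subgroup[OF Mp_group Gens_Mp])

lemma Gens_Mp2: "g \<in> Gens \<Longrightarrow> g \<in> Mp2"
  unfolding Mp2_def by (rule generate.incl)

lemma Mp2_good: "g \<in> Mp2 \<Longrightarrow> good (fst g) (snd g)"
  unfolding Mp2_def
proof (induction rule: generate.induct)
  case one
  have "good (\<lambda>w\<in>W. w) (\<lambda>\<Phi>\<in>\<S>. \<Phi>)" using good_sign[of 1] by simp
  then show ?case unfolding Mp_one fst_conv snd_conv .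
next
  case (incl h)
  then show ?case using Gens_good[of "fst h" "snd h"] by simp
next
  case (inv h)
  obtain h' where h': "h' \<in> Gens" "h' \<otimes>\<^bsub>Mp v smul chi\<^esub> h = \<one>\<^bsub>Mp v smul chi\<^esub>" using Gens_inverse[OF inv] by blast
  have "inv\<^bsub>Mp v smul chi\<^esub> h = h'"
    by (rule group.inv_equality[OF Mp_group h'(2)]) (use inv h'(1) Gens_Mp in auto)
  then show ?case using Gens_good[of "fst h'" "snd h'"] h'(1) by simp
next
  case (eng h h')
  have "fst (h \<otimes>\<^bsub>Mp v smul chi\<^esub> h') = fst h \<otimes>\<^bsub>Sp smul\<^esub> fst h'"
    "snd (h \<otimes>\<^bsub>Mp v smul chi\<^esub> h') = snd h \<otimes>\<^bsub>Aut_S v smul\<^esub> snd h'"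
    by (cases h; cases h'; simp add: Mp_mult)+
  then show ?case using good_mult[OF eng.IH] by simp
qed

lemma Mp2_surjective: "is_Sp \<sigma> \<Longrightarrow> \<sigma> \<in> fst ` Mp2"
proof (rule Sp_generation[of "\<lambda>\<sigma>. \<sigma> \<in> fst ` Mp2"])
  interpret M: group "Mp v smul chi" by (rule Mp_group)
  have sub: "g \<in> carrier (Mp v smul chi)" if "g \<in> Mp2" for g using subgroup.mem_carrier[OF Mp2_subgroup that] .
  show Sp: "is_Sp \<tau>" if "\<tau> \<in> fst ` Mp2" for \<tau> using that sub carrier_Mp_iff by fastforce
  show one: "(\<lambda>w\<in>W. w) \<in> fst ` Mp2"
    using subgroup.one_closed[OF Mp2_subgroup] unfolding Mp_one by (metis fst_conv imageI)
  show "\<tau> \<otimes>\<^bsub>Sp smul\<^esub> \<rho> \<in> fst ` Mp2" if P: "\<tau> \<in> fst ` Mp2" "\<rho> \<in> fst ` Mp2" for \<tau> \<rho>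
  proof -
    obtain g h where gh: "g \<in> Mp2" "\<tau> = fst g" "h \<in> Mp2" "\<rho> = fst h" using P by blast
    have "fst (g \<otimes>\<^bsub>Mp v smul chi\<^esub> h) = \<tau> \<otimes>\<^bsub>Sp smul\<^esub> \<rho>" unfolding gh by (cases g; cases h; simp add: Mp_mult)
    then show ?thesis using subgroup.m_closed[OF Mp2_subgroup gh(1,3)] by (metis imageI)
  qed
  show "inv\<^bsub>Sp smul\<^esub> \<tau> \<in> fst ` Mp2" if P: "\<tau> \<in> fst ` Mp2" for \<tau>
  proof -
    obtain g where "g \<in> Mp2" "\<tau> = fst g" using P by blast
    then have s: "(\<tau>, snd g) \<in> Mp2" by simp
    obtain \<rho> t where \<rho>: "inv\<^bsub>Mp v smul chi\<^esub> (\<tau>, snd g) = (\<rho>, t)" by fastforce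
    have m: "(\<rho>, t) \<in> Mp2" using subgroup.m_inv_closed[OF Mp2_subgroup s] \<rho> by simp
    have "(\<rho>, t) \<otimes>\<^bsub>Mp v smul chi\<^esub> (\<tau>, snd g) = \<one>\<^bsub>Mp v smul chi\<^esub>" using M.l_inv[OF sub[OF s]] \<rho> by simp
    then have "\<rho> \<otimes>\<^bsub>Sp smul\<^esub> \<tau> = \<one>\<^bsub>Sp smul\<^esub>" by (simp add: Mp_mult Mp_one Sp_one)
    then have "inv\<^bsub>Sp smul\<^esub> \<tau> = \<rho>"
      by (rule group.inv_equality[OF Sp_group]) (use s m sub carrier_Mp_iff in auto)
    then show ?thesis using m by (metis fst_conv imageI)
  qed
  show "restrict (nq \<beta>) W \<in> fst ` Mp2" if "bilin \<beta>" for \<beta>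
  proof -
    have "(restrict (nq \<beta>) W, Mop \<beta>) \<in> Mp2" by (rule Gens_Mp2) (use that in \<open>auto simp: Gens_def\<close>)
    then show ?thesis by (metis fst_conv imageI)
  qed
  show "restrict (tv y a) W \<in> fst ` Mp2" for y a
  proof (cases "a = 0")
    \<comment> \<open>The generators have nonzero parameter, so the trivial transvection is obtained
      from the identity.\<close>
    case True
    have "restrict (tv y a) W = (\<lambda>w\<in>W. w)" unfolding True by (rule restrict_ext) (simp add: tv_def)
    then show ?thesis using one by simp
  next
    case False
    define c where "c = 1 / (2 * a)"
    have c: "c \<noteq> 0" "1 / (2 * c) = a" using False two by (simp_all add: c_def)
    have "(restrict (tv y (1 / (2 * c))) W, Cop y c) \<in> Mp2" by (rule Gens_Mp2) (use c(1) in \<open>auto simp: Gens_def\<close>)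
    then show ?thesis unfolding c(2) by (metis fst_conv imageI)
  qed
qed

text \<open>An element over the identity is a scalar by \<open>schur\<close>, and a scalar
  satisfying \<open>good\<close> has square 1.\<close>

lemma Mp2_kernel: "{g \<in> Mp2. fst g = (\<lambda>w\<in>W. w)} = unit_embedding v smul ` mu2"
proof
  show "unit_embedding v smul ` mu2 \<subseteq> {g \<in> Mp2. fst g = (\<lambda>w\<in>W. w)}"
  proof
    fix g assume g: "g \<in> unit_embedding v smul ` (mu2 :: 'r set)"
    then have "g \<in> Gens" unfolding Gens_def by blast
    then show "g \<in> {g \<in> Mp2. fst g = (\<lambda>w\<in>W. w)}" using g Gens_Mp2 by (auto simp: unit_embedding_def)
  qed
  show "{g \<in> Mp2. fst g = (\<lambda>w\<in>W. w)} \<subseteq> unit_embedding v smul ` mu2"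
  proof
    fix g assume "g \<in> {g \<in> Mp2. fst g = (\<lambda>w\<in>W. w)}"
    then obtain s where s: "g = (\<lambda>w\<in>W. w, s)" "g \<in> Mp2" by (cases g) auto
    then have "(\<lambda>w\<in>W. w, s) \<in> carrier (Mp v smul chi)" using subgroup.mem_carrier[OF Mp2_subgroup] by blast
    then have "is_Aut s" "intertwines (\<lambda>w\<in>W. w) s" using carrier_Mp_iff by blast+
    then obtain t where t: "t dvd 1" "s = (\<lambda>\<Phi>\<in>\<S>. \<lambda>x. t * \<Phi> x)" using schur by blast
    have "good (\<lambda>w\<in>W. w) s" using Mp2_good[OF s(2)] s(1) by simp
    then have "t\<^sup>2 = 1" unfolding t(2) by (rule good_scalar)
    then have "t \<in> mu2" using t(1) by (simp add: mu2_def)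
    moreover have "g = unit_embedding v smul t" by (simp add: s(1) t(2) unit_embedding_def)
    ultimately show "g \<in> unit_embedding v smul ` mu2" by blast
  qed
qed

text \<open>Lets the kernel be counted as the set \<open>mu2\<close> itself.\<close>

lemma unit_embedding_inj: "inj (unit_embedding v smul :: 'r \<Rightarrow> _)"
proof (rule injI)
  fix t t' :: 'r assume "unit_embedding v smul t = unit_embedding v smul t'"
  then have "(\<lambda>\<Phi>\<in>\<S>. \<lambda>x. t * \<Phi> x) (ind 0) 0 = (\<lambda>\<Phi>\<in>\<S>. \<lambda>x. t' * \<Phi> x) (ind 0) 0"
    by (simp add: unit_embedding_def)
  then show "t = t'" by (simp add: ind_Schwartz) (simp add: ind_def L_0)
qed

lemma Mp2_cover:
  "is_cover (Mp v smul chi \<lparr>carrier := Mp2\<rparr>) (Sp smul) Mp_proj (unit_embedding v smul ` mu2)"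
  unfolding is_cover_def
proof (intro conjI)
  have sub: "(\<sigma>, s) \<in> Mp2 \<Longrightarrow> is_Sp \<sigma>" for \<sigma> s
    using subgroup.mem_carrier[OF Mp2_subgroup] carrier_Mp_iff by blast
  show "group_hom (Mp v smul chi \<lparr>carrier := Mp2\<rparr>) (Sp smul) Mp_proj"
  proof (rule group_hom.intro[OF subgroup.subgroup_is_group[OF Mp2_subgroup Mp_group] Sp_group])
    show "group_hom_axioms (Mp v smul chi \<lparr>carrier := Mp2\<rparr>) (Sp smul) Mp_proj"
      by unfold_locales (use sub in \<open>auto simp: hom_def Mp_proj_def Mp_mult\<close>)
  qed
  show "Mp_proj ` carrier (Mp v smul chi \<lparr>carrier := Mp2\<rparr>) = carrier (Sp smul)"
    using Mp2_surjective sub by (auto simp: Mp_proj_def)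
  show "kernel (Mp v smul chi \<lparr>carrier := Mp2\<rparr>) (Sp smul) Mp_proj = unit_embedding v smul ` mu2"
    unfolding Mp2_kernel[symmetric] by (simp add: kernel_def Mp_proj_def Sp_one)
qed

end

section \<open>Counting the kernel, and the theorem\<close>

lemma two_nonzero: "CHAR('a::idom) \<noteq> 2 \<Longrightarrow> (2::'a) \<noteq> 0"
proof
  assume "CHAR('a) \<noteq> 2" "(2::'a) = 0"
  then have "of_nat 2 = (0::'a)" by simp
  then have "CHAR('a) dvd 2" by (simp only: of_nat_eq_0_iff_char_dvd)
  then have "CHAR('a) = 1 \<or> CHAR('a) = 2" using two_is_prime_nat prime_nat_iff by blast
  then show False using \<open>CHAR('a) \<noteq> 2\<close> by simp
qed

lemma card_mu2:
  assumes "CHAR('r::idom) \<noteq> 2" shows "card (mu2 :: 'r set) = 2"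
proof -
  have "(1::'r) \<noteq> - 1" using two_nonzero[OF assms] by (simp add: eq_neg_iff_add_eq_0)
  moreover have "mu2 = {1, - 1 :: 'r}" by (auto simp: mu2_def power2_eq_1_iff)
  ultimately show ?thesis using card_2_iff by blast
qed

theorem theorem5p3:
  fixes v :: "'f::field \<Rightarrow> real"
    and smul :: "'f \<Rightarrow> 'x::ab_group_add \<Rightarrow> 'x"
    and Basis :: "'x set"
    and chi :: "'f \<Rightarrow> 'r::idom"
    and p q :: nat
  assumes "nonarch_local_field v"
    and "CHAR('f) \<noteq> 2"
    and "has_characteristic (residue_field v) p"
    and "q = card (carrier (residue_field v))"
    and "(of_nat p :: 'r) dvd 1"
    and "\<exists>s::'r. s\<^sup>2 = of_nat q"
    and "smooth_character v chi"
    and "\<exists>x. chi x \<noteq> 1"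
    and "finite_dimensional_vector_space smul Basis"
  shows "\<exists>Mp2. subgroup Mp2 (Mp v smul chi) \<and>
           is_cover (Mp v smul chi \<lparr> carrier := Mp2 \<rparr>) (Sp smul) Mp_proj
             (unit_embedding v smul ` mu2) \<and>
           (CHAR('r) \<noteq> 2 \<longrightarrow>
             card (kernel (Mp v smul chi \<lparr> carrier := Mp2 \<rparr>) (Sp smul) Mp_proj) = 2)"
proof -
  have lf: "local_field v" by unfold_locales (fact assms(1))
  have q: "q = local_field.q v" using local_field.card_residue_field(2)[OF lf] assms(4) by simp
  have "(of_nat q :: 'r) dvd 1" unfolding q by (rule local_field.q_unit[OF lf assms(3,5)])
  then obtain iq :: 'r where "1 = of_nat q * iq" by (rule dvdE)
  then have iq: "of_nat q * iq = 1" by simp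
  obtain sq :: 'r where sq: "sq\<^sup>2 = of_nat q" using assms(6) by blast
  have weil: "weil v chi iq sq smul Basis"
    by (intro weil.intro gauss_sums.intro gauss_sums_axioms.intro lf assms(7-9) two_nonzero[OF assms(2)]
        iq[unfolded q] sq[unfolded q])
  note cover = weil.Mp2_cover[OF weil]
  have "card (kernel (Mp v smul chi \<lparr>carrier := weil.Mp2 v chi iq smul\<rparr>) (Sp smul) Mp_proj) = 2" if "CHAR('r) \<noteq> 2"
    using cover card_image[OF inj_on_subset[OF weil.unit_embedding_inj[OF weil]], of mu2] card_mu2[OF that]
    by (simp add: is_cover_def)
  then show ?thesis using weil.Mp2_subgroup[OF weil] cover by blast
qed

end
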